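(* Let $\mathbf{p}:A\times B\to\Bbbk$ be an admissible pairing between two regular multiplier Hopf algebras $(A,\Delta_A)$ and $(B,\Delta_B)$, let $X$ be an algebra, let $\alpha:X\to \mathrm{M}(A^{\mathrm{op}}\otimes X)$ be a left coaction of $(A^{\mathrm{op}},\Delta_A^{\mathrm{op}})$ on $X$ and $\beta:X\to \mathrm{M}(B\otimes X)$ be a left coaction of $(B,\Delta_B)$ on $X$. Let $\lhd_{\beta,\mathbf p}:X\otimes A\to X$, $x\lhd_{\beta,\mathbf p}a=(\mathbf p(a,\cdot)\otimes \mathrm{id})(\beta(x))$, be the right action of $(A,\Delta_A)$ on $X$ induced by $\beta$ and $\mathbf p$. Then $(X,\alpha,\beta)$ is a left-left Yetter--Drinfeld algebra over $\mathbf p$ if and only if $(X,\lhd_{\beta,\mathbf p},\alpha)$ is a right-left Yetter--Drinfeld $(A,\Delta_A)$-algebra.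
   Context: Conventions. Algebras are over a field $\Bbbk$, not necessarily unital, but non-degenerate ($ab=0\ \forall b\Rightarrow a=0$ and $ba=0\ \forall b\Rightarrow a=0$) and idempotent ($A\cdot A=A$, linear span). $\mathrm{M}(A)$ is the multiplier algebra. A homomorphism $f:A\to \mathrm{M}(B)$ is non-degenerate if $f(A)B=B=Bf(A)$; it then extends uniquely to $\mathrm{M}(A)\to \mathrm{M}(B)$, and (tensor products of) such maps and (anti-)isomorphisms are used in extended form. $\Sigma$ is the flip, subscripts denote leg positions, and $\mathrm{Ad}(W)(z)=WzW^{-1}$. $A^{\mathrm{op}}=\{a^{\mathrm{op}}\}$ is the opposite algebra. Multiplier Hopf algebras. $(A,\Delta)$ is a regular multiplier Hopf algebra if $\Delta:A\to \mathrm{M}(A\otimes A)$ is a homomorphism with $\Delta(a)(1\otimes b),(a\otimes1)\Delta(b)\in A\otimes A$, coassociative in the sense $(a\otimes1\otimes1)(\Delta\otimes \mathrm{id})(\Delta(b)(1\otimes c))=(\mathrm{id}\otimes\Delta)((a\otimes1)\Delta(b))(1\otimes1\otimes c)$, such that $a\otimes b\mapsto\Delta(a)(1\otimes b)$ and $a\otimes b\mapsto(a\otimes1)\Delta(b)$ are bijections of $A\otimes A$, and the same holds for $\Delta^{\mathrm{co}}=\Sigma\Delta$. It has a counit $\varepsilon$ and a bijective antipode $S$; Sweedler notation $\Delta(a)=a_{(1)}\otimes a_{(2)}$ is used with suitable covering. $(A^{\mathrm{op}},\Delta^{\mathrm{op}})$ has $\Delta^{\mathrm{op}}(a^{\mathrm{op}})=a_{(1)}^{\mathrm{op}}\otimes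 a_{(2)}^{\mathrm{op}}$. A right action of $(A,\Delta)$ on $X$ is a unital right module map $\lhd:X\otimes A\to X$ ($X\lhd A=X$) with $xy\lhd a=(x\lhd a_{(1)})(y\lhd a_{(2)})$. A left coaction of $(A,\Delta)$ on $X$ is a non-degenerate homomorphism $\Gamma:X\to \mathrm{M}(A\otimes X)$ with $(A\otimes1)\Gamma(X)=A\otimes X=\Gamma(X)(A\otimes1)$, $(\Delta\otimes \mathrm{id})\Gamma=(\mathrm{id}\otimes\Gamma)\Gamma$, $(\varepsilon\otimes \mathrm{id})\Gamma=\mathrm{id}$. Pairings. A pairing of regular multiplier Hopf algebras is a non-degenerate bilinear $\mathbf p:A\times B\to\Bbbk$ such that the multipliers $a\blacktriangleright b=b_{(1)}\mathbf p(a,b_{(2)})$, $b\blacktriangleleft a=\mathbf p(a,b_{(1)})b_{(2)}$ lie in $B$, $b\blacktriangleright a=a_{(1)}\mathbf p(a_{(2)},b)$, $a\blacktriangleleft b=\mathbf p(a_{(1)},b)a_{(2)}$ lie in $A$, $\mathbf p(aa',b)=\mathbf p(a,b_{(1)})\mathbf p(a',b_{(2)})$, $\mathbf p(a,bb')=\mathbf p(a_{(1)},b)\mathbf p(a_{(2)},b')$, and these four module actions are unital. Put $\mathbf p^2(a\otimes b,b'\otimes a')=\mathbf p(a,b')\mathbf p(a',b)$, extended to $m\in \mathrm{M}(A\otimes B)$ by $\mathbf p^2(m,b\otimes a)=\mathbf p^2(m(x\otimes y),b\otimes a)$ for any $x\in A,y\in B$ with $x\blacktriangleright b=b$, $y\blacktriangleright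 a=a$. A canonical multiplier is an invertible $U\in \mathrm{M}(A\otimes B)$ with $\mathbf p^2(U,b\otimes a)=\mathbf p(a,b)$ for all $a,b$ (it is unique). $\mathbf p$ is admissible if it has a canonical multiplier $U$ with $(1\otimes b)U(a\otimes1),(a\otimes1)U(1\otimes b)\in A\otimes B$ for all $a,b$. Then $U^{\circ}=({}^{\mathrm{op}}\otimes \mathrm{id})(U)\in \mathrm{M}(A^{\mathrm{op}}\otimes B)$ is the multiplier with $U^\circ(a^{\mathrm{op}}\otimes b)=({}^{\mathrm{op}}\otimes \mathrm{id})((a\otimes1)U(1\otimes b))$ and $(a^{\mathrm{op}}\otimes b)U^\circ=({}^{\mathrm{op}}\otimes \mathrm{id})((1\otimes b)U(a\otimes1))$. Yetter--Drinfeld algebras. $(X,\alpha,\beta)$, with $\alpha,\beta$ left coactions of $(A^{\mathrm{op}},\Delta_A^{\mathrm{op}})$ and $(B,\Delta_B)$ on $X$, is a left-left Yetter--Drinfeld algebra over $\mathbf p$ if $(\mathrm{id}\otimes\alpha)\beta=\Sigma_{12}\,\mathrm{Ad}(U^\circ_{12})(\mathrm{id}\otimes\beta)\alpha$. Given a right action $\lhd$ of $(A,\Delta)$ on $X$ and a left coaction $\Gamma$ of $(A^{\mathrm{op}},\Delta^{\mathrm{op}})$ on $X$, written $\Gamma(x)=x_{[-1]}^{\mathrm{op}}\otimes x_{[0]}$, the triple $(X,\lhd,\Gamma)$ is a right-left Yetter--Drinfeld $(A,\Delta)$-algebra if $a'x_{[-1]}a_{(1)}\otimes(x_{[0]}\lhd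 a_{(2)})=a'a_{(2)}(x\lhd a_{(1)})_{[-1]}\otimes(x\lhd a_{(1)})_{[0]}$ for all $x\in X$, $a,a'\in A$. *)

theory Defs
  imports Complex_Main "HOL-Library.Function_Algebras" "HOL-Library.Product_Plus"
begin

section \<open>Algebras over a field\<close>

text \<open>
  An algebra over the field \<open>'k\<close> lives on a linear subspace \<open>carr A\<close> of an ambient
  \<open>'k\<close>-vector space; its addition is that of the ambient type. The subspace (rather than a
  whole type) is needed because tensor products and multiplier algebras, whose underlying sets
  depend on the given algebras, must again be algebras. The values of \<open>mul A\<close> outside
  \<open>carr A\<close> are irrelevant.
\<close>

record ('k, 'a) alg =
  carr :: "'a set"
  smul :: "'k \<Rightarrow> 'a \<Rightarrow> 'a"
  mul :: "'a \<Rightarrow> 'a \<Rightarrow> 'a"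

definition is_algebra :: "('k::field, 'a::ab_group_add) alg \<Rightarrow> bool" where
  "is_algebra A \<longleftrightarrow>
     vector_space (smul A) \<and> module.subspace (smul A) (carr A) \<and>
     (\<forall>x\<in>carr A. \<forall>y\<in>carr A. mul A x y \<in> carr A) \<and>
     (\<forall>x\<in>carr A. \<forall>y\<in>carr A. \<forall>z\<in>carr A. mul A (mul A x y) z = mul A x (mul A y z)) \<and>
     (\<forall>x\<in>carr A. \<forall>y\<in>carr A. \<forall>z\<in>carr A.
        mul A (x + y) z = mul A x z + mul A y z \<and> mul A x (y + z) = mul A x y + mul A x z) \<and>
     (\<forall>c. \<forall>x\<in>carr A. \<forall>y\<in>carr A.
        mul A (smul A c x) y = smul A c (mul A x y) \<and> mul A x (smul A c y) = smul A c (mul A x y))"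

definition lspan :: "('k::field, 'a::ab_group_add) alg \<Rightarrow> 'a set \<Rightarrow> 'a set" where
  "lspan A S = module.span (smul A) S"

definition nd_algebra :: "('k::field, 'a::ab_group_add) alg \<Rightarrow> bool" where
  "nd_algebra A \<longleftrightarrow> is_algebra A \<and>
     (\<forall>a\<in>carr A. (\<forall>b\<in>carr A. mul A a b = 0) \<longrightarrow> a = 0) \<and>
     (\<forall>a\<in>carr A. (\<forall>b\<in>carr A. mul A b a = 0) \<longrightarrow> a = 0) \<and>
     lspan A {mul A a b | a b. a \<in> carr A \<and> b \<in> carr A} = carr A"

definition field_alg :: "('k::field, 'k) alg" where
  "field_alg = \<lparr>carr = UNIV, smul = (*), mul = (*)\<rparr>"

text \<open>
  The opposite algebra has the same underlying vector space, so \<open>a \<mapsto> a\<^sup>o\<^sup>p\<close> is the identity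
  map, and \<open>op \<otimes> id\<close> is the identity of the vector space underlying both \<open>A \<otimes> B\<close> and
  \<open>A\<^sup>o\<^sup>p \<otimes> B\<close>.
\<close>

definition op_alg :: "('k, 'a) alg \<Rightarrow> ('k, 'a) alg" where
  "op_alg A = \<lparr>carr = carr A, smul = smul A, mul = (\<lambda>x y. mul A y x)\<rparr>"

definition alg_hom ::
  "('k::field, 'a::ab_group_add) alg \<Rightarrow> ('k, 'b::ab_group_add) alg \<Rightarrow> ('a \<Rightarrow> 'b) \<Rightarrow> bool" where
  "alg_hom A B f \<longleftrightarrow>
     (\<forall>x\<in>carr A. f x \<in> carr B) \<and>
     (\<forall>x\<in>carr A. \<forall>y\<in>carr A. f (x + y) = f x + f y \<and> f (mul A x y) = mul B (f x) (f y)) \<and>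
     (\<forall>c. \<forall>x\<in>carr A. f (smul A c x) = smul B c (f x))"


section \<open>Tensor products\<close>

definition bilinear_on :: "('k::field, 'a::ab_group_add) alg \<Rightarrow> ('k, 'b::ab_group_add) alg \<Rightarrow>
    ('k \<Rightarrow> 'c \<Rightarrow> 'c) \<Rightarrow> ('a \<Rightarrow> 'b \<Rightarrow> 'c::ab_group_add) \<Rightarrow> bool" where
  "bilinear_on A B s f \<longleftrightarrow>
     (\<forall>a\<in>carr A. \<forall>b\<in>carr B. \<forall>b'\<in>carr B. f a (b + b') = f a b + f a b') \<and>
     (\<forall>a\<in>carr A. \<forall>a'\<in>carr A. \<forall>b\<in>carr B. f (a + a') b = f a b + f a' b) \<and>
     (\<forall>c. \<forall>a\<in>carr A. \<forall>b\<in>carr B. f (smul A c a) b = s c (f a b) \<and> f a (smul B c b) = s c (f a b))"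

text \<open>
  The tensor product of vector spaces is realised inside the dual of the space of bilinear
  forms: \<open>a \<otimes> b\<close> is evaluation at \<open>(a, b)\<close>, and \<open>A \<otimes> B\<close> is the linear span of these
  functionals. Over a field this has the universal property of the tensor product, see
  \<open>tlift_universal\<close> below.
\<close>

type_synonym ('k, 'a, 'b) tensor = "('a \<Rightarrow> 'b \<Rightarrow> 'k) \<Rightarrow> 'k"

definition ten :: "('k::field, 'a::ab_group_add) alg \<Rightarrow> ('k, 'b::ab_group_add) alg \<Rightarrow>
    'a \<Rightarrow> 'b \<Rightarrow> ('k, 'a, 'b) tensor" where
  "ten A B a b = (\<lambda>f. if bilinear_on A B (*) f then f a b else 0)"

definition tsmul :: "'k::field \<Rightarrow> ('k, 'a, 'b) tensor \<Rightarrow> ('k, 'a, 'b) tensor" where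
  "tsmul c t = (\<lambda>f. c * t f)"

definition tcarr :: "('k::field, 'a::ab_group_add) alg \<Rightarrow> ('k, 'b::ab_group_add) alg \<Rightarrow>
    ('k, 'a, 'b) tensor set" where
  "tcarr A B = module.span tsmul {ten A B a b | a b. a \<in> carr A \<and> b \<in> carr B}"

text \<open>
  \<open>tlift A B f\<close> is the linear map on \<open>A \<otimes> B\<close> induced by a bilinear map \<open>f\<close>, extended by 0.
  Additivity and the values on elementary tensors already determine it.
\<close>

definition tlift :: "('k::field, 'a::ab_group_add) alg \<Rightarrow> ('k, 'b::ab_group_add) alg \<Rightarrow>
    ('a \<Rightarrow> 'b \<Rightarrow> 'c::ab_group_add) \<Rightarrow> ('k, 'a, 'b) tensor \<Rightarrow> 'c" where
  "tlift A B f = (THE F.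
     (\<forall>a\<in>carr A. \<forall>b\<in>carr B. F (ten A B a b) = f a b) \<and>
     (\<forall>s\<in>tcarr A B. \<forall>t\<in>tcarr A B. F (s + t) = F s + F t) \<and>
     (\<forall>t. t \<notin> tcarr A B \<longrightarrow> F t = 0))"

lemma vector_space_tsmul: "vector_space (tsmul :: 'k::field \<Rightarrow> ('k, 'a, 'b) tensor \<Rightarrow> ('k, 'a, 'b) tensor)"
  by unfold_locales (auto simp: tsmul_def fun_eq_iff algebra_simps)

lemma tlift_universal:
  fixes A :: "('k::field, 'a::ab_group_add) alg" and B :: "('k, 'b::ab_group_add) alg"
    and s :: "'k \<Rightarrow> 'c::ab_group_add \<Rightarrow> 'c"
  assumes A: "vector_space (smul A)" "module.subspace (smul A) (carr A)"
    and B: "vector_space (smul B)" "module.subspace (smul B) (carr B)"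
    and s: "vector_space s" and f: "bilinear_on A B s f"
  shows "\<forall>a\<in>carr A. \<forall>b\<in>carr B. tlift A B f (ten A B a b) = f a b"
    and "\<forall>t\<in>tcarr A B. \<forall>u\<in>tcarr A B. tlift A B f (t + u) = tlift A B f t + tlift A B f u"
    and "\<forall>c. \<forall>t\<in>tcarr A B. tlift A B f (tsmul c t) = s c (tlift A B f t)"
    and "\<forall>t. t \<notin> tcarr A B \<longrightarrow> tlift A B f t = 0"
    and "\<And>F. (\<forall>a\<in>carr A. \<forall>b\<in>carr B. F (ten A B a b) = f a b) \<Longrightarrow>
           (\<forall>t\<in>tcarr A B. \<forall>u\<in>tcarr A B. F (t + u) = F t + F u) \<Longrightarrow>
           t \<in> tcarr A B \<Longrightarrow> F t = tlift A B f t"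
proof -
  interpret VA: vector_space "smul A" by fact
  interpret VB: vector_space "smul B" by fact
  interpret VC: vector_space s by fact
  interpret T: vector_space "tsmul :: 'k \<Rightarrow> ('k, 'a, 'b) tensor \<Rightarrow> ('k, 'a, 'b) tensor"
    by (rule vector_space_tsmul)
  interpret P: vector_space_pair s "(*) :: 'k \<Rightarrow> 'k \<Rightarrow> 'k"
    by unfold_locales (auto simp: algebra_simps)
  define E where "E = {ten A B a b | a b. a \<in> carr A \<and> b \<in> carr B}"
  have tcarr: "tcarr A B = T.span E" by (simp add: tcarr_def E_def)
  have smulA: "smul A c a \<in> carr A" if "a \<in> carr A" for c a
    using A that VA.subspace_scale by blast
  have smulB: "smul B c b \<in> carr B" if "b \<in> carr B" for c b
    using B that VB.subspace_scale by blast
  have ten_smul: "tsmul c (ten A B a b) = ten A B (smul A c a) b"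
    if "a \<in> carr A" "b \<in> carr B" for c a b
    using that by (auto simp: tsmul_def ten_def fun_eq_iff bilinear_on_def)
  text \<open>Linear functionals separate the points of the target.\<close>
  have sep: "z = 0" if z: "\<And>g. Vector_Spaces.linear s (*) g \<Longrightarrow> g z = 0" for z
  proof (rule ccontr)
    assume "z \<noteq> 0"
    then have i: "VC.independent {z}" by simp
    from P.linear_independent_extend[OF i, of "\<lambda>_. 1"]
    obtain g where "Vector_Spaces.linear s (*) g" "g z = 1" by auto
    with z[of g] show False by simp
  qed
  have comp: "bilinear_on A B (*) (\<lambda>a b. g (f a b))"
    if g: "Vector_Spaces.linear s (*) g" for g :: "'c \<Rightarrow> 'k"
  proof -
    interpret g: Vector_Spaces.linear s "(*)" g by fact
    show ?thesis using f unfolding bilinear_on_def by (auto simp: g.add g.scale)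
  qed
  define R where "R t z \<longleftrightarrow> (\<forall>g. Vector_Spaces.linear s (*) g \<longrightarrow> g z = t (\<lambda>a b. g (f a b)))"
    for t :: "('k, 'a, 'b) tensor" and z
  have R_unique: "z = z'" if "R t z" "R t z'" for t z z'
  proof -
    have "z - z' = 0"
    proof (rule sep)
      fix g :: "'c \<Rightarrow> 'k" assume g: "Vector_Spaces.linear s (*) g"
      then interpret g: Vector_Spaces.linear s "(*)" g .
      show "g (z - z') = 0" using that g unfolding R_def g.diff by (metis diff_self)
    qed
    then show ?thesis by simp
  qed
  have R_ten: "R (ten A B a b) (f a b)" for a b
    unfolding R_def by (auto simp: ten_def comp)
  have R_add: "R (t + u) (y + z)" if "R t y" "R u z" for t u y z
    using that unfolding R_def by (auto simp:
        P.linear_add)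
  have R_smul: "R (tsmul c t) (s c z)" if "R t z" for t c z
    using that unfolding R_def by (auto simp: tsmul_def P.linear_scale)
  have R_0: "R 0 0" unfolding R_def by (auto simp: P.linear_0)
  have R_ex: "\<exists>z. R t z" if "t \<in> tcarr A B" for t
    using that unfolding tcarr
  proof (induction rule: T.span_induct_alt)
    case base then show ?case using R_0 by blast
  next
    case (step c x y)
    then obtain a b z where "x = ten A B a b" "R y z" by (auto simp: E_def)
    then have "R (tsmul c x + y) (s c (f a b) + z)" by (intro R_add) (auto intro: R_smul R_ten)
    then show ?case by blast
  qed
  define G where "G t = (if t \<in> tcarr A B then THE z. R t z else 0)" for t
  have RG: "R t (G t)" if "t \<in> tcarr A B" for t
  proof -
    obtain z where z: "R t z" using R_ex[OF \<open>t \<in> tcarr A B\<close>] by blast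
    then have "(THE z. R t z) = z" using R_unique by blast
    with z that show ?thesis by (simp add: G_def)
  qed
  have ten_in: "ten A B a b \<in> tcarr A B" if "a \<in> carr A" "b \<in> carr B" for a b
    unfolding tcarr by (rule T.span_base) (use that in \<open>auto simp: E_def\<close>)
  have add_in: "t + u \<in> tcarr A B" if "t \<in> tcarr A B" "u \<in> tcarr A B" for t u
    using that T.span_add unfolding tcarr by blast
  have smul_in: "tsmul c t \<in> tcarr A B" if "t \<in> tcarr A B" for c t
    using that T.span_scale unfolding tcarr by blast
  have G1: "\<forall>a\<in>carr A. \<forall>b\<in>carr B. G (ten A B a b) = f a b"
    by (intro ballI R_unique[OF RG R_ten] ten_in)
  have G2: "\<forall>t\<in>tcarr A B. \<forall>u\<in>tcarr A B. G (t + u) = G t + G u"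
    by (intro ballI R_unique[OF RG R_add] RG add_in)
  have G3: "\<forall>c. \<forall>t\<in>tcarr A B. G (tsmul c t) = s c (G t)"
    by (intro allI ballI R_unique[OF RG R_smul] RG smul_in)
  have G4: "\<forall>t. t \<notin> tcarr A B \<longrightarrow> G t = 0" by (simp add: G_def)
  have uniq: "F t = G t"
    if F1: "\<forall>a\<in>carr A. \<forall>b\<in>carr B. F (ten A B a b) = f a b"
      and F2: "\<forall>t\<in>tcarr A B. \<forall>u\<in>tcarr A B. F (t + u) = F t + F u"
      and t: "t \<in> tcarr A B" for F t
  proof -
    have zero: "0 \<in> tcarr A B" unfolding tcarr by (rule T.span_zero)
    have F0: "F 0 = 0" using F2 zero by (metis add_cancel_right_right)
    have G0: "G 0 = 0" using G2 zero by (metis add_cancel_right_right)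
    from t[unfolded tcarr] have "t \<in> tcarr A B \<and> F t = G t"
    proof (induction rule: T.span_induct_alt)
      case base show ?case by (intro conjI zero trans[OF F0 G0[symmetric]])
    next
      case (step c x y)
      then obtain a b where x: "x = ten A B a b" "a \<in> carr A" "b \<in> carr B" by (auto simp: E_def)
      then have "tsmul c x = ten A B (smul A c a) b" by (simp add: ten_smul)
      moreover have "tsmul c x \<in> tcarr A B" using x smul_in ten_in by simp
      moreover have "F (tsmul c x) = G (tsmul c x)" using calculation x F1 G1 smulA by simp
      moreover from step have y: "y \<in> tcarr A B" "F y = G y" by blast+
      moreover have "F (tsmul c x + y) = F (tsmul c x) + F y"
        using F2 calculation by blast
      moreover have "G (tsmul c x + y) = G (tsmul c x) + G y"
        using G2 calculation by blast
      ultimately show ?case using add_in by metis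
    qed
    then show ?thesis by simp
  qed
  have "tlift A B f = G"
    unfolding tlift_def
  proof (rule the_equality)
    fix F assume F: "(\<forall>a\<in>carr A. \<forall>b\<in>carr B. F (ten A B a b) = f a b) \<and>
      (\<forall>s\<in>tcarr A B. \<forall>t\<in>tcarr A B. F (s + t) = F s + F t) \<and> (\<forall>t. t \<notin> tcarr A B \<longrightarrow> F t = 0)"
    show "F = G"
    proof
      fix t show "F t = G t"
      proof (cases "t \<in> tcarr A B")
        case True then show ?thesis using F by (intro uniq) blast+
      next
        case False then show ?thesis using F by (simp only: G4 simp_thms)
      qed
    qed
  qed (intro conjI G1 G2 G4)
  then have eq: "tlift A B f t = G t" for t by (rule fun_cong)
  show "\<forall>a\<in>carr A. \<forall>b\<in>carr B. tlift A B f (ten A B a b) = f a b"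
    unfolding eq by (rule G1)
  show "\<forall>t\<in>tcarr A B. \<forall>u\<in>tcarr A B. tlift A B f (t + u) = tlift A B f t + tlift A B f u"
    unfolding eq by (rule G2)
  show "\<forall>c. \<forall>t\<in>tcarr A B. tlift A B f (tsmul c t) = s c (tlift A B f t)"
    unfolding eq by (rule G3)
  show "\<forall>t. t \<notin> tcarr A B \<longrightarrow> tlift A B f t = 0"
    unfolding eq by (rule G4)
  show "F t = tlift A B f t"
    if "\<forall>a\<in>carr A. \<forall>b\<in>carr B. F (ten A B a b) = f a b"
      "\<forall>t\<in>tcarr A B. \<forall>u\<in>tcarr A B. F (t + u) = F t + F u"
      "t \<in> tcarr A B" for F
    unfolding eq by (rule uniq[OF that])
qed

lemma ten_bilinear: "bilinear_on A B tsmul (ten A B)"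
  by (auto simp: bilinear_on_def ten_def tsmul_def fun_eq_iff)

definition tensor_alg :: "('k::field, 'a::ab_group_add) alg \<Rightarrow> ('k, 'b::ab_group_add) alg \<Rightarrow>
    ('k, ('k, 'a, 'b) tensor) alg"  (infixr \<open>\<otimes>\<close> 70) where
  "A \<otimes> B = \<lparr>carr = tcarr A B, smul = tsmul,
     mul = (\<lambda>s t. tlift A B (\<lambda>a b. tlift A B (\<lambda>a' b'. ten A B (mul A a a') (mul B b b')) t) s)\<rparr>"

definition flip :: "('k::field, 'a::ab_group_add) alg \<Rightarrow> ('k, 'b::ab_group_add) alg \<Rightarrow>
    ('k, 'a, 'b) tensor \<Rightarrow> ('k, 'b, 'a) tensor" where
  "flip A B = tlift A B (\<lambda>a b. ten B A b a)"

definition tassoc :: "('k::field, 'a::ab_group_add) alg \<Rightarrow> ('k, 'b::ab_group_add) alg \<Rightarrow>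
    ('k, 'c::ab_group_add) alg \<Rightarrow>
    ('k, ('k, 'a, 'b) tensor, 'c) tensor \<Rightarrow> ('k, 'a, ('k, 'b, 'c) tensor) tensor" where
  "tassoc A B C = tlift (A \<otimes> B) C (\<lambda>t c. tlift A B (\<lambda>a b. ten A (B \<otimes> C) a (ten B C b c)) t)"

definition flip12 :: "('k::field, 'a::ab_group_add) alg \<Rightarrow> ('k, 'b::ab_group_add) alg \<Rightarrow>
    ('k, 'c::ab_group_add) alg \<Rightarrow>
    ('k, 'a, ('k, 'b, 'c) tensor) tensor \<Rightarrow> ('k, 'b, ('k, 'a, 'c) tensor) tensor" where
  "flip12 A B C = tlift A (B \<otimes> C) (\<lambda>a t. tlift B C (\<lambda>b c. ten B (A \<otimes> C) b (ten A C a c)) t)"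

text \<open>Slice maps \<open>\<omega> \<otimes> id\<close> and \<open>id \<otimes> \<omega>\<close> on \<open>A \<otimes> B\<close>.\<close>

definition slice1 :: "('k::field, 'a::ab_group_add) alg \<Rightarrow> ('k, 'b::ab_group_add) alg \<Rightarrow>
    ('a \<Rightarrow> 'k) \<Rightarrow> ('k, 'a, 'b) tensor \<Rightarrow> 'b" where
  "slice1 A B \<omega> = tlift A B (\<lambda>a b. smul B (\<omega> a) b)"

definition slice2 :: "('k::field, 'a::ab_group_add) alg \<Rightarrow> ('k, 'b::ab_group_add) alg \<Rightarrow>
    ('b \<Rightarrow> 'k) \<Rightarrow> ('k, 'a, 'b) tensor \<Rightarrow> 'a" where
  "slice2 A B \<omega> = tlift A B (\<lambda>a b. smul A (\<omega> b) a)"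


section \<open>Multipliers\<close>

text \<open>
  A multiplier \<open>m\<close> is the pair of the maps \<open>x \<mapsto> m x\<close> (first component) and \<open>x \<mapsto> x m\<close>
  (second component), both set to 0 outside the algebra.
\<close>

type_synonym 'a multiplier = "('a \<Rightarrow> 'a) \<times> ('a \<Rightarrow> 'a)"

definition mmul :: "'a multiplier \<Rightarrow> 'a multiplier \<Rightarrow> 'a multiplier"  (infixl \<open>\<cdot>\<close> 72) where
  "m \<cdot> n = (fst m \<circ> fst n, snd n \<circ> snd m)"

definition linear_endo :: "('k::field, 'a::ab_group_add) alg \<Rightarrow> ('a \<Rightarrow> 'a) \<Rightarrow> bool" where
  "linear_endo A f \<longleftrightarrow>
     (\<forall>x\<in>carr A. f x \<in> carr A) \<and> (\<forall>x. x \<notin> carr A \<longrightarrow> f x = 0) \<and>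
     (\<forall>x\<in>carr A. \<forall>y\<in>carr A. f (x + y) = f x + f y) \<and>
     (\<forall>c. \<forall>x\<in>carr A. f (smul A c x) = smul A c (f x))"

definition mult_alg :: "('k::field, 'a::ab_group_add) alg \<Rightarrow> ('k, 'a multiplier) alg" where
  "mult_alg A =
     \<lparr>carr = {m. linear_endo A (fst m) \<and> linear_endo A (snd m) \<and>
        (\<forall>x\<in>carr A. \<forall>y\<in>carr A.
           fst m (mul A x y) = mul A (fst m x) y \<and>
           snd m (mul A x y) = mul A x (snd m y) \<and>
           mul A x (fst m y) = mul A (snd m x) y)},
      smul = (\<lambda>c m. (\<lambda>x. smul A c (fst m x), \<lambda>x. smul A c (snd m x))),
      mul = mmul\<rparr>"

definition mone :: "('k, 'a::zero) alg \<Rightarrow> 'a multiplier" where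
  "mone A = (\<lambda>x. if x \<in> carr A then x else 0, \<lambda>x. if x \<in> carr A then x else 0)"

definition minv :: "('k::field, 'a::ab_group_add) alg \<Rightarrow> 'a multiplier \<Rightarrow> 'a multiplier" where
  "minv A m = (THE n. n \<in> carr (mult_alg A) \<and> m \<cdot> n = mone A \<and> n \<cdot> m = mone A)"

text \<open>The embedding \<open>A \<rightarrow> M(A)\<close>, and its inverse on the image.\<close>

definition emb :: "('k, 'a::zero) alg \<Rightarrow> 'a \<Rightarrow> 'a multiplier" where
  "emb A a = (\<lambda>x. if x \<in> carr A then mul A a x else 0, \<lambda>x. if x \<in> carr A then mul A x a else 0)"

abbreviation emb_image :: "('k, 'a::zero) alg \<Rightarrow> 'a multiplier set" where
  "emb_image A \<equiv> emb A ` carr A"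

definition unemb :: "('k, 'a::zero) alg \<Rightarrow> 'a multiplier \<Rightarrow> 'a" where
  "unemb A m = the_inv_into (carr A) (emb A) m"

definition nondeg_hom ::
  "('k::field, 'a::ab_group_add) alg \<Rightarrow> ('k, 'b::ab_group_add) alg \<Rightarrow> ('a \<Rightarrow> 'b multiplier) \<Rightarrow> bool"
where
  "nondeg_hom A B f \<longleftrightarrow> alg_hom A (mult_alg B) f \<and>
     lspan B {fst (f a) b | a b. a \<in> carr A \<and> b \<in> carr B} = carr B \<and>
     lspan B {snd (f a) b | a b. a \<in> carr A \<and> b \<in> carr B} = carr B"

text \<open>
  The extension of a non-degenerate homomorphism \<open>f : A \<rightarrow> M(B)\<close> to \<open>M(A) \<rightarrow> M(B)\<close>: the image
  \<open>n\<close> of \<open>m\<close> is determined by \<open>n (f(a) b) = f(m a) b\<close> and \<open>(b f(a)) n = b f(a m)\<close>.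
\<close>

definition ext :: "('k::field, 'a::ab_group_add) alg \<Rightarrow> ('k, 'b::ab_group_add) alg \<Rightarrow>
    ('a \<Rightarrow> 'b multiplier) \<Rightarrow> 'a multiplier \<Rightarrow> 'b multiplier" where
  "ext A B f m = (THE n. n \<in> carr (mult_alg B) \<and>
     (\<forall>a\<in>carr A. \<forall>b\<in>carr B.
        fst n (fst (f a) b) = fst (f (fst m a)) b \<and>
        snd n (snd (f a) b) = snd (f (snd m a)) b))"

text \<open>The same for a surjective homomorphism \<open>\<phi> : A \<rightarrow> B\<close>, as a map \<open>M(A) \<rightarrow> M(B)\<close>.\<close>

definition ext_alg :: "('k::field, 'a::ab_group_add) alg \<Rightarrow> ('k, 'b::ab_group_add) alg \<Rightarrow>
    ('a \<Rightarrow> 'b) \<Rightarrow> 'a multiplier \<Rightarrow> 'b multiplier" where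
  "ext_alg A B \<phi> = ext A B (emb B \<circ> \<phi>)"

text \<open>\<open>m \<otimes> n \<in> M(A \<otimes> B)\<close> for \<open>m \<in> M(A)\<close> and \<open>n \<in> M(B)\<close>.\<close>

definition mten :: "('k::field, 'a::ab_group_add) alg \<Rightarrow> ('k, 'b::ab_group_add) alg \<Rightarrow>
    'a multiplier \<Rightarrow> 'b multiplier \<Rightarrow> ('k, 'a, 'b) tensor multiplier" where
  "mten A B m n =
     (tlift A B (\<lambda>a b. ten A B (fst m a) (fst n b)),
      tlift A B (\<lambda>a b. ten A B (snd m a) (snd n b)))"

text \<open>The multipliers \<open>a \<otimes> 1\<close> and \<open>1 \<otimes> b\<close> of \<open>A \<otimes> B\<close>.\<close>

definition leg1 :: "('k::field, 'a::ab_group_add) alg \<Rightarrow> ('k, 'b::ab_group_add) alg \<Rightarrow>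
    'a \<Rightarrow> ('k, 'a, 'b) tensor multiplier" where
  "leg1 A B a = mten A B (emb A a) (mone B)"

definition leg2 :: "('k::field, 'a::ab_group_add) alg \<Rightarrow> ('k, 'b::ab_group_add) alg \<Rightarrow>
    'b \<Rightarrow> ('k, 'a, 'b) tensor multiplier" where
  "leg2 A B b = mten A B (mone A) (emb B b)"

text \<open>\<open>f \<otimes> g : A \<otimes> C \<rightarrow> M(B \<otimes> D)\<close> for \<open>f : A \<rightarrow> M(B)\<close> and \<open>g : C \<rightarrow> M(D)\<close>.\<close>

definition hten :: "('k::field, 'a::ab_group_add) alg \<Rightarrow> ('k, 'b::ab_group_add) alg \<Rightarrow>
    ('k, 'c::ab_group_add) alg \<Rightarrow> ('k, 'd::ab_group_add) alg \<Rightarrow>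
    ('a \<Rightarrow> 'b multiplier) \<Rightarrow> ('c \<Rightarrow> 'd multiplier) \<Rightarrow>
    ('k, 'a, 'c) tensor \<Rightarrow> ('k, 'b, 'd) tensor multiplier" where
  "hten A B C D f g = tlift A C (\<lambda>a c. mten B D (f a) (g c))"


section \<open>Regular multiplier Hopf algebras\<close>

type_synonym ('k, 'a) comult = "'a \<Rightarrow> ('k, 'a, 'a) tensor multiplier"

definition co_comult :: "('k::field, 'a::ab_group_add) alg \<Rightarrow> ('k, 'a) comult \<Rightarrow> ('k, 'a) comult"
where
  "co_comult A \<Delta> a = ext_alg (A \<otimes> A) (A \<otimes> A) (flip A A) (\<Delta> a)"

text \<open>
  As \<open>A\<^sup>o\<^sup>p \<otimes> A\<^sup>o\<^sup>p\<close> is the opposite of \<open>A \<otimes> A\<close>, passing from \<open>\<Delta>\<close> to \<open>\<Delta>\<^sup>o\<^sup>p\<close> exchanges left and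
  right multiplication.
\<close>

definition op_comult :: "('k, 'a) comult \<Rightarrow> ('k, 'a) comult" where
  "op_comult \<Delta> a = prod.swap (\<Delta> a)"

text \<open>\<open>\<Delta>(a)(1 \<otimes> b)\<close> and \<open>(a \<otimes> 1)\<Delta>(b)\<close>, as elements of \<open>A \<otimes> A\<close>.\<close>

definition T1 :: "('k::field, 'a::ab_group_add) alg \<Rightarrow> ('k, 'a) comult \<Rightarrow> 'a \<Rightarrow> 'a \<Rightarrow>
    ('k, 'a, 'a) tensor" where
  "T1 A \<Delta> a b = unemb (A \<otimes> A) (\<Delta> a \<cdot> leg2 A A b)"

definition T2 :: "('k::field, 'a::ab_group_add) alg \<Rightarrow> ('k, 'a) comult \<Rightarrow> 'a \<Rightarrow> 'a \<Rightarrow>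
    ('k, 'a, 'a) tensor" where
  "T2 A \<Delta> a b = unemb (A \<otimes> A) (leg1 A A a \<cdot> \<Delta> b)"

definition mult_hopf_alg :: "('k::field, 'a::ab_group_add) alg \<Rightarrow> ('k, 'a) comult \<Rightarrow> bool" where
  "mult_hopf_alg A \<Delta> \<longleftrightarrow>
     nd_algebra A \<and> alg_hom A (mult_alg (A \<otimes> A)) \<Delta> \<and>
     (\<forall>a\<in>carr A. \<forall>b\<in>carr A.
        \<Delta> a \<cdot> leg2 A A b \<in> emb_image (A \<otimes> A) \<and> leg1 A A a \<cdot> \<Delta> b \<in> emb_image (A \<otimes> A)) \<and>
     (\<forall>a\<in>carr A. \<forall>b\<in>carr A. \<forall>c\<in>carr A.
        leg1 A (A \<otimes> A) a \<cdot>
          ext_alg ((A \<otimes> A) \<otimes> A) (A \<otimes> A \<otimes> A) (tassoc A A A)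
            (hten A (A \<otimes> A) A A \<Delta> (emb A) (T1 A \<Delta> b c))
        = hten A A A (A \<otimes> A) (emb A) \<Delta> (T2 A \<Delta> a b) \<cdot>
          mten A (A \<otimes> A) (mone A) (leg2 A A c)) \<and>
     bij_betw (tlift A A (T1 A \<Delta>)) (carr (A \<otimes> A)) (carr (A \<otimes> A)) \<and>
     bij_betw (tlift A A (T2 A \<Delta>)) (carr (A \<otimes> A)) (carr (A \<otimes> A))"

definition regular_mult_hopf_alg :: "('k::field, 'a::ab_group_add) alg \<Rightarrow> ('k, 'a) comult \<Rightarrow> bool"
where
  "regular_mult_hopf_alg A \<Delta> \<longleftrightarrow> mult_hopf_alg A \<Delta> \<and> mult_hopf_alg A (co_comult A \<Delta>)"

text \<open>
  The counit is the homomorphism \<open>\<epsilon> : A \<rightarrow> k\<close> with \<open>(\<epsilon> \<otimes> id)(\<Delta>(a)(1 \<otimes> b)) = a b\<close> and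
  \<open>(id \<otimes> \<epsilon>)((a \<otimes> 1)\<Delta>(b)) = a b\<close>.
\<close>

definition counit :: "('k::field, 'a::ab_group_add) alg \<Rightarrow> ('k, 'a) comult \<Rightarrow> 'a \<Rightarrow> 'k" where
  "counit A \<Delta> = (THE \<epsilon>. alg_hom A field_alg \<epsilon> \<and> (\<forall>a. a \<notin> carr A \<longrightarrow> \<epsilon> a = 0) \<and>
     (\<forall>a\<in>carr A. \<forall>b\<in>carr A.
        slice1 A A \<epsilon> (T1 A \<Delta> a b) = mul A a b \<and> slice2 A A \<epsilon> (T2 A \<Delta> a b) = mul A a b))"


section \<open>Actions and coactions\<close>

definition left_coaction :: "('k::field, 'a::ab_group_add) alg \<Rightarrow> ('k, 'a) comult \<Rightarrow>
    ('k, 'x::ab_group_add) alg \<Rightarrow> ('x \<Rightarrow> ('k, 'a, 'x) tensor multiplier) \<Rightarrow> bool" where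
  "left_coaction A \<Delta> X \<Gamma> \<longleftrightarrow>
     nondeg_hom X (A \<otimes> X) \<Gamma> \<and>
     lspan (mult_alg (A \<otimes> X)) {leg1 A X a \<cdot> \<Gamma> x | a x. a \<in> carr A \<and> x \<in> carr X}
       = emb_image (A \<otimes> X) \<and>
     lspan (mult_alg (A \<otimes> X)) {\<Gamma> x \<cdot> leg1 A X a | a x. a \<in> carr A \<and> x \<in> carr X}
       = emb_image (A \<otimes> X) \<and>
     (\<forall>x\<in>carr X.
        ext_alg ((A \<otimes> A) \<otimes> X) (A \<otimes> A \<otimes> X) (tassoc A A X)
          (ext (A \<otimes> X) ((A \<otimes> A) \<otimes> X) (hten A (A \<otimes> A) X X \<Delta> (emb X)) (\<Gamma> x))
        = ext (A \<otimes> X) (A \<otimes> A \<otimes> X) (hten A A X (A \<otimes> X) (emb A) \<Gamma>) (\<Gamma> x)) \<and>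
     (\<forall>x\<in>carr X. ext_alg (A \<otimes> X) X (slice1 A X (counit A \<Delta>)) (\<Gamma> x) = emb X x)"

text \<open>
  In the compatibility condition \<open>x y \<lhd> a = (x \<lhd> a\<^sub>(\<^sub>1\<^sub>)) (y \<lhd> a\<^sub>(\<^sub>2\<^sub>))\<close> the first leg of \<open>\<Delta>(a)\<close> is
  covered by writing \<open>x = z \<lhd> c\<close>: then \<open>x \<lhd> a\<^sub>(\<^sub>1\<^sub>) = z \<lhd> c a\<^sub>(\<^sub>1\<^sub>)\<close> and \<open>(c \<otimes> 1)\<Delta>(a) \<in> A \<otimes> A\<close>. By
  unitality such \<open>x\<close> span \<open>X\<close>.
\<close>

definition right_action :: "('k::field, 'a::ab_group_add) alg \<Rightarrow> ('k, 'a) comult \<Rightarrow>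
    ('k, 'x::ab_group_add) alg \<Rightarrow> ('x \<Rightarrow> 'a \<Rightarrow> 'x) \<Rightarrow> bool" where
  "right_action A \<Delta> X act \<longleftrightarrow>
     (\<forall>x\<in>carr X. \<forall>a\<in>carr A. act x a \<in> carr X) \<and>
     bilinear_on X A (smul X) act \<and>
     (\<forall>x\<in>carr X. \<forall>a\<in>carr A. \<forall>b\<in>carr A. act (act x a) b = act x (mul A a b)) \<and>
     lspan X {act x a | x a. x \<in> carr X \<and> a \<in> carr A} = carr X \<and>
     (\<forall>z\<in>carr X. \<forall>c\<in>carr A. \<forall>y\<in>carr X. \<forall>a\<in>carr A.
        act (mul X (act z c) y) a
        = tlift A A (\<lambda>e f. mul X (act z e) (act y f)) (T2 A \<Delta> c a))"


section \<open>Pairings\<close>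

text \<open>
  The multipliers \<open>\<omega>(c\<^sub>(\<^sub>1\<^sub>)) c\<^sub>(\<^sub>2\<^sub>)\<close> and \<open>c\<^sub>(\<^sub>1\<^sub>) \<omega>(c\<^sub>(\<^sub>2\<^sub>))\<close> of \<open>C\<close>, for a linear functional \<open>\<omega>\<close>.
\<close>

definition mslice1 :: "('k::field, 'c::ab_group_add) alg \<Rightarrow> ('k, 'c) comult \<Rightarrow> ('c \<Rightarrow> 'k) \<Rightarrow>
    'c \<Rightarrow> 'c multiplier" where
  "mslice1 C \<Delta> \<omega> c =
     (\<lambda>d. if d \<in> carr C then slice1 C C \<omega> (unemb (C \<otimes> C) (\<Delta> c \<cdot> leg2 C C d)) else 0,
      \<lambda>d. if d \<in> carr C then slice1 C C \<omega> (unemb (C \<otimes> C) (leg2 C C d \<cdot> \<Delta> c)) else 0)"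

definition mslice2 :: "('k::field, 'c::ab_group_add) alg \<Rightarrow> ('k, 'c) comult \<Rightarrow> ('c \<Rightarrow> 'k) \<Rightarrow>
    'c \<Rightarrow> 'c multiplier" where
  "mslice2 C \<Delta> \<omega> c =
     (\<lambda>d. if d \<in> carr C then slice2 C C \<omega> (unemb (C \<otimes> C) (\<Delta> c \<cdot> leg1 C C d)) else 0,
      \<lambda>d. if d \<in> carr C then slice2 C C \<omega> (unemb (C \<otimes> C) (leg1 C C d \<cdot> \<Delta> c)) else 0)"

text \<open>
  When these multipliers lie in \<open>C\<close>, the four actions of a pairing \<open>p\<close> are

    \<open>a \<rhd> b = b\<^sub>(\<^sub>1\<^sub>) p(a, b\<^sub>(\<^sub>2\<^sub>)) = hit2 B \<Delta>B (p a) b\<close>,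
    \<open>b \<lhd> a = p(a, b\<^sub>(\<^sub>1\<^sub>)) b\<^sub>(\<^sub>2\<^sub>) = hit1 B \<Delta>B (p a) b\<close>,

    \<open>b \<rhd> a = a\<^sub>(\<^sub>1\<^sub>) p(a\<^sub>(\<^sub>2\<^sub>), b) = hit2 A \<Delta>A (\<lambda>x. p x b) a\<close>,
    \<open>a \<lhd> b = p(a\<^sub>(\<^sub>1\<^sub>), b) a\<^sub>(\<^sub>2\<^sub>) = hit1 A \<Delta>A (\<lambda>x. p x b) a\<close>.
\<close>

definition hit1 :: "('k::field, 'c::ab_group_add) alg \<Rightarrow> ('k, 'c) comult \<Rightarrow> ('c \<Rightarrow> 'k) \<Rightarrow> 'c \<Rightarrow> 'c"
where
  "hit1 C \<Delta> \<omega> c = unemb C (mslice1 C \<Delta> \<omega> c)"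

definition hit2 :: "('k::field, 'c::ab_group_add) alg \<Rightarrow> ('k, 'c) comult \<Rightarrow> ('c \<Rightarrow> 'k) \<Rightarrow> 'c \<Rightarrow> 'c"
where
  "hit2 C \<Delta> \<omega> c = unemb C (mslice2 C \<Delta> \<omega> c)"

text \<open>
  \<open>p(a a', b) = p(a, b\<^sub>(\<^sub>1\<^sub>)) p(a', b\<^sub>(\<^sub>2\<^sub>))\<close> is read with either factor evaluated first, that is as
  \<open>p(a a', b) = p(a, a' \<rhd> b)\<close> and as \<open>p(a a', b) = p(a', b \<lhd> a)\<close>, and likewise for
  \<open>p(a, b b')\<close>; given the other axioms the two readings agree.
\<close>

definition pairing :: "('k::field, 'a::ab_group_add) alg \<Rightarrow> ('k, 'a) comult \<Rightarrow>
    ('k, 'b::ab_group_add) alg \<Rightarrow> ('k, 'b) comult \<Rightarrow> ('a \<Rightarrow> 'b \<Rightarrow> 'k) \<Rightarrow> bool" where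
  "pairing A \<Delta>A B \<Delta>B p \<longleftrightarrow>
     regular_mult_hopf_alg A \<Delta>A \<and> regular_mult_hopf_alg B \<Delta>B \<and>
     bilinear_on A B (*) p \<and>
     (\<forall>a\<in>carr A. (\<forall>b\<in>carr B. p a b = 0) \<longrightarrow> a = 0) \<and>
     (\<forall>b\<in>carr B. (\<forall>a\<in>carr A. p a b = 0) \<longrightarrow> b = 0) \<and>
     (\<forall>a\<in>carr A. \<forall>b\<in>carr B.
        mslice2 B \<Delta>B (p a) b \<in> emb_image B \<and> mslice1 B \<Delta>B (p a) b \<in> emb_image B \<and>
        mslice2 A \<Delta>A (\<lambda>x. p x b) a \<in> emb_image A \<and> mslice1 A \<Delta>A (\<lambda>x. p x b) a \<in> emb_image A) \<and>
     (\<forall>a\<in>carr A. \<forall>a'\<in>carr A. \<forall>b\<in>carr B.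
        p (mul A a a') b = p a (hit2 B \<Delta>B (p a') b) \<and>
        p (mul A a a') b = p a' (hit1 B \<Delta>B (p a) b)) \<and>
     (\<forall>a\<in>carr A. \<forall>b\<in>carr B. \<forall>b'\<in>carr B.
        p a (mul B b b') = p (hit2 A \<Delta>A (\<lambda>x. p x b') a) b \<and>
        p a (mul B b b') = p (hit1 A \<Delta>A (\<lambda>x. p x b) a) b') \<and>
     lspan B {hit2 B \<Delta>B (p a) b | a b. a \<in> carr A \<and> b \<in> carr B} = carr B \<and>
     lspan B {hit1 B \<Delta>B (p a) b | a b. a \<in> carr A \<and> b \<in> carr B} = carr B \<and>
     lspan A {hit2 A \<Delta>A (\<lambda>x. p x b) a | a b. a \<in> carr A \<and> b \<in> carr B} = carr A \<and>
     lspan A {hit1 A \<Delta>A (\<lambda>x. p x b) a | a b. a \<in> carr A \<and> b \<in> carr B} = carr A"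

text \<open>\<open>p\<^sup>2(t, b \<otimes> a)\<close> for \<open>t \<in> A \<otimes> B\<close>, and its extension to \<open>m \<in> M(A \<otimes> B)\<close>.\<close>

definition pair2 :: "('k::field, 'a::ab_group_add) alg \<Rightarrow> ('k, 'b::ab_group_add) alg \<Rightarrow>
    ('a \<Rightarrow> 'b \<Rightarrow> 'k) \<Rightarrow> ('k, 'a, 'b) tensor \<Rightarrow> 'b \<Rightarrow> 'a \<Rightarrow> 'k" where
  "pair2 A B p t b a = tlift A B (\<lambda>a' b'. p a' b * p a b') t"

definition pair2_ext :: "('k::field, 'a::ab_group_add) alg \<Rightarrow> ('k, 'a) comult \<Rightarrow>
    ('k, 'b::ab_group_add) alg \<Rightarrow> ('k, 'b) comult \<Rightarrow> ('a \<Rightarrow> 'b \<Rightarrow> 'k) \<Rightarrow>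
    ('k, 'a, 'b) tensor multiplier \<Rightarrow> 'b \<Rightarrow> 'a \<Rightarrow> 'k" where
  "pair2_ext A \<Delta>A B \<Delta>B p m b a = (THE r. \<forall>x\<in>carr A. \<forall>y\<in>carr B.
     hit2 B \<Delta>B (p x) b = b \<and> hit2 A \<Delta>A (\<lambda>z. p z y) a = a \<longrightarrow>
     r = pair2 A B p (fst m (ten A B x y)) b a)"

definition is_canonical_multiplier :: "('k::field, 'a::ab_group_add) alg \<Rightarrow> ('k, 'a) comult \<Rightarrow>
    ('k, 'b::ab_group_add) alg \<Rightarrow> ('k, 'b) comult \<Rightarrow> ('a \<Rightarrow> 'b \<Rightarrow> 'k) \<Rightarrow>
    ('k, 'a, 'b) tensor multiplier \<Rightarrow> bool" where
  "is_canonical_multiplier A \<Delta>A B \<Delta>B p U \<longleftrightarrow>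
     U \<in> carr (mult_alg (A \<otimes> B)) \<and>
     (\<exists>V \<in> carr (mult_alg (A \<otimes> B)). U \<cdot> V = mone (A \<otimes> B) \<and> V \<cdot> U = mone (A \<otimes> B)) \<and>
     (\<forall>a\<in>carr A. \<forall>b\<in>carr B. pair2_ext A \<Delta>A B \<Delta>B p U b a = p a b)"

definition canonical_multiplier :: "('k::field, 'a::ab_group_add) alg \<Rightarrow> ('k, 'a) comult \<Rightarrow>
    ('k, 'b::ab_group_add) alg \<Rightarrow> ('k, 'b) comult \<Rightarrow> ('a \<Rightarrow> 'b \<Rightarrow> 'k) \<Rightarrow>
    ('k, 'a, 'b) tensor multiplier" where
  "canonical_multiplier A \<Delta>A B \<Delta>B p = (THE U. is_canonical_multiplier A \<Delta>A B \<Delta>B p U)"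

definition admissible_pairing :: "('k::field, 'a::ab_group_add) alg \<Rightarrow> ('k, 'a) comult \<Rightarrow>
    ('k, 'b::ab_group_add) alg \<Rightarrow> ('k, 'b) comult \<Rightarrow> ('a \<Rightarrow> 'b \<Rightarrow> 'k) \<Rightarrow> bool" where
  "admissible_pairing A \<Delta>A B \<Delta>B p \<longleftrightarrow>
     pairing A \<Delta>A B \<Delta>B p \<and>
     (\<exists>U. is_canonical_multiplier A \<Delta>A B \<Delta>B p U \<and>
        (\<forall>a\<in>carr A. \<forall>b\<in>carr B.
           leg2 A B b \<cdot> U \<cdot> leg1 A B a \<in> emb_image (A \<otimes> B) \<and>
           leg1 A B a \<cdot> U \<cdot> leg2 A B b \<in> emb_image (A \<otimes> B)))"

text \<open>\<open>U\<^sup>\<circ> \<in> M(A\<^sup>o\<^sup>p \<otimes> B)\<close> for \<open>U \<in> M(A \<otimes> B)\<close> as in the definition of admissibility.\<close>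

definition circ_multiplier :: "('k::field, 'a::ab_group_add) alg \<Rightarrow> ('k, 'b::ab_group_add) alg \<Rightarrow>
    ('k, 'a, 'b) tensor multiplier \<Rightarrow> ('k, 'a, 'b) tensor multiplier" where
  "circ_multiplier A B U =
     (tlift A B (\<lambda>a b. unemb (A \<otimes> B) (leg1 A B a \<cdot> U \<cdot> leg2 A B b)),
      tlift A B (\<lambda>a b. unemb (A \<otimes> B) (leg2 A B b \<cdot> U \<cdot> leg1 A B a)))"

text \<open>
  The slice \<open>(p(a, -) \<otimes> id)(\<beta>(x))\<close>. Since \<open>p(a \<lhd> b, b') = p(a, b b')\<close>, the functional
  \<open>p(a, -)\<close> absorbs \<open>b\<close> whenever \<open>a \<lhd> b = a\<close>, so that the slice is evaluated on
  \<open>(b \<otimes> 1)\<beta>(x) \<in> B \<otimes> X\<close> for any such \<open>b\<close>.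
\<close>

definition induced_action :: "('k::field, 'a::ab_group_add) alg \<Rightarrow> ('k, 'a) comult \<Rightarrow>
    ('k, 'b::ab_group_add) alg \<Rightarrow> ('a \<Rightarrow> 'b \<Rightarrow> 'k) \<Rightarrow>
    ('k, 'x::ab_group_add) alg \<Rightarrow> ('x \<Rightarrow> ('k, 'b, 'x) tensor multiplier) \<Rightarrow> 'x \<Rightarrow> 'a \<Rightarrow> 'x" where
  "induced_action A \<Delta>A B p X \<beta> x a = (THE y. \<forall>b\<in>carr B.
     hit1 A \<Delta>A (\<lambda>z. p z b) a = a \<longrightarrow>
     y = slice1 B X (p a) (unemb (B \<otimes> X) (leg1 B X b \<cdot> \<beta> x)))"


section \<open>Yetter--Drinfeld algebras\<close>

definition left_left_YD_algebra :: "('k::field, 'a::ab_group_add) alg \<Rightarrow> ('k, 'a) comult \<Rightarrow>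
    ('k, 'b::ab_group_add) alg \<Rightarrow> ('k, 'b) comult \<Rightarrow> ('a \<Rightarrow> 'b \<Rightarrow> 'k) \<Rightarrow>
    ('k, 'x::ab_group_add) alg \<Rightarrow> ('x \<Rightarrow> ('k, 'a, 'x) tensor multiplier) \<Rightarrow>
    ('x \<Rightarrow> ('k, 'b, 'x) tensor multiplier) \<Rightarrow> bool" where
  "left_left_YD_algebra A \<Delta>A B \<Delta>B p X \<alpha> \<beta> \<longleftrightarrow>
     left_coaction (op_alg A) (op_comult \<Delta>A) X \<alpha> \<and> left_coaction B \<Delta>B X \<beta> \<and>
     (let A' = op_alg A;
          W = ext_alg ((A' \<otimes> B) \<otimes> X) (A' \<otimes> B \<otimes> X) (tassoc A' B X)
                (mten (A' \<otimes> B) X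
                   (circ_multiplier A B (canonical_multiplier A \<Delta>A B \<Delta>B p)) (mone X))
      in \<forall>x\<in>carr X.
        ext (B \<otimes> X) (B \<otimes> A' \<otimes> X) (hten B B X (A' \<otimes> X) (emb B) \<alpha>) (\<beta> x)
        = ext_alg (A' \<otimes> B \<otimes> X) (B \<otimes> A' \<otimes> X) (flip12 A' B X)
            (W \<cdot> ext (A' \<otimes> X) (A' \<otimes> B \<otimes> X) (hten A' A' X (B \<otimes> X) (emb A') \<beta>) (\<alpha> x)
               \<cdot> minv (A' \<otimes> B \<otimes> X) W))"

text \<open>
  \<open>bracket A X \<Gamma> x a'\<close> is \<open>a' x\<^sub>[\<^sub>-\<^sub>1\<^sub>] \<otimes> x\<^sub>[\<^sub>0\<^sub>] \<in> A \<otimes> X\<close>, i.e. \<open>\<Gamma>(x)(a' \<otimes> 1) \<in> A\<^sup>o\<^sup>p \<otimes> X\<close>. In the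
  Yetter--Drinfeld condition, the left-hand side \<open>a' x\<^sub>[\<^sub>-\<^sub>1\<^sub>] a\<^sub>(\<^sub>1\<^sub>) \<otimes> (x\<^sub>[\<^sub>0\<^sub>] \<lhd> a\<^sub>(\<^sub>2\<^sub>))\<close> is obtained from
  \<open>\<Sum> c \<otimes> y = bracket A X \<Gamma> x a'\<close> by evaluating \<open>(c \<otimes> 1)\<Delta>(a) \<in> A \<otimes> A\<close>, and the right-hand
  side from \<open>\<Sum> d \<otimes> e = a\<^sub>(\<^sub>1\<^sub>) \<otimes> a' a\<^sub>(\<^sub>2\<^sub>) = (1 \<otimes> a')\<Delta>(a) \<in> A \<otimes> A\<close> as
  \<open>\<Sum> e (x \<lhd> d)\<^sub>[\<^sub>-\<^sub>1\<^sub>] \<otimes> (x \<lhd> d)\<^sub>[\<^sub>0\<^sub>]\<close>.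
\<close>

definition bracket :: "('k::field, 'a::ab_group_add) alg \<Rightarrow> ('k, 'x::ab_group_add) alg \<Rightarrow>
    ('x \<Rightarrow> ('k, 'a, 'x) tensor multiplier) \<Rightarrow> 'x \<Rightarrow> 'a \<Rightarrow> ('k, 'a, 'x) tensor" where
  "bracket A X \<Gamma> x a' = unemb (op_alg A \<otimes> X) (\<Gamma> x \<cdot> leg1 (op_alg A) X a')"

definition right_left_YD_algebra :: "('k::field, 'a::ab_group_add) alg \<Rightarrow> ('k, 'a) comult \<Rightarrow>
    ('k, 'x::ab_group_add) alg \<Rightarrow> ('x \<Rightarrow> 'a \<Rightarrow> 'x) \<Rightarrow>
    ('x \<Rightarrow> ('k, 'a, 'x) tensor multiplier) \<Rightarrow> bool" where
  "right_left_YD_algebra A \<Delta> X act \<Gamma> \<longleftrightarrow>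
     right_action A \<Delta> X act \<and> left_coaction (op_alg A) (op_comult \<Delta>) X \<Gamma> \<and>
     (\<forall>x\<in>carr X. \<forall>a\<in>carr A. \<forall>a'\<in>carr A.
        tlift A X (\<lambda>c y. tlift A A (\<lambda>e f. ten A X e (act y f)) (T2 A \<Delta> c a)) (bracket A X \<Gamma> x a')
        = tlift A A (\<lambda>d e. bracket A X \<Gamma> (act x d) e)
            (unemb (A \<otimes> A) (leg2 A A a' \<cdot> \<Delta> a)))"

end

theory Submission
  imports Defs
begin

text \<open>
  Slicing the \<open>B\<close>-leg of the canonical multiplier \<open>U\<close> with \<open>p(a, -)\<close> returns \<open>a\<close>, and slicing
  \<open>(x \<otimes> 1)U(1 \<otimes> y)\<close> gives \<open>x\<close> times the translate of \<open>a\<close> by \<open>y\<close>. Hence, if the Yetter--Drinfeld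
  equation for \<open>\<alpha>\<close> and \<open>\<beta>\<close>, multiplied by \<open>U\<^sup>\<circ>\<close> so that no inverse occurs, is applied to
  \<open>c \<otimes> b \<otimes> y\<close> and its \<open>B\<close>-leg is sliced with \<open>p(a, -)\<close>, both sides become the two sides of the
  right-left condition for the translate of \<open>a\<close> by \<open>b\<close>, times \<open>1 \<otimes> y\<close>. The pairing is
  non-degenerate and its module actions are unital, so these slices contain all information.
  The remaining point is the invertibility of \<open>U\<^sup>\<circ>\<close>; an inverse of
  \<open>x \<otimes> y \<mapsto> (x \<otimes> 1)U(1 \<otimes> y)\<close> is built from \<open>(S\<^sup>-\<^sup>1 \<otimes> id)(U)\<close>.
\<close>

text \<open>\<open>U\<^sup>\<circ>\<close> lives over the opposite algebra, so an inverse of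
  \<open>U\<close> does not directly yield an inverse of it. This is why an antipode is needed, and
  the definitions contain none. Counit and antipode are rebuilt from the canonical bijections and
  the pairing: \<epsilon>(a) is p(a, e) for a local unit e, and S comes from inverting a \<otimes> c
  \<mapsto> \<Delta>(a)(1 \<otimes> c). Local units of A and B come from the same bijections, and
  the unital module actions carry them over to the pairing. The second obstacle is covering: no
  Sweedler leg exists by itself, so every formula is proved for elements of a tensor product and
  tested by multiplication with elementary tensors or by slices. The right-left notion also demands
  that the induced action be a unital action compatible with products; this is derived from the span
  conditions, the coassociativity and the multiplicativity of \<beta>. Tensors are functions, so the
  pointwise simp rules for sums are switched off to keep sums of tensors intact.\<close>

declare plus_fun_apply [simp del] zero_fun_apply [simp del] minus_apply [simp del]

section \<open>Linear and bilinear maps on carriers\<close>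

definition vsp :: "('k::field, 'a::ab_group_add) alg \<Rightarrow> bool" where
  "vsp A \<longleftrightarrow> vector_space (smul A) \<and> module.subspace (smul A) (carr A)"

text \<open>Linearity is demanded on carriers only, so maps written as lambda terms need no cutoff
  outside. Only \<open>carr\<close> and \<open>smul\<close> are read, so the notion serves
  \<open>field_alg\<close>, \<open>op_alg\<close> and \<open>mult_alg\<close> alike.\<close>

definition lin :: "('k::field, 'a::ab_group_add) alg \<Rightarrow> ('k, 'b::ab_group_add) alg \<Rightarrow> ('a \<Rightarrow> 'b) \<Rightarrow> bool"
where
  "lin A C f \<longleftrightarrow> (\<forall>x\<in>carr A. f x \<in> carr C) \<and> (\<forall>x\<in>carr A. \<forall>y\<in>carr A. f (x + y) = f x + f y) \<and>
     (\<forall>c. \<forall>x\<in>carr A. f (smul A c x) = smul C c (f x))"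

definition bil :: "('k::field, 'a::ab_group_add) alg \<Rightarrow> ('k, 'b::ab_group_add) alg \<Rightarrow>
    ('k, 'c::ab_group_add) alg \<Rightarrow> ('a \<Rightarrow> 'b \<Rightarrow> 'c) \<Rightarrow> bool" where
  "bil A B C f \<longleftrightarrow> (\<forall>a\<in>carr A. lin B C (f a)) \<and> (\<forall>b\<in>carr B. lin A C (\<lambda>a. f a b))"

definition tmap :: "('k::field, 'a::ab_group_add) alg \<Rightarrow> ('k, 'b::ab_group_add) alg \<Rightarrow>
    ('k, 'c::ab_group_add) alg \<Rightarrow> ('k, 'd::ab_group_add) alg \<Rightarrow> ('a \<Rightarrow> 'c) \<Rightarrow> ('b \<Rightarrow> 'd) \<Rightarrow>
    ('k, 'a, 'b) tensor \<Rightarrow> ('k, 'c, 'd) tensor" where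
  "tmap A B C D f g = tlift A B (\<lambda>a b. ten C D (f a) (g b))"

context
  fixes A :: "('k::field, 'a::ab_group_add) alg"
  assumes A: "vsp A"
begin

interpretation vector_space "smul A" using A by (simp add: vsp_def)

lemma vsp_add [intro]: "x \<in> carr A \<Longrightarrow> y \<in> carr A \<Longrightarrow> x + y \<in> carr A"
  and vsp_zero [simp, intro]: "0 \<in> carr A"
  and vsp_smul [intro]: "x \<in> carr A \<Longrightarrow> smul A c x \<in> carr A"
  and vsp_diff [intro]: "x \<in> carr A \<Longrightarrow> y \<in> carr A \<Longrightarrow> x - y \<in> carr A"
  using A subspace_add subspace_0 subspace_scale subspace_diff unfolding vsp_def by blast+

lemma vsp_sum: "(\<And>i. i \<in> I \<Longrightarrow> f i \<in> carr A) \<Longrightarrow> sum f I \<in> carr A"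
  using A subspace_sum unfolding vsp_def by blast

lemma smul_laws:
  "smul A c (x + y) = smul A c x + smul A c y"
  "smul A (c + d) x = smul A c x + smul A d x"
  "smul A c (smul A d x) = smul A (c * d) x"
  "smul A 1 x = x" "smul A 0 x = 0" "smul A c 0 = 0"
  "smul A c (x - y) = smul A c x - smul A c y"
  by (simp_all add: scale_right_distrib scale_left_distrib scale_right_diff_distrib)

lemma smul_eq_0: "smul A c x = 0 \<longleftrightarrow> c = 0 \<or> x = 0"
  by (rule scale_eq_0_iff)

lemma lspan_induct:
  assumes x: "x \<in> lspan A E" and E: "\<And>e. e \<in> E \<Longrightarrow> P e" and z: "P 0"
    and a: "\<And>x y. P x \<Longrightarrow> P y \<Longrightarrow> P (x + y)" and s: "\<And>c x. P x \<Longrightarrow> P (smul A c x)"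
  shows "P x"
  using x unfolding lspan_def
  by (induction rule: span_induct_alt) (auto intro: E z a s)

lemma lspan_base: "e \<in> E \<Longrightarrow> e \<in> lspan A E"
  unfolding lspan_def by (rule span_base)

lemma lspan_carr: "lspan A (carr A) = carr A"
  using A unfolding lspan_def vsp_def by (simp add: span_eq_iff)

lemma lspan_mono: "E \<subseteq> F \<Longrightarrow> lspan A E \<subseteq> lspan A F"
  unfolding lspan_def by (rule span_mono)

lemma lspan_eqI:
  assumes "E \<subseteq> carr A" "\<And>x. x \<in> carr A \<Longrightarrow> x \<in> lspan A E"
  shows "lspan A E = carr A"
  using assms lspan_mono[of E "carr A"] lspan_carr by blast

lemma lspan_add: "x \<in> lspan A E \<Longrightarrow> y \<in> lspan A E \<Longrightarrow> x + y \<in> lspan A E"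
  and lspan_smul: "x \<in> lspan A E \<Longrightarrow> smul A c x \<in> lspan A E"
  and lspan_zero: "0 \<in> lspan A E"
  unfolding lspan_def by (auto intro: span_add span_scale span_zero)

end

lemma vsp_algebra [simp]: "is_algebra A \<Longrightarrow> vsp A"
  by (simp add: is_algebra_def vsp_def)

lemma vsp_field [simp]: "vsp field_alg"
  unfolding vsp_def field_alg_def
  by (auto simp: vector_space_def module_def module.subspace_def algebra_simps)

lemma field_alg_simps [simp]: "carr field_alg = UNIV" "smul field_alg = (*)" "mul field_alg = (*)"
  by (simp_all add: field_alg_def)

lemma op_alg_simps [simp]: "carr (op_alg A) = carr A" "smul (op_alg A) = smul A"
    "mul (op_alg A) x y = mul A y x"
  by (simp_all add: op_alg_def)

lemma tensor_alg_simps [simp]: "carr (A \<otimes> B) = tcarr A B" "smul (A \<otimes> B) = tsmul"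
  by (simp_all add: tensor_alg_def)

lemma vsp_tensor [simp]: "vsp (A \<otimes> B)"
  unfolding vsp_def tcarr_def tensor_alg_simps
  by (intro conjI vector_space_tsmul module.subspace_span module_iff_vector_space[THEN iffD2])

lemma vsp_op [simp]: "vsp (op_alg A) \<longleftrightarrow> vsp A"
  by (simp add: vsp_def)

lemma linI:
  assumes "\<And>x. x \<in> carr A \<Longrightarrow> f x \<in> carr C"
    and "\<And>x y. x \<in> carr A \<Longrightarrow> y \<in> carr A \<Longrightarrow> f (x + y) = f x + f y"
    and "\<And>c x. x \<in> carr A \<Longrightarrow> f (smul A c x) = smul C c (f x)"
  shows "lin A C f"
  using assms by (simp add: lin_def)

lemma lin_carr: "lin A C f \<Longrightarrow> x \<in> carr A \<Longrightarrow> f x \<in> carr C"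
  and lin_add: "lin A C f \<Longrightarrow> x \<in> carr A \<Longrightarrow> y \<in> carr A \<Longrightarrow> f (x + y) = f x + f y"
  and lin_smul: "lin A C f \<Longrightarrow> x \<in> carr A \<Longrightarrow> f (smul A c x) = smul C c (f x)"
  by (simp_all add: lin_def)

lemma lin_zero: "vsp A \<Longrightarrow> lin A C f \<Longrightarrow> f 0 = 0"
  using lin_add[of A C f 0 0] by simp

lemma lin_diff: "vsp A \<Longrightarrow> lin A C f \<Longrightarrow> x \<in> carr A \<Longrightarrow> y \<in> carr A \<Longrightarrow> f (x - y) = f x - f y"
  using lin_add[of A C f "x - y" y] by (simp add: vsp_diff)

lemma lin_sum:
  assumes "vsp A" "lin A C f" "\<And>i. i \<in> I \<Longrightarrow> x i \<in> carr A"
  shows "f (sum x I) = (\<Sum>i\<in>I. f (x i))"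
  using assms(3)
proof (induction I rule: infinite_finite_induct)
  case (insert i I)
  then show ?case using assms by (simp add: lin_add vsp_sum)
qed (use assms in \<open>simp_all add: lin_zero\<close>)

lemma lin_comp: "lin A B f \<Longrightarrow> lin B C g \<Longrightarrow> lin A C (\<lambda>x. g (f x))"
  by (simp add: lin_def)

lemma lin_id: "lin A A (\<lambda>x. x)"
  by (simp add: lin_def)

lemma lin_const_zero: "vsp C \<Longrightarrow> lin A C (\<lambda>x. 0)"
  by (auto intro!: linI simp: smul_laws)

lemma lin_plus: "vsp C \<Longrightarrow> lin A C f \<Longrightarrow> lin A C g \<Longrightarrow> lin A C (\<lambda>x. f x + g x)"
  by (rule linI) (auto simp: lin_def smul_laws)

lemma lin_minus: "vsp C \<Longrightarrow> lin A C f \<Longrightarrow> lin A C g \<Longrightarrow> lin A C (\<lambda>x. f x - g x)"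
  by (rule linI) (auto simp: lin_def smul_laws)

lemma lin_smul_const: "vsp C \<Longrightarrow> lin A C f \<Longrightarrow> lin A C (\<lambda>x. smul C c (f x))"
  by (rule linI) (auto simp: lin_def smul_laws mult.commute)

lemma lin_smul_fun: "vsp C \<Longrightarrow> lin A field_alg \<omega> \<Longrightarrow> x \<in> carr C \<Longrightarrow> lin A C (\<lambda>a. smul C (\<omega> a) x)"
  by (rule linI) (auto simp: lin_def smul_laws)

lemma lin_op [simp]: "lin (op_alg A) C f \<longleftrightarrow> lin A C f" "lin A (op_alg C) f \<longleftrightarrow> lin A C f"
  by (simp_all add: lin_def)

lemma lin_cong: "(\<And>x. x \<in> carr A \<Longrightarrow> f x = g x) \<Longrightarrow> vsp A \<Longrightarrow> lin A C f \<longleftrightarrow> lin A C g"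
  by (simp add: lin_def vsp_add vsp_smul)

lemma bilI:
  "(\<And>a. a \<in> carr A \<Longrightarrow> lin B C (f a)) \<Longrightarrow> (\<And>b. b \<in> carr B \<Longrightarrow> lin A C (\<lambda>a. f a b)) \<Longrightarrow> bil A B C f"
  by (simp add: bil_def)

lemma bil_lin1: "bil A B C f \<Longrightarrow> b \<in> carr B \<Longrightarrow> lin A C (\<lambda>a. f a b)"
  and bil_lin2: "bil A B C f \<Longrightarrow> a \<in> carr A \<Longrightarrow> lin B C (f a)"
  and bil_carr: "bil A B C f \<Longrightarrow> a \<in> carr A \<Longrightarrow> b \<in> carr B \<Longrightarrow> f a b \<in> carr C"
  by (simp_all add: bil_def lin_def)

lemma bil_comp1: "bil A B C f \<Longrightarrow> lin X A g \<Longrightarrow> b \<in> carr B \<Longrightarrow> lin X C (\<lambda>x. f (g x) b)"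
  using lin_comp[of X A g C "\<lambda>a. f a b"] by (simp add: bil_def)

lemma bil_comp2: "bil A B C f \<Longrightarrow> lin X B g \<Longrightarrow> a \<in> carr A \<Longrightarrow> lin X C (\<lambda>x. f a (g x))"
  using lin_comp[of X B g C "f a"] by (simp add: bil_def)

lemma bil_bilinear_on: "bil A B C f \<Longrightarrow> bilinear_on A B (smul C) f"
  by (simp add: bil_def lin_def bilinear_on_def)

lemma bilinear_on_bil:
  "bilinear_on A B (smul C) f \<Longrightarrow> (\<And>a b. a \<in> carr A \<Longrightarrow> b \<in> carr B \<Longrightarrow> f a b \<in> carr C) \<Longrightarrow> bil A B C f"
  by (simp add: bil_def lin_def bilinear_on_def)

lemma bil_swap: "bil A B C f \<Longrightarrow> bil B A C (\<lambda>b a. f a b)"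
  by (simp add: bil_def)

lemma bil_op [simp]: "bil (op_alg A) B C f \<longleftrightarrow> bil A B C f" "bil A (op_alg B) C f \<longleftrightarrow> bil A B C f"
    "bil A B (op_alg C) f \<longleftrightarrow> bil A B C f"
  by (simp_all add: bil_def)

lemma bilinear_on_op [simp]:
  "bilinear_on (op_alg A) B s f = bilinear_on A B s f" "bilinear_on A (op_alg B) s f = bilinear_on A B s f"
  by (simp_all add: bilinear_on_def)

lemma ten_op [simp]: "ten (op_alg A) B = ten A B" "ten A (op_alg B) = ten A B"
  by (simp_all add: ten_def fun_eq_iff)

lemma tcarr_op [simp]: "tcarr (op_alg A) B = tcarr A B" "tcarr A (op_alg B) = tcarr A B"
  by (simp_all add: tcarr_def)

lemma tlift_op [simp]: "tlift (op_alg A) B = tlift A B" "tlift A (op_alg B) = tlift A B"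
  by (simp_all add: tlift_def fun_eq_iff)

lemma lin_tensor_op [simp]:
  "lin (op_alg A \<otimes> B) C f \<longleftrightarrow> lin (A \<otimes> B) C f" "lin (A \<otimes> op_alg B) C f \<longleftrightarrow> lin (A \<otimes> B) C f"
  "lin C (op_alg A \<otimes> B) g \<longleftrightarrow> lin C (A \<otimes> B) g" "lin C (A \<otimes> op_alg B) g \<longleftrightarrow> lin C (A \<otimes> B) g"
  by (simp_all add: lin_def)

lemma ten_carr [simp, intro]: "a \<in> carr A \<Longrightarrow> b \<in> carr B \<Longrightarrow> ten A B a b \<in> tcarr A B"
  unfolding tcarr_def
  by (rule module.span_base) (auto simp: module_iff_vector_space vector_space_tsmul)

lemma bil_ten: "bil A B (A \<otimes> B) (ten A B)"
  using ten_bilinear[of A B] by (intro bilinear_on_bil) auto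

lemma tcarr_add [intro]: "s \<in> tcarr A B \<Longrightarrow> t \<in> tcarr A B \<Longrightarrow> s + t \<in> tcarr A B"
  using vsp_add[OF vsp_tensor, of s A B t] by simp

lemma tcarr_zero [simp]: "0 \<in> tcarr A B"
  using vsp_zero[OF vsp_tensor, of A B] by simp

lemma tcarr_diff [intro]: "s \<in> tcarr A B \<Longrightarrow> t \<in> tcarr A B \<Longrightarrow> s - t \<in> tcarr A B"
  using vsp_diff[OF vsp_tensor, of s A B t] by simp

lemma lin_ten1: "lin X A g \<Longrightarrow> b \<in> carr B \<Longrightarrow> lin X (A \<otimes> B) (\<lambda>x. ten A B (g x) b)"
  by (rule bil_comp1[OF bil_ten])

lemma lin_ten2: "lin X B g \<Longrightarrow> a \<in> carr A \<Longrightarrow> lin X (A \<otimes> B) (\<lambda>x. ten A B a (g x))"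
  by (rule bil_comp2[OF bil_ten])

text \<open>There is no scalar case, since a scalar can be absorbed into the first factor of an
  elementary tensor.\<close>

lemma tcarr_induct [consumes 3, case_names ten add]:
  fixes A :: "('k::field, 'a::ab_group_add) alg" and B :: "('k, 'b::ab_group_add) alg"
  assumes A: "vsp A" and B: "vsp B" and t: "t \<in> tcarr A B"
    and 1: "\<And>a b. a \<in> carr A \<Longrightarrow> b \<in> carr B \<Longrightarrow> P (ten A B a b)"
    and 2: "\<And>s t. s \<in> tcarr A B \<Longrightarrow> t \<in> tcarr A B \<Longrightarrow> P s \<Longrightarrow> P t \<Longrightarrow> P (s + t)"
  shows "P t"
proof -
  interpret T: vector_space "tsmul :: 'k \<Rightarrow> ('k, 'a, 'b) tensor \<Rightarrow> ('k, 'a, 'b) tensor"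
    by (rule vector_space_tsmul)
  have "t \<in> tcarr A B \<and> P t" using t unfolding tcarr_def
  proof (induction rule: T.span_induct_alt)
    case base
    have "ten A B 0 0 = 0" using lin_zero[OF A bil_lin1[OF bil_ten vsp_zero[OF B]]] .
    then show ?case using 1[OF vsp_zero[OF A] vsp_zero[OF B]] by (simp add: T.span_zero)
  next
    case (step c x y)
    then obtain a b where x: "x = ten A B a b" "a \<in> carr A" "b \<in> carr B" by auto
    then have "tsmul c x = ten A B (smul A c a) b"
      using lin_smul[OF bil_lin1[OF bil_ten], of b B a A c] by simp
    moreover have "smul A c a \<in> carr A" using x A by (simp add: vsp_smul)
    moreover have "y \<in> tcarr A B" "P y" using step by (simp_all add: tcarr_def)
    ultimately have "tsmul c x + y \<in> tcarr A B \<and> P (tsmul c x + y)"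
      using x 1 2 by (simp add: tcarr_add)
    then show ?case by (simp add: tcarr_def)
  qed
  then show ?thesis by simp
qed

context
  fixes A :: "('k::field, 'a::ab_group_add) alg" and B :: "('k, 'b::ab_group_add) alg"
    and C :: "('k, 'c::ab_group_add) alg" and f
  assumes A: "vsp A" and B: "vsp B" and C: "vsp C" and f: "bil A B C f"
begin

lemma tlift_ten: "a \<in> carr A \<Longrightarrow> b \<in> carr B \<Longrightarrow> tlift A B f (ten A B a b) = f a b"
  using tlift_universal(1)[of A B "smul C" f] A B C bil_bilinear_on[OF f] by (simp add: vsp_def)

lemma tlift_outside: "t \<notin> tcarr A B \<Longrightarrow> tlift A B f t = 0"
  using tlift_universal(4)[of A B "smul C" f] A B C bil_bilinear_on[OF f] by (simp add: vsp_def)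

lemma lin_tlift: "lin (A \<otimes> B) C (tlift A B f)"
proof (rule linI)
  show add: "tlift A B f (s + t) = tlift A B f s + tlift A B f t"
    if "s \<in> carr (A \<otimes> B)" "t \<in> carr (A \<otimes> B)" for s t
    using tlift_universal(2)[of A B "smul C" f] A B C bil_bilinear_on[OF f] that by (simp add: vsp_def)
  show "tlift A B f (smul (A \<otimes> B) c t) = smul C c (tlift A B f t)" if "t \<in> carr (A \<otimes> B)" for c t
    using tlift_universal(3)[of A B "smul C" f] A B C bil_bilinear_on[OF f] that by (simp add: vsp_def)
  show "tlift A B f t \<in> carr C" if "t \<in> carr (A \<otimes> B)" for t
    using A B that[simplified]
    by (induction rule: tcarr_induct) (auto simp: tlift_ten bil_carr[OF f] add intro: vsp_add[OF C])
qed

end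

text \<open>Extensionality for linear maps on a tensor product. The codomains \<open>C\<close> and
  \<open>C'\<close> may differ, because the comparison only uses additivity.\<close>

lemma tensor_eqI:
  assumes "vsp A" "vsp B" "lin (A \<otimes> B) C f" "lin (A \<otimes> B) C' g" "t \<in> tcarr A B"
    and "\<And>a b. a \<in> carr A \<Longrightarrow> b \<in> carr B \<Longrightarrow> f (ten A B a b) = g (ten A B a b)"
  shows "f t = g t"
  using assms(1,2,5)
  by (induction rule: tcarr_induct) (use assms in \<open>auto simp: lin_def\<close>)

lemma tlift_cong:
  assumes "\<And>a b. a \<in> carr A \<Longrightarrow> b \<in> carr B \<Longrightarrow> f a b = g a b"
  shows "tlift A B f = tlift A B g"
  using assms by (simp add: tlift_def fun_eq_iff cong: ball_cong)

text \<open>With the tensor held fixed, \<open>tlift\<close> is a finite sum of linear functions of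
  the parameter. This provides the bilinearity of nested \<open>tlift\<close> expressions.\<close>

lemma lin_tlift_param:
  assumes A: "vsp A" and B: "vsp B" and C: "vsp C" and X: "vsp X" and g: "\<And>x. x \<in> carr X \<Longrightarrow> bil A B C (g x)"
    and l: "\<And>a b. a \<in> carr A \<Longrightarrow> b \<in> carr B \<Longrightarrow> lin X C (\<lambda>x. g x a b)" and t: "t \<in> tcarr A B"
  shows "lin X C (\<lambda>x. tlift A B (g x) t)"
  using A B t
proof (induction rule: tcarr_induct)
  case (ten a b)
  then show ?case
    using l[OF ten] lin_cong[OF _ X, of "\<lambda>x. tlift A B (g x) (ten A B a b)" "\<lambda>x. g x a b" C]
    by (simp add: tlift_ten[OF A B C g])
next
  case (add s t)
  then show ?case
    using lin_plus[OF C add(3,4)] lin_cong[OF _ X, of "\<lambda>x. tlift A B (g x) (s + t)"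
        "\<lambda>x. tlift A B (g x) s + tlift A B (g x) t" C]
    by (simp add: lin_add[OF lin_tlift[OF A B C g]])
qed

lemma tlift_tlift:
  assumes A: "vsp A" and B: "vsp B" and C: "vsp C" and D: "vsp D" and f: "bil A B C f" and g: "lin C D g" and t: "t \<in> tcarr A B"
  shows "g (tlift A B f t) = tlift A B (\<lambda>a b. g (f a b)) t"
proof -
  have b: "bil A B D (\<lambda>a b. g (f a b))"
    by (intro bilI lin_comp[OF bil_lin1[OF f] g] lin_comp[OF bil_lin2[OF f] g])
  show ?thesis
    by (rule tensor_eqI[OF A B lin_comp[OF lin_tlift[OF A B C f] g] lin_tlift[OF A B D b] t])
      (simp add: tlift_ten[OF A B C f] tlift_ten[OF A B D b])
qed

lemma bil_tmap:
  assumes "lin A C f" "lin B D g"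
  shows "bil A B (C \<otimes> D) (\<lambda>a b. ten C D (f a) (g b))"
  using assms by (intro bilI lin_ten1[where g = f] lin_ten2[where g = g]) (simp_all add: lin_carr)

context
  fixes A :: "('k::field, 'a::ab_group_add) alg" and B :: "('k, 'b::ab_group_add) alg"
  assumes A: "vsp A" and B: "vsp B"
begin

lemma lin_tmap: "lin A C f \<Longrightarrow> lin B D g \<Longrightarrow> lin (A \<otimes> B) (C \<otimes> D) (tmap A B C D f g)"
  unfolding tmap_def by (intro lin_tlift A B vsp_tensor bil_tmap)

lemma tmap_ten: "lin A C f \<Longrightarrow> lin B D g \<Longrightarrow> a \<in> carr A \<Longrightarrow> b \<in> carr B \<Longrightarrow>
    tmap A B C D f g (ten A B a b) = ten C D (f a) (g b)"
  unfolding tmap_def by (rule tlift_ten[OF A B vsp_tensor bil_tmap])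

lemma bil_slice1: "lin A field_alg \<omega> \<Longrightarrow> bil A B B (\<lambda>a b. smul B (\<omega> a) b)"
  using B by (auto intro!: bilI lin_smul_fun lin_smul_const lin_id)

lemma bil_slice2: "lin B field_alg \<omega> \<Longrightarrow> bil A B A (\<lambda>a b. smul A (\<omega> b) a)"
  using A by (auto intro!: bilI lin_smul_fun lin_smul_const lin_id)

lemma lin_slice1: "lin A field_alg \<omega> \<Longrightarrow> lin (A \<otimes> B) B (slice1 A B \<omega>)"
  and slice1_ten: "lin A field_alg \<omega> \<Longrightarrow> a \<in> carr A \<Longrightarrow> b \<in> carr B \<Longrightarrow> slice1 A B \<omega> (ten A B a b) = smul B (\<omega> a) b"
  unfolding slice1_def by (rule lin_tlift[OF A B B bil_slice1], assumption)
    (rule tlift_ten[OF A B B bil_slice1])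

lemma lin_slice2: "lin B field_alg \<omega> \<Longrightarrow> lin (A \<otimes> B) A (slice2 A B \<omega>)"
  and slice2_ten: "lin B field_alg \<omega> \<Longrightarrow> a \<in> carr A \<Longrightarrow> b \<in> carr B \<Longrightarrow> slice2 A B \<omega> (ten A B a b) = smul A (\<omega> b) a"
  unfolding slice2_def by (rule lin_tlift[OF A B A bil_slice2], assumption)
    (rule tlift_ten[OF A B A bil_slice2])

lemma bil_flip: "bil A B (B \<otimes> A) (\<lambda>a b. ten B A b a)"
  using bil_swap[OF bil_ten] .

lemma lin_flip: "lin (A \<otimes> B) (B \<otimes> A) (flip A B)"
  and flip_ten: "a \<in> carr A \<Longrightarrow> b \<in> carr B \<Longrightarrow> flip A B (ten A B a b) = ten B A b a"
  unfolding flip_def by (rule lin_tlift[OF A B vsp_tensor bil_flip])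
    (rule tlift_ten[OF A B vsp_tensor bil_flip])

end

lemma slice_op [simp]: "slice1 (op_alg A) B = slice1 A B" "slice2 A (op_alg B) = slice2 A B"
    "slice1 A (op_alg B) = slice1 A B" "slice2 (op_alg A) B = slice2 A B"
  by (simp_all add: slice1_def slice2_def fun_eq_iff)

lemma flip_flip:
  assumes A: "vsp A" and B: "vsp B" and t: "t \<in> tcarr A B"
  shows "flip B A (flip A B t) = t"
  by (rule tensor_eqI[OF A B lin_comp[OF lin_flip[OF A B] lin_flip[OF B A]] lin_id t])
    (simp add: flip_ten A B)

lemma flip_carr: "vsp A \<Longrightarrow> vsp B \<Longrightarrow> t \<in> tcarr A B \<Longrightarrow> flip A B t \<in> tcarr B A"
  using lin_carr[OF lin_flip, of A B t] by simp

section \<open>Slice maps separate tensors\<close>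

text \<open>With a basis \<open>E\<close> of X and its coordinate functionals, t is the sum over e
  in E of its slice at e, tensored with e; vanishing slices leave nothing.\<close>

lemma slice_functionals_separate:
  assumes A: "vsp A" and X: "vsp X" and t: "t \<in> tcarr A X"
    and 0: "\<And>\<omega>. lin X field_alg \<omega> \<Longrightarrow> slice2 A X \<omega> t = 0"
  shows "t = 0"
proof -
  interpret VX: vector_space "smul X" using X by (simp add: vsp_def)
  obtain E where E: "E \<subseteq> carr X" "VX.independent E" "carr X \<subseteq> VX.span E"
    using VX.basis_exists[of "carr X"] by metis
  define \<omega> where "\<omega> e x = VX.representation E x e" for e x
  have \<omega>: "lin X field_alg (\<omega> e)" for e
    using E by (auto intro!: linI simp: \<omega>_def VX.representation_add VX.representation_scale subset_iff)
  \<comment> \<open>Stability under enlarging F is part of the claim, so that two summands can be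
    expanded over a common finite set.\<close>
  have "\<exists>F. finite F \<and> F \<subseteq> E \<and> (\<forall>F'. finite F' \<longrightarrow> F \<subseteq> F' \<longrightarrow> F' \<subseteq> E \<longrightarrow>
      t = (\<Sum>e\<in>F'. ten A X (slice2 A X (\<omega> e) t) e))"
    using A X t
  proof (induction rule: tcarr_induct)
    case (ten a x)
    let ?F = "{e. VX.representation E x e \<noteq> 0}"
    have x: "x \<in> VX.span E" using ten E by auto
    have "ten A X a x = (\<Sum>e\<in>F'. ten A X (slice2 A X (\<omega> e) (ten A X a x)) e)"
      if F': "finite F'" "?F \<subseteq> F'" "F' \<subseteq> E" for F'
    proof -
      have "(\<Sum>e\<in>F'. ten A X (slice2 A X (\<omega> e) (ten A X a x)) e) = (\<Sum>e\<in>F'. ten A X a (smul X (\<omega> e x) e))"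
      proof (rule sum.cong[OF refl])
        fix e assume "e \<in> F'"
        then have e: "e \<in> carr X" using F' E by auto
        show "ten A X (slice2 A X (\<omega> e) (ten A X a x)) e = ten A X a (smul X (\<omega> e x) e)"
          using ten e lin_smul[OF bil_lin1[OF bil_ten e] ten(1)] lin_smul[OF bil_lin2[OF bil_ten ten(1)] e]
          by (simp add: slice2_ten[OF A X \<omega>])
      qed
      also have "\<dots> = ten A X a (\<Sum>e\<in>F'. smul X (\<omega> e x) e)"
        by (rule lin_sum[symmetric, OF X bil_lin2[OF bil_ten ten(1)]])
          (use F' E X in \<open>auto intro: vsp_smul\<close>)
      also have "(\<Sum>e\<in>F'. smul X (\<omega> e x) e) = x"
        using VX.sum_nonzero_representation_eq[OF E(2) x] sum.mono_neutral_right[OF F'(1,2), of "\<lambda>e. smul X (\<omega> e x) e"]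
          X by (auto simp: \<omega>_def smul_laws)
      finally show ?thesis by simp
    qed
    moreover have "finite ?F" by (rule VX.finite_representation)
    moreover have "?F \<subseteq> E" using VX.representation_ne_zero by blast
    ultimately show ?case by blast
  next
    case (add s t)
    then obtain F1 F2 where F: "finite F1" "F1 \<subseteq> E" "finite F2" "F2 \<subseteq> E"
      and s: "\<And>F'. finite F' \<Longrightarrow> F1 \<subseteq> F' \<Longrightarrow> F' \<subseteq> E \<Longrightarrow> s = (\<Sum>e\<in>F'. ten A X (slice2 A X (\<omega> e) s) e)"
      and t: "\<And>F'. finite F' \<Longrightarrow> F2 \<subseteq> F' \<Longrightarrow> F' \<subseteq> E \<Longrightarrow> t = (\<Sum>e\<in>F'. ten A X (slice2 A X (\<omega> e) t) e)"
      by blast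
    have "s + t = (\<Sum>e\<in>F'. ten A X (slice2 A X (\<omega> e) (s + t)) e)"
      if F': "finite F'" "F1 \<union> F2 \<subseteq> F'" "F' \<subseteq> E" for F'
    proof -
      have "(\<Sum>e\<in>F'. ten A X (slice2 A X (\<omega> e) (s + t)) e)
        = (\<Sum>e\<in>F'. ten A X (slice2 A X (\<omega> e) s) e + ten A X (slice2 A X (\<omega> e) t) e)"
      proof (rule sum.cong[OF refl])
        fix e assume "e \<in> F'"
        then have e: "e \<in> carr X" using F' E by auto
        note l = lin_slice2[OF A X \<omega>[of e]]
        show "ten A X (slice2 A X (\<omega> e) (s + t)) e
          = ten A X (slice2 A X (\<omega> e) s) e + ten A X (slice2 A X (\<omega> e) t) e"
          using add lin_add[OF l, of s t] lin_carr[OF l, of s] lin_carr[OF l, of t]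
            lin_add[OF bil_lin1[OF bil_ten e]] by simp
      qed
      also have "\<dots> = s + t" using s[of F'] t[of F'] F' by (simp add: sum.distrib)
      finally show ?thesis by simp
    qed
    moreover have "finite (F1 \<union> F2)" "F1 \<union> F2 \<subseteq> E" using F by blast+
    ultimately show ?case by blast
  qed
  then obtain F where F: "finite F" "F \<subseteq> E" "t = (\<Sum>e\<in>F. ten A X (slice2 A X (\<omega> e) t) e)"
    by blast
  have "ten A X (slice2 A X (\<omega> e) t) e = 0" if "e \<in> F" for e
    using 0[OF \<omega>] that F(2) E(1) lin_zero[OF A bil_lin1[OF bil_ten[of A X]], of e] by (auto simp: subset_iff)
  then show ?thesis using F(3) by simp
qed

lemma slice2_tmap:
  assumes "vsp A" "vsp X" "vsp C" "lin A C \<phi>" "lin X field_alg \<omega>" "t \<in> tcarr A X"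
  shows "slice2 C X \<omega> (tmap A X C X \<phi> (\<lambda>x. x) t) = \<phi> (slice2 A X \<omega> t)"
  by (rule tensor_eqI[OF assms(1,2) lin_comp[OF lin_tmap[OF assms(1,2,4) lin_id] lin_slice2[OF assms(3,2,5)]]
        lin_comp[OF lin_slice2[OF assms(1,2,5)] assms(4)] assms(6)])
    (use assms in \<open>simp add: tmap_ten lin_id slice2_ten lin_carr lin_smul\<close>)

lemma functional_slice:
  assumes "vsp A" "vsp X" "lin A field_alg \<phi>" "lin X field_alg \<omega>" "t \<in> tcarr A X"
  shows "\<omega> (slice1 A X \<phi> t) = \<phi> (slice2 A X \<omega> t)"
  by (rule tensor_eqI[OF assms(1,2) lin_comp[OF lin_slice1[OF assms(1-3)] assms(4)]
        lin_comp[OF lin_slice2[OF assms(1,2,4)] assms(3)] assms(5)])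
    (use assms lin_smul[OF assms(3)] lin_smul[OF assms(4)] in \<open>simp add: slice2_ten slice1_ten\<close>)

lemma slice2_carr: "vsp A \<Longrightarrow> vsp X \<Longrightarrow> lin X field_alg \<omega> \<Longrightarrow> t \<in> tcarr A X \<Longrightarrow> slice2 A X \<omega> t \<in> carr A"
  using lin_carr[OF lin_slice2, of A X \<omega> t] by simp

lemma slice1_flip:
  assumes "vsp A" "vsp X" "lin X field_alg \<omega>" "t \<in> tcarr A X"
  shows "slice1 X A \<omega> (flip A X t) = slice2 A X \<omega> t"
  by (rule tensor_eqI[OF assms(1,2) lin_comp[OF lin_flip[OF assms(1,2)] lin_slice1[OF assms(2,1,3)]]
        lin_slice2[OF assms(1-3)] assms(4)])
    (use assms in \<open>simp add: flip_ten slice1_ten slice2_ten\<close>)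

text \<open>A jointly injective family on A stays so after tensoring with the identity: functionals
  on the X-leg commute with \<phi> i \<otimes> id and reduce the claim to A.\<close>

lemma tmap_separates1:
  assumes A: "vsp A" and X: "vsp X" and C: "vsp C" and t: "t \<in> tcarr A X"
    and l: "\<And>i. i \<in> I \<Longrightarrow> lin A C (\<phi> i)"
    and sep: "\<And>a. a \<in> carr A \<Longrightarrow> (\<And>i. i \<in> I \<Longrightarrow> \<phi> i a = 0) \<Longrightarrow> a = 0"
    and 0: "\<And>i. i \<in> I \<Longrightarrow> tmap A X C X (\<phi> i) (\<lambda>x. x) t = 0"
  shows "t = 0"
proof (rule slice_functionals_separate[OF A X t])
  fix \<omega> assume \<omega>: "lin X field_alg \<omega>"
  show "slice2 A X \<omega> t = 0"
  proof (rule sep)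
    show "\<phi> i (slice2 A X \<omega> t) = 0" if "i \<in> I" for i
      using slice2_tmap[OF A X C l[OF that] \<omega> t] 0[OF that] lin_zero[OF vsp_tensor lin_slice2[OF C X \<omega>]]
      by simp
  qed (rule slice2_carr[OF A X \<omega> t])
qed

lemma slice1_separates:
  assumes A: "vsp A" and X: "vsp X" and t: "t \<in> tcarr A X"
    and l: "\<And>i. i \<in> I \<Longrightarrow> lin A field_alg (\<phi> i)"
    and sep: "\<And>a. a \<in> carr A \<Longrightarrow> (\<And>i. i \<in> I \<Longrightarrow> \<phi> i a = 0) \<Longrightarrow> a = 0"
    and 0: "\<And>i. i \<in> I \<Longrightarrow> slice1 A X (\<phi> i) t = 0"
  shows "t = 0"
proof (rule slice_functionals_separate[OF A X t])
  fix \<omega> assume \<omega>: "lin X field_alg \<omega>"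
  show "slice2 A X \<omega> t = 0"
  proof (rule sep)
    show "\<phi> i (slice2 A X \<omega> t) = 0" if "i \<in> I" for i
      using functional_slice[OF A X l[OF that] \<omega> t] 0[OF that] lin_zero[OF X \<omega>] by simp
  qed (rule slice2_carr[OF A X \<omega> t])
qed

lemma flip_eq_0:
  assumes "vsp A" "vsp X" "t \<in> tcarr A X" "flip A X t = 0" shows "t = 0"
  using flip_flip[OF assms(1-3)] lin_zero[OF vsp_tensor lin_flip[OF assms(2,1)]] assms(4) by simp

lemma slice2_separates:
  assumes A: "vsp A" and X: "vsp X" and t: "t \<in> tcarr A X"
    and l: "\<And>i. i \<in> I \<Longrightarrow> lin X field_alg (\<phi> i)"
    and sep: "\<And>a. a \<in> carr X \<Longrightarrow> (\<And>i. i \<in> I \<Longrightarrow> \<phi> i a = 0) \<Longrightarrow> a = 0"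
    and 0: "\<And>i. i \<in> I \<Longrightarrow> slice2 A X (\<phi> i) t = 0"
  shows "t = 0"
proof -
  have "flip A X t = 0"
  proof (rule slice1_separates[OF X A flip_carr[OF A X t] l sep])
    show "slice1 X A (\<phi> i) (flip A X t) = 0" if "i \<in> I" for i
      using slice1_flip[OF A X l[OF that] t] 0[OF that] by simp
  qed
  then show ?thesis using flip_eq_0[OF A X t] by simp
qed

lemma flip_tmap:
  assumes "vsp A" "vsp X" "vsp C" "vsp D" "lin A C f" "lin X D g" "t \<in> tcarr A X"
  shows "flip C D (tmap A X C D f g t) = tmap X A D C g f (flip A X t)"
  by (rule tensor_eqI[OF assms(1,2) lin_comp[OF lin_tmap[OF assms(1,2,5,6)] lin_flip[OF assms(3,4)]]
        lin_comp[OF lin_flip[OF assms(1,2)] lin_tmap[OF assms(2,1,6,5)]] assms(7)])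
    (use assms in \<open>simp add: tmap_ten flip_ten lin_carr\<close>)

lemma tmap_separates2:
  assumes A: "vsp A" and X: "vsp X" and C: "vsp C" and t: "t \<in> tcarr A X"
    and l: "\<And>i. i \<in> I \<Longrightarrow> lin X C (\<phi> i)"
    and sep: "\<And>a. a \<in> carr X \<Longrightarrow> (\<And>i. i \<in> I \<Longrightarrow> \<phi> i a = 0) \<Longrightarrow> a = 0"
    and 0: "\<And>i. i \<in> I \<Longrightarrow> tmap A X A C (\<lambda>x. x) (\<phi> i) t = 0"
  shows "t = 0"
proof -
  have "flip A X t = 0"
  proof (rule tmap_separates1[OF X A C flip_carr[OF A X t] l sep])
    show "tmap X A C A (\<phi> i) (\<lambda>x. x) (flip A X t) = 0" if "i \<in> I" for i
      using flip_tmap[OF A X A C lin_id l[OF that] t] 0[OF that] lin_zero[OF vsp_tensor lin_flip[OF A C]]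
      by simp
  qed
  then show ?thesis using flip_eq_0[OF A X t] by simp
qed

section \<open>Algebras and their tensor products\<close>

lemma bil_mul: "is_algebra A \<Longrightarrow> bil A A A (mul A)"
  by (simp add: bil_def lin_def is_algebra_def)

lemma mul_carr [simp, intro]: "is_algebra A \<Longrightarrow> x \<in> carr A \<Longrightarrow> y \<in> carr A \<Longrightarrow> mul A x y \<in> carr A"
  by (simp add: is_algebra_def)

lemma mul_assoc: "is_algebra A \<Longrightarrow> x \<in> carr A \<Longrightarrow> y \<in> carr A \<Longrightarrow> z \<in> carr A \<Longrightarrow>
    mul A (mul A x y) z = mul A x (mul A y z)"
  by (simp add: is_algebra_def)

lemma lin_mul1: "is_algebra A \<Longrightarrow> lin X A g \<Longrightarrow> b \<in> carr A \<Longrightarrow> lin X A (\<lambda>x. mul A (g x) b)"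
  by (rule bil_comp1[OF bil_mul])

lemma lin_mul2: "is_algebra A \<Longrightarrow> lin X A g \<Longrightarrow> b \<in> carr A \<Longrightarrow> lin X A (\<lambda>x. mul A b (g x))"
  by (rule bil_comp2[OF bil_mul])

lemma mul_zero: "is_algebra A \<Longrightarrow> x \<in> carr A \<Longrightarrow> mul A x 0 = 0"
    "is_algebra A \<Longrightarrow> x \<in> carr A \<Longrightarrow> mul A 0 x = 0"
  by (blast intro: lin_zero[OF vsp_algebra bil_lin2[OF bil_mul]]) (blast intro: lin_zero[OF vsp_algebra bil_lin1[OF bil_mul]])

lemma is_algebraI:
  assumes "vsp A" "bil A A A (mul A)"
    "\<And>x y z. x \<in> carr A \<Longrightarrow> y \<in> carr A \<Longrightarrow> z \<in> carr A \<Longrightarrow> mul A (mul A x y) z = mul A x (mul A y z)"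
  shows "is_algebra A"
  using assms by (simp add: is_algebra_def vsp_def bil_def lin_def)

lemma is_algebra_op [simp]: "is_algebra A \<Longrightarrow> is_algebra (op_alg A)"
  using bil_swap[OF bil_mul[of A]] by (intro is_algebraI) (simp_all add: mul_assoc bil_def, simp add: op_alg_def)

lemma nd_algebra_alg [simp]: "nd_algebra A \<Longrightarrow> is_algebra A"
  and nd_left: "nd_algebra A \<Longrightarrow> a \<in> carr A \<Longrightarrow> (\<And>b. b \<in> carr A \<Longrightarrow> mul A a b = 0) \<Longrightarrow> a = 0"
  and nd_right: "nd_algebra A \<Longrightarrow> a \<in> carr A \<Longrightarrow> (\<And>b. b \<in> carr A \<Longrightarrow> mul A b a = 0) \<Longrightarrow> a = 0"
  unfolding nd_algebra_def by blast+

lemma nd_algebra_op [simp]: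
  assumes n: "nd_algebra A" shows "nd_algebra (op_alg A)"
  unfolding nd_algebra_def
proof (intro conjI ballI impI)
  have eq: "{mul A b a |a b. a \<in> carr A \<and> b \<in> carr A} = {mul A a b |a b. a \<in> carr A \<and> b \<in> carr A}"
    by blast
  show "lspan (op_alg A) {mul (op_alg A) a b |a b. a \<in> carr (op_alg A) \<and> b \<in> carr (op_alg A)} = carr (op_alg A)"
    using n unfolding nd_algebra_def lspan_def op_alg_simps eq by blast
  show "is_algebra (op_alg A)" using n by simp
qed (use nd_left[OF n] nd_right[OF n] in \<open>simp_all only: op_alg_simps\<close>)

lemma nd_eq_left:
  assumes "nd_algebra A" "x \<in> carr A" "y \<in> carr A" "\<And>b. b \<in> carr A \<Longrightarrow> mul A x b = mul A y b"
  shows "x = y"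
  using nd_left[of A "x - y"] assms vsp_diff[of A x y]
  by (simp add: lin_diff[OF _ bil_lin1[OF bil_mul]])

lemma nd_eq_right:
  assumes "nd_algebra A" "x \<in> carr A" "y \<in> carr A" "\<And>b. b \<in> carr A \<Longrightarrow> mul A b x = mul A b y"
  shows "x = y"
  using nd_right[of A "x - y"] assms vsp_diff[of A x y]
  by (simp add: lin_diff[OF _ bil_lin2[OF bil_mul]])

text \<open>The equation A A = A as an induction rule. \<open>P\<close> need not be closed under
  scalars: they are carried through the span and absorbed into a factor of the product.\<close>

lemma idempotent_induct [consumes 2, case_names mul add]:
  assumes A: "nd_algebra A" and x: "x \<in> carr A"
    and m: "\<And>a b. a \<in> carr A \<Longrightarrow> b \<in> carr A \<Longrightarrow> P (mul A a b)"
    and a: "\<And>x y. x \<in> carr A \<Longrightarrow> y \<in> carr A \<Longrightarrow> P x \<Longrightarrow> P y \<Longrightarrow> P (x + y)"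
  shows "P x"
proof -
  have 0: "P 0" using m[of 0 0] A by (simp add: mul_zero)
  have "x \<in> lspan A {mul A a b |a b. a \<in> carr A \<and> b \<in> carr A}"
    using A x unfolding nd_algebra_def by blast
  then have "x \<in> carr A \<and> (\<forall>c. P (smul A c x))"
  proof (rule lspan_induct[rotated])
    show "e \<in> carr A \<and> (\<forall>c. P (smul A c e))"
      if e: "e \<in> {mul A a b |a b. a \<in> carr A \<and> b \<in> carr A}" for e
    proof -
      from e obtain a b where e: "e = mul A a b" "a \<in> carr A" "b \<in> carr A" by auto
      have "P (smul A c e)" for c
        using m[OF vsp_smul[of A a c] e(3)] e A
        by (simp add: lin_smul[OF bil_lin1[OF bil_mul]])
      then show ?thesis using e A by simp
    qed
    show "x + y \<in> carr A \<and> (\<forall>c. P (smul A c (x + y)))"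
      if "x \<in> carr A \<and> (\<forall>c. P (smul A c x))" "y \<in> carr A \<and> (\<forall>c. P (smul A c y))" for x y
    proof -
      have "P (smul A c x + smul A c y)" for c
        by (rule a) (use that A in \<open>auto intro: vsp_smul\<close>)
      then show ?thesis using that A by (simp add: smul_laws vsp_add)
    qed
  qed (use A 0 in \<open>auto simp: smul_laws intro: vsp_smul\<close>)
  then have "P (smul A 1 x)" by blast
  then show ?thesis using A by (simp add: smul_laws)
qed

lemma lin_idempotent_eqI:
  assumes "nd_algebra A" "lin A C f" "lin A C' g" "x \<in> carr A"
    and "\<And>a b. a \<in> carr A \<Longrightarrow> b \<in> carr A \<Longrightarrow> f (mul A a b) = g (mul A a b)"
  shows "f x = g x"
  using assms(1,4) by (induction rule: idempotent_induct) (use assms in \<open>simp_all add: lin_add\<close>)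

context
  fixes A :: "('k::field, 'a::ab_group_add) alg" and B :: "('k, 'b::ab_group_add) alg"
  assumes A: "is_algebra A" and B: "is_algebra B"
begin

private lemma vA: "vsp A" and vB: "vsp B" using A B by simp_all

private lemma b1: "a \<in> carr A \<Longrightarrow> b \<in> carr B \<Longrightarrow> bil A B (A \<otimes> B) (\<lambda>a' b'. ten A B (mul A a a') (mul B b b'))"
  by (intro bil_tmap lin_mul2[OF A lin_id] lin_mul2[OF B lin_id])

lemma bil_mul_tensor: "bil (A \<otimes> B) (A \<otimes> B) (A \<otimes> B) (mul (A \<otimes> B))"
proof -
  have b2: "bil A B (A \<otimes> B) (\<lambda>a b. tlift A B (\<lambda>a' b'. ten A B (mul A a a') (mul B b b')) t)"
    if t: "t \<in> tcarr A B" for t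
    by (intro bilI lin_tlift_param[OF vA vB vsp_tensor _ b1 _ t] vA vB)
      (auto intro!: lin_ten1 lin_ten2 lin_mul1 lin_id simp: A B)
  show ?thesis
  proof (rule bilI)
    show "lin (A \<otimes> B) (A \<otimes> B) (mul (A \<otimes> B) s)" if s: "s \<in> carr (A \<otimes> B)" for s
      unfolding tensor_alg_def alg.simps 
      using s by (intro lin_tlift_param[OF vA vB vsp_tensor vsp_tensor, unfolded tensor_alg_def alg.simps])
        (auto intro!: b2[unfolded tensor_alg_def] lin_tlift[OF vA vB vsp_tensor b1, unfolded tensor_alg_def] simp: tensor_alg_def)
    show "lin (A \<otimes> B) (A \<otimes> B) (\<lambda>s. mul (A \<otimes> B) s t)" if t: "t \<in> carr (A \<otimes> B)" for t
      using lin_tlift[OF vA vB vsp_tensor b2] t by (simp add: tensor_alg_def)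
  qed
qed

lemma mul_ten: "a \<in> carr A \<Longrightarrow> b \<in> carr B \<Longrightarrow> a' \<in> carr A \<Longrightarrow> b' \<in> carr B \<Longrightarrow>
   mul (A \<otimes> B) (ten A B a b) (ten A B a' b') = ten A B (mul A a a') (mul B b b')"
proof -
  assume *: "a \<in> carr A" "b \<in> carr B" "a' \<in> carr A" "b' \<in> carr B"
  have b2: "bil A B (A \<otimes> B) (\<lambda>a b. tlift A B (\<lambda>a' b'. ten A B (mul A a a') (mul B b b')) t)"
    if t: "t \<in> tcarr A B" for t
    by (intro bilI lin_tlift_param[OF vA vB vsp_tensor _ b1 _ t] vA vB)
      (auto intro!: lin_ten1 lin_ten2 lin_mul1 lin_id simp: A B)
  show ?thesis
    using * unfolding tensor_alg_def alg.simps
    by (simp add: tlift_ten[OF vA vB vsp_tensor b2] tlift_ten[OF vA vB vsp_tensor b1])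
qed

lemma mul_ten_right:
  assumes "t \<in> tcarr A B" "a \<in> carr A" "b \<in> carr B"
  shows "mul (A \<otimes> B) t (ten A B a b) = tmap A B A B (\<lambda>x. mul A x a) (\<lambda>y. mul B y b) t"
  by (rule tensor_eqI[OF vA vB bil_lin1[OF bil_mul_tensor] lin_tmap[OF vA vB] assms(1)])
    (use assms A B in \<open>auto simp: mul_ten tmap_ten[OF vA vB] lin_mul1 lin_id\<close>)

lemma mul_ten_left:
  assumes "t \<in> tcarr A B" "a \<in> carr A" "b \<in> carr B"
  shows "mul (A \<otimes> B) (ten A B a b) t = tmap A B A B (mul A a) (mul B b) t"
  by (rule tensor_eqI[OF vA vB bil_lin2[OF bil_mul_tensor] lin_tmap[OF vA vB] assms(1)])
    (use assms A B in \<open>auto simp: mul_ten tmap_ten[OF vA vB] lin_mul2 lin_id\<close>)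

lemma is_algebra_tensor [simp]: "is_algebra (A \<otimes> B)"
proof (rule is_algebraI[OF vsp_tensor bil_mul_tensor])
  fix s t u assume stu: "s \<in> carr (A \<otimes> B)" "t \<in> carr (A \<otimes> B)" "u \<in> carr (A \<otimes> B)"
  note l1 = bil_comp1[OF bil_mul_tensor] and l2 = bil_comp2[OF bil_mul_tensor]
  have 1: "mul (A \<otimes> B) (mul (A \<otimes> B) s' t') u = mul (A \<otimes> B) s' (mul (A \<otimes> B) t' u)"
    if s': "s' = ten A B a b" "a \<in> carr A" "b \<in> carr B" and t': "t' = ten A B a' b'" "a' \<in> carr A" "b' \<in> carr B" for s' t' a b a' b'
    by (rule tensor_eqI[OF vA vB _ _ stu(3)[unfolded tensor_alg_simps]])
      (use s' t' A B in \<open>auto intro!: l2 lin_id bil_carr[OF bil_mul_tensor] simp: mul_ten mul_assoc\<close>)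
  have 2: "mul (A \<otimes> B) (mul (A \<otimes> B) s' t) u = mul (A \<otimes> B) s' (mul (A \<otimes> B) t u)"
    if s': "s' = ten A B a b" "a \<in> carr A" "b \<in> carr B" for s' a b
    by (rule tensor_eqI[OF vA vB _ _ stu(2)[unfolded tensor_alg_simps], where f = "\<lambda>t. mul (A \<otimes> B) (mul (A \<otimes> B) s' t) u"])
      (use s' stu in \<open>auto intro!: 1 l2 l1 lin_id\<close>)
  show "mul (A \<otimes> B) (mul (A \<otimes> B) s t) u = mul (A \<otimes> B) s (mul (A \<otimes> B) t u)"
    by (rule tensor_eqI[OF vA vB _ _ stu(1)[unfolded tensor_alg_simps], where f = "\<lambda>s. mul (A \<otimes> B) (mul (A \<otimes> B) s t) u"])
      (use stu in \<open>auto intro!: 2 l2 l1 lin_id bil_carr[OF bil_mul_tensor, unfolded tensor_alg_simps]\<close>)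
qed

end

lemma tmap_tmap:
  assumes "vsp A" "vsp B" "vsp C" "vsp D" "lin A C f" "lin B D g" "lin C E h" "lin D F k" "t \<in> tcarr A B"
  shows "tmap C D E F h k (tmap A B C D f g t) = tmap A B E F (\<lambda>x. h (f x)) (\<lambda>x. k (g x)) t"
  by (rule tensor_eqI[OF assms(1,2) lin_comp[OF lin_tmap[OF assms(1,2,5,6)] lin_tmap[OF assms(3,4,7,8)]]
        lin_tmap[OF assms(1,2) lin_comp[OF assms(5,7)] lin_comp[OF assms(6,8)]] assms(9)])
    (use assms lin_comp[OF assms(5,7)] lin_comp[OF assms(6,8)] in \<open>simp add: tmap_ten lin_carr\<close>)

lemma tmap_carr: "vsp A \<Longrightarrow> vsp B \<Longrightarrow> lin A C f \<Longrightarrow> lin B D g \<Longrightarrow> t \<in> tcarr A B \<Longrightarrow> tmap A B C D f g t \<in> tcarr C D"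
  by (rule lin_carr[OF lin_tmap, unfolded tensor_alg_simps])

text \<open>Multiplication with c \<otimes> d is split into one leg at a time, and
  \<open>tmap_separates1\<close> and \<open>tmap_separates2\<close> remove each leg by
  non-degeneracy of its factor. Idempotence is inherited factorwise.\<close>

lemma nd_algebra_tensor [simp]:
  fixes A :: "('k::field, 'a::ab_group_add) alg" and B :: "('k, 'b::ab_group_add) alg"
  assumes A: "nd_algebra A" and B: "nd_algebra B" shows "nd_algebra (A \<otimes> B)"
proof -
  note a = nd_algebra_alg[OF A] nd_algebra_alg[OF B]
  note v = vsp_algebra[OF a(1)] vsp_algebra[OF a(2)]
  note m = lin_mul1[OF a(1) lin_id] lin_mul1[OF a(2) lin_id] lin_mul2[OF a(1) lin_id] lin_mul2[OF a(2) lin_id]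
  have left: "t = 0" if t: "t \<in> tcarr A B" and 0: "\<And>s. s \<in> tcarr A B \<Longrightarrow> mul (A \<otimes> B) t s = 0" for t
  proof (rule tmap_separates1[OF v(1,2,1) t, where I = "carr A" and \<phi> = "\<lambda>c x. mul A x c"])
    fix c assume c: "c \<in> carr A"
    show "tmap A B A B (\<lambda>x. mul A x c) (\<lambda>x. x) t = 0"
    proof (rule tmap_separates2[OF v(1,2,2) tmap_carr[OF v m(1)[OF c] lin_id t], where I = "carr B" and \<phi> = "\<lambda>d x. mul B x d"])
      fix d assume d: "d \<in> carr B"
      show "tmap A B A B (\<lambda>x. x) (\<lambda>x. mul B x d) (tmap A B A B (\<lambda>x. mul A x c) (\<lambda>x. x) t) = 0"
        using 0[OF ten_carr[OF c d]]
        by (simp add: tmap_tmap[OF v v m(1)[OF c] lin_id lin_id m(2)[OF d] t] mul_ten_right[OF a t c d])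
    qed (use nd_left[OF B] m(2) in auto)
  qed (use nd_left[OF A] m(1) in auto)
  have right: "t = 0" if t: "t \<in> tcarr A B" and 0: "\<And>s. s \<in> tcarr A B \<Longrightarrow> mul (A \<otimes> B) s t = 0" for t
  proof (rule tmap_separates1[OF v(1,2,1) t, where I = "carr A" and \<phi> = "\<lambda>c. mul A c"])
    fix c assume c: "c \<in> carr A"
    show "tmap A B A B (mul A c) (\<lambda>x. x) t = 0"
    proof (rule tmap_separates2[OF v(1,2,2) tmap_carr[OF v m(3)[OF c] lin_id t], where I = "carr B" and \<phi> = "\<lambda>d. mul B d"])
      fix d assume d: "d \<in> carr B"
      show "tmap A B A B (\<lambda>x. x) (mul B d) (tmap A B A B (mul A c) (\<lambda>x. x) t) = 0"
        using 0[OF ten_carr[OF c d]]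
        by (simp add: tmap_tmap[OF v v m(3)[OF c] lin_id lin_id m(4)[OF d] t] mul_ten_left[OF a t c d])
    qed (use nd_right[OF B] m(4) in auto)
  qed (use nd_right[OF A] m(3) in auto)
  let ?S = "{mul (A \<otimes> B) s t |s t. s \<in> carr (A \<otimes> B) \<and> t \<in> carr (A \<otimes> B)}"
  have span: "lspan (A \<otimes> B) ?S = carr (A \<otimes> B)"
  proof (rule lspan_eqI[OF vsp_tensor])
    show "?S \<subseteq> carr (A \<otimes> B)" using bil_carr[OF bil_mul_tensor[OF a]] by blast
    fix t assume "t \<in> carr (A \<otimes> B)"
    then have "t \<in> tcarr A B" by simp
    with v show "t \<in> lspan (A \<otimes> B) ?S"
    proof (induction rule: tcarr_induct)
      case (ten x y)
      have "ten A B (mul A a a') y \<in> lspan (A \<otimes> B) ?S" if a': "a \<in> carr A" "a' \<in> carr A" for a a'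
        using B ten(2)
      proof (induction rule: idempotent_induct)
        case (mul b b')
        show ?case
          by (rule lspan_base[OF vsp_tensor]) (use mul a' a in \<open>auto simp: mul_ten[symmetric] intro: ten_carr\<close>)
      next
        case (add y y')
        then show ?case
          using lin_add[OF bil_lin2[OF bil_ten, of "mul A a a'" A B], of y y'] a' a
          by (simp add: lspan_add)
      qed
      with A ten(1) show ?case
      proof (induction rule: idempotent_induct)
        case (add x x')
        then show ?case
          using lin_add[OF bil_lin1[OF bil_ten, of y B A], of x x'] ten a
          by (simp add: lspan_add)
      qed
    qed (simp add: lspan_add)
  qed
  show ?thesis
    unfolding nd_algebra_def using a left right span by (simp only: tensor_alg_simps) auto
qed

section \<open>Multipliers\<close>

lemma linear_endo_lin: "linear_endo A f \<longleftrightarrow> lin A A f \<and> (\<forall>x. x \<notin> carr A \<longrightarrow> f x = 0)"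
  by (auto simp: linear_endo_def lin_def)

lemma mult_alg_simps [simp]: "smul (mult_alg A) = (\<lambda>c m. (\<lambda>x. smul A c (fst m x), \<lambda>x. smul A c (snd m x)))"
    "mul (mult_alg A) = mmul"
  by (simp_all add: mult_alg_def)

lemma multI:
  assumes "lin A A (fst m)" "lin A A (snd m)" "\<And>x. x \<notin> carr A \<Longrightarrow> fst m x = 0" "\<And>x. x \<notin> carr A \<Longrightarrow> snd m x = 0"
    "\<And>x y. x \<in> carr A \<Longrightarrow> y \<in> carr A \<Longrightarrow> fst m (mul A x y) = mul A (fst m x) y"
    "\<And>x y. x \<in> carr A \<Longrightarrow> y \<in> carr A \<Longrightarrow> snd m (mul A x y) = mul A x (snd m y)"
    "\<And>x y. x \<in> carr A \<Longrightarrow> y \<in> carr A \<Longrightarrow> mul A x (fst m y) = mul A (snd m x) y"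
  shows "m \<in> carr (mult_alg A)"
  using assms by (simp add: mult_alg_def linear_endo_lin)

context
  fixes A :: "('k::field, 'a::ab_group_add) alg" and m
  assumes m: "m \<in> carr (mult_alg A)"
begin

lemma mult_lin1: "lin A A (fst m)" and mult_lin2: "lin A A (snd m)"
  and mult_out1: "x \<notin> carr A \<Longrightarrow> fst m x = 0" and mult_out2: "x \<notin> carr A \<Longrightarrow> snd m x = 0"
  and mult_mul1: "x \<in> carr A \<Longrightarrow> y \<in> carr A \<Longrightarrow> fst m (mul A x y) = mul A (fst m x) y"
  and mult_mul2: "x \<in> carr A \<Longrightarrow> y \<in> carr A \<Longrightarrow> snd m (mul A x y) = mul A x (snd m y)"
  and mult_mul: "x \<in> carr A \<Longrightarrow> y \<in> carr A \<Longrightarrow> mul A x (fst m y) = mul A (snd m x) y"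
  using m by (simp_all add: mult_alg_def linear_endo_lin)

lemma mult_carr1: "x \<in> carr A \<Longrightarrow> fst m x \<in> carr A" and mult_carr2: "x \<in> carr A \<Longrightarrow> snd m x \<in> carr A"
  using lin_carr mult_lin1 mult_lin2 by blast+

lemma mult_swap: "prod.swap m \<in> carr (mult_alg (op_alg A))"
  using mult_lin1 mult_lin2 mult_out1 mult_out2 mult_mul1 mult_mul2 mult_mul by (intro multI) simp_all

end

lemma vsp_mult_alg [simp]:
  fixes A :: "('k::field, 'a::ab_group_add) alg" assumes A: "is_algebra A" shows "vsp (mult_alg A)"
proof -
  have v: "vsp A" using A by simp
  have 1: "vector_space (smul (mult_alg A))"
    by unfold_locales (auto simp: prod_eq_iff fun_eq_iff plus_fun_apply smul_laws[OF v])
  have m: "mul A x 0 = 0" "mul A 0 x = 0" if "x \<in> carr A" for x using A that by (simp_all add: mul_zero)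
  have d: "mul A x (y + z) = mul A x y + mul A x z" "mul A (y + z) x = mul A y x + mul A z x"
    "mul A x (smul A c y) = smul A c (mul A x y)" "mul A (smul A c x) y = smul A c (mul A x y)"
     if "x \<in> carr A" "y \<in> carr A" "z \<in> carr A" for x y z c using A that unfolding is_algebra_def by blast+
  have "module.subspace (smul (mult_alg A)) (carr (mult_alg A))"
    unfolding module.subspace_def[OF 1[folded module_iff_vector_space]]
  proof (intro conjI ballI allI impI)
    show "0 \<in> carr (mult_alg A)"
      by (rule multI) (use v m in \<open>simp_all add: lin_def zero_fun_apply vsp_zero smul_laws\<close>)
    fix x y c assume x: "x \<in> carr (mult_alg A)"
    note x' = mult_lin1[OF x] mult_lin2[OF x] mult_out1[OF x] mult_out2[OF x] mult_mul1[OF x] mult_mul2[OF x] mult_mul[OF x] mult_carr1[OF x] mult_carr2[OF x]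
    show "smul (mult_alg A) c x \<in> carr (mult_alg A)"
      by (rule multI) (use x' v d in \<open>simp_all add: lin_smul_const smul_laws\<close>)
    assume y: "y \<in> carr (mult_alg A)"
    note y' = mult_lin1[OF y] mult_lin2[OF y] mult_out1[OF y] mult_out2[OF y] mult_mul1[OF y] mult_mul2[OF y] mult_mul[OF y] mult_carr1[OF y] mult_carr2[OF y]
    have e: "f + g = (\<lambda>x. f x + g x)" for f g :: "'a \<Rightarrow> 'a" by (simp add: fun_eq_iff plus_fun_apply)
    show "x + y \<in> carr (mult_alg A)"
      by (rule multI) (use x' y' v d in \<open>simp_all add: e lin_plus\<close>)
  qed
  then show ?thesis using 1 by (simp add: vsp_def)
qed

text \<open>The left component determines the right one, because x (m y) = (x m) y and the algebra
  is non-degenerate; comparing \<open>fst\<close> therefore suffices.\<close>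

lemma mult_eqI:
  assumes A: "nd_algebra A" and m: "m \<in> carr (mult_alg A)" and n: "n \<in> carr (mult_alg A)"
    and e: "\<And>x. x \<in> carr A \<Longrightarrow> fst m x = fst n x"
  shows "m = n"
proof (rule prod_eqI; rule ext)
  show "fst m x = fst n x" for x
    using e mult_out1[OF m] mult_out1[OF n] by (cases "x \<in> carr A") auto
  show "snd m x = snd n x" for x
  proof (cases "x \<in> carr A")
    case True
    show ?thesis
      by (rule nd_eq_left[OF A])
        (use True mult_carr2[OF m] mult_carr2[OF n] e in \<open>auto simp: mult_mul[OF m, symmetric] mult_mul[OF n, symmetric]\<close>)
  qed (use mult_out2[OF m] mult_out2[OF n] in auto)
qed

lemma mmul_fst [simp]: "fst (m \<cdot> n) x = fst m (fst n x)" and mmul_snd [simp]: "snd (m \<cdot> n) x = snd n (snd m x)"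
  by (simp_all add: mmul_def)

lemma mmul_mult: 
  assumes A: "vsp A" and m: "m \<in> carr (mult_alg A)" and n: "n \<in> carr (mult_alg A)" shows "m \<cdot> n \<in> carr (mult_alg A)"
  by (rule multI)
    (use m n A in \<open>simp_all add: mult_mul mult_mul1 mult_mul2 mult_out1 mult_out2 mult_carr1 mult_carr2 lin_zero[OF A mult_lin1] lin_zero[OF A mult_lin2],
     simp_all add: mmul_def comp_def lin_comp[OF mult_lin1 mult_lin1] lin_comp[OF mult_lin2 mult_lin2]\<close>)

lemma mone_simps [simp]: "x \<in> carr A \<Longrightarrow> fst (mone A) x = x" "x \<in> carr A \<Longrightarrow> snd (mone A) x = x"
  by (simp_all add: mone_def)

lemma mone_mult: "is_algebra A \<Longrightarrow> mone A \<in> carr (mult_alg A)"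
  by (rule multI) (auto simp: mone_def lin_def intro: vsp_add vsp_smul)

lemma emb_simps [simp]: "x \<in> carr A \<Longrightarrow> fst (emb A a) x = mul A a x" "x \<in> carr A \<Longrightarrow> snd (emb A a) x = mul A x a"
  by (simp_all add: emb_def)

lemma emb_mult:
  assumes A: "is_algebra A" and a: "a \<in> carr A" shows "emb A a \<in> carr (mult_alg A)"
proof (rule multI)
  have v: "vsp A" using A by simp
  show "lin A A (fst (emb A a))" using lin_mul2[OF A lin_id a] lin_cong[OF _ v, of "fst (emb A a)" "mul A a" A] by simp
  show "lin A A (snd (emb A a))" using lin_mul1[OF A lin_id a] lin_cong[OF _ v, of "snd (emb A a)" "\<lambda>x. mul A x a" A] by simp
qed (use A a in \<open>auto simp: mul_assoc emb_def\<close>)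

lemma emb_eqI:
  assumes A: "nd_algebra A" and m: "m \<in> carr (mult_alg A)" and a: "a \<in> carr A"
    and e: "\<And>x. x \<in> carr A \<Longrightarrow> fst m x = mul A a x"
  shows "m = emb A a"
  by (rule mult_eqI[OF A m emb_mult]) (use A a e in auto)

lemma emb_inj: "nd_algebra A \<Longrightarrow> inj_on (emb A) (carr A)"
proof (rule inj_onI)
  fix x y assume A: "nd_algebra A" and xy: "x \<in> carr A" "y \<in> carr A" "emb A x = emb A y"
  show "x = y" 
  proof (rule nd_eq_left[OF A xy(1,2)])
    show "mul A x b = mul A y b" if "b \<in> carr A" for b
      using emb_simps(1)[OF that, of x] emb_simps(1)[OF that, of y] xy(3) by simp
  qed
qed

lemma unemb_emb: "nd_algebra A \<Longrightarrow> a \<in> carr A \<Longrightarrow> unemb A (emb A a) = a"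
  unfolding unemb_def by (rule the_inv_into_f_f[OF emb_inj])

context
  fixes A :: "('k::field, 'a::ab_group_add) alg" and m
  assumes A: "nd_algebra A" and m: "m \<in> emb_image A"
begin

lemma emb_unemb: "emb A (unemb A m) = m"
  using m unemb_emb[OF A] by auto

lemma unemb_carr: "unemb A m \<in> carr A"
  using m unemb_emb[OF A] by auto

lemma mul_unemb1: "x \<in> carr A \<Longrightarrow> mul A (unemb A m) x = fst m x"
  and mul_unemb2: "x \<in> carr A \<Longrightarrow> mul A x (unemb A m) = snd m x"
  using emb_simps[of x A "unemb A m"] by (simp_all add: emb_unemb)

end

text \<open>The two inverse maps fit together to a multiplier automatically. This is how
  \<open>circ_multiplier\<close> gets its inverse, once its two components are known to be
  bijective.\<close>

lemma mult_invertible: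
  assumes A: "nd_algebra A" and m: "m \<in> carr (mult_alg A)"
    and b1: "bij_betw (fst m) (carr A) (carr A)" and b2: "bij_betw (snd m) (carr A) (carr A)"
  shows "\<exists>n\<in>carr (mult_alg A). m \<cdot> n = mone A \<and> n \<cdot> m = mone A"
proof -
  note a = nd_algebra_alg[OF A]
  define f where "f x = (if x \<in> carr A then inv_into (carr A) (fst m) x else 0)" for x
  define g where "g x = (if x \<in> carr A then inv_into (carr A) (snd m) x else 0)" for x
  have f: "f x \<in> carr A" "fst m (f x) = x" "f (fst m x) = x" if "x \<in> carr A" for x
    using that b1 bij_betw_inv_into_right[OF b1 that] bij_betw_inv_into_left[OF b1 that] mult_carr1[OF m that]
      bij_betw_imp_surj_on[OF b1]
    by (auto simp: f_def inv_into_into)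
  have g: "g x \<in> carr A" "snd m (g x) = x" "g (snd m x) = x" if "x \<in> carr A" for x
    using that b2 bij_betw_inv_into_right[OF b2 that] bij_betw_inv_into_left[OF b2 that] mult_carr2[OF m that]
      bij_betw_imp_surj_on[OF b2]
    by (auto simp: g_def inv_into_into)
  have fI: "f x = y" if "y \<in> carr A" "fst m y = x" for x y using that f(3) by blast
  have gI: "g x = y" if "y \<in> carr A" "snd m y = x" for x y using that g(3) by blast
  have n: "(f, g) \<in> carr (mult_alg A)"
  proof (rule multI, simp_all only: fst_conv snd_conv)
    show "lin A A f"
      by (rule linI; (rule fI)?)
        (use f a in \<open>auto simp: lin_add[OF mult_lin1[OF m]] lin_smul[OF mult_lin1[OF m]] intro: vsp_add vsp_smul\<close>)
    show "lin A A g"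
      by (rule linI; (rule gI)?)
        (use g a in \<open>auto simp: lin_add[OF mult_lin2[OF m]] lin_smul[OF mult_lin2[OF m]] intro: vsp_add vsp_smul\<close>)
    fix x y assume xy: "x \<in> carr A" "y \<in> carr A"
    show "f (mul A x y) = mul A (f x) y" by (rule fI) (use xy f a in \<open>simp_all add: mult_mul1[OF m]\<close>)
    show "g (mul A x y) = mul A x (g y)" by (rule gI) (use xy g a in \<open>simp_all add: mult_mul2[OF m]\<close>)
    \<comment> \<open>Both sides equal (g x) m (f y), since x = (g x) m and y = m (f y).\<close>
    show "mul A x (f y) = mul A (g x) y"
      using mult_mul[OF m g(1)[OF xy(1)] f(1)[OF xy(2)]] xy by (simp add: f g)
  qed (simp_all add: f_def g_def)
  show ?thesis
    by (intro bexI[OF _ n] conjI; rule mult_eqI[OF A mmul_mult[OF vsp_algebra[OF a]] mone_mult[OF a]])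
      (use n m f in simp_all)
qed

lemma mult_inverse_unique:
  assumes A: "nd_algebra A" and m: "m \<in> carr (mult_alg A)" and n: "n \<in> carr (mult_alg A)"
    "m \<cdot> n = mone A" "n \<cdot> m = mone A"
  shows "minv A m = n"
  unfolding minv_def
proof (rule the_equality)
  show "n' = n" if n': "n' \<in> carr (mult_alg A) \<and> m \<cdot> n' = mone A \<and> n' \<cdot> m = mone A" for n'
  proof (rule mult_eqI[OF A])
    fix x assume x: "x \<in> carr A"
    have "fst n' (fst m (fst n x)) = fst n x"
      using n' mmul_fst[of n' m "fst n x"] mult_carr1[OF n(1) x] by simp
    moreover have "fst m (fst n x) = x" using n(2) mmul_fst[of m n x] x by simp
    ultimately show "fst n' x = fst n x" by simp
  qed (use n n' in auto)
qed (use n in auto)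

section \<open>Tensor products of multipliers\<close>

lemma tmap_outside: "vsp A \<Longrightarrow> vsp B \<Longrightarrow> lin A C f \<Longrightarrow> lin B D g \<Longrightarrow> t \<notin> tcarr A B \<Longrightarrow> tmap A B C D f g t = 0"
  unfolding tmap_def by (rule tlift_outside[OF _ _ vsp_tensor bil_tmap])

text \<open>The multiplier identities are additive in both test elements, so elementary tensors
  suffice.\<close>

lemma mult_tensorI:
  fixes A :: "('k::field, 'a::ab_group_add) alg" and B :: "('k, 'b::ab_group_add) alg"
  assumes A: "is_algebra A" and B: "is_algebra B"
    and lf: "lin (A \<otimes> B) (A \<otimes> B) (fst m)" and lg: "lin (A \<otimes> B) (A \<otimes> B) (snd m)"
    and 0: "\<And>x. x \<notin> tcarr A B \<Longrightarrow> fst m x = 0" "\<And>x. x \<notin> tcarr A B \<Longrightarrow> snd m x = 0"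
    and 1: "\<And>a b a' b'. a \<in> carr A \<Longrightarrow> b \<in> carr B \<Longrightarrow> a' \<in> carr A \<Longrightarrow> b' \<in> carr B \<Longrightarrow>
      fst m (ten A B (mul A a a') (mul B b b')) = mul (A \<otimes> B) (fst m (ten A B a b)) (ten A B a' b')"
    and 2: "\<And>a b a' b'. a \<in> carr A \<Longrightarrow> b \<in> carr B \<Longrightarrow> a' \<in> carr A \<Longrightarrow> b' \<in> carr B \<Longrightarrow>
      snd m (ten A B (mul A a a') (mul B b b')) = mul (A \<otimes> B) (ten A B a b) (snd m (ten A B a' b'))"
    and 3: "\<And>a b a' b'. a \<in> carr A \<Longrightarrow> b \<in> carr B \<Longrightarrow> a' \<in> carr A \<Longrightarrow> b' \<in> carr B \<Longrightarrow>
      mul (A \<otimes> B) (ten A B a b) (fst m (ten A B a' b')) = mul (A \<otimes> B) (snd m (ten A B a b)) (ten A B a' b')"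
  shows "m \<in> carr (mult_alg (A \<otimes> B))"
proof -
  have v: "vsp A" "vsp B" using A B by simp_all
  let ?C = "A \<otimes> B"
  note b = bil_mul_tensor[OF A B]
  note c = lin_carr[OF lf, simplified] lin_carr[OF lg, simplified] bil_carr[OF b, simplified]
  have *: "fst m (mul ?C s t) = mul ?C (fst m s) t \<and> snd m (mul ?C s t) = mul ?C s (snd m t) \<and> mul ?C s (fst m t) = mul ?C (snd m s) t"
    if s: "s \<in> tcarr A B" and t: "t \<in> tcarr A B" for s t
    using v s
  proof (induction rule: tcarr_induct)
    case ab: (ten x y)
    from v t show ?case
    proof (induction rule: tcarr_induct)
      case (ten a' b')
      then show ?case using ab by (simp add: mul_ten[OF A B] 1 2 3)
    next
      case (add u w)
      then show ?case using ab
        by (simp add: c lin_add[OF lf] lin_add[OF lg] lin_add[OF bil_lin2[OF b]])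
    qed
  next
    case (add u w)
    then show ?case using t
      by (simp add: c lin_add[OF lf] lin_add[OF lg] lin_add[OF bil_lin1[OF b]])
  qed
  show ?thesis by (rule multI[OF lf lg]) (use * 0 in auto)
qed

lemma mten_tmap: "mten A B m n = (tmap A B A B (fst m) (fst n), tmap A B A B (snd m) (snd n))"
  by (simp add: mten_def tmap_def)

context
  fixes A :: "('k::field, 'a::ab_group_add) alg" and B :: "('k, 'b::ab_group_add) alg" and m n
  assumes A: "is_algebra A" and B: "is_algebra B" and m: "m \<in> carr (mult_alg A)" and n: "n \<in> carr (mult_alg B)"
begin

private lemma vm: "vsp A" "vsp B" using A B by simp_all

lemma mten_ten: 
  assumes "a \<in> carr A" "b \<in> carr B"
  shows "fst (mten A B m n) (ten A B a b) = ten A B (fst m a) (fst n b)"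
    and "snd (mten A B m n) (ten A B a b) = ten A B (snd m a) (snd n b)"
  using assms m n by (simp_all add: mten_tmap tmap_ten[OF vm] mult_lin1 mult_lin2)

lemma mten_mult: "mten A B m n \<in> carr (mult_alg (A \<otimes> B))"
proof (rule mult_tensorI[OF A B])
  note c = mult_carr1[OF m] mult_carr1[OF n] mult_carr2[OF m] mult_carr2[OF n]
  note i = mten_ten mul_ten[OF A B] c A B mult_mul1[OF m] mult_mul1[OF n] mult_mul2[OF m] mult_mul2[OF n] mult_mul[OF m] mult_mul[OF n]
  show "lin (A \<otimes> B) (A \<otimes> B) (fst (mten A B m n))" "lin (A \<otimes> B) (A \<otimes> B) (snd (mten A B m n))"
    using m n by (auto simp: mten_tmap intro!: lin_tmap[OF vm] mult_lin1 mult_lin2)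
  show "fst (mten A B m n) x = 0" "snd (mten A B m n) x = 0" if "x \<notin> tcarr A B" for x
    using that m n by (simp_all add: mten_tmap tmap_outside[OF vm] mult_lin1 mult_lin2)
qed (simp_all add: mten_ten mul_ten[OF A B] mult_carr1[OF m] mult_carr1[OF n] mult_carr2[OF m] mult_carr2[OF n] A B
    mult_mul1[OF m] mult_mul1[OF n] mult_mul2[OF m] mult_mul2[OF n] mult_mul[OF m] mult_mul[OF n])

end

context
  fixes A :: "('k::field, 'a::ab_group_add) alg" and B :: "('k, 'b::ab_group_add) alg"
  assumes A: "is_algebra A" and B: "is_algebra B"
begin

lemma leg1_mult: "a \<in> carr A \<Longrightarrow> leg1 A B a \<in> carr (mult_alg (A \<otimes> B))"
  and leg2_mult: "b \<in> carr B \<Longrightarrow> leg2 A B b \<in> carr (mult_alg (A \<otimes> B))"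
  unfolding leg1_def leg2_def using A B by (simp_all add: mten_mult emb_mult mone_mult)

lemma leg1_ten: "a \<in> carr A \<Longrightarrow> x \<in> carr A \<Longrightarrow> y \<in> carr B \<Longrightarrow> fst (leg1 A B a) (ten A B x y) = ten A B (mul A a x) y"
    "a \<in> carr A \<Longrightarrow> x \<in> carr A \<Longrightarrow> y \<in> carr B \<Longrightarrow> snd (leg1 A B a) (ten A B x y) = ten A B (mul A x a) y"
  unfolding leg1_def using A B by (simp_all add: mten_ten emb_mult mone_mult)

lemma leg2_ten: "b \<in> carr B \<Longrightarrow> x \<in> carr A \<Longrightarrow> y \<in> carr B \<Longrightarrow> fst (leg2 A B b) (ten A B x y) = ten A B x (mul B b y)"
    "b \<in> carr B \<Longrightarrow> x \<in> carr A \<Longrightarrow> y \<in> carr B \<Longrightarrow> snd (leg2 A B b) (ten A B x y) = ten A B x (mul B y b)"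
  unfolding leg2_def using A B by (simp_all add: mten_ten emb_mult mone_mult)

lemma leg1_tmap: "a \<in> carr A \<Longrightarrow> t \<in> tcarr A B \<Longrightarrow> fst (leg1 A B a) t = tmap A B A B (mul A a) (\<lambda>x. x) t"
  and leg2_tmap: "b \<in> carr B \<Longrightarrow> t \<in> tcarr A B \<Longrightarrow> fst (leg2 A B b) t = tmap A B A B (\<lambda>x. x) (mul B b) t"
proof -
  have v: "vsp A" "vsp B" using A B by simp_all
  have l: "lin A A (mul A a)" if "a \<in> carr A" for a by (rule lin_mul2[OF A lin_id that])
  have l': "lin B B (mul B b)" if "b \<in> carr B" for b by (rule lin_mul2[OF B lin_id that])
  show "a \<in> carr A \<Longrightarrow> t \<in> tcarr A B \<Longrightarrow> fst (leg1 A B a) t = tmap A B A B (mul A a) (\<lambda>x. x) t"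
    by (rule tensor_eqI[OF v mult_lin1[OF leg1_mult] lin_tmap[OF v l lin_id]]) (simp_all add: leg1_ten tmap_ten[OF v] l lin_id)
  show "b \<in> carr B \<Longrightarrow> t \<in> tcarr A B \<Longrightarrow> fst (leg2 A B b) t = tmap A B A B (\<lambda>x. x) (mul B b) t"
    by (rule tensor_eqI[OF v mult_lin1[OF leg2_mult] lin_tmap[OF v lin_id l']]) (simp_all add: leg2_ten tmap_ten[OF v] l' lin_id)
qed

text \<open>Rules for tests by u \<otimes> v: a right factor on a leg of t moves into the test
  element, a left factor moves outside. With \<open>tensor_nd_eqI\<close> they turn identities
  between covered expressions into rewriting.\<close>

lemma mul_tmap:
  assumes t: "t \<in> tcarr A B" and u: "u \<in> carr A" and v: "v \<in> carr B"
  shows "x \<in> carr A \<Longrightarrow> mul (A \<otimes> B) (tmap A B A B (\<lambda>z. mul A z x) (\<lambda>z. z) t) (ten A B u v) = mul (A \<otimes> B) t (ten A B (mul A x u) v)"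
    and "y \<in> carr B \<Longrightarrow> mul (A \<otimes> B) (tmap A B A B (\<lambda>z. z) (\<lambda>z. mul B z y) t) (ten A B u v) = mul (A \<otimes> B) t (ten A B u (mul B y v))"
    and "x \<in> carr A \<Longrightarrow> mul (A \<otimes> B) (tmap A B A B (mul A x) (\<lambda>z. z) t) (ten A B u v) = tmap A B A B (mul A x) (\<lambda>z. z) (mul (A \<otimes> B) t (ten A B u v))"
    and "y \<in> carr B \<Longrightarrow> mul (A \<otimes> B) (tmap A B A B (\<lambda>z. z) (mul B y) t) (ten A B u v) = tmap A B A B (\<lambda>z. z) (mul B y) (mul (A \<otimes> B) t (ten A B u v))"
proof -
  have vs: "vsp A" "vsp B" using A B by simp_all
  note m = bil_lin1[OF bil_mul_tensor[OF A B]]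
  note l = lin_mul1[OF A lin_id] lin_mul1[OF B lin_id] lin_mul2[OF A lin_id] lin_mul2[OF B lin_id]
  note s = tmap_ten[OF vs] lin_id mul_ten mul_assoc A B l
  show "x \<in> carr A \<Longrightarrow> mul (A \<otimes> B) (tmap A B A B (\<lambda>z. mul A z x) (\<lambda>z. z) t) (ten A B u v) = mul (A \<otimes> B) t (ten A B (mul A x u) v)"
    by (rule tensor_eqI[OF vs lin_comp[OF lin_tmap[OF vs l(1) lin_id] m] m t]) (use u v in \<open>simp_all add: s\<close>)
  show "y \<in> carr B \<Longrightarrow> mul (A \<otimes> B) (tmap A B A B (\<lambda>z. z) (\<lambda>z. mul B z y) t) (ten A B u v) = mul (A \<otimes> B) t (ten A B u (mul B y v))"
    by (rule tensor_eqI[OF vs lin_comp[OF lin_tmap[OF vs lin_id l(2)] m] m t]) (use u v in \<open>simp_all add: s\<close>)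
  show "x \<in> carr A \<Longrightarrow> mul (A \<otimes> B) (tmap A B A B (mul A x) (\<lambda>z. z) t) (ten A B u v) = tmap A B A B (mul A x) (\<lambda>z. z) (mul (A \<otimes> B) t (ten A B u v))"
    by (rule tensor_eqI[OF vs lin_comp[OF lin_tmap[OF vs l(3) lin_id] m] lin_comp[OF m lin_tmap[OF vs l(3) lin_id]] t]) (use u v in \<open>simp_all add: s\<close>)
  show "y \<in> carr B \<Longrightarrow> mul (A \<otimes> B) (tmap A B A B (\<lambda>z. z) (mul B y) t) (ten A B u v) = tmap A B A B (\<lambda>z. z) (mul B y) (mul (A \<otimes> B) t (ten A B u v))"
    by (rule tensor_eqI[OF vs lin_comp[OF lin_tmap[OF vs lin_id l(4)] m] lin_comp[OF m lin_tmap[OF vs lin_id l(4)]] t]) (use u v in \<open>simp_all add: s\<close>)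
qed

end

lemma lin_eval1: "x \<in> carr A \<Longrightarrow> lin (mult_alg A) A (\<lambda>m. fst m x)"
  and lin_eval2: "x \<in> carr A \<Longrightarrow> lin (mult_alg A) A (\<lambda>m. snd m x)"
  by (auto intro!: linI mult_carr1 mult_carr2 simp: plus_fun_apply)

lemma tensor_fun_eqI:
  assumes "vsp A" "vsp B" "lin (A \<otimes> B) C f" "lin (A \<otimes> B) C' g"
    and "\<And>t. t \<notin> tcarr A B \<Longrightarrow> f t = g t"
    and "\<And>a b. a \<in> carr A \<Longrightarrow> b \<in> carr B \<Longrightarrow> f (ten A B a b) = g (ten A B a b)"
  shows "f = g"
proof
  show "f t = g t" for t
    using tensor_eqI[OF assms(1-4) _ assms(6)] assms(5) by (cases "t \<in> tcarr A B") auto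
qed

lemma bil_mten:
  fixes A :: "('k::field, 'a::ab_group_add) alg" and B :: "('k, 'b::ab_group_add) alg"
  assumes A: "is_algebra A" and B: "is_algebra B"
  shows "bil (mult_alg A) (mult_alg B) (mult_alg (A \<otimes> B)) (mten A B)"
proof -
  have v: "vsp A" "vsp B" using A B by simp_all
  note o = tmap_outside[OF v]
  have 1: "tmap A B A B (f + f') g = tmap A B A B f g + tmap A B A B f' g"
    if f: "lin A A f" "lin A A f'" and g: "lin B B g" for f f' g
    unfolding plus_fun_def[of "tmap A B A B _ _"] plus_fun_def[of f f']
    by (rule tensor_fun_eqI[OF v lin_tmap[OF v lin_plus[OF v(1) f] g] lin_plus[OF vsp_tensor lin_tmap[OF v f(1) g] lin_tmap[OF v f(2) g]]])
      (use f g lin_plus[OF v(1) f] in \<open>simp_all add: o tmap_ten[OF v] lin_carr lin_add[OF bil_lin1[OF bil_ten]]\<close>)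
  have 2: "tmap A B A B f (g + g') = tmap A B A B f g + tmap A B A B f g'"
    if f: "lin A A f" and g: "lin B B g" "lin B B g'" for f g g'
    unfolding plus_fun_def[of "tmap A B A B _ _"] plus_fun_def[of g g']
    by (rule tensor_fun_eqI[OF v lin_tmap[OF v f lin_plus[OF v(2) g]] lin_plus[OF vsp_tensor lin_tmap[OF v f g(1)] lin_tmap[OF v f g(2)]]])
      (use f g lin_plus[OF v(2) g] in \<open>simp_all add: o tmap_ten[OF v] lin_carr lin_add[OF bil_lin2[OF bil_ten]]\<close>)
  have 3: "tmap A B A B (\<lambda>x. smul A c (f x)) g = (\<lambda>t. smul (A \<otimes> B) c (tmap A B A B f g t))"
    if f: "lin A A f" and g: "lin B B g" for f g c
    by (rule tensor_fun_eqI[OF v lin_tmap[OF v lin_smul_const[OF v(1) f] g] lin_smul_const[OF vsp_tensor lin_tmap[OF v f g]]])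
      (use f g lin_smul_const[OF v(1) f] in \<open>simp_all add: o tmap_ten[OF v] lin_carr lin_smul[OF bil_lin1[OF bil_ten]] smul_laws(6)[OF vsp_tensor, unfolded tensor_alg_simps]\<close>)
  have 4: "tmap A B A B f (\<lambda>x. smul B c (g x)) = (\<lambda>t. smul (A \<otimes> B) c (tmap A B A B f g t))"
    if f: "lin A A f" and g: "lin B B g" for f g c
    by (rule tensor_fun_eqI[OF v lin_tmap[OF v f lin_smul_const[OF v(2) g]] lin_smul_const[OF vsp_tensor lin_tmap[OF v f g]]])
      (use f g lin_smul_const[OF v(2) g] in \<open>simp_all add: o tmap_ten[OF v] lin_carr lin_smul[OF bil_lin2[OF bil_ten]] smul_laws(6)[OF vsp_tensor, unfolded tensor_alg_simps]\<close>)
  show ?thesis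
  proof (intro bilI linI)
    show "mten A B m n \<in> carr (mult_alg (A \<otimes> B))" "mten A B m n \<in> carr (mult_alg (A \<otimes> B))"
      if "m \<in> carr (mult_alg A)" "n \<in> carr (mult_alg B)" for m n
      using that mten_mult[OF A B] by simp_all
  qed (simp_all add: mten_tmap 1 2 3 4 mult_lin1 mult_lin2)
qed

section \<open>Extending non-degenerate homomorphisms to multipliers\<close>

lemma alg_hom_lin: "alg_hom A B f \<Longrightarrow> lin A B f"
  by (simp add: alg_hom_def lin_def)

lemma alg_hom_mul: "alg_hom A B f \<Longrightarrow> x \<in> carr A \<Longrightarrow> y \<in> carr A \<Longrightarrow> f (mul A x y) = mul B (f x) (f y)"
  by (simp add: alg_hom_def)

lemma alg_homI: "lin A B f \<Longrightarrow> (\<And>x y. x \<in> carr A \<Longrightarrow> y \<in> carr A \<Longrightarrow> f (mul A x y) = mul B (f x) (f y)) \<Longrightarrow> alg_hom A B f"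
  by (simp add: alg_hom_def lin_def)

lemma span_image_induct:
  assumes B: "vsp B" and s: "lspan B {F a b |a b. a \<in> carr A \<and> b \<in> carr C} = carr B" and x: "x \<in> carr B" and C: "vsp C"
    and F: "bil A C B F"
    and 1: "\<And>a b. a \<in> carr A \<Longrightarrow> b \<in> carr C \<Longrightarrow> P (F a b)"
    and 2: "\<And>x y. x \<in> carr B \<Longrightarrow> y \<in> carr B \<Longrightarrow> P x \<Longrightarrow> P y \<Longrightarrow> P (x + y)" and A: "vsp A"
  shows "P x"
proof -
  have 0: "P 0" using 1[OF vsp_zero[OF A] vsp_zero[OF C]] lin_zero[OF C bil_lin2[OF F vsp_zero[OF A]]] by simp
  have "x \<in> lspan B {F a b |a b. a \<in> carr A \<and> b \<in> carr C}" using s x by blast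
  then have "x \<in> carr B \<and> (\<forall>c. P (smul B c x))"
  proof (rule lspan_induct[OF B])
    show "e \<in> carr B \<and> (\<forall>c. P (smul B c e))" if e: "e \<in> {F a b |a b. a \<in> carr A \<and> b \<in> carr C}" for e
    proof -
      from e obtain a b where e: "e = F a b" "a \<in> carr A" "b \<in> carr C" by auto
      have "P (smul B c e)" for c
        using 1[OF e(2) vsp_smul[OF C e(3), of c]] e by (simp add: lin_smul[OF bil_lin2[OF F]])
      then show ?thesis using e bil_carr[OF F] by simp
    qed
    show "x + y \<in> carr B \<and> (\<forall>c. P (smul B c (x + y)))"
      if "x \<in> carr B \<and> (\<forall>c. P (smul B c x))" "y \<in> carr B \<and> (\<forall>c. P (smul B c y))" for x y
    proof -
      have "P (smul B c x + smul B c y)" for c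
        by (rule 2) (use that B in \<open>auto intro: vsp_smul\<close>)
      then show ?thesis using that B by (simp add: smul_laws vsp_add)
    qed
  qed (use B 0 in \<open>auto simp: smul_laws intro: vsp_smul\<close>)
  then have "P (smul B 1 x)" by blast
  then show ?thesis using B by (simp add: smul_laws)
qed

context
  fixes A :: "('k::field, 'a::ab_group_add) alg" and B :: "('k, 'b::ab_group_add) alg" and f
  assumes A: "is_algebra A" and B: "nd_algebra B" and f: "nondeg_hom A B f"
begin

private lemma ve: "vsp A" "vsp B" using A B by simp_all

lemma hom_lin: "lin A (mult_alg B) f"
  using f alg_hom_lin unfolding nondeg_hom_def by blast

lemma hom_mult: "a \<in> carr A \<Longrightarrow> f a \<in> carr (mult_alg B)"
  using lin_carr[OF hom_lin] .

lemma hom_mul: "a \<in> carr A \<Longrightarrow> b \<in> carr A \<Longrightarrow> f (mul A a b) = f a \<cdot> f b"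
  using f alg_hom_mul[of A "mult_alg B" f a b] unfolding nondeg_hom_def by simp

lemma hom_bil1: "bil A B B (\<lambda>a. fst (f a))" and hom_bil2: "bil A B B (\<lambda>a. snd (f a))"
  by (auto intro!: bilI lin_comp[OF hom_lin] lin_eval1 lin_eval2 mult_lin1 mult_lin2 hom_mult)

lemma nondeg_induct1:
  assumes "y \<in> carr B" "\<And>a b. a \<in> carr A \<Longrightarrow> b \<in> carr B \<Longrightarrow> P (fst (f a) b)"
    "\<And>x y. x \<in> carr B \<Longrightarrow> y \<in> carr B \<Longrightarrow> P x \<Longrightarrow> P y \<Longrightarrow> P (x + y)"
  shows "P y"
  using f ve by (intro span_image_induct[OF ve(2) _ assms(1) ve(2) hom_bil1 assms(2,3)]) (simp_all add: nondeg_hom_def)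

lemma nondeg_induct2:
  assumes "y \<in> carr B" "\<And>a b. a \<in> carr A \<Longrightarrow> b \<in> carr B \<Longrightarrow> P (snd (f a) b)"
    "\<And>x y. x \<in> carr B \<Longrightarrow> y \<in> carr B \<Longrightarrow> P x \<Longrightarrow> P y \<Longrightarrow> P (x + y)"
  shows "P y"
  using f ve by (intro span_image_induct[OF ve(2) _ assms(1) ve(2) hom_bil2 assms(2,3)]) (simp_all add: nondeg_hom_def)

text \<open>Since B = B f(A), products with any b reduce to the values f(a) y.\<close>

lemma nondeg_separates:
  assumes y: "y \<in> carr B" "y' \<in> carr B" and 0: "\<And>a. a \<in> carr A \<Longrightarrow> fst (f a) y = fst (f a) y'"
  shows "y = y'"
proof (rule nd_eq_right[OF B y])
  fix b assume "b \<in> carr B"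
  then show "mul B b y = mul B b y'"
  proof (rule nondeg_induct2)
    show "mul B (snd (f a) b) y = mul B (snd (f a) b) y'" if "a \<in> carr A" "b \<in> carr B" for a b
      using 0 that y by (simp add: mult_mul[OF hom_mult, symmetric])
  qed (use B y in \<open>simp_all add: lin_add[OF bil_lin1[OF bil_mul]]\<close>)
qed

text \<open>The opposite algebras turn statements about right multiplication into statements about
  left multiplication.\<close>

lemma nondeg_swap: "nondeg_hom (op_alg A) (op_alg B) (\<lambda>a. prod.swap (f a))"
  unfolding nondeg_hom_def
proof (intro conjI alg_homI linI)
  have e: "lspan (op_alg B) E = lspan B E" for E by (simp add: lspan_def)
  show "lspan (op_alg B) {fst (prod.swap (f a)) b |a b. a \<in> carr (op_alg A) \<and> b \<in> carr (op_alg B)} = carr (op_alg B)"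
    "lspan (op_alg B) {snd (prod.swap (f a)) b |a b. a \<in> carr (op_alg A) \<and> b \<in> carr (op_alg B)} = carr (op_alg B)"
    using f unfolding e nondeg_hom_def by simp_all
qed (use A in \<open>simp_all add: mult_swap hom_mult hom_mul lin_add[OF hom_lin] lin_smul[OF hom_lin],
    simp_all add: mmul_def prod_eq_iff\<close>)

text \<open>The prescription n(f(a) b) = f(m a) b is well defined because f(a') f(m a) b = f(a' m)
  f(a) b: applying f(a') to the intended value gives something that depends on the argument alone,
  and \<open>nondeg_separates\<close> then fixes the value.\<close>

lemma ext_exists_left:
  assumes m: "m \<in> carr (mult_alg A)"
  obtains n where "lin B B n" "\<And>x. x \<notin> carr B \<Longrightarrow> n x = 0"
    "\<And>a b. a \<in> carr A \<Longrightarrow> b \<in> carr B \<Longrightarrow> n (fst (f a) b) = fst (f (fst m a)) b"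
    "\<And>a b. a \<in> carr A \<Longrightarrow> b \<in> carr B \<Longrightarrow> fst (f a) (n b) = fst (f (snd m a)) b"
    "\<And>x y. x \<in> carr B \<Longrightarrow> y \<in> carr B \<Longrightarrow> n (mul B x y) = mul B (n x) y"
proof -
  define G where "G = tlift A B (\<lambda>a b. fst (f a) b)"
  define H where "H = tlift A B (\<lambda>a b. fst (f (fst m a)) b)"
  have bH: "bil A B B (\<lambda>a b. fst (f (fst m a)) b)"
    using bil_comp1[OF hom_bil1 mult_lin1[OF m]] bil_lin2[OF hom_bil1 mult_carr1[OF m]] by (auto intro!: bilI)
  note G = lin_tlift[OF ve ve(2) hom_bil1, folded G_def] tlift_ten[OF ve ve(2) hom_bil1, folded G_def]
  note H = lin_tlift[OF ve ve(2) bH, folded H_def] tlift_ten[OF ve ve(2) bH, folded H_def]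
  have surj: "\<exists>t\<in>tcarr A B. G t = y" if "y \<in> carr B" for y
    using that
  proof (rule nondeg_induct1)
    show "\<exists>t\<in>tcarr A B. G t = fst (f a) b" if "a \<in> carr A" "b \<in> carr B" for a b
      using G(2)[OF that] ten_carr[OF that] by blast
    show "\<exists>t\<in>tcarr A B. G t = x + y" if "\<exists>t\<in>tcarr A B. G t = x" "\<exists>t\<in>tcarr A B. G t = y" for x y
      using that lin_add[OF G(1)] tcarr_add by (metis tensor_alg_simps(1))
  qed
  have key: "fst (f a) (H t) = fst (f (snd m a)) (G t)" if t: "t \<in> tcarr A B" and a: "a \<in> carr A" for t a
  proof (rule tensor_eqI[OF ve lin_comp[OF H(1) mult_lin1[OF hom_mult[OF a]]]
        lin_comp[OF G(1) mult_lin1[OF hom_mult[OF mult_carr2[OF m a]]]] t])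
    fix a' b assume ab: "a' \<in> carr A" "b \<in> carr B"
    have "fst (f a) (fst (f (fst m a')) b) = fst (f (mul A a (fst m a'))) b"
      using a ab m by (simp add: hom_mul mult_carr1)
    also have "\<dots> = fst (f (snd m a)) (fst (f a') b)"
      using a ab m by (simp add: hom_mul mult_carr2 mult_mul)
    finally show "fst (f a) (H (ten A B a' b)) = fst (f (snd m a)) (G (ten A B a' b))"
      using ab by (simp add: G H)
  qed
  \<comment> \<open>Any preimage under \<open>G\<close> will do; \<open>key\<close> shows that the
    choice does not matter.\<close>
  define n where "n y = (if y \<in> carr B then H (SOME t. t \<in> tcarr A B \<and> G t = y) else 0)" for y
  have n_key: "n y \<in> carr B \<and> (\<forall>a\<in>carr A. fst (f a) (n y) = fst (f (snd m a)) y)" if y: "y \<in> carr B" for y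
  proof -
    have "\<exists>t. t \<in> tcarr A B \<and> G t = y" using surj[OF y] by blast
    then have t: "(SOME t. t \<in> tcarr A B \<and> G t = y) \<in> tcarr A B" "G (SOME t. t \<in> tcarr A B \<and> G t = y) = y"
      using someI_ex[of "\<lambda>t. t \<in> tcarr A B \<and> G t = y"] by blast+
    then show ?thesis using y key[OF t(1)] lin_carr[OF H(1)] by (simp add: n_def)
  qed
  have nI: "n y = z" if "y \<in> carr B" "z \<in> carr B" "\<And>a. a \<in> carr A \<Longrightarrow> fst (f a) z = fst (f (snd m a)) y" for y z
    by (rule nondeg_separates) (use that n_key in auto)
  note c = mult_carr1[OF hom_mult] mult_carr1[OF m] mult_carr2[OF m]
  show ?thesis
  proof (rule that[of n])
    show "lin B B n"
    proof (rule linI)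
      show "n x \<in> carr B" if "x \<in> carr B" for x using n_key that by blast
      show "n (x + y) = n x + n y" if "x \<in> carr B" "y \<in> carr B" for x y
        by (rule nI) (use that n_key ve in \<open>simp_all add: vsp_add lin_add[OF mult_lin1[OF hom_mult]] c\<close>)
      show "n (smul B k x) = smul B k (n x)" if "x \<in> carr B" for x k
        by (rule nI) (use that n_key ve in \<open>simp_all add: vsp_smul lin_smul[OF mult_lin1[OF hom_mult]] c\<close>)
    qed
    show "n x = 0" if "x \<notin> carr B" for x using that by (simp add: n_def)
    show "n (fst (f a) b) = fst (f (fst m a)) b" if "a \<in> carr A" "b \<in> carr B" for a b
    proof (rule nI)
      show "fst (f a') (fst (f (fst m a)) b) = fst (f (snd m a')) (fst (f a) b)" if "a' \<in> carr A" for a'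
        using key[of "ten A B a b" a'] that \<open>a \<in> carr A\<close> \<open>b \<in> carr B\<close> by (simp add: G H)
    qed (use that c in auto)
    show "fst (f a) (n b) = fst (f (snd m a)) b" if "a \<in> carr A" "b \<in> carr B" for a b
      using n_key that by blast
    show "n (mul B x y) = mul B (n x) y" if "x \<in> carr B" "y \<in> carr B" for x y
      by (rule nI) (use that n_key B in \<open>simp_all add: c mult_mul1[OF hom_mult]\<close>)
  qed
qed

end

context
  fixes A :: "('k::field, 'a::ab_group_add) alg" and B :: "('k, 'b::ab_group_add) alg" and f m
  assumes A: "is_algebra A" and B: "nd_algebra B" and f: "nondeg_hom A B f" and m: "m \<in> carr (mult_alg A)"
begin

lemma ext_ex: "\<exists>n. n \<in> carr (mult_alg B) \<and>
     (\<forall>a\<in>carr A. \<forall>b\<in>carr B. fst n (fst (f a) b) = fst (f (fst m a)) b \<and> snd n (snd (f a) b) = snd (f (snd m a)) b)"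
proof -
  obtain n1 where n1: "lin B B n1" "\<And>x. x \<notin> carr B \<Longrightarrow> n1 x = 0"
    "\<And>a b. a \<in> carr A \<Longrightarrow> b \<in> carr B \<Longrightarrow> n1 (fst (f a) b) = fst (f (fst m a)) b"
    "\<And>a b. a \<in> carr A \<Longrightarrow> b \<in> carr B \<Longrightarrow> fst (f a) (n1 b) = fst (f (snd m a)) b"
    "\<And>x y. x \<in> carr B \<Longrightarrow> y \<in> carr B \<Longrightarrow> n1 (mul B x y) = mul B (n1 x) y"
    using ext_exists_left[OF A B f m] by metis
  obtain n2 where n2: "lin B B n2" "\<And>x. x \<notin> carr B \<Longrightarrow> n2 x = 0"
    "\<And>a b. a \<in> carr A \<Longrightarrow> b \<in> carr B \<Longrightarrow> n2 (snd (f a) b) = snd (f (snd m a)) b"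
    "\<And>x y. x \<in> carr B \<Longrightarrow> y \<in> carr B \<Longrightarrow> n2 (mul B x y) = mul B x (n2 y)"
  \<comment> \<open>The right component is the left one for the opposite algebras.\<close>
  proof (rule ext_exists_left[OF is_algebra_op[OF A] nd_algebra_op[OF B] nondeg_swap[OF A B f] mult_swap[OF m]], goal_cases)
    case (1 n)
    show ?case by (rule that[of n]) (use 1 in simp_all)
  qed
  have "(n1, n2) \<in> carr (mult_alg B)"
  proof (rule multI)
    fix x y assume xy: "x \<in> carr B" "y \<in> carr B"
    have "mul B x (n1 y) = mul B (n2 x) y" using xy(1)
    proof (rule nondeg_induct2[OF A B f])
      fix a b assume ab: "a \<in> carr A" "b \<in> carr B"
      have "mul B (snd (f a) b) (n1 y) = mul B b (fst (f (snd m a)) y)"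
        using ab xy n1 lin_carr[OF n1(1)] hom_mult[OF A B f] by (simp add: mult_mul[symmetric])
      also have "\<dots> = mul B (n2 (snd (f a) b)) y"
        using ab xy n2 hom_mult[OF A B f] mult_carr2[OF m] by (simp add: mult_mul)
      finally show "mul B (snd (f a) b) (n1 y) = mul B (n2 (snd (f a) b)) y" .
    qed (use B xy lin_carr[OF n1(1)] lin_carr[OF n2(1)] in \<open>simp_all add: lin_add[OF n2(1)] lin_add[OF bil_lin1[OF bil_mul]]\<close>)
    then show "mul B x (fst (n1, n2) y) = mul B (snd (n1, n2) x) y" by simp
  qed (use n1 n2 in auto)
  then show ?thesis using n1 n2 by (intro exI[of _ "(n1, n2)"]) auto
qed

lemma ext_spec:
  shows ext_mult: "ext A B f m \<in> carr (mult_alg B)"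
    and ext_fst: "a \<in> carr A \<Longrightarrow> b \<in> carr B \<Longrightarrow> fst (ext A B f m) (fst (f a) b) = fst (f (fst m a)) b"
    and ext_snd: "a \<in> carr A \<Longrightarrow> b \<in> carr B \<Longrightarrow> snd (ext A B f m) (snd (f a) b) = snd (f (snd m a)) b"
proof -
  have *: "ext A B f m \<in> carr (mult_alg B) \<and>
     (\<forall>a\<in>carr A. \<forall>b\<in>carr B. fst (ext A B f m) (fst (f a) b) = fst (f (fst m a)) b \<and> 
        snd (ext A B f m) (snd (f a) b) = snd (f (snd m a)) b)"
    unfolding ext_def
  proof (rule theI')
    show "\<exists>!n. n \<in> carr (mult_alg B) \<and> (\<forall>a\<in>carr A. \<forall>b\<in>carr B.
        fst n (fst (f a) b) = fst (f (fst m a)) b \<and> snd n (snd (f a) b) = snd (f (snd m a)) b)"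
    proof (rule ex_ex1I[OF ext_ex], elim conjE)
      fix n n' assume n: "n \<in> carr (mult_alg B)" "\<forall>a\<in>carr A. \<forall>b\<in>carr B.
        fst n (fst (f a) b) = fst (f (fst m a)) b \<and> snd n (snd (f a) b) = snd (f (snd m a)) b"
        and n': "n' \<in> carr (mult_alg B)" "\<forall>a\<in>carr A. \<forall>b\<in>carr B.
        fst n' (fst (f a) b) = fst (f (fst m a)) b \<and> snd n' (snd (f a) b) = snd (f (snd m a)) b"
      show "n = n'"
      proof (rule mult_eqI[OF B n(1) n'(1)])
        fix x assume "x \<in> carr B"
        then show "fst n x = fst n' x"
          by (rule nondeg_induct1[OF A B f]) (use n n' in \<open>simp_all add: lin_add[OF mult_lin1]\<close>)
      qed
    qed
  qed
  then show "ext A B f m \<in> carr (mult_alg B)"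
    "a \<in> carr A \<Longrightarrow> b \<in> carr B \<Longrightarrow> fst (ext A B f m) (fst (f a) b) = fst (f (fst m a)) b"
    "a \<in> carr A \<Longrightarrow> b \<in> carr B \<Longrightarrow> snd (ext A B f m) (snd (f a) b) = snd (f (snd m a)) b" 
    by blast+
qed

end

lemma nondeg_emb:
  assumes A: "nd_algebra A" shows "nondeg_hom A A (emb A)"
proof -
  note a = nd_algebra_alg[OF A] and v = vsp_algebra[OF nd_algebra_alg[OF A]]
  have eq1: "{fst (emb A x) b |x b. x \<in> carr A \<and> b \<in> carr A} = {mul A x b |x b. x \<in> carr A \<and> b \<in> carr A}"
    using emb_simps(1)[of _ A] by metis
  have eq2: "{snd (emb A x) b |x b. x \<in> carr A \<and> b \<in> carr A} = {mul A b x |b x. b \<in> carr A \<and> x \<in> carr A}"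
    using emb_simps(2)[of _ A] by metis
  have "alg_hom A (mult_alg A) (emb A)"
  proof (rule alg_homI[OF linI])
    fix x y c assume x: "x \<in> carr A"
    have s: "smul (mult_alg A) c (emb A x) \<in> carr (mult_alg A)"
      using vsp_smul[OF vsp_mult_alg[OF a] emb_mult[OF a x]] .
    show "emb A (smul A c x) = smul (mult_alg A) c (emb A x)"
      by (rule mult_eqI[OF A emb_mult[OF a] s]) (use x v a in \<open>auto simp: lin_smul[OF bil_lin1[OF bil_mul]] intro: vsp_smul\<close>)
    assume y: "y \<in> carr A"
    have p: "emb A x + emb A y \<in> carr (mult_alg A)"
      using vsp_add[OF vsp_mult_alg[OF a] emb_mult[OF a x] emb_mult[OF a y]] .
    show "emb A (x + y) = emb A x + emb A y"
      by (rule mult_eqI[OF A emb_mult[OF a] p]) 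
        (use x y v a in \<open>auto simp: plus_fun_apply lin_add[OF bil_lin1[OF bil_mul]] intro: vsp_add\<close>)
    show "emb A (mul A x y) = mul (mult_alg A) (emb A x) (emb A y)"
      unfolding mult_alg_simps
      by (rule mult_eqI[OF A emb_mult[OF a] mmul_mult[OF v emb_mult[OF a] emb_mult[OF a]]])
        (use x y a in \<open>auto simp: mul_assoc\<close>)
  qed (use emb_mult[OF a] in auto)
  then show ?thesis
    unfolding nondeg_hom_def eq1 eq2 using A unfolding nd_algebra_def by simp
qed

text \<open>Elements that arise through \<open>unemb\<close> are known by their products, so
  equality is tested by right multiplication with elementary tensors.\<close>

lemma tensor_nd_eqI:
  assumes A: "nd_algebra A" and B: "nd_algebra B" and t: "t \<in> tcarr A B" "t' \<in> tcarr A B"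
    and e: "\<And>a b. a \<in> carr A \<Longrightarrow> b \<in> carr B \<Longrightarrow> mul (A \<otimes> B) t (ten A B a b) = mul (A \<otimes> B) t' (ten A B a b)"
  shows "t = t'"
proof (rule nd_eq_left[OF nd_algebra_tensor[OF A B]])
  note a = nd_algebra_alg[OF A] nd_algebra_alg[OF B]
  note b = bil_lin2[OF bil_mul_tensor[OF a]]
  show "mul (A \<otimes> B) t s = mul (A \<otimes> B) t' s" if "s \<in> carr (A \<otimes> B)" for s
    by (rule tensor_eqI[OF vsp_algebra[OF a(1)] vsp_algebra[OF a(2)] b b]) (use t e that in simp_all)
qed (use t in simp_all)

lemma mult_tensor_eqI:
  assumes A: "nd_algebra A" and B: "nd_algebra B" and m: "m \<in> carr (mult_alg (A \<otimes> B))" "n \<in> carr (mult_alg (A \<otimes> B))"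
    and e: "\<And>a b. a \<in> carr A \<Longrightarrow> b \<in> carr B \<Longrightarrow> fst m (ten A B a b) = fst n (ten A B a b)"
  shows "m = n"
proof (rule mult_eqI[OF nd_algebra_tensor[OF A B] m])
  fix x assume "x \<in> carr (A \<otimes> B)"
  then have x: "x \<in> tcarr A B" by simp
  show "fst m x = fst n x"
    by (rule tensor_eqI[OF _ _ mult_lin1[OF m(1)] mult_lin1[OF m(2)] x]) (use A B e in simp_all)
qed

context
  fixes A :: "('k::field, 'a::ab_group_add) alg" and B :: "('k, 'b::ab_group_add) alg"
    and C :: "('k, 'c::ab_group_add) alg" and D :: "('k, 'd::ab_group_add) alg" and f g
  assumes A: "is_algebra A" and B: "nd_algebra B" and f: "nondeg_hom A B f"
    and C: "is_algebra C" and D: "nd_algebra D" and g: "nondeg_hom C D g"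
begin

private lemma vh: "vsp A" "vsp B" "vsp C" "vsp D" and a: "is_algebra B" "is_algebra D"
  using A B C D by simp_all

private lemma nd: "nd_algebra (B \<otimes> D)" using B D by simp
private lemma algBD: "is_algebra (B \<otimes> D)" using nd by simp

private lemma bh: "bil A C (mult_alg (B \<otimes> D)) (\<lambda>a c. mten B D (f a) (g c))"
  by (intro bilI bil_comp1[OF bil_mten hom_lin[OF A B f]] bil_comp2[OF bil_mten hom_lin[OF C D g]])
    (simp_all add: a hom_mult[OF A B f] hom_mult[OF C D g])

lemma hten_lin: "lin (A \<otimes> C) (mult_alg (B \<otimes> D)) (hten A B C D f g)"
  and hten_ten: "x \<in> carr A \<Longrightarrow> y \<in> carr C \<Longrightarrow> hten A B C D f g (ten A C x y) = mten B D (f x) (g y)"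
  unfolding hten_def by (rule lin_tlift[OF vh(1,3) vsp_mult_alg[OF algBD] bh])
    (rule tlift_ten[OF vh(1,3) vsp_mult_alg[OF algBD] bh])

lemma hten_nondeg: "nondeg_hom (A \<otimes> C) (B \<otimes> D) (hten A B C D f g)"
proof -
  let ?h = "hten A B C D f g"
  have m: "?h x \<in> carr (mult_alg (B \<otimes> D))" if "x \<in> tcarr A C" for x
    using lin_carr[OF hten_lin] that by simp
  have el: "lin (A \<otimes> C) (B \<otimes> D) (\<lambda>x. fst (?h x) u)" if "u \<in> tcarr B D" for u
    using that by (intro lin_comp[OF hten_lin lin_eval1]) simp
  have mult: "?h (mul (A \<otimes> C) x y) = ?h x \<cdot> ?h y" if x: "x \<in> tcarr A C" and y: "y \<in> tcarr A C" for x y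
  proof (rule mult_tensor_eqI[OF B D m mmul_mult[OF vsp_tensor m[OF x] m[OF y]]])
    show "mul (A \<otimes> C) x y \<in> tcarr A C" using bil_carr[OF bil_mul_tensor[OF A C]] x y by simp
    fix b d assume bd: "b \<in> carr B" "d \<in> carr D"
    have 1: "fst (?h (mul (A \<otimes> C) (ten A C a' c') y)) (ten B D b d) = fst (?h (ten A C a' c')) (fst (?h y) (ten B D b d))"
      if a': "a' \<in> carr A" "c' \<in> carr C" for a' c'
    proof (rule tensor_eqI[OF vh(1,3) lin_comp[OF bil_lin2[OF bil_mul_tensor[OF A C]] el] lin_comp[OF el mult_lin1[OF m]] y])
      fix a2 c2 assume ac: "a2 \<in> carr A" "c2 \<in> carr C"
      note hm = hom_mult[OF A B f] hom_mult[OF C D g]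
      show "fst (?h (mul (A \<otimes> C) (ten A C a' c') (ten A C a2 c2))) (ten B D b d) = fst (?h (ten A C a' c')) (fst (?h (ten A C a2 c2)) (ten B D b d))"
        using a' ac bd A C
        by (simp add: mul_ten[OF A C] hten_ten mten_ten[OF a hm] mten_ten[OF a mmul_mult[OF vh(2)] mmul_mult[OF vh(4)]] hm mult_carr1 
             hom_mul[OF A B f] hom_mul[OF C D g])
    qed (use a' bd in simp_all)
    have "fst (?h (mul (A \<otimes> C) x y)) (ten B D b d) = fst (?h x) (fst (?h y) (ten B D b d))"
      by (rule tensor_eqI[OF vh(1,3) lin_comp[OF bil_lin1[OF bil_mul_tensor[OF A C]] el] el x])
        (use bd y 1 mult_carr1[OF m[OF y]] in simp_all)
    then show "fst (?h (mul (A \<otimes> C) x y)) (ten B D b d) = fst (?h x \<cdot> ?h y) (ten B D b d)" by simp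
  qed
  \<comment> \<open>Both one-sided density conditions at once: \<open>s\<close>, \<open>F\<close>
    and \<open>K\<close> are all left or all right components, at three different types.\<close>
  have span: "lspan (B \<otimes> D) {s (?h x) y |x y. x \<in> carr (A \<otimes> C) \<and> y \<in> carr (B \<otimes> D)} = carr (B \<otimes> D)"
    if s: "s = fst \<and> F = fst \<and> K = fst \<or> s = snd \<and> F = snd \<and> K = snd" 
    for s and F :: "'b multiplier \<Rightarrow> 'b \<Rightarrow> 'b" and K :: "'d multiplier \<Rightarrow> 'd \<Rightarrow> 'd"
  proof (rule lspan_eqI[OF vsp_tensor])
    let ?E = "{s (?h x) y |x y. x \<in> carr (A \<otimes> C) \<and> y \<in> carr (B \<otimes> D)}"
    show "?E \<subseteq> carr (B \<otimes> D)" using s mult_carr1[OF m] mult_carr2[OF m] by auto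
    note hm = hom_mult[OF A B f] hom_mult[OF C D g]
    fix t assume "t \<in> carr (B \<otimes> D)"
    then have t: "t \<in> tcarr B D" by simp
    have ind: "P x" if "x \<in> carr B" "\<And>a b. a \<in> carr A \<Longrightarrow> b \<in> carr B \<Longrightarrow> P (F (f a) b)"
      "\<And>x y. x \<in> carr B \<Longrightarrow> y \<in> carr B \<Longrightarrow> P x \<Longrightarrow> P y \<Longrightarrow> P (x + y)" for x P
      using s nondeg_induct1[OF A B f that(1), of P] nondeg_induct2[OF A B f that(1), of P] that(2,3) by blast
    have ind': "P x" if "x \<in> carr D" "\<And>a b. a \<in> carr C \<Longrightarrow> b \<in> carr D \<Longrightarrow> P (K (g a) b)"
      "\<And>x y. x \<in> carr D \<Longrightarrow> y \<in> carr D \<Longrightarrow> P x \<Longrightarrow> P y \<Longrightarrow> P (x + y)" for x P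
      using s nondeg_induct1[OF C D g that(1), of P] nondeg_induct2[OF C D g that(1), of P] that(2,3) by blast
    from vh(2,4) t show "t \<in> lspan (B \<otimes> D) ?E"
    proof (induction rule: tcarr_induct)
      case xy: (ten x y)
      from xy(1) show ?case
      proof (rule ind)
        fix a' b assume ab: "a' \<in> carr A" "b \<in> carr B"
        then have Fb: "F (f a') b \<in> carr B" using s hm mult_carr1 mult_carr2 by metis
        from xy(2) show "ten B D (F (f a') b) y \<in> lspan (B \<otimes> D) ?E"
        proof (rule ind')
          fix c d assume cd: "c \<in> carr C" "d \<in> carr D"
          have "ten B D (F (f a') b) (K (g c) d) = s (?h (ten A C a' c)) (ten B D b d)"
            using s ab cd by (auto simp: hten_ten mten_ten[OF a hm])
          then show "ten B D (F (f a') b) (K (g c) d) \<in> lspan (B \<otimes> D) ?E"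
            using ab cd by (intro lspan_base[OF vsp_tensor]) auto
        next
          fix y y' assume "y \<in> carr D" "y' \<in> carr D"
            "ten B D (F (f a') b) y \<in> lspan (B \<otimes> D) ?E" "ten B D (F (f a') b) y' \<in> lspan (B \<otimes> D) ?E"
          then show "ten B D (F (f a') b) (y + y') \<in> lspan (B \<otimes> D) ?E"
            using lin_add[OF bil_lin2[OF bil_ten[of B D] Fb]] by (simp add: lspan_add)
        qed
      next
        fix x x' assume "x \<in> carr B" "x' \<in> carr B" "ten B D x y \<in> lspan (B \<otimes> D) ?E" "ten B D x' y \<in> lspan (B \<otimes> D) ?E"
        then show "ten B D (x + x') y \<in> lspan (B \<otimes> D) ?E"
          using lin_add[OF bil_lin1[OF bil_ten[of B D] xy(2)]] by (simp add: lspan_add)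
      qed
    qed (simp add: lspan_add)
  qed
  show ?thesis
    unfolding nondeg_hom_def using span[of fst fst fst] span[of snd snd snd] mult
    by (intro conjI alg_homI[OF hten_lin]) simp_all
qed

end

lemma ext_alg_spec:
  fixes A :: "('k::field, 'a::ab_group_add) alg" and B :: "('k, 'b::ab_group_add) alg"
  assumes A: "nd_algebra A" and B: "nd_algebra B" and f: "alg_hom A B \<phi>" and s: "\<phi> ` carr A = carr B"
    and m: "m \<in> carr (mult_alg A)"
  shows ext_alg_mult: "ext_alg A B \<phi> m \<in> carr (mult_alg B)"
    and ext_alg_fst: "a \<in> carr A \<Longrightarrow> fst (ext_alg A B \<phi> m) (\<phi> a) = \<phi> (fst m a)"
proof -
  note al = nd_algebra_alg[OF A] nd_algebra_alg[OF B]
  note E = nondeg_emb[OF B]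
  have c: "\<phi> x \<in> carr B" if "x \<in> carr A" for x using s that by blast
  have "alg_hom B (mult_alg B) (emb B)" using E by (simp add: nondeg_hom_def)
  then have hom: "alg_hom A (mult_alg B) (emb B \<circ> \<phi>)"
    using f unfolding alg_hom_def by simp
  have eq: "{s' ((emb B \<circ> \<phi>) a) b |a b. a \<in> carr A \<and> b \<in> carr B} = {s' (emb B a) b |a b. a \<in> carr B \<and> b \<in> carr B}" for s'
    using s by (auto simp: image_iff) (metis imageE)
  have n: "nondeg_hom A B (emb B \<circ> \<phi>)"
    using hom E unfolding nondeg_hom_def eq by blast
  show M: "ext_alg A B \<phi> m \<in> carr (mult_alg B)"
    unfolding ext_alg_def by (rule ext_mult[OF al(1) B n m])
  show "fst (ext_alg A B \<phi> m) (\<phi> a) = \<phi> (fst m a)" if a: "a \<in> carr A"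
  proof (rule nd_eq_left[OF B])
    fix b assume b: "b \<in> carr B"
    show "mul B (fst (ext_alg A B \<phi> m) (\<phi> a)) b = mul B (\<phi> (fst m a)) b"
      using ext_fst[OF al(1) B n m a b] b mult_mul1[OF M c[OF a] b] by (simp add: ext_alg_def)
  qed (use a M m c in \<open>auto simp: mult_carr1\<close>)
qed

text \<open>\<open>ext\<close> is specified only on vectors h(s) u, and c \<otimes> w need not be
  visibly of this form. The formula is first proved with c e' in place of c, and the test by e'
  \<otimes> u then removes e'.\<close>

lemma ext_hten_leg1:
  fixes C :: "('k::field, 'c::ab_group_add) alg" and X :: "('k, 'x::ab_group_add) alg" and D :: "('k, 'd::ab_group_add) alg"
  assumes C: "nd_algebra C" and X: "nd_algebra X" and D: "nd_algebra D" and g: "nondeg_hom X D \<Gamma>"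
    and m: "m \<in> carr (mult_alg (C \<otimes> X))" and c: "c \<in> carr C" and t: "t \<in> tcarr C X" and e: "m \<cdot> leg1 C X c = emb (C \<otimes> X) t"
    and w: "w \<in> carr D"
  shows "fst (ext (C \<otimes> X) (C \<otimes> D) (hten C C X D (emb C) \<Gamma>) m) (ten C D c w) = tlift C X (\<lambda>c' x. ten C D c' (fst (\<Gamma> x) w)) t"
proof -
  note a = nd_algebra_alg[OF C] nd_algebra_alg[OF X] nd_algebra_alg[OF D]
  note v = vsp_algebra[OF a(1)] vsp_algebra[OF a(2)] vsp_algebra[OF a(3)]
  note em = nondeg_emb[OF C]
  note ht = hten_ten[OF a(1) C em a(2) D g] and hn = hten_nondeg[OF a(1) C em a(2) D g]
  note CX = is_algebra_tensor[OF a(1,2)] and CD = nd_algebra_tensor[OF C D]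
  define h where "h = hten C C X D (emb C) \<Gamma>"
  define n where "n = ext (C \<otimes> X) (C \<otimes> D) h m"
  define K where "K w = tlift C X (\<lambda>c' x. ten C D c' (fst (\<Gamma> x) w)) t" for w
  have nM: "n \<in> carr (mult_alg (C \<otimes> D))" unfolding n_def h_def by (rule ext_mult[OF CX CD hn m])
  note gm = hom_mult[OF a(2) D g]
  have bK: "bil C X (C \<otimes> D) (\<lambda>c' x. ten C D c' (fst (\<Gamma> x) w))" if "w \<in> carr D" for w
    using that by (intro bil_tmap lin_id bil_lin1[OF hom_bil1[OF a(2) D g]])
  have linK: "lin D (C \<otimes> D) K"
    unfolding K_def by (rule lin_tlift_param[OF v(1,2) vsp_tensor v(3) bK _ t]) 
      (auto intro!: lin_ten2 mult_lin1 gm)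
  have Kc: "K w \<in> tcarr C D" if "w \<in> carr D" for w using lin_carr[OF linK that] by simp
  have key: "fst n (ten C D (mul C c e') w) = tmap C D C D (\<lambda>x. mul C x e') (\<lambda>x. x) (K w)" if e': "e' \<in> carr C" and w: "w \<in> carr D" for e' w
  proof (rule lin_idempotent_eqI[OF C _ _ e'])
    note l1 = lin_comp[OF lin_ten1[OF bil_lin2[OF bil_mul[OF a(1)] c] w] mult_lin1[OF nM]]
    show "lin C (C \<otimes> D) (\<lambda>e'. fst n (ten C D (mul C c e') w))" by (rule l1)
    show "lin C (C \<otimes> D) (\<lambda>e'. tmap C D C D (\<lambda>x. mul C x e') (\<lambda>x. x) (K w))"
      unfolding tmap_def
      by (rule lin_tlift_param[OF v(1,3) vsp_tensor v(1) _ _ Kc[OF w]])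
        (auto intro!: bil_tmap lin_id lin_ten1 lin_mul1 lin_mul2 simp: a)
    fix c2 d assume cd: "c2 \<in> carr C" "d \<in> carr C"
    then have cc: "mul C c2 d \<in> carr C" using a by simp
    note lm = lin_mul1[OF a(1) lin_id cc]
    show "fst n (ten C D (mul C c (mul C c2 d)) w) = tmap C D C D (\<lambda>x. mul C x (mul C c2 d)) (\<lambda>x. x) (K w)"
    proof (rule nondeg_induct1[OF a(2) D g w])
      fix x' w' assume x': "x' \<in> carr X" "w' \<in> carr D"
      \<comment> \<open>With e' = c2 d and w = \<Gamma>(x') w' the vector is h(c c2 \<otimes> x')
        applied to d \<otimes> w', which is the form that \<open>ext_fst\<close> can
        evaluate.\<close>
      have "ten C D (mul C c (mul C c2 d)) (fst (\<Gamma> x') w') = fst (h (ten C X (mul C c c2) x')) (ten C D d w')"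
        using x' cd c a by (simp add: h_def ht mten_ten emb_mult gm mul_assoc)
      then have "fst n (ten C D (mul C c (mul C c2 d)) (fst (\<Gamma> x') w')) = fst (h (fst m (ten C X (mul C c c2) x'))) (ten C D d w')"
        using ext_fst[OF CX CD hn m, of "ten C X (mul C c c2) x'" "ten C D d w'"] x' cd c a
        by (simp add: n_def h_def)
      also have "fst m (ten C X (mul C c c2) x') = fst (emb (C \<otimes> X) t) (ten C X c2 x')"
        unfolding e[symmetric] using cd c x' by (simp add: leg1_ten[OF a(1,2)])
      also have "\<dots> = tmap C X C X (\<lambda>x. mul C x c2) (\<lambda>x. mul X x x') t"
        using cd c x' t by (simp add: mul_ten_right[OF a(1,2)])
      also have "fst (h (tmap C X C X (\<lambda>x. mul C x c2) (\<lambda>x. mul X x x') t)) (ten C D d w') 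
          = tmap C D C D (\<lambda>x. mul C x (mul C c2 d)) (\<lambda>x. x) (K (fst (\<Gamma> x') w'))"
      proof -
        have w2: "fst (\<Gamma> x') w' \<in> carr D" using x' gm mult_carr1 by blast
        note l = lin_tmap[OF v(1,2) lin_mul1[OF a(1) lin_id cd(1)] lin_mul1[OF a(2) lin_id x'(1)]]
        have t1: "ten C D d w' \<in> carr (C \<otimes> D)" using cd x' by simp
        note l2 = lin_comp[OF l lin_comp[OF hten_lin[OF a(1) C em a(2) D g, folded h_def] lin_eval1[OF t1]]]
        note l3 = lin_comp[OF lin_tlift[OF v(1,2) vsp_tensor bK[OF w2]] lin_tmap[OF v(1,3) lm lin_id]]
        show ?thesis unfolding K_def
          by (rule tensor_eqI[OF v(1,2) l2 l3 t])
            (use x' cd cc w2 a lm in \<open>simp add: tmap_ten[OF v(1,2)] tmap_ten[OF v(1,3)] lin_mul1 lin_id tlift_ten[OF v(1,2) vsp_tensor bK[OF w2]]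
              h_def ht mten_ten emb_mult gm mult_carr1 hom_mul[OF a(2) D g] mmul_mult[OF v(3)] mul_assoc\<close>)
      qed
      finally show "fst n (ten C D (mul C c (mul C c2 d)) (fst (\<Gamma> x') w')) =
         tmap C D C D (\<lambda>x. mul C x (mul C c2 d)) (\<lambda>x. x) (K (fst (\<Gamma> x') w'))" .
    next
      have "mul C c (mul C c2 d) \<in> carr C" using c cc a by simp
      then have l4: "lin D (C \<otimes> D) (\<lambda>w. fst n (ten C D (mul C c (mul C c2 d)) w))"
        by (intro lin_comp[OF bil_lin2[OF bil_ten] mult_lin1[OF nM]])
      note l5 = lin_comp[OF linK lin_tmap[OF v(1,3) lm lin_id]]
      fix w w' assume "w \<in> carr D" "w' \<in> carr D"
        "fst n (ten C D (mul C c (mul C c2 d)) w) = tmap C D C D (\<lambda>x. mul C x (mul C c2 d)) (\<lambda>x. x) (K w)"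
        "fst n (ten C D (mul C c (mul C c2 d)) w') = tmap C D C D (\<lambda>x. mul C x (mul C c2 d)) (\<lambda>x. x) (K w')"
      then show "fst n (ten C D (mul C c (mul C c2 d)) (w + w')) = tmap C D C D (\<lambda>x. mul C x (mul C c2 d)) (\<lambda>x. x) (K (w + w'))"
        by (simp add: lin_add[OF l4] lin_add[OF l5])
    qed
  qed
  have "fst n (ten C D c w) = K w"
  proof (rule tensor_nd_eqI[OF C D])
    show "fst n (ten C D c w) \<in> tcarr C D" using mult_carr1[OF nM] c w by simp
    show "K w \<in> tcarr C D" by (rule Kc[OF w])
    fix e' u assume eu: "e' \<in> carr C" "u \<in> carr D"
    have "mul (C \<otimes> D) (fst n (ten C D c w)) (ten C D e' u) = fst n (ten C D (mul C c e') (mul D w u))"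
      using mult_mul1[OF nM, of "ten C D c w" "ten C D e' u"] c w eu by (simp add: mul_ten a)
    also have "\<dots> = tmap C D C D (\<lambda>x. mul C x e') (\<lambda>x. x) (K (mul D w u))"
      by (rule key) (use eu w a in auto)
    also have "K (mul D w u) = tmap C D C D (\<lambda>x. x) (\<lambda>x. mul D x u) (K w)"
    proof -
      have wu: "mul D w u \<in> carr D" using w eu a by simp
      note lu = lin_mul1[OF a(3) lin_id eu(2)]
      show ?thesis unfolding K_def
        by (rule tensor_eqI[OF v(1,2) lin_tlift[OF v(1,2) vsp_tensor bK[OF wu]] 
            lin_comp[OF lin_tlift[OF v(1,2) vsp_tensor bK[OF w]] lin_tmap[OF v(1,3) lin_id lu]] t])
          (use w wu lu eu in \<open>simp add: tlift_ten[OF v(1,2) vsp_tensor bK] tmap_ten[OF v(1,3)] lin_id gm mult_carr1 mult_mul1\<close>)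
    qed
    also have "tmap C D C D (\<lambda>x. mul C x e') (\<lambda>x. x) (tmap C D C D (\<lambda>x. x) (\<lambda>x. mul D x u) (K w)) = mul (C \<otimes> D) (K w) (ten C D e' u)"
      using eu a Kc[OF w] by (simp add: mul_ten_right tmap_tmap[OF v(1,3,1,3)] lin_id lin_mul1)
    finally show "mul (C \<otimes> D) (fst n (ten C D c w)) (ten C D e' u) = mul (C \<otimes> D) (K w) (ten C D e' u)" .
  qed
  then show ?thesis by (simp add: n_def h_def K_def)
qed

section \<open>Local units\<close>

lemma functional_exists:
  fixes A :: "('k::field, 'a::ab_group_add) alg"
  assumes A: "vsp A" and x: "x \<noteq> 0"
  obtains \<omega> where "lin A field_alg \<omega>" "\<omega> x \<noteq> 0"
proof -
  interpret VA: vector_space "smul A" using A by (simp add: vsp_def)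
  interpret P: vector_space_pair "smul A" "(*) :: 'k \<Rightarrow> 'k \<Rightarrow> 'k"
    by unfold_locales (auto simp: algebra_simps)
  have i: "VA.independent {x}" using x by simp
  from P.linear_independent_extend[OF i, of "\<lambda>_. 1"]
  obtain g where g: "Vector_Spaces.linear (smul A) (*) g" "g x = 1" by auto
  have "lin A field_alg g" by (rule linI) (simp_all add: P.linear_add[OF g(1)] P.linear_scale[OF g(1)])
  with g show ?thesis by (intro that[of g]) auto
qed

lemma ten_eq_0:
  assumes A: "vsp A" and B: "vsp B" and x: "x \<in> carr A" "x \<noteq> 0" and y: "y \<in> carr B" and 0: "ten A B x y = 0"
  shows "y = 0"
proof -
  obtain \<omega> where \<omega>: "lin A field_alg \<omega>" "\<omega> x \<noteq> 0" by (rule functional_exists[OF A x(2)])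
  have "smul B (\<omega> x) y = 0"
    using slice1_ten[OF A B \<omega>(1) x(1) y] lin_zero[OF vsp_tensor lin_slice1[OF A B \<omega>(1)]] 0 by simp
  then show ?thesis using \<omega>(2) smul_eq_0[OF B] by blast
qed

lemma projection_exists:
  fixes A :: "('k::field, 'a::ab_group_add) alg"
  assumes A: "vsp A" and W: "module.subspace (smul A) W" "W \<subseteq> carr A"
  obtains g where "lin A A g" "\<And>x. g x \<in> W" "\<And>w. w \<in> W \<Longrightarrow> g w = w"
proof -
  interpret VA: vector_space "smul A" using A by (simp add: vsp_def)
  interpret P: vector_space_pair "smul A" "smul A" by unfold_locales
  have "Vector_Spaces.linear (smul A) (smul A) (\<lambda>x. x)" using VA.linear_ident by simp
  from P.linear_exists_left_inverse_on[OF this W(1)]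
  obtain g where g: "g ` UNIV \<subseteq> W" "Vector_Spaces.linear (smul A) (smul A) g" "\<forall>v\<in>W. g v = v"
    by (auto simp: inj_on_def)
  have "lin A A g" by (rule linI) (use g W in \<open>auto simp: P.linear_add[OF g(2)] P.linear_scale[OF g(2)]\<close>)
  with g show ?thesis by (intro that[of g]) auto
qed

lemma lin_inv_into:
  assumes A: "vsp A" and f: "lin A B f" and b: "bij_betw f (carr A) (carr B)"
  shows "lin B A (inv_into (carr A) f)"
    and "\<And>y. y \<in> carr B \<Longrightarrow> inv_into (carr A) f y \<in> carr A"
    and "\<And>y. y \<in> carr B \<Longrightarrow> f (inv_into (carr A) f y) = y"
    and "\<And>x. x \<in> carr A \<Longrightarrow> inv_into (carr A) f (f x) = x"
proof -
  let ?g = "inv_into (carr A) f"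
  show 1: "?g y \<in> carr A" "f (?g y) = y" if "y \<in> carr B" for y
    using that b bij_betw_inv_into_right[OF b] by (auto simp: bij_betw_def inv_into_into)
  show 2: "?g (f x) = x" if "x \<in> carr A" for x using bij_betw_inv_into_left[OF b that] .
  show "lin B A ?g"
  proof (rule linI)
    show "?g (x + y) = ?g x + ?g y" if "x \<in> carr B" "y \<in> carr B" for x y
      using 2[of "?g x + ?g y"] 1 that A by (simp add: lin_add[OF f] vsp_add)
    show "?g (smul B c x) = smul A c (?g x)" if "x \<in> carr B" for x c
      using 2[of "smul A c (?g x)"] 1 that A by (simp add: lin_smul[OF f] vsp_smul)
  qed (rule 1)
qed

lemma tmap_zero2:
  assumes "vsp A" "vsp B" "vsp D" "lin A C f" "t \<in> tcarr A B" shows "tmap A B C D f (\<lambda>x. 0) t = 0"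
  by (rule tensor_eqI[OF assms(1,2) lin_tmap[OF assms(1,2,4) lin_const_zero[OF assms(3)]] lin_const_zero[of "C \<otimes> D" "A \<otimes> B", OF vsp_tensor] assms(5)])
    (use assms lin_zero[OF assms(3) bil_lin2[OF bil_ten[of C D]]] in \<open>simp add: tmap_ten lin_const_zero lin_carr\<close>)

text \<open>Surjectivity of a canonical map says that the elements T a b generate the target, which
  makes it an induction rule.\<close>

lemma tlift_surj_induct:
  assumes A: "vsp A" and B: "vsp B" and T: "bil A B (A' \<otimes> B') T" and s: "tcarr A' B' \<subseteq> tlift A B T ` tcarr A B"
    and t: "t \<in> tcarr A' B'" and 1: "\<And>a b. a \<in> carr A \<Longrightarrow> b \<in> carr B \<Longrightarrow> P (T a b)"
    and 2: "\<And>s t. s \<in> tcarr A' B' \<Longrightarrow> t \<in> tcarr A' B' \<Longrightarrow> P s \<Longrightarrow> P t \<Longrightarrow> P (s + t)"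
  shows "P t"
proof -
  note lt = lin_tlift[OF A B vsp_tensor T]
  have "P (tlift A B T u)" if "u \<in> tcarr A B" for u
    using A B that
  proof (induction rule: tcarr_induct)
    case (add s t)
    then show ?case using 2[of "tlift A B T s" "tlift A B T t"] lin_carr[OF lt] by (simp add: lin_add[OF lt])
  qed (simp add: tlift_ten[OF A B vsp_tensor T] 1)
  then show ?thesis using s t by blast
qed

text \<open>
  For \<open>T\<^sub>1(c \<otimes> a) = \<Delta>(c)(1 \<otimes> a)\<close> the subspace \<open>A \<otimes> A a\<close> is mapped onto itself, because \<open>T\<^sub>1\<close> is
  right linear in the second leg, and it contains \<open>T\<^sub>1(c \<otimes> a)\<close>, because it does so after
  multiplication by \<open>b \<otimes> 1\<close>. Hence \<open>c \<otimes> a \<in> A \<otimes> A a\<close>. A projection with image \<open>A a\<close> tests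
  membership.
\<close>

lemma left_local_unit:
  assumes A: "nd_algebra A" and T: "bil A A (A \<otimes> A) T"
    and b: "bij_betw (tlift A A T) (tcarr A A) (tcarr A A)"
    and Tr: "\<And>c d e. c \<in> carr A \<Longrightarrow> d \<in> carr A \<Longrightarrow> e \<in> carr A \<Longrightarrow>
      T c (mul A d e) = tmap A A A A (\<lambda>x. x) (\<lambda>x. mul A x e) (T c d)"
    and Tl: "\<And>b c d. b \<in> carr A \<Longrightarrow> c \<in> carr A \<Longrightarrow> d \<in> carr A \<Longrightarrow>
      \<exists>s\<in>tcarr A A. tmap A A A A (mul A b) (\<lambda>x. x) (T c d) = tmap A A A A (\<lambda>x. x) (\<lambda>x. mul A x d) s"
    and a: "a \<in> carr A"
  shows "\<exists>e\<in>carr A. mul A e a = a"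
proof -
  note al = nd_algebra_alg[OF A] and v = vsp_algebra[OF nd_algebra_alg[OF A]]
  define W where "W = (\<lambda>e. mul A e a) ` carr A"
  note ra = lin_mul1[OF al lin_id a]
  have sub: "W \<subseteq> carr A" using al a by (auto simp: W_def)
  interpret VA: vector_space "smul A" using v by (simp add: vsp_def)
  have W: "VA.subspace W"
  proof (rule VA.subspaceI)
    show "0 \<in> W" unfolding W_def by (rule image_eqI[of _ _ 0]) (use al a in \<open>auto simp: mul_zero\<close>)
    show "x + y \<in> W" if xy: "x \<in> W" "y \<in> W" for x y
    proof -
      from xy obtain e f where "x = mul A e a" "y = mul A f a" "e \<in> carr A" "f \<in> carr A" by (auto simp: W_def)
      then show ?thesis unfolding W_def using v by (intro image_eqI[of _ _ "e + f"]) (auto simp: lin_add[OF ra] vsp_add)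
    qed
    show "smul A c x \<in> W" if x: "x \<in> W" for x c
    proof -
      from x obtain e where "x = mul A e a" "e \<in> carr A" by (auto simp: W_def)
      then show ?thesis unfolding W_def using v by (intro image_eqI[of _ _ "smul A c e"]) (auto simp: lin_smul[OF ra] vsp_smul)
    qed
  qed
  obtain g where g: "lin A A g" "\<And>x. g x \<in> W" "\<And>w. w \<in> W \<Longrightarrow> g w = w"
    using projection_exists[OF v W sub] by metis
  define \<pi> where "\<pi> x = x - g x" for x
  have \<pi>: "lin A A \<pi>" unfolding \<pi>_def by (rule lin_minus[OF v lin_id g(1)])
  have \<pi>W: "\<pi> (mul A x a) = 0" if "x \<in> carr A" for x using g(3) that by (simp add: \<pi>_def W_def)
  note lT = lin_tlift[OF v v vsp_tensor T] and Tt = tlift_ten[OF v v vsp_tensor T]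
  define Q where "Q = inv_into (tcarr A A) (tlift A A T)"
  note Q = lin_inv_into[OF vsp_tensor lT, unfolded tensor_alg_simps, OF b, folded Q_def]
  note I = lin_tmap[OF v v lin_id ra] lin_tmap[OF v v lin_id \<pi>] lin_tmap[OF v v lin_id g(1)]
  have c: "T x y \<in> tcarr A A" if "x \<in> carr A" "y \<in> carr A" for x y using bil_carr[OF T that] by simp
  have kill: "tmap A A A A (\<lambda>x. x) \<pi> (tmap A A A A (\<lambda>x. x) (\<lambda>x. mul A x a) s) = 0" if s: "s \<in> tcarr A A" for s
  proof -
    have "tmap A A A A (\<lambda>x. x) (\<lambda>x. \<pi> (mul A x a)) s = tmap A A A A (\<lambda>x. x) (\<lambda>x. 0) s"
      unfolding tmap_def by (rule arg_cong[where f = "\<lambda>h. h s"], rule tlift_cong) (simp add: \<pi>W)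
    then show ?thesis using s by (simp add: tmap_tmap[OF v v v v lin_id ra lin_id \<pi>] tmap_zero2[OF v v v lin_id])
  qed
  have Ta: "tmap A A A A (\<lambda>x. x) \<pi> (T c a) = 0" if c': "c \<in> carr A" for c
  proof (rule tmap_separates1[OF v v v, where I = "carr A" and \<phi> = "mul A"])
    show "tmap A A A A (\<lambda>x. x) \<pi> (T c a) \<in> tcarr A A" using lin_carr[OF I(2)] c c' a by simp
    fix b assume b: "b \<in> carr A"
    note lb = lin_mul2[OF al lin_id b]
    obtain s where s: "s \<in> tcarr A A" "tmap A A A A (mul A b) (\<lambda>x. x) (T c a) = tmap A A A A (\<lambda>x. x) (\<lambda>x. mul A x a) s"
      using Tl[OF b c' a] by blast
    have "tmap A A A A (mul A b) (\<lambda>x. x) (tmap A A A A (\<lambda>x. x) \<pi> (T c a)) = tmap A A A A (\<lambda>x. x) \<pi> (tmap A A A A (mul A b) (\<lambda>x. x) (T c a))"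
      using c[OF c' a] by (simp add: tmap_tmap[OF v v v v lin_id \<pi> lb lin_id] tmap_tmap[OF v v v v lb lin_id lin_id \<pi>])
    then show "tmap A A A A (mul A b) (\<lambda>x. x) (tmap A A A A (\<lambda>x. x) \<pi> (T c a)) = 0"
      unfolding s(2) kill[OF s(1)] .
  qed (use nd_right[OF A] lin_mul2[OF al lin_id] in auto)
  have Qa: "Q (tmap A A A A (\<lambda>x. x) (\<lambda>x. mul A x a) t) = tmap A A A A (\<lambda>x. x) (\<lambda>x. mul A x a) (Q t)" if t: "t \<in> tcarr A A" for t
  proof -
    have "tlift A A T (tmap A A A A (\<lambda>x. x) (\<lambda>x. mul A x a) s) = tmap A A A A (\<lambda>x. x) (\<lambda>x. mul A x a) (tlift A A T s)" if s: "s \<in> tcarr A A" for s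
      by (rule tensor_eqI[OF v v lin_comp[OF I(1) lT] lin_comp[OF lT I(1)] s])
        (use a al in \<open>simp add: tmap_ten[OF v v] lin_id ra Tt Tr\<close>)
    from this[of "Q t"] have "tmap A A A A (\<lambda>x. x) (\<lambda>x. mul A x a) t = tlift A A T (tmap A A A A (\<lambda>x. x) (\<lambda>x. mul A x a) (Q t))"
      using Q t by simp
    then show ?thesis using Q(4) lin_carr[OF I(1)] Q(2)[OF t] by simp
  qed
  define G where "G t = tmap A A A A (\<lambda>x. x) \<pi> (Q t)" for t
  have G: "lin (A \<otimes> A) (A \<otimes> A) G" unfolding G_def using Q(1) by (intro lin_comp[OF _ I(2)]) (simp add: lin_def)
  have "ten A A c (\<pi> a) = 0" if c': "c \<in> carr A" for c
  proof -
    have Gg: "G (tmap A A A A (\<lambda>x. x) g u) = 0" if "u \<in> tcarr A A" for u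
    proof (rule tensor_eqI[OF v v lin_comp[OF I(3) G] lin_const_zero[of "A \<otimes> A" "A \<otimes> A", OF vsp_tensor] that])
      fix x y assume xy: "x \<in> carr A" "y \<in> carr A"
      obtain e where e: "g y = mul A e a" "e \<in> carr A" using g(2)[of y] by (auto simp: W_def)
      have "ten A A x (g y) = tmap A A A A (\<lambda>x. x) (\<lambda>x. mul A x a) (ten A A x e)"
        using xy e by (simp add: tmap_ten[OF v v] lin_id ra)
      then show "G (tmap A A A A (\<lambda>x. x) g (ten A A x y)) = 0"
        using xy e Q(2) by (simp add: tmap_ten[OF v v] lin_id g(1) G_def Qa kill)
    qed
    have split: "u = tmap A A A A (\<lambda>x. x) \<pi> u + tmap A A A A (\<lambda>x. x) g u" if "u \<in> tcarr A A" for u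
      by (rule tensor_eqI[OF v v lin_id lin_plus[OF vsp_tensor I(2,3)] that])
       (use lin_diff[OF v bil_lin2[OF bil_ten[of A A]]] g lin_carr[OF g(1)] in \<open>simp add: tmap_ten[OF v v] lin_id \<pi>, simp add: \<pi>_def\<close>)
    have "T c a = tmap A A A A (\<lambda>x. x) g (T c a)"
      using split[OF c[OF c' a]] Ta[OF c'] by simp
    then have "G (T c a) = 0" using Gg[OF c[OF c' a]] by simp
    moreover have "Q (T c a) = ten A A c a" using Q(4)[OF ten_carr[OF c' a]] Tt[OF c' a] by simp
    ultimately show ?thesis using c' a by (simp add: G_def tmap_ten[OF v v] lin_id \<pi>)
  qed
  from ten_eq_0[OF v v a _ _ this[OF a]] have "\<pi> a = 0" if "a \<noteq> 0" using that lin_carr[OF \<pi> a] by blast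
  then have "a \<in> W" using g(2)[of a] VA.subspace_0[OF W] by (cases "a = 0") (auto simp: \<pi>_def)
  then obtain e where e: "a = mul A e a" "e \<in> carr A" unfolding W_def by blast
  show ?thesis by (rule bexI[OF _ e(2)]) (rule e(1)[symmetric])
qed

text \<open>The recursion is 1 - e = (1 - e2)(1 - e1), where e1 serves \<open>F\<close> and e2 is a
  left unit for b - e1 b.\<close>

lemma left_local_units:
  assumes A: "is_algebra A" and u: "\<And>a. a \<in> carr A \<Longrightarrow> \<exists>e\<in>carr A. mul A e a = a"
    and F: "finite F" "F \<subseteq> carr A"
  shows "\<exists>e\<in>carr A. \<forall>a\<in>F. mul A e a = a"
  using F
proof (induction F rule: finite_induct)
  case empty
  then show ?case using vsp_zero[OF vsp_algebra[OF A]] by blast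
next
  case (insert b F)
  then obtain e1 where e1: "e1 \<in> carr A" "\<forall>a\<in>F. mul A e1 a = a" by auto
  have v: "vsp A" using A by simp
  have b: "b \<in> carr A" "b - mul A e1 b \<in> carr A" using insert A e1 v by (auto intro!: vsp_diff)
  obtain e2 where e2: "e2 \<in> carr A" "mul A e2 (b - mul A e1 b) = b - mul A e1 b" using u[OF b(2)] by blast
  let ?e = "e1 + e2 - mul A e2 e1"
  note c = mul_carr[OF A e2(1) e1(1)] vsp_add[OF v e1(1) e2(1)]
  have dist: "mul A ?e a = mul A e1 a + mul A e2 a - mul A e2 (mul A e1 a)" if "a \<in> carr A" for a
    using that c e1 e2 A lin_diff[OF v bil_lin1[OF bil_mul[OF A] that]] lin_add[OF bil_lin1[OF bil_mul[OF A] that]]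
    by (simp add: mul_assoc)
  have "mul A ?e a = a" if "a \<in> F" for a using dist[of a] e1 that insert by auto
  moreover have "mul A ?e b = b"
    using dist[OF b(1)] e2 b A e1 lin_diff[OF v bil_lin2[OF bil_mul[OF A] e2(1)]] by (simp add: algebra_simps)
  moreover have "?e \<in> carr A" using c v by (intro vsp_diff)
  ultimately show ?case by blast
qed

text \<open>Again 1 - e = (1 - e2)(1 - e1), now with (1 - e1) a = 0 and a (1 - e2) = 0 for every a
  in F.\<close>

lemma two_sided_local_units:
  assumes A: "is_algebra A" and l: "\<And>a. a \<in> carr A \<Longrightarrow> \<exists>e\<in>carr A. mul A e a = a"
    and r: "\<And>a. a \<in> carr A \<Longrightarrow> \<exists>e\<in>carr A. mul A a e = a"
    and F: "finite F" "F \<subseteq> carr A" 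
  shows "\<exists>e\<in>carr A. \<forall>a\<in>F. mul A e a = a \<and> mul A a e = a"
proof -
  obtain e1 where e1: "e1 \<in> carr A" "\<forall>a\<in>F. mul A e1 a = a" using left_local_units[OF A l F] by blast
  obtain e2 where e2: "e2 \<in> carr A" "\<forall>a\<in>F. mul A a e2 = a"
    using left_local_units[OF is_algebra_op[OF A], of F] r F by auto
  have v: "vsp A" using A by simp
  let ?e = "e1 + e2 - mul A e2 e1"
  note c = mul_carr[OF A e2(1) e1(1)] vsp_add[OF v e1(1) e2(1)]
  have "mul A ?e a = a \<and> mul A a ?e = a" if a: "a \<in> F" for a
  proof
    have a': "a \<in> carr A" using a F by blast
    show "mul A ?e a = a"
      using a a' c e1 e2 A lin_diff[OF v bil_lin1[OF bil_mul[OF A] a']] lin_add[OF bil_lin1[OF bil_mul[OF A] a']]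
      by (simp add: mul_assoc)
    show "mul A a ?e = a"
      using a a' c e1 e2 A lin_diff[OF v bil_lin2[OF bil_mul[OF A] a']] lin_add[OF bil_lin2[OF bil_mul[OF A] a']]
      by (simp add: mul_assoc[symmetric])
  qed
  moreover have "?e \<in> carr A" using c v by (intro vsp_diff)
  ultimately show ?thesis by blast
qed

section \<open>The antipode of a paired multiplier Hopf algebra\<close>

text \<open>A tensor involves finitely many first legs. A functional may thus be replaced by one
  that agrees with it on a finite set only, as p(-, e) does with the counit.\<close>

lemma tensor_finite_legs:
  fixes A :: "('k::field, 'a::ab_group_add) alg" and X :: "('k, 'x::ab_group_add) alg"
  assumes A: "vsp A" and X: "vsp X" and t: "t \<in> tcarr A X"
  shows "\<exists>F. finite F \<and> F \<subseteq> carr A \<and> (\<forall>\<phi> \<psi>. lin A field_alg \<phi> \<longrightarrow> lin A field_alg \<psi> \<longrightarrow> (\<forall>a\<in>F. \<phi> a = \<psi> a) \<longrightarrow>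
    slice1 A X \<phi> t = slice1 A X \<psi> t)"
  using A X t
proof (induction rule: tcarr_induct)
  case (ten a b)
  then show ?case by (intro exI[of _ "{a}"]) (auto simp: slice1_ten[OF A X])
next
  case (add s t)
  then obtain F G where F: "finite F" "F \<subseteq> carr A" "\<forall>\<phi> \<psi>. lin A field_alg \<phi> \<longrightarrow> lin A field_alg \<psi> \<longrightarrow> (\<forall>a\<in>F. \<phi> a = \<psi> a) \<longrightarrow>
      slice1 A X \<phi> s = slice1 A X \<psi> s"
    and G: "finite G" "G \<subseteq> carr A" "\<forall>\<phi> \<psi>. lin A field_alg \<phi> \<longrightarrow> lin A field_alg \<psi> \<longrightarrow> (\<forall>a\<in>G. \<phi> a = \<psi> a) \<longrightarrow>
      slice1 A X \<phi> t = slice1 A X \<psi> t" by blast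
  show ?case
  proof (intro exI[of _ "F \<union> G"] conjI allI impI)
    fix \<phi> \<psi> assume *: "lin A field_alg \<phi>" "lin A field_alg \<psi>" "\<forall>a\<in>F \<union> G. \<phi> a = \<psi> a"
    then have "slice1 A X \<phi> s = slice1 A X \<psi> s" "slice1 A X \<phi> t = slice1 A X \<psi> t" using F G by blast+
    then show "slice1 A X \<phi> (s + t) = slice1 A X \<psi> (s + t)"
      using add * by (simp add: lin_add[OF lin_slice1[OF A X]])
  qed (use F G in auto)
qed

text \<open>A pairing seen through the dual actions alone: \<open>l b a\<close> is the left and
  \<open>r b a\<close> the right action of b on a, both characterised by duality in
  \<open>p_l\<close> and \<open>p_r\<close>. No comultiplication appears, so the setting can be
  instantiated with the two algebras exchanged and with opposite algebras.\<close>

locale algebra_pairing =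
  fixes A :: "('k::field, 'a::ab_group_add) alg" and B :: "('k, 'b::ab_group_add) alg"
    and p :: "'a \<Rightarrow> 'b \<Rightarrow> 'k" and l r :: "'b \<Rightarrow> 'a \<Rightarrow> 'a"
  assumes ndA: "nd_algebra A" and algB: "is_algebra B" and bil_p: "bil A B field_alg p"
    and sepA: "\<And>a. a \<in> carr A \<Longrightarrow> (\<And>b. b \<in> carr B \<Longrightarrow> p a b = 0) \<Longrightarrow> a = 0"
    and sepB: "\<And>b. b \<in> carr B \<Longrightarrow> (\<And>a. a \<in> carr A \<Longrightarrow> p a b = 0) \<Longrightarrow> b = 0"
    and l_carr: "\<And>a b. a \<in> carr A \<Longrightarrow> b \<in> carr B \<Longrightarrow> l b a \<in> carr A"
    and r_carr: "\<And>a b. a \<in> carr A \<Longrightarrow> b \<in> carr B \<Longrightarrow> r b a \<in> carr A"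
    and p_l: "\<And>a b c. a \<in> carr A \<Longrightarrow> b \<in> carr B \<Longrightarrow> c \<in> carr B \<Longrightarrow> p (l b a) c = p a (mul B c b)"
    and p_r: "\<And>a b c. a \<in> carr A \<Longrightarrow> b \<in> carr B \<Longrightarrow> c \<in> carr B \<Longrightarrow> p (r b a) c = p a (mul B b c)"
begin

lemma algA: "is_algebra A" and vA: "vsp A" and vB: "vsp B"
  using ndA algB by simp_all

lemma p1: "b \<in> carr B \<Longrightarrow> lin A field_alg (\<lambda>a. p a b)" and p2: "a \<in> carr A \<Longrightarrow> lin B field_alg (p a)"
  using bil_lin1[OF bil_p] bil_lin2[OF bil_p] by blast+

lemma p_add1: "a \<in> carr A \<Longrightarrow> a' \<in> carr A \<Longrightarrow> b \<in> carr B \<Longrightarrow> p (a + a') b = p a b + p a' b"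
  and p_smul1: "a \<in> carr A \<Longrightarrow> b \<in> carr B \<Longrightarrow> p (smul A c a) b = c * p a b"
  and p_add2: "a \<in> carr A \<Longrightarrow> b \<in> carr B \<Longrightarrow> b' \<in> carr B \<Longrightarrow> p a (b + b') = p a b + p a b'"
  and p_smul2: "a \<in> carr A \<Longrightarrow> b \<in> carr B \<Longrightarrow> p a (smul B c b) = c * p a b"
  using lin_add[OF p1] lin_add[OF p2] lin_smul[OF p1] lin_smul[OF p2] by simp_all

lemma eqA: "x \<in> carr A \<Longrightarrow> y \<in> carr A \<Longrightarrow> (\<And>b. b \<in> carr B \<Longrightarrow> p x b = p y b) \<Longrightarrow> x = y"
  using sepA[of "x - y"] vA by (simp add: vsp_diff lin_diff[OF vA p1])

text \<open>The pairing separates the points of A, and p a (c b) is linear in a and in b.\<close>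

lemma bil_l: "bil B A A l"
proof (intro bilI linI)
  note v = vsp_add[OF vA] vsp_add[OF vB] vsp_smul[OF vA] vsp_smul[OF vB] l_carr
    lin_add[OF bil_lin2[OF bil_mul[OF algB]]] lin_smul[OF bil_lin2[OF bil_mul[OF algB]]]
  fix b c a a' assume b: "b \<in> carr B" and a: "a \<in> carr A"
  show c1: "l b a \<in> carr A" "l b a \<in> carr A" using l_carr a b by simp_all
  show "l b (smul A c a) = smul A c (l b a)"
    by (rule eqA) (use a b algB in \<open>simp_all add: v p_l p_smul1\<close>)
  show "l (smul B c b) a = smul A c (l b a)"
    by (rule eqA) (use a b algB in \<open>simp_all add: v p_l p_smul1 p_smul2\<close>)
  show "l b (a + a') = l b a + l b a'" if "a' \<in> carr A"
    by (rule eqA) (use a b algB that in \<open>simp_all add: v p_l p_add1\<close>)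
  show "l (b + b') a = l b a + l b' a" if "b' \<in> carr B" for b'
    by (rule eqA) (use a b algB that in \<open>simp_all add: v p_l p_add1 p_add2\<close>)
qed

lemma lin_l: "b \<in> carr B \<Longrightarrow> lin A A (l b)" and lin_l': "a \<in> carr A \<Longrightarrow> lin B A (\<lambda>b. l b a)"
  using bil_lin1[OF bil_l] bil_lin2[OF bil_l] by blast+

lemma l_l: "a \<in> carr A \<Longrightarrow> b \<in> carr B \<Longrightarrow> c \<in> carr B \<Longrightarrow> l b (l c a) = l (mul B b c) a"
  by (rule eqA) (use algB in \<open>auto simp: p_l l_carr mul_assoc\<close>)

lemma l_r: "a \<in> carr A \<Longrightarrow> b \<in> carr B \<Longrightarrow> c \<in> carr B \<Longrightarrow> l b (r c a) = r c (l b a)"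
  by (rule eqA) (use algB in \<open>auto simp: p_l p_r l_carr r_carr mul_assoc\<close>)

lemma r_r: "a \<in> carr A \<Longrightarrow> b \<in> carr B \<Longrightarrow> c \<in> carr B \<Longrightarrow> r b (r c a) = r (mul B c b) a"
  by (rule eqA) (use algB in \<open>auto simp: p_r r_carr mul_assoc\<close>)

lemma slices_eqA:
  assumes X: "vsp X" and t: "s \<in> tcarr A X" "t \<in> tcarr A X"
    and e: "\<And>b. b \<in> carr B \<Longrightarrow> slice1 A X (\<lambda>a. p a b) s = slice1 A X (\<lambda>a. p a b) t"
  shows "s = t"
proof -
  have "s - t = 0"
    by (rule slice1_separates[OF vA X tcarr_diff[OF t], where I = "carr B" and \<phi> = "\<lambda>b a. p a b"])
      (use p1 sepA t e lin_diff[OF vsp_tensor lin_slice1[OF vA X p1]] in auto)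
  then show ?thesis by simp
qed

lemma slices_eqA2:
  assumes X: "vsp X" and t: "s \<in> tcarr X A" "t \<in> tcarr X A"
    and e: "\<And>b. b \<in> carr B \<Longrightarrow> slice2 X A (\<lambda>a. p a b) s = slice2 X A (\<lambda>a. p a b) t"
  shows "s = t"
proof -
  have "s - t = 0"
    by (rule slice2_separates[OF X vA tcarr_diff[OF t], where I = "carr B" and \<phi> = "\<lambda>b a. p a b"])
      (use p1 sepA t e lin_diff[OF vsp_tensor lin_slice2[OF X vA p1]] in auto)
  then show ?thesis by simp
qed

lemma slices_eqB:
  assumes X: "vsp X" and t: "s \<in> tcarr X B" "t \<in> tcarr X B"
    and e: "\<And>a. a \<in> carr A \<Longrightarrow> slice2 X B (p a) s = slice2 X B (p a) t"
  shows "s = t"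
proof -
  have "s - t = 0"
    by (rule slice2_separates[OF X vB tcarr_diff[OF t], where I = "carr A" and \<phi> = p])
      (use p2 sepB t e lin_diff[OF vsp_tensor lin_slice2[OF X vB p2]] in auto)
  then show ?thesis by simp
qed

lemma slices_eqB1:
  assumes X: "vsp X" and t: "s \<in> tcarr B X" "t \<in> tcarr B X"
    and e: "\<And>a. a \<in> carr A \<Longrightarrow> slice1 B X (p a) s = slice1 B X (p a) t"
  shows "s = t"
proof -
  have "s - t = 0"
    by (rule slice1_separates[OF vB X tcarr_diff[OF t], where I = "carr A" and \<phi> = p])
      (use p2 sepB t e lin_diff[OF vsp_tensor lin_slice1[OF vB X p2]] in auto)
  then show ?thesis by simp
qed

end

locale paired_algebras = algebra_pairing A B p l r
  for A :: "('k::field, 'a::ab_group_add) alg" and B :: "('k, 'b::ab_group_add) alg" and p l r +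
  assumes local_units: "\<And>F. finite F \<Longrightarrow> F \<subseteq> carr A \<Longrightarrow> \<exists>e\<in>carr B. \<forall>a\<in>F. l e a = a \<and> r e a = a"
begin

lemma swap_paired: "paired_algebras A (op_alg B) p r l"
  using ndA algB bil_p sepA sepB l_carr r_carr p_l p_r local_units
  by unfold_locales (auto simp: conj_commute)

text \<open>The counit as pairing with 1, where the missing unit of B is replaced by an element e
  that acts trivially on a.\<close>

definition \<epsilon> :: "'a \<Rightarrow> 'k" where
  "\<epsilon> a = p a (SOME e. e \<in> carr B \<and> l e a = a \<and> r e a = a)"

text \<open>Independence of the choice: p(a, f) = p(a, f e) = p(a, e), the first step by l e a = a
  and the second by r f a = a; the other case is symmetric.\<close>

lemma \<epsilon>_eq:
  assumes a: "a \<in> carr A" and e: "e \<in> carr B" "l e a = a \<or> r e a = a"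
  shows "\<epsilon> a = p a e"
proof -
  define f where "f = (SOME e. e \<in> carr B \<and> l e a = a \<and> r e a = a)"
  have "\<exists>e. e \<in> carr B \<and> l e a = a \<and> r e a = a" using local_units[of "{a}"] a by auto
  then have f: "f \<in> carr B" "l f a = a" "r f a = a" unfolding f_def by (metis (mono_tags, lifting) someI_ex)+
  have "p a f = p a e"
  proof (cases "l e a = a")
    case True
    then have "p a f = p a (mul B f e)" using p_l[OF a e(1) f(1)] by simp
    then show ?thesis using p_r[OF a f(1) e(1)] f by simp
  next
    case False
    then have "p a f = p a (mul B e f)" using p_r[OF a e(1) f(1)] e by simp
    then show ?thesis using p_l[OF a f(1) e(1)] f by simp
  qed
  then show ?thesis by (simp add: \<epsilon>_def f_def)
qed

lemma \<epsilon>_units: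
  assumes F: "finite F" "F \<subseteq> carr A"
  shows "\<exists>e\<in>carr B. \<forall>a\<in>F. l e a = a \<and> r e a = a \<and> \<epsilon> a = p a e"
proof -
  obtain e where "e \<in> carr B" "\<forall>a\<in>F. l e a = a \<and> r e a = a" using local_units[OF F] by blast
  then show ?thesis using \<epsilon>_eq F by (intro bexI[of _ e]) auto
qed

lemma lin_\<epsilon>: "lin A field_alg \<epsilon>"
proof (rule linI)
  fix x y c assume x: "x \<in> carr A"
  note v = vA
  obtain e where e: "e \<in> carr B" "\<forall>a\<in>{x, smul A c x}. \<epsilon> a = p a e"
    using \<epsilon>_units[of "{x, smul A c x}"] x vsp_smul[OF v] by auto
  then show "\<epsilon> (smul A c x) = smul field_alg c (\<epsilon> x)" using x by (simp add: p_smul1)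
  assume y: "y \<in> carr A"
  obtain e where e: "e \<in> carr B" "\<forall>a\<in>{x, y, x + y}. \<epsilon> a = p a e"
    using \<epsilon>_units[of "{x, y, x + y}"] x y vsp_add[OF v] by auto
  then show "\<epsilon> (x + y) = \<epsilon> x + \<epsilon> y" using x y by (simp add: p_add1)
qed simp

lemma \<epsilon>_l: "a \<in> carr A \<Longrightarrow> b \<in> carr B \<Longrightarrow> \<epsilon> (l b a) = p a b"
proof -
  assume a: "a \<in> carr A" and b: "b \<in> carr B"
  obtain e where e: "e \<in> carr B" "r e a = a" "\<epsilon> (l b a) = p (l b a) e"
    using \<epsilon>_units[of "{a, l b a}"] a b l_carr by auto
  then show ?thesis using a b p_l[OF a b e(1)] p_r[OF a e(1) b] by simp
qed

lemma \<epsilon>_r: "a \<in> carr A \<Longrightarrow> b \<in> carr B \<Longrightarrow> \<epsilon> (r b a) = p a b"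
proof -
  assume a: "a \<in> carr A" and b: "b \<in> carr B"
  obtain e where e: "e \<in> carr B" "l e a = a" "\<epsilon> (r b a) = p (r b a) e"
    using \<epsilon>_units[of "{a, r b a}"] a b r_carr by auto
  then show ?thesis using a b p_r[OF a b e(1)] p_l[OF a e(1) b] by simp
qed

text \<open>On a given tensor the counit acts as some p(-, e), and e can be chosen to fix finitely
  many further elements. Slice identities for p thereby pass to \<epsilon>.\<close>

lemma \<epsilon>_slice:
  assumes X: "vsp X" and t: "t \<in> tcarr A X" and F: "finite F" "F \<subseteq> carr A"
  obtains e where "e \<in> carr B" "slice1 A X \<epsilon> t = slice1 A X (\<lambda>a. p a e) t" "\<And>a. a \<in> F \<Longrightarrow> l e a = a" "\<And>a. a \<in> F \<Longrightarrow> r e a = a"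
proof -
  obtain G where G: "finite G" "G \<subseteq> carr A" "\<forall>\<phi> \<psi>. lin A field_alg \<phi> \<longrightarrow> lin A field_alg \<psi> \<longrightarrow> (\<forall>a\<in>G. \<phi> a = \<psi> a) \<longrightarrow>
    slice1 A X \<phi> t = slice1 A X \<psi> t" using tensor_finite_legs[OF vA X t] by blast
  obtain e where e: "e \<in> carr B" "\<forall>a\<in>F \<union> G. l e a = a \<and> r e a = a \<and> \<epsilon> a = p a e"
    using \<epsilon>_units[of "F \<union> G"] F G by auto
  then have "slice1 A X \<epsilon> t = slice1 A X (\<lambda>a. p a e) t" using G lin_\<epsilon> p1[OF e(1)] by blast
  then show ?thesis using e by (intro that[of e]) auto
qed

end

text \<open>
  \<open>T\<close> and \<open>T'\<close> stand for \<open>a \<otimes> c \<mapsto> \<Delta>(a)(1 \<otimes> c)\<close> and \<open>a \<otimes> c \<mapsto> \<Delta>\<^sup>c\<^sup>o(a)(1 \<otimes> c)\<close>. The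
  assumptions are invariant under passing to \<open>\<Delta>\<^sup>c\<^sup>o\<close> and \<open>B\<^sup>o\<^sup>p\<close>, which exchanges \<open>T\<close> with
  \<open>T'\<close> and \<open>l\<close> with \<open>r\<close>.
\<close>

locale paired_hopf = paired_algebras A B p l r
  for A :: "('k::field, 'a::ab_group_add) alg" and B :: "('k, 'b::ab_group_add) alg" and p l r +
  fixes T T' :: "'a \<Rightarrow> 'a \<Rightarrow> ('k, 'a, 'a) tensor"
  assumes bil_T: "bil A A (A \<otimes> A) T" and bil_T': "bil A A (A \<otimes> A) T'"
    and bij_T: "bij_betw (tlift A A T) (tcarr A A) (tcarr A A)"
    and bij_T': "bij_betw (tlift A A T') (tcarr A A) (tcarr A A)"
    and T_right: "\<And>a c d. a \<in> carr A \<Longrightarrow> c \<in> carr A \<Longrightarrow> d \<in> carr A \<Longrightarrow>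
      T a (mul A c d) = tmap A A A A (\<lambda>x. x) (\<lambda>x. mul A x d) (T a c)"
    and T'_right: "\<And>a c d. a \<in> carr A \<Longrightarrow> c \<in> carr A \<Longrightarrow> d \<in> carr A \<Longrightarrow>
      T' a (mul A c d) = tmap A A A A (\<lambda>x. x) (\<lambda>x. mul A x d) (T' a c)"
    and T_hom: "\<And>a b c. a \<in> carr A \<Longrightarrow> b \<in> carr A \<Longrightarrow> c \<in> carr A \<Longrightarrow>
      T (mul A a b) c = tlift A A (\<lambda>x y. tmap A A A A (\<lambda>z. mul A z x) (\<lambda>z. z) (T a y)) (T b c)"
    and T'_hom: "\<And>a b c. a \<in> carr A \<Longrightarrow> b \<in> carr A \<Longrightarrow> c \<in> carr A \<Longrightarrow>
      T' (mul A a b) c = tlift A A (\<lambda>x y. tmap A A A A (\<lambda>z. mul A z x) (\<lambda>z. z) (T' a y)) (T' b c)"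
    and T_flip: "\<And>a x y. a \<in> carr A \<Longrightarrow> x \<in> carr A \<Longrightarrow> y \<in> carr A \<Longrightarrow>
      flip A A (tmap A A A A (\<lambda>z. mul A z x) (\<lambda>z. z) (T a y)) = tmap A A A A (\<lambda>z. mul A z y) (\<lambda>z. z) (T' a x)"
    and T_slice: "\<And>a b c. a \<in> carr A \<Longrightarrow> b \<in> carr B \<Longrightarrow> c \<in> carr A \<Longrightarrow>
      slice1 A A (\<lambda>x. p x b) (T a c) = mul A (r b a) c"
    and T'_slice: "\<And>a b c. a \<in> carr A \<Longrightarrow> b \<in> carr B \<Longrightarrow> c \<in> carr A \<Longrightarrow>
      slice1 A A (\<lambda>x. p x b) (T' a c) = mul A (l b a) c"
begin

section \<open>Counit law, antipode and inverse antipode\<close>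

lemma T_carr: "a \<in> carr A \<Longrightarrow> c \<in> carr A \<Longrightarrow> T a c \<in> tcarr A A"
  and T'_carr: "a \<in> carr A \<Longrightarrow> c \<in> carr A \<Longrightarrow> T' a c \<in> tcarr A A"
  using bil_carr[OF bil_T] bil_carr[OF bil_T'] by simp_all

lemma lin_rmul: "b \<in> carr A \<Longrightarrow> lin A A (\<lambda>x. mul A x b)" and lin_lmul: "b \<in> carr A \<Longrightarrow> lin A A (mul A b)"
  using lin_mul1[OF algA lin_id] lin_mul2[OF algA lin_id] by blast+

lemma swap_hopf: "paired_hopf A (op_alg B) p r l T' T"
proof -
  interpret sw: paired_algebras A "op_alg B" p r l by (rule swap_paired)
  show ?thesis
  proof unfold_locales
    fix a x y assume *: "a \<in> carr A" "x \<in> carr A" "y \<in> carr A"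
    have "flip A A (tmap A A A A (\<lambda>z. mul A z x) (\<lambda>z. z) (T' a y))
      = flip A A (flip A A (tmap A A A A (\<lambda>z. mul A z y) (\<lambda>z. z) (T a x)))"
      using T_flip[of a y x] * by simp
    then show "flip A A (tmap A A A A (\<lambda>z. mul A z x) (\<lambda>z. z) (T' a y)) = tmap A A A A (\<lambda>z. mul A z y) (\<lambda>z. z) (T a x)"
      using * by (simp add: flip_flip[OF vA vA] tmap_carr[OF vA vA] lin_rmul lin_id T_carr)
  qed (use bil_T bil_T' bij_T bij_T' T_right T'_right T_hom T'_hom T_slice T'_slice in auto)
qed

lemma T_induct:
  assumes "t \<in> tcarr A A" "\<And>a b. a \<in> carr A \<Longrightarrow> b \<in> carr A \<Longrightarrow> P (T a b)"
    "\<And>s t. s \<in> tcarr A A \<Longrightarrow> t \<in> tcarr A A \<Longrightarrow> P s \<Longrightarrow> P t \<Longrightarrow> P (s + t)"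
  shows "P t"
  by (rule tlift_surj_induct[OF vA vA bil_T _ assms]) (use bij_T in \<open>auto simp: bij_betw_def\<close>)

lemma T_eqI:
  assumes "lin (A \<otimes> A) C f" "lin (A \<otimes> A) C' g" "t \<in> tcarr A A" 
    "\<And>a b. a \<in> carr A \<Longrightarrow> b \<in> carr A \<Longrightarrow> f (T a b) = g (T a b)"
  shows "f t = g t"
  by (rule T_induct[OF assms(3)]) (use assms in \<open>simp_all add: lin_add[OF assms(1)] lin_add[OF assms(2)]\<close>)

text \<open>One and the same e computes \<epsilon> on the legs of T a c and fixes a, so
  \<open>T_slice\<close> returns a c.\<close>

lemma \<epsilon>_T: 
  assumes a: "a \<in> carr A" and c: "c \<in> carr A" shows "slice1 A A \<epsilon> (T a c) = mul A a c"
proof -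
  obtain e where "e \<in> carr B" "slice1 A A \<epsilon> (T a c) = slice1 A A (\<lambda>a. p a e) (T a c)" "r e a = a"
    using \<epsilon>_slice[OF vA T_carr[OF a c], of "{a}"] a by auto
  then show ?thesis using T_slice a c by simp
qed

text \<open>Left multiplication by \<Delta>(a) on A \<otimes> A, expressed through \<open>T\<close>:
  x \<otimes> y goes to (\<Delta>(a)(1 \<otimes> y))(x \<otimes> 1).\<close>

definition K :: "'a \<Rightarrow> ('k, 'a, 'a) tensor \<Rightarrow> ('k, 'a, 'a) tensor" where
  "K a = tlift A A (\<lambda>x y. tmap A A A A (\<lambda>z. mul A z x) (\<lambda>z. z) (T a y))"

lemma bil_K: "a \<in> carr A \<Longrightarrow> bil A A (A \<otimes> A) (\<lambda>x y. tmap A A A A (\<lambda>z. mul A z x) (\<lambda>z. z) (T a y))"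
  by (intro bilI lin_comp[OF bil_lin2[OF bil_T] lin_tmap[OF vA vA]], unfold tmap_def)
    (auto intro!: lin_rmul lin_id lin_tlift_param[OF vA vA vsp_tensor vA] bil_tmap lin_ten1 lin_lmul simp: T_carr)

lemma K_ten: "a \<in> carr A \<Longrightarrow> x \<in> carr A \<Longrightarrow> y \<in> carr A \<Longrightarrow> K a (ten A A x y) = tmap A A A A (\<lambda>z. mul A z x) (\<lambda>z. z) (T a y)"
  unfolding K_def by (rule tlift_ten[OF vA vA vsp_tensor bil_K])

lemma lin_K: "a \<in> carr A \<Longrightarrow> lin (A \<otimes> A) (A \<otimes> A) (K a)"
  unfolding K_def by (rule lin_tlift[OF vA vA vsp_tensor bil_K])

lemma K_T: "a \<in> carr A \<Longrightarrow> b \<in> carr A \<Longrightarrow> c \<in> carr A \<Longrightarrow> K a (T b c) = T (mul A a b) c"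
  unfolding K_def by (rule T_hom[symmetric])

lemma lin_s\<epsilon>: "lin (A \<otimes> A) A (slice1 A A \<epsilon>)"
  by (rule lin_slice1[OF vA vA lin_\<epsilon>])

text \<open>Applying \<epsilon> \<otimes> id to \<Delta>(x)(b \<otimes> y) gives \<epsilon>(b) x y.
  Hence right multiplication by b on the first leg multiplies the slice by \<epsilon>(b) on the
  tensors \<Delta>(x)(1 \<otimes> y), and these exhaust A \<otimes> A. The tensor a \<otimes> a with
  a \<noteq> 0 then isolates the scalar.\<close>

lemma \<epsilon>_mul:
  assumes a: "a \<in> carr A" and b: "b \<in> carr A" shows "\<epsilon> (mul A a b) = \<epsilon> a * \<epsilon> b"
proof (cases "a = 0")
  case True
  then show ?thesis using lin_zero[OF vA lin_\<epsilon>] mul_zero[OF algA b] by simp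
next
  case False
  have 1: "slice1 A A \<epsilon> (K x t) = mul A x (slice1 A A \<epsilon> t)" if x: "x \<in> carr A" and t: "t \<in> tcarr A A" for x t
    by (rule T_eqI[OF lin_comp[OF lin_K[OF x] lin_s\<epsilon>] lin_comp[OF lin_s\<epsilon> lin_lmul[OF x]] t])
      (use x algA in \<open>simp add: K_T \<epsilon>_T mul_assoc\<close>)
  note lr = lin_tmap[OF vA vA lin_rmul[OF b] lin_id]
  have 2: "slice1 A A \<epsilon> (tmap A A A A (\<lambda>z. mul A z b) (\<lambda>z. z) t) = smul A (\<epsilon> b) (slice1 A A \<epsilon> t)" if t: "t \<in> tcarr A A" for t
  proof (rule T_eqI[OF lin_comp[OF lr lin_s\<epsilon>] lin_smul_const[OF vA lin_s\<epsilon>] t])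
    fix x y assume xy: "x \<in> carr A" "y \<in> carr A"
    show "slice1 A A \<epsilon> (tmap A A A A (\<lambda>z. mul A z b) (\<lambda>z. z) (T x y)) = smul A (\<epsilon> b) (slice1 A A \<epsilon> (T x y))"
      using 1[OF xy(1) ten_carr[OF b xy(2)]] xy b
      by (simp add: K_ten \<epsilon>_T slice1_ten[OF vA vA lin_\<epsilon>] lin_smul[OF lin_lmul])
  qed
  have "smul A (\<epsilon> (mul A a b)) a = smul A (\<epsilon> b * \<epsilon> a) a"
    using 2[OF ten_carr[OF a a]] a b algA vA
    by (simp add: tmap_ten[OF vA vA] lin_rmul lin_id slice1_ten[OF vA vA lin_\<epsilon>] smul_laws)
  then have "smul A (\<epsilon> (mul A a b) - \<epsilon> b * \<epsilon> a) a = 0"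
    using smul_laws(2)[OF vA, of "\<epsilon> (mul A a b) - \<epsilon> b * \<epsilon> a" "\<epsilon> b * \<epsilon> a" a] by simp
  then show ?thesis using False smul_eq_0[OF vA] by (simp add: mult.commute)
qed

text \<open>This is a \<otimes> c \<mapsto> S(a) c before S is known: the antipode law, that S(a1)
  a2 c = \<epsilon>(a) c in Sweedler notation, forces the value (\<epsilon> \<otimes> id)
  T^-1.\<close>

definition \<mu> :: "('k, 'a, 'a) tensor \<Rightarrow> 'a" where
  "\<mu> t = slice1 A A \<epsilon> (inv_into (tcarr A A) (tlift A A T) t)"

lemma lin_\<mu>: "lin (A \<otimes> A) A \<mu>"
  unfolding \<mu>_def
  by (rule lin_comp[OF lin_inv_into(1)[OF vsp_tensor lin_tlift[OF vA vA vsp_tensor bil_T], unfolded tensor_alg_simps, OF bij_T] lin_s\<epsilon>])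

lemma \<mu>_T: "a \<in> carr A \<Longrightarrow> c \<in> carr A \<Longrightarrow> \<mu> (T a c) = smul A (\<epsilon> a) c"
  using lin_inv_into(4)[OF vsp_tensor lin_tlift[OF vA vA vsp_tensor bil_T], unfolded tensor_alg_simps, OF bij_T ten_carr, of a c]
  unfolding \<mu>_def by (simp add: tlift_ten[OF vA vA vsp_tensor bil_T] slice1_ten[OF vA vA lin_\<epsilon>])

lemma \<mu>_carr: "t \<in> tcarr A A \<Longrightarrow> \<mu> t \<in> carr A"
  using lin_carr[OF lin_\<mu>] by simp

lemma \<mu>_K: "a \<in> carr A \<Longrightarrow> t \<in> tcarr A A \<Longrightarrow> \<mu> (K a t) = smul A (\<epsilon> a) (\<mu> t)"
  by (rule T_eqI[OF lin_comp[OF lin_K lin_\<mu>] lin_smul_const[OF vA lin_\<mu>]])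
    (use vA algA in \<open>auto simp: K_T \<mu>_T \<epsilon>_mul smul_laws\<close>)

text \<open>This anticipates S(a b) c = S(b) S(a) c. In the form \<mu>(t (b \<otimes> 1)) = \<mu>(b
  \<otimes> \<mu>(t)) it holds on t = T x y, where both sides are \<epsilon>(x) \<mu>(b \<otimes>
  y).\<close>

lemma \<mu>_anti:
  assumes a: "a \<in> carr A" and b: "b \<in> carr A" and c: "c \<in> carr A"
  shows "\<mu> (ten A A (mul A a b) c) = \<mu> (ten A A b (\<mu> (ten A A a c)))"
proof -
  have "\<mu> (tmap A A A A (\<lambda>z. mul A z b) (\<lambda>z. z) t) = \<mu> (ten A A b (\<mu> t))" if t: "t \<in> tcarr A A" for t
  proof (rule T_eqI[OF lin_comp[OF lin_tmap[OF vA vA lin_rmul[OF b] lin_id] lin_\<mu>] lin_comp[OF lin_ten2[OF lin_\<mu> b] lin_\<mu>] t])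
    fix x y assume xy: "x \<in> carr A" "y \<in> carr A"
    show "\<mu> (tmap A A A A (\<lambda>z. mul A z b) (\<lambda>z. z) (T x y)) = \<mu> (ten A A b (\<mu> (T x y)))"
      using \<mu>_K[OF xy(1) ten_carr[OF b xy(2)]] xy b lin_smul[OF lin_comp[OF bil_lin2[OF bil_ten[of A A] b] lin_\<mu>] xy(2)]
      by (simp add: K_ten \<mu>_T)
  qed
  from this[OF ten_carr[OF a c]] show ?thesis using a b c by (simp add: tmap_ten[OF vA vA] lin_rmul lin_id)
qed

lemma \<mu>_right:
  assumes d: "d \<in> carr A" and t: "t \<in> tcarr A A"
  shows "\<mu> (tmap A A A A (\<lambda>x. x) (\<lambda>x. mul A x d) t) = mul A (\<mu> t) d"
  by (rule T_eqI[OF lin_comp[OF lin_tmap[OF vA vA lin_id lin_rmul[OF d]] lin_\<mu>] lin_comp[OF lin_\<mu> lin_rmul[OF d]] t])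
    (use d algA in \<open>simp add: T_right[symmetric] \<mu>_T lin_smul[OF lin_rmul]\<close>)

text \<open>The flip of T' a b is \<Delta>(a)(b \<otimes> 1); multiplied by 1 \<otimes> c it becomes
  \<Delta>(a)(b \<otimes> c), from which \<mu> splits off \<epsilon>(a).\<close>

lemma \<mu>_flip_mul:
  assumes a: "a \<in> carr A" and b: "b \<in> carr A" and c: "c \<in> carr A"
  shows "mul A (\<mu> (flip A A (T' a b))) c = smul A (\<epsilon> a) (\<mu> (ten A A b c))"
proof -
  note l = lin_id[of A] lin_rmul[OF c]
  have "mul A (\<mu> (flip A A (T' a b))) c = \<mu> (tmap A A A A (\<lambda>x. x) (\<lambda>x. mul A x c) (flip A A (T' a b)))"
    using \<mu>_right[OF c flip_carr[OF vA vA T'_carr[OF a b]]] by simp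
  also have "tmap A A A A (\<lambda>x. x) (\<lambda>x. mul A x c) (flip A A (T' a b)) = flip A A (tmap A A A A (\<lambda>x. mul A x c) (\<lambda>x. x) (T' a b))"
    by (rule flip_tmap[symmetric, OF vA vA vA vA l(2,1) T'_carr[OF a b]])
  also have "\<dots> = K a (ten A A b c)"
    using T_flip[OF a b c, symmetric] a b c flip_flip[OF vA vA tmap_carr[OF vA vA lin_rmul[OF b] lin_id T_carr[OF a c]]]
    by (simp add: K_ten)
  finally show ?thesis using \<mu>_K[OF a ten_carr[OF b c]] by simp
qed

lemma \<epsilon>_nonzero:
  assumes "x \<in> carr A" "x \<noteq> 0" obtains a where "a \<in> carr A" "\<epsilon> a = 1"
proof -
  obtain b where b: "b \<in> carr B" "p x b \<noteq> 0" using sepA[OF assms(1)] assms(2) by blast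
  let ?a = "smul A (1 / p x b) (l b x)"
  have "?a \<in> carr A" "\<epsilon> ?a = 1"
    using b assms(1) l_carr[OF assms(1) b(1)] vA by (auto simp: lin_smul[OF lin_\<epsilon>] \<epsilon>_l intro: vsp_smul)
  then show ?thesis by (rule that)
qed

text \<open>A priori c \<mapsto> \<mu>(b \<otimes> c) is only a left multiplier. If \<epsilon>(a) =
  1, it is left multiplication by the element \<mu>(\<Delta>(a)(b \<otimes> 1)) of A; such an a
  exists unless A = 0.\<close>

lemma antipode_exists: "\<exists>S. lin A A S \<and> (\<forall>b\<in>carr A. \<forall>c\<in>carr A. mul A (S b) c = \<mu> (ten A A b c))"
proof (cases "\<exists>x\<in>carr A. x \<noteq> 0")
  case True
  then obtain a where a: "a \<in> carr A" "\<epsilon> a = 1" using \<epsilon>_nonzero by blast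
  have "lin A A (\<lambda>b. \<mu> (flip A A (T' a b)))"
    by (rule lin_comp[OF lin_comp[OF bil_lin2[OF bil_T' a(1)] lin_flip[OF vA vA]] lin_\<mu>])
  then show ?thesis using \<mu>_flip_mul[OF a(1)] a(2) smul_laws(4)[OF vA]
    by (intro exI[of _ "\<lambda>b. \<mu> (flip A A (T' a b))"]) auto
next
  case False
  then have "\<mu> (ten A A b c) = 0" if "b \<in> carr A" "c \<in> carr A" for b c
    using \<mu>_carr[OF ten_carr[OF that]] by blast
  then show ?thesis using lin_id[of A] False mul_zero[OF algA] by (intro exI[of _ "\<lambda>x. x"]) auto
qed

definition S :: "'a \<Rightarrow> 'a" where
  "S = (SOME S. lin A A S \<and> (\<forall>b\<in>carr A. \<forall>c\<in>carr A. mul A (S b) c = \<mu> (ten A A b c)))"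

lemma lin_S: "lin A A S" and S_mul: "b \<in> carr A \<Longrightarrow> c \<in> carr A \<Longrightarrow> mul A (S b) c = \<mu> (ten A A b c)"
  using someI_ex[OF antipode_exists] unfolding S_def by blast+

lemma S_carr: "a \<in> carr A \<Longrightarrow> S a \<in> carr A"
  using lin_carr[OF lin_S] .

lemma S_anti:
  assumes a: "a \<in> carr A" and b: "b \<in> carr A" shows "S (mul A a b) = mul A (S b) (S a)"
proof (rule nd_eq_left[OF ndA])
  fix c assume c: "c \<in> carr A"
  have "mul A (S (mul A a b)) c = mul A (S b) (mul A (S a) c)"
    using a b c algA by (simp add: S_mul \<mu>_anti \<mu>_carr)
  then show "mul A (S (mul A a b)) c = mul A (mul A (S b) (S a)) c"
    using a b c algA by (simp add: mul_assoc S_carr)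
qed (use a b algA S_carr in auto)

lemma \<mu>_flip:
  assumes "a \<in> carr A" "b \<in> carr A" shows "\<mu> (flip A A (T' a b)) = smul A (\<epsilon> a) (S b)"
  by (rule nd_eq_left[OF ndA])
    (use assms algA in \<open>simp_all add: \<mu>_flip_mul S_mul lin_smul[OF bil_lin1[OF bil_mul]] S_carr \<mu>_carr flip_carr[OF vA vA] T'_carr vsp_smul[OF vA]\<close>)

text \<open>Coassociativity in dual form: after pairing the first leg with b' it becomes the module
  law \<open>r_r\<close>.\<close>

lemma T_r:
  assumes a: "a \<in> carr A" and c: "c \<in> carr A" and b: "b \<in> carr B"
  shows "T (r b a) c = tmap A A A A (r b) (\<lambda>x. x) (T a c)"
proof (rule slices_eqA[OF vA])
  interpret sw: paired_algebras A "op_alg B" p r l by (rule swap_paired)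
  have lr: "lin A A (r b)" using sw.lin_l b by simp
  show "tmap A A A A (r b) (\<lambda>x. x) (T a c) \<in> tcarr A A" by (rule tmap_carr[OF vA vA lr lin_id T_carr[OF a c]])
  fix b' assume b': "b' \<in> carr B"
  have bb: "mul B b b' \<in> carr B" using algB b b' by simp
  have "slice1 A A (\<lambda>x. p x b') (tmap A A A A (r b) (\<lambda>x. x) (T a c)) = slice1 A A (\<lambda>x. p x (mul B b b')) (T a c)"
    by (rule tensor_eqI[OF vA vA lin_comp[OF lin_tmap[OF vA vA lr lin_id] lin_slice1[OF vA vA p1[OF b']]] lin_slice1[OF vA vA p1[OF bb]] T_carr[OF a c]])
      (use b b' bb in \<open>simp add: tmap_ten[OF vA vA] lr lin_id slice1_ten[OF vA vA] p1 r_carr p_r\<close>)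
  then show "slice1 A A (\<lambda>x. p x b') (T (r b a) c) = slice1 A A (\<lambda>x. p x b') (tmap A A A A (r b) (\<lambda>x. x) (T a c))"
    using a b b' c bb by (simp add: T_slice r_carr r_r)
qed (use a b c r_carr T_carr in auto)

text \<open>Write z \<otimes> z as the image of t under the canonical map. Applying r b \<otimes> id
  and then \<mu> turns the image of a \<otimes> c into p(a, b) c, so the slices of t are the
  products S(r b z) z = 0. Hence t = 0 and z = 0.\<close>

lemma S_separates:
  assumes z: "z \<in> carr A" and 0: "\<And>y. y \<in> carr A \<Longrightarrow> mul A (S y) z = 0" shows "z = 0"
proof (rule ccontr)
  assume nz: "z \<noteq> 0"
  interpret sw: paired_algebras A "op_alg B" p r l by (rule swap_paired)
  have lr: "lin A A (r b)" if "b \<in> carr B" for b using sw.lin_l that by simp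
  note lT = lin_tlift[OF vA vA vsp_tensor bil_T]
  obtain t where t: "t \<in> tcarr A A" "tlift A A T t = ten A A z z"
    using bij_T ten_carr[OF z z] unfolding bij_betw_def by (metis imageE)
  have "t = 0"
  proof (rule slices_eqA[OF vA t(1) tcarr_zero])
    fix b assume b: "b \<in> carr B"
    have "slice1 A A (\<lambda>x. p x b) t = \<mu> (tmap A A A A (r b) (\<lambda>x. x) (tlift A A T t))"
      by (rule tensor_eqI[OF vA vA lin_slice1[OF vA vA p1[OF b]] lin_comp[OF lin_comp[OF lT lin_tmap[OF vA vA lr[OF b] lin_id]] lin_\<mu>] t(1)])
        (use b in \<open>simp add: slice1_ten[OF vA vA p1] tlift_ten[OF vA vA vsp_tensor bil_T] T_r[symmetric] \<mu>_T r_carr \<epsilon>_r\<close>)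
    also have "\<dots> = mul A (S (r b z)) z"
      using t b z by (simp add: tmap_ten[OF vA vA] lr lin_id S_mul r_carr)
    finally show "slice1 A A (\<lambda>x. p x b) t = slice1 A A (\<lambda>x. p x b) 0"
      using 0 r_carr[OF z b] lin_zero[OF vsp_tensor lin_slice1[OF vA vA p1[OF b]]] by simp
  qed
  then have "ten A A z z = 0" using t lin_zero[OF vsp_tensor lT] by simp
  then show False using ten_eq_0[OF vA vA z nz z] nz by simp
qed

text \<open>The same structure for the co-opposite comultiplication; its antipode
  \<open>sw.S\<close> is going to invert \<open>S\<close>.\<close>

interpretation sw: paired_hopf A "op_alg B" p r l T' T
  by (rule swap_hopf)

lemma sw_\<epsilon>: "a \<in> carr A \<Longrightarrow> sw.\<epsilon> a = \<epsilon> a"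
  using local_units[of "{a}"] \<epsilon>_eq[of a] sw.\<epsilon>_eq[of a] by auto

text \<open>Write S' for \<open>sw.S\<close>. Summed over the legs x \<otimes> y of t = T a c, the
  products S'(y) S'(S(x)) give S'(\<mu>(t)), and the products S'(y) x give \<open>sw.\<mu>\<close>
  of the flip of t; both are \<epsilon>(a) S'(c). As T is onto, S'(y) annihilates S'(S(x)) - x for
  all x and y, and \<open>sw.S_separates\<close> applies.\<close>

lemma sw_S_S:
  assumes x: "x \<in> carr A" shows "sw.S (S x) = x"
proof -
  define d where "d x = sw.S (S x) - x" for x
  have d: "lin A A d" unfolding d_def by (rule lin_minus[OF vA lin_comp[OF lin_S sw.lin_S] lin_id])
  have b: "bil A A A (\<lambda>x y. mul A (sw.S y) (d x))"
    by (intro bilI lin_comp[OF sw.lin_S lin_rmul] lin_comp[OF d lin_lmul] lin_carr[OF d] sw.S_carr)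
  note lb = lin_tlift[OF vA vA vA b]
  have b1: "bil A A A (\<lambda>x y. mul A (sw.S y) x)"
    by (intro bilI lin_comp[OF sw.lin_S lin_rmul] lin_lmul sw.S_carr)
  have b2: "bil A A A (\<lambda>x y. mul A (sw.S y) (sw.S (S x)))"
    by (intro bilI lin_comp[OF sw.lin_S lin_rmul] lin_comp[OF lin_comp[OF lin_S sw.lin_S] lin_lmul] sw.S_carr S_carr)
  have 1: "tlift A A (\<lambda>x y. mul A (sw.S y) x) t = sw.\<mu> (flip A A t)" if t: "t \<in> tcarr A A" for t
    by (rule tensor_eqI[OF vA vA lin_tlift[OF vA vA vA b1] lin_comp[OF lin_flip[OF vA vA] sw.lin_\<mu>] t])
      (simp add: tlift_ten[OF vA vA vA b1] flip_ten[OF vA vA] sw.S_mul)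
  have 2: "tlift A A (\<lambda>x y. mul A (sw.S y) (sw.S (S x))) t = sw.S (\<mu> t)" if t: "t \<in> tcarr A A" for t
    by (rule tensor_eqI[OF vA vA lin_tlift[OF vA vA vA b2] lin_comp[OF lin_\<mu> sw.lin_S] t])
      (simp add: tlift_ten[OF vA vA vA b2] S_mul[symmetric] sw.S_anti S_carr)
  have 3: "tlift A A (\<lambda>x y. mul A (sw.S y) (d x)) t = sw.S (\<mu> t) - sw.\<mu> (flip A A t)" if t: "t \<in> tcarr A A" for t
    unfolding 1[OF t, symmetric] 2[OF t, symmetric]
    by (rule tensor_eqI[OF vA vA lb lin_minus[OF vA lin_tlift[OF vA vA vA b2] lin_tlift[OF vA vA vA b1]] t])
      (simp add: tlift_ten[OF vA vA vA] b b1 b2, simp add: d_def lin_diff[OF vA lin_lmul] sw.S_carr S_carr)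
  have 4: "tlift A A (\<lambda>x y. mul A (sw.S y) (d x)) t = 0" if t: "t \<in> tcarr A A" for t
    by (rule T_eqI[OF lb lin_const_zero[OF vA, of "A \<otimes> A"] t])
      (use vA in \<open>simp add: 3 T_carr \<mu>_T sw.\<mu>_flip sw_\<epsilon> lin_smul[OF sw.lin_S]\<close>)
  have "mul A (sw.S y) (d x) = 0" if "y \<in> carr A" for y
    using 4[OF ten_carr[OF x that]] tlift_ten[OF vA vA vA b x that] by simp
  then have "d x = 0" by (rule sw.S_separates[OF lin_carr[OF d x]])
  then show ?thesis by (simp add: d_def)
qed

text \<open>
  For a multiplier \<open>U\<close> with slices \<open>(id \<otimes> p(a, -))(U) = a\<close>, the following applies to
  \<open>x \<otimes> y \<mapsto> (x \<otimes> 1)U(1 \<otimes> y)\<close>: the inverse sends \<open>S'(d) \<otimes> b\<close> to \<open>(S' \<otimes> id)(U(d \<otimes> b))\<close>, where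
  \<open>S'\<close> is the inverse antipode.
\<close>

lemma twisted_canonical_bij:
  assumes M: "lin (A \<otimes> B) (A \<otimes> B) M" and UL: "lin (A \<otimes> B) (A \<otimes> B) UL"
    and M_slice: "\<And>x y a. x \<in> carr A \<Longrightarrow> y \<in> carr B \<Longrightarrow> a \<in> carr A \<Longrightarrow>
      slice2 A B (p a) (M (ten A B x y)) = mul A x (l y a)"
    and U_slice: "\<And>x y a. x \<in> carr A \<Longrightarrow> y \<in> carr B \<Longrightarrow> a \<in> carr A \<Longrightarrow>
      slice2 A B (p a) (UL (ten A B x y)) = mul A (l y a) x"
  shows "bij_betw M (tcarr A B) (tcarr A B)"
  unfolding bij_betw_def
proof
  have bM: "bil A B A (\<lambda>x y. mul A x (f y))" if "lin B A f" for f
    by (intro bilI lin_comp[OF that lin_lmul] lin_rmul lin_carr[OF that])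
  have sM: "slice2 A B (p a) (M t) = tlift A B (\<lambda>x y. mul A x (l y a)) t" if a: "a \<in> carr A" and t: "t \<in> tcarr A B" for a t
    by (rule tensor_eqI[OF vA vB lin_comp[OF M lin_slice2[OF vA vB p2[OF a]]] lin_tlift[OF vA vB vA bM[OF lin_l'[OF a]]] t])
      (use a in \<open>simp add: M_slice tlift_ten[OF vA vB vA bM] lin_l'\<close>)
  have inj: "t = 0" if t: "t \<in> tcarr A B" and 0: "M t = 0" for t
  proof (rule slices_eqB[OF vA t tcarr_zero])
    \<comment> \<open>\<open>M t = 0\<close> says that the sum of x (l y a) over the legs of t
      vanishes for each a. The slice of T' a c is (l y a) c and T' is onto, so (l y a) c may be
      replaced by p(a, y) h with arbitrary a and h.\<close>
    have 1: "tlift A B (\<lambda>x y. mul A x (slice1 A A (\<lambda>a. p a y) s)) t = 0" if s: "s \<in> tcarr A A" for s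
    proof -
      have ls: "lin B A (\<lambda>y. slice1 A A (\<lambda>a. p a y) s)" if "s \<in> tcarr A A" for s
        unfolding slice1_def
        by (rule lin_tlift_param[OF vA vA vA vB bil_slice1[OF vA vA p1] _ that])
          (auto intro!: lin_smul_fun[OF vA] p2)
      have R: "lin (A \<otimes> A) A (\<lambda>s. tlift A B (\<lambda>x y. mul A x (slice1 A A (\<lambda>a. p a y) s)) t)"
        by (rule lin_tlift_param[OF vA vB vA vsp_tensor bM[OF ls] _ t])
          (auto intro!: lin_comp[OF lin_slice1[OF vA vA p1] lin_lmul])
      show ?thesis
      proof (rule sw.T_eqI[OF R lin_const_zero[OF vA, of "A \<otimes> A"] s])
        fix a c assume ac: "a \<in> carr A" "c \<in> carr A"
        have "tlift A B (\<lambda>x y. mul A x (slice1 A A (\<lambda>a. p a y) (T' a c))) t = tlift A B (\<lambda>x y. mul A (mul A x (l y a)) c) t"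
          by (rule fun_cong[OF tlift_cong]) (use ac algA in \<open>simp add: T'_slice mul_assoc l_carr\<close>)
        also have "\<dots> = mul A (tlift A B (\<lambda>x y. mul A x (l y a)) t) c"
          by (rule tlift_tlift[symmetric, OF vA vB vA vA bM[OF lin_l'[OF ac(1)]] lin_rmul[OF ac(2)] t])
        finally show "tlift A B (\<lambda>x y. mul A x (slice1 A A (\<lambda>a. p a y) (T' a c))) t = 0"
          using sM[OF ac(1) t] 0 ac algA lin_zero[OF vsp_tensor lin_slice2[OF vA vB p2[OF ac(1)]]] by (simp add: mul_zero)
      qed
    qed
    fix a assume a: "a \<in> carr A"
    show "slice2 A B (p a) t = slice2 A B (p a) 0"
      unfolding lin_zero[OF vsp_tensor lin_slice2[OF vA vB p2[OF a]]]
    proof (rule nd_left[OF ndA slice2_carr[OF vA vB p2[OF a] t]])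
      fix h assume h: "h \<in> carr A"
      have "mul A (slice2 A B (p a) t) h = tlift A B (\<lambda>x y. mul A (smul A (p a y) x) h) t"
        unfolding slice2_def by (rule tlift_tlift[OF vA vB vA vA bil_slice2[OF vA vB p2[OF a]] lin_rmul[OF h] t])
      also have "\<dots> = tlift A B (\<lambda>x y. mul A x (slice1 A A (\<lambda>a. p a y) (ten A A a h))) t"
        by (rule fun_cong[OF tlift_cong]) (use a h in \<open>simp add: slice1_ten[OF vA vA p1] lin_smul[OF lin_rmul] lin_smul[OF lin_lmul]\<close>)
      finally show "mul A (slice2 A B (p a) t) h = 0" using 1[OF ten_carr[OF a h]] by simp
    qed
  qed
  show "inj_on M (tcarr A B)"
  proof (rule inj_onI)
    fix s t assume "s \<in> tcarr A B" "t \<in> tcarr A B" "M s = M t"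
    then show "s = t" using inj[of "s - t"] lin_diff[OF vsp_tensor M] by (simp add: tcarr_diff)
  qed
  have hit: "M (tmap A B A B sw.S (\<lambda>y. y) (UL (ten A B d b))) = ten A B (sw.S d) b" if d: "d \<in> carr A" and b: "b \<in> carr B" for d b
  proof (rule slices_eqB[OF vA])
    define u where "u = UL (ten A B d b)"
    have u: "u \<in> tcarr A B" using lin_carr[OF UL] d b by (simp add: u_def)
    note lS = lin_tmap[OF vA vB sw.lin_S lin_id]
    show "M (tmap A B A B sw.S (\<lambda>y. y) (UL (ten A B d b))) \<in> tcarr A B"
      using lin_carr[OF M] lin_carr[OF lS] u by (simp add: u_def)
    show "ten A B (sw.S d) b \<in> tcarr A B" using d b sw.S_carr by simp
    fix a assume a: "a \<in> carr A"
    have bu: "bil A B (A \<otimes> A) (\<lambda>x y. ten A A (l y a) x)"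
      by (intro bilI lin_ten1[OF lin_l'[OF a]] lin_ten2[OF lin_id] l_carr a)
    define Z where "Z = tlift A B (\<lambda>x y. ten A A (l y a) x) u"
    have Zc: "Z \<in> tcarr A A" using lin_carr[OF lin_tlift[OF vA vB vsp_tensor bu]] u by (simp add: Z_def)
    \<comment> \<open>Reading the second leg of U(d \<otimes> b) through y \<mapsto> l y a turns it
      into \<Delta>(l b a)(1 \<otimes> d). On its flip \<open>sw.\<mu>\<close> has the value
      \<epsilon>(l b a) S'(d) = p(a, b) S'(d).\<close>
    have Z: "Z = T (l b a) d"
    proof (rule slices_eqA[OF vA Zc T_carr[OF l_carr[OF a b] d]])
      fix b' assume b': "b' \<in> carr B"
      have "slice1 A A (\<lambda>x. p x b') Z = slice2 A B (p (r b' a)) u"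
        unfolding Z_def
        by (rule tensor_eqI[OF vA vB lin_comp[OF lin_tlift[OF vA vB vsp_tensor bu] lin_slice1[OF vA vA p1[OF b']]] lin_slice2[OF vA vB p2[OF r_carr[OF a b']]] u])
          (use a b' in \<open>simp add: tlift_ten[OF vA vB vsp_tensor bu] slice1_ten[OF vA vA p1] slice2_ten[OF vA vB p2] l_carr r_carr p_l p_r\<close>)
      then show "slice1 A A (\<lambda>x. p x b') Z = slice1 A A (\<lambda>x. p x b') (T (l b a) d)"
        using a b b' d by (simp add: u_def U_slice r_carr l_carr T_slice l_r)
    qed
    have "slice2 A B (p a) (M (tmap A B A B sw.S (\<lambda>y. y) u)) = tlift A B (\<lambda>x y. mul A x (l y a)) (tmap A B A B sw.S (\<lambda>y. y) u)"
      using sM[OF a] lin_carr[OF lS] u by simp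
    also have "\<dots> = sw.\<mu> (flip A A Z)"
      unfolding Z_def
      by (rule tensor_eqI[OF vA vB lin_comp[OF lS lin_tlift[OF vA vB vA bM[OF lin_l'[OF a]]]]
            lin_comp[OF lin_comp[OF lin_tlift[OF vA vB vsp_tensor bu] lin_flip[OF vA vA]] sw.lin_\<mu>] u])
        (use a in \<open>simp add: tmap_ten[OF vA vB] sw.lin_S lin_id tlift_ten[OF vA vB vA bM] lin_l' sw.S_carr tlift_ten[OF vA vB vsp_tensor bu] flip_ten[OF vA vA] l_carr sw.S_mul\<close>)
    also have "\<dots> = smul A (p a b) (sw.S d)"
      using a b d by (simp add: Z sw.\<mu>_flip l_carr sw_\<epsilon> \<epsilon>_l)
    finally show "slice2 A B (p a) (M (tmap A B A B sw.S (\<lambda>y. y) (UL (ten A B d b)))) = slice2 A B (p a) (ten A B (sw.S d) b)"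
      using a b d by (simp add: u_def slice2_ten[OF vA vB p2] sw.S_carr)
  qed
  show "M ` tcarr A B = tcarr A B"
  proof
    show "M ` tcarr A B \<subseteq> tcarr A B" using lin_carr[OF M] by auto
    show "tcarr A B \<subseteq> M ` tcarr A B"
    proof
      fix t assume "t \<in> tcarr A B"
      with vA vB show "t \<in> M ` tcarr A B"
      proof (induction rule: tcarr_induct)
        case (ten c b)
        \<comment> \<open>The preimage of c \<otimes> b is formed with d = S c, for which
          \<open>sw.S d\<close> is c.\<close>
        have "UL (ten A B (S c) b) \<in> tcarr A B" using lin_carr[OF UL] ten S_carr by simp
        then have "tmap A B A B sw.S (\<lambda>y. y) (UL (ten A B (S c) b)) \<in> tcarr A B"
          by (rule tmap_carr[OF vA vB sw.lin_S lin_id])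
        then show ?case using hit[OF S_carr[OF ten(1)] ten(2)] sw_S_S[OF ten(1)] by (metis imageI)
      next
        case (add s t)
        then obtain s' t' where "s' \<in> tcarr A B" "t' \<in> tcarr A B" "s = M s'" "t = M t'" by auto
        then have "s + t = M (s' + t')" "s' + t' \<in> tcarr A B" using lin_add[OF M] by auto
        then show ?case by blast
      qed
    qed
  qed
qed

end

section \<open>Regular multiplier Hopf algebras\<close>

lemma hom_lin_mult: "alg_hom A (mult_alg B) f \<Longrightarrow> a \<in> carr A \<Longrightarrow> f a \<in> carr (mult_alg B)"
  using lin_carr[OF alg_hom_lin] by blast

lemma flip_mul:
  assumes A: "is_algebra A" and B: "is_algebra B" and s: "s \<in> tcarr A B" and t: "t \<in> tcarr A B"
  shows "flip A B (mul (A \<otimes> B) s t) = mul (B \<otimes> A) (flip A B s) (flip A B t)"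
proof -
  note v = vsp_algebra[OF A] vsp_algebra[OF B]
  note m = bil_mul_tensor[OF A B] bil_mul_tensor[OF B A]
  note f = lin_flip[OF v]
  have c: "flip A B t \<in> tcarr B A" by (rule flip_carr[OF v t])
  have 1: "flip A B (mul (A \<otimes> B) (ten A B a b) t) = mul (B \<otimes> A) (flip A B (ten A B a b)) (flip A B t)"
    if ab: "a \<in> carr A" "b \<in> carr B" for a b
    by (rule tensor_eqI[OF v lin_comp[OF bil_lin2[OF m(1)] f] lin_comp[OF f bil_lin2[OF m(2)]] t])
      (use ab A B in \<open>simp_all add: flip_ten[OF v] mul_ten\<close>)
  show ?thesis
    by (rule tensor_eqI[OF v lin_comp[OF bil_lin1[OF m(1)] f] lin_comp[OF f bil_lin1[OF m(2)]] s])
      (use t c 1 in simp_all)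
qed

lemma flip_bij: "vsp A \<Longrightarrow> vsp B \<Longrightarrow> bij_betw (flip A B) (tcarr A B) (tcarr B A)"
  by (rule bij_betw_byWitness[where f' = "flip B A"]) (auto simp: flip_flip flip_carr)

lemma flip_alg_hom: "is_algebra A \<Longrightarrow> is_algebra B \<Longrightarrow> alg_hom (A \<otimes> B) (B \<otimes> A) (flip A B)"
  by (rule alg_homI[OF lin_flip]) (simp_all add: flip_mul)

text \<open>Meant for maps given through \<open>unemb\<close>, whose values are known by their
  products: linearity is tested after right multiplication by x \<otimes> y.\<close>

lemma lin_tensorI:
  assumes A: "nd_algebra A" and B: "nd_algebra B" and X: "vsp X" and c: "\<And>z. z \<in> carr X \<Longrightarrow> f z \<in> tcarr A B"
    and l: "\<And>x y. x \<in> carr A \<Longrightarrow> y \<in> carr B \<Longrightarrow> lin X (A \<otimes> B) (\<lambda>z. mul (A \<otimes> B) (f z) (ten A B x y))"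
  shows "lin X (A \<otimes> B) f"
proof (rule linI)
  have m: "lin (A \<otimes> B) (A \<otimes> B) (\<lambda>s. mul (A \<otimes> B) s (ten A B x y))" if "x \<in> carr A" "y \<in> carr B" for x y
    using that A B by (intro bil_lin1[OF bil_mul_tensor]) simp_all
  show "f x \<in> carr (A \<otimes> B)" if "x \<in> carr X" for x using c that by simp
  show "f (x + y) = f x + f y" if xy: "x \<in> carr X" "y \<in> carr X" for x y
  proof (rule tensor_nd_eqI[OF A B])
    fix a b assume ab: "a \<in> carr A" "b \<in> carr B"
    show "mul (A \<otimes> B) (f (x + y)) (ten A B a b) = mul (A \<otimes> B) (f x + f y) (ten A B a b)"
      using lin_add[OF l[OF ab] xy] lin_add[OF m[OF ab], of "f x" "f y"] c xy by simp
  qed (use c X xy in \<open>simp_all add: vsp_add tcarr_add\<close>)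
  show "f (smul X k x) = smul (A \<otimes> B) k (f x)" if x: "x \<in> carr X" for x k
  proof (rule tensor_nd_eqI[OF A B])
    show "smul (A \<otimes> B) k (f x) \<in> tcarr A B" using vsp_smul[OF vsp_tensor[of A B], of "f x" k] c[OF x] by simp
    fix a b assume ab: "a \<in> carr A" "b \<in> carr B"
    show "mul (A \<otimes> B) (f (smul X k x)) (ten A B a b) = mul (A \<otimes> B) (smul (A \<otimes> B) k (f x)) (ten A B a b)"
      using lin_smul[OF l[OF ab] x] lin_smul[OF m[OF ab]] c[OF x] by simp
  qed (use c X x in \<open>simp add: vsp_smul\<close>)
qed

section \<open>Opposite algebras and the exchange of left and right multiplication\<close>

lemma bil_tensor_op [simp]:
  "bil X Y (op_alg A \<otimes> B) f \<longleftrightarrow> bil X Y (A \<otimes> B) f" "bil X Y (A \<otimes> op_alg B) f \<longleftrightarrow> bil X Y (A \<otimes> B) f"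
  by (simp_all add: bil_def)

lemma tmap_op [simp]: "tmap (op_alg A) B C D f g = tmap A B C D f g" "tmap A (op_alg B) C D f g = tmap A B C D f g"
    "tmap A B (op_alg C) D f g = tmap A B C D f g" "tmap A B C (op_alg D) f g = tmap A B C D f g"
  by (simp_all add: tmap_def)

lemma flip_op [simp]: "flip (op_alg A) B = flip A B" "flip A (op_alg B) = flip A B"
  by (simp_all add: flip_def)

context
  fixes A :: "('k::field, 'a::ab_group_add) alg" and B :: "('k, 'b::ab_group_add) alg"
  assumes A: "nd_algebra A" and B: "nd_algebra B"
begin

private lemma al: "is_algebra A" "is_algebra B" using A B by simp_all

lemma mul_tensor_op: "s \<in> tcarr A B \<Longrightarrow> t \<in> tcarr A B \<Longrightarrow> mul (op_alg A \<otimes> op_alg B) s t = mul (A \<otimes> B) t s"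
proof -
  assume s: "s \<in> tcarr A B" and t: "t \<in> tcarr A B"
  note v = vsp_algebra[OF al(1)] vsp_algebra[OF al(2)]
  note m = bil_mul_tensor[OF is_algebra_op[OF al(1)] is_algebra_op[OF al(2)], simplified] bil_mul_tensor[OF al]
  have m1: "lin (A \<otimes> B) (A \<otimes> B) (\<lambda>s. mul (op_alg A \<otimes> op_alg B) s t)" "lin (A \<otimes> B) (A \<otimes> B) (mul (op_alg A \<otimes> op_alg B) t)"
     if "t \<in> tcarr A B" for t
    using bil_lin1[OF bil_mul_tensor[OF is_algebra_op[OF al(1)] is_algebra_op[OF al(2)]], of t]
      bil_lin2[OF bil_mul_tensor[OF is_algebra_op[OF al(1)] is_algebra_op[OF al(2)]], of t] that by simp_all
  have 1: "mul (op_alg A \<otimes> op_alg B) (ten A B a b) t = mul (A \<otimes> B) t (ten A B a b)" if ab: "a \<in> carr A" "b \<in> carr B" for a b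
    by (rule tensor_eqI[OF v m1(2) bil_lin1[OF bil_mul_tensor[OF al]] t])
      (use ab al mul_ten[of "op_alg A" "op_alg B"] in \<open>simp_all add: mul_ten\<close>)
  show "mul (op_alg A \<otimes> op_alg B) s t = mul (A \<otimes> B) t s"
    by (rule tensor_eqI[OF v m1(1)[OF t] bil_lin2[OF bil_mul_tensor[OF al]] s]) (use t 1 in simp_all)
qed

lemma mult_tensor_op: "m \<in> carr (mult_alg (A \<otimes> B)) \<Longrightarrow> prod.swap m \<in> carr (mult_alg (op_alg A \<otimes> op_alg B))"
proof -
  assume m: "m \<in> carr (mult_alg (A \<otimes> B))"
  note c = mult_carr1[OF m, simplified] mult_carr2[OF m, simplified]
  note c' = bil_carr[OF bil_mul_tensor[OF al], simplified]
  show ?thesis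
    by (rule multI)
      (use mult_lin1[OF m] mult_lin2[OF m] mult_out1[OF m] mult_out2[OF m] mult_mul1[OF m] mult_mul2[OF m] mult_mul[OF m] c c'
        in \<open>simp_all add: mul_tensor_op\<close>)
qed

lemma emb_tensor_op: "t \<in> tcarr A B \<Longrightarrow> emb (op_alg A \<otimes> op_alg B) t = prod.swap (emb (A \<otimes> B) t)"
  by (auto simp: emb_def prod_eq_iff fun_eq_iff mul_tensor_op)

lemma emb_image_tensor_op: "m \<in> emb_image (A \<otimes> B) \<Longrightarrow> prod.swap m \<in> emb_image (op_alg A \<otimes> op_alg B)"
  using emb_tensor_op by (auto simp: image_iff)

lemma unemb_tensor_op:
  assumes "m \<in> emb_image (A \<otimes> B)" shows "unemb (op_alg A \<otimes> op_alg B) (prod.swap m) = unemb (A \<otimes> B) m"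
proof -
  obtain t where t: "m = emb (A \<otimes> B) t" "t \<in> tcarr A B" using assms by auto
  have "unemb (op_alg A \<otimes> op_alg B) (emb (op_alg A \<otimes> op_alg B) t) = t"
    by (rule unemb_emb) (use A B t in simp_all)
  then show ?thesis using t A B emb_tensor_op[OF t(2)] by (simp add: unemb_emb)
qed

lemma leg_op: "leg1 (op_alg A) (op_alg B) a = prod.swap (leg1 A B a)" "leg2 (op_alg A) (op_alg B) b = prod.swap (leg2 A B b)"
  by (simp_all add: leg1_def leg2_def mten_tmap, simp_all add: emb_def mone_def cong: if_cong)

end

lemma mmul_swap: "prod.swap (m \<cdot> n) = prod.swap n \<cdot> prod.swap m"
  by (simp add: mmul_def)

text \<open>
  The four families \<open>\<Delta>(a)(c \<otimes> 1)\<close>, \<open>\<Delta>(a)(1 \<otimes> c)\<close>, \<open>(c \<otimes> 1)\<Delta>(a)\<close>, \<open>(1 \<otimes> c)\<Delta>(a)\<close> enter symmetrically,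
  so that the opposite algebra need not be treated separately.
\<close>

definition dr1 :: "('k::field, 'a::ab_group_add) alg \<Rightarrow> ('k, 'a) comult \<Rightarrow> 'a \<Rightarrow> 'a \<Rightarrow> ('k, 'a, 'a) tensor" where
  "dr1 A \<Delta> a c = unemb (A \<otimes> A) (\<Delta> a \<cdot> leg1 A A c)"

definition dr2 :: "('k::field, 'a::ab_group_add) alg \<Rightarrow> ('k, 'a) comult \<Rightarrow> 'a \<Rightarrow> 'a \<Rightarrow> ('k, 'a, 'a) tensor" where
  "dr2 A \<Delta> a c = unemb (A \<otimes> A) (\<Delta> a \<cdot> leg2 A A c)"

definition dl1 :: "('k::field, 'a::ab_group_add) alg \<Rightarrow> ('k, 'a) comult \<Rightarrow> 'a \<Rightarrow> 'a \<Rightarrow> ('k, 'a, 'a) tensor" where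
  "dl1 A \<Delta> a c = unemb (A \<otimes> A) (leg1 A A c \<cdot> \<Delta> a)"

definition dl2 :: "('k::field, 'a::ab_group_add) alg \<Rightarrow> ('k, 'a) comult \<Rightarrow> 'a \<Rightarrow> 'a \<Rightarrow> ('k, 'a, 'a) tensor" where
  "dl2 A \<Delta> a c = unemb (A \<otimes> A) (leg2 A A c \<cdot> \<Delta> a)"

definition covered0 :: "('k::field, 'a::ab_group_add) alg \<Rightarrow> ('k, 'a) comult \<Rightarrow> bool" where
  "covered0 A \<Delta> \<longleftrightarrow> nd_algebra A \<and> alg_hom A (mult_alg (A \<otimes> A)) \<Delta> \<and>
     (\<forall>a\<in>carr A. \<forall>c\<in>carr A. \<Delta> a \<cdot> leg1 A A c \<in> emb_image (A \<otimes> A) \<and> \<Delta> a \<cdot> leg2 A A c \<in> emb_image (A \<otimes> A) \<and>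
       leg1 A A c \<cdot> \<Delta> a \<in> emb_image (A \<otimes> A) \<and> leg2 A A c \<cdot> \<Delta> a \<in> emb_image (A \<otimes> A))"

definition covered :: "('k::field, 'a::ab_group_add) alg \<Rightarrow> ('k, 'a) comult \<Rightarrow> bool" where
  "covered A \<Delta> \<longleftrightarrow> covered0 A \<Delta> \<and>
     bij_betw (tlift A A (dr1 A \<Delta>)) (tcarr A A) (tcarr A A) \<and> bij_betw (tlift A A (dr2 A \<Delta>)) (tcarr A A) (tcarr A A) \<and>
     bij_betw (tlift A A (dl1 A \<Delta>)) (tcarr A A) (tcarr A A) \<and> bij_betw (tlift A A (dl2 A \<Delta>)) (tcarr A A) (tcarr A A)"

lemma covered0_op:
  assumes c: "covered0 A \<Delta>"
  shows "covered0 (op_alg A) (op_comult \<Delta>)"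
    and "\<And>a c. a \<in> carr A \<Longrightarrow> c \<in> carr A \<Longrightarrow> dr1 (op_alg A) (op_comult \<Delta>) a c = dl1 A \<Delta> a c"
    and "\<And>a c. a \<in> carr A \<Longrightarrow> c \<in> carr A \<Longrightarrow> dr2 (op_alg A) (op_comult \<Delta>) a c = dl2 A \<Delta> a c"
    and "\<And>a c. a \<in> carr A \<Longrightarrow> c \<in> carr A \<Longrightarrow> dl1 (op_alg A) (op_comult \<Delta>) a c = dr1 A \<Delta> a c"
    and "\<And>a c. a \<in> carr A \<Longrightarrow> c \<in> carr A \<Longrightarrow> dl2 (op_alg A) (op_comult \<Delta>) a c = dr2 A \<Delta> a c"
proof -
  have A: "nd_algebra A" and h: "alg_hom A (mult_alg (A \<otimes> A)) \<Delta>"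
    and m: "\<And>a c. a \<in> carr A \<Longrightarrow> c \<in> carr A \<Longrightarrow> \<Delta> a \<cdot> leg1 A A c \<in> emb_image (A \<otimes> A)"
    "\<And>a c. a \<in> carr A \<Longrightarrow> c \<in> carr A \<Longrightarrow> \<Delta> a \<cdot> leg2 A A c \<in> emb_image (A \<otimes> A)"
    "\<And>a c. a \<in> carr A \<Longrightarrow> c \<in> carr A \<Longrightarrow> leg1 A A c \<cdot> \<Delta> a \<in> emb_image (A \<otimes> A)"
    "\<And>a c. a \<in> carr A \<Longrightarrow> c \<in> carr A \<Longrightarrow> leg2 A A c \<cdot> \<Delta> a \<in> emb_image (A \<otimes> A)"
    using c unfolding covered0_def by blast+
  show d: "\<And>a c. a \<in> carr A \<Longrightarrow> c \<in> carr A \<Longrightarrow> dr1 (op_alg A) (op_comult \<Delta>) a c = dl1 A \<Delta> a c"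
    "\<And>a c. a \<in> carr A \<Longrightarrow> c \<in> carr A \<Longrightarrow> dr2 (op_alg A) (op_comult \<Delta>) a c = dl2 A \<Delta> a c"
    "\<And>a c. a \<in> carr A \<Longrightarrow> c \<in> carr A \<Longrightarrow> dl1 (op_alg A) (op_comult \<Delta>) a c = dr1 A \<Delta> a c"
    "\<And>a c. a \<in> carr A \<Longrightarrow> c \<in> carr A \<Longrightarrow> dl2 (op_alg A) (op_comult \<Delta>) a c = dr2 A \<Delta> a c"
    unfolding dr1_def dr2_def dl1_def dl2_def leg_op[OF A A] op_comult_def mmul_swap[symmetric]
    using m by (simp_all add: unemb_tensor_op[OF A A])
  have "alg_hom (op_alg A) (mult_alg (op_alg A \<otimes> op_alg A)) (op_comult \<Delta>)"
  proof (rule alg_homI[OF linI])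
    fix x y k assume x: "x \<in> carr (op_alg A)"
    then show "op_comult \<Delta> x \<in> carr (mult_alg (op_alg A \<otimes> op_alg A))"
      using hom_lin_mult[OF h] by (simp add: op_comult_def mult_tensor_op[OF A A])
    show "op_comult \<Delta> (smul (op_alg A) k x) = smul (mult_alg (op_alg A \<otimes> op_alg A)) k (op_comult \<Delta> x)"
      using x by (simp add: op_comult_def lin_smul[OF alg_hom_lin[OF h]])
    assume y: "y \<in> carr (op_alg A)"
    show "op_comult \<Delta> (x + y) = op_comult \<Delta> x + op_comult \<Delta> y"
      using x y by (simp add: op_comult_def lin_add[OF alg_hom_lin[OF h]] prod_eq_iff)
    show "op_comult \<Delta> (mul (op_alg A) x y) = mul (mult_alg (op_alg A \<otimes> op_alg A)) (op_comult \<Delta> x) (op_comult \<Delta> y)"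
      using x y by (simp add: op_comult_def alg_hom_mul[OF h] mmul_swap)
  qed
  moreover have "\<forall>a\<in>carr A. \<forall>c\<in>carr A. op_comult \<Delta> a \<cdot> leg1 (op_alg A) (op_alg A) c \<in> emb_image (op_alg A \<otimes> op_alg A) \<and>
       op_comult \<Delta> a \<cdot> leg2 (op_alg A) (op_alg A) c \<in> emb_image (op_alg A \<otimes> op_alg A) \<and>
       leg1 (op_alg A) (op_alg A) c \<cdot> op_comult \<Delta> a \<in> emb_image (op_alg A \<otimes> op_alg A) \<and>
       leg2 (op_alg A) (op_alg A) c \<cdot> op_comult \<Delta> a \<in> emb_image (op_alg A \<otimes> op_alg A)"
    unfolding leg_op[OF A A] op_comult_def mmul_swap[symmetric] using m emb_image_tensor_op[OF A A] by blast
  ultimately show "covered0 (op_alg A) (op_comult \<Delta>)"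
    using A unfolding covered0_def by simp
qed

lemma covered_op:
  assumes c: "covered A \<Delta>" shows "covered (op_alg A) (op_comult \<Delta>)"
proof -
  have c0: "covered0 A \<Delta>" using c by (simp add: covered_def)
  have t: "tlift A A (dr1 (op_alg A) (op_comult \<Delta>)) = tlift A A (dl1 A \<Delta>)" "tlift A A (dr2 (op_alg A) (op_comult \<Delta>)) = tlift A A (dl2 A \<Delta>)"
    "tlift A A (dl1 (op_alg A) (op_comult \<Delta>)) = tlift A A (dr1 A \<Delta>)" "tlift A A (dl2 (op_alg A) (op_comult \<Delta>)) = tlift A A (dr2 A \<Delta>)"
    by (rule tlift_cong, simp add: covered0_op[OF c0])+
  show ?thesis using c covered0_op(1)[OF c0] unfolding covered_def by (simp add: t)
qed

section \<open>Comultiplications covered on one leg, and local units\<close>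

locale covered_comult =
  fixes A :: "('k::field, 'a::ab_group_add) alg" and \<Delta> :: "('k, 'a) comult"
  assumes cov: "covered0 A \<Delta>"
begin

lemma ndA: "nd_algebra A" and hom: "alg_hom A (mult_alg (A \<otimes> A)) \<Delta>"
  and emb_r1: "a \<in> carr A \<Longrightarrow> c \<in> carr A \<Longrightarrow> \<Delta> a \<cdot> leg1 A A c \<in> emb_image (A \<otimes> A)"
  and emb_r2: "a \<in> carr A \<Longrightarrow> c \<in> carr A \<Longrightarrow> \<Delta> a \<cdot> leg2 A A c \<in> emb_image (A \<otimes> A)"
  and emb_l1: "a \<in> carr A \<Longrightarrow> c \<in> carr A \<Longrightarrow> leg1 A A c \<cdot> \<Delta> a \<in> emb_image (A \<otimes> A)"
  and emb_l2: "a \<in> carr A \<Longrightarrow> c \<in> carr A \<Longrightarrow> leg2 A A c \<cdot> \<Delta> a \<in> emb_image (A \<otimes> A)"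
  using cov unfolding covered0_def by blast+

lemma algA: "is_algebra A" and vA: "vsp A" and ndAA: "nd_algebra (A \<otimes> A)"
  using ndA by simp_all

lemma \<Delta>_mult: "a \<in> carr A \<Longrightarrow> \<Delta> a \<in> carr (mult_alg (A \<otimes> A))"
  using hom_lin_mult[OF hom] .

lemma \<Delta>_lin: "lin A (mult_alg (A \<otimes> A)) \<Delta>"
  by (rule alg_hom_lin[OF hom])

lemma \<Delta>_mul: "a \<in> carr A \<Longrightarrow> b \<in> carr A \<Longrightarrow> \<Delta> (mul A a b) = \<Delta> a \<cdot> \<Delta> b"
  using alg_hom_mul[OF hom] by simp

lemma \<Delta>_carr: "a \<in> carr A \<Longrightarrow> t \<in> tcarr A A \<Longrightarrow> fst (\<Delta> a) t \<in> tcarr A A"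
  using mult_carr1[OF \<Delta>_mult] by simp

lemma lin_rmul: "b \<in> carr A \<Longrightarrow> lin A A (\<lambda>x. mul A x b)" and lin_lmul: "b \<in> carr A \<Longrightarrow> lin A A (mul A b)"
  using lin_mul1[OF algA lin_id] lin_mul2[OF algA lin_id] by blast+

lemma dr1_carr: "a \<in> carr A \<Longrightarrow> c \<in> carr A \<Longrightarrow> dr1 A \<Delta> a c \<in> tcarr A A"
  and dr2_carr: "a \<in> carr A \<Longrightarrow> c \<in> carr A \<Longrightarrow> dr2 A \<Delta> a c \<in> tcarr A A"
  and dl1_carr: "a \<in> carr A \<Longrightarrow> c \<in> carr A \<Longrightarrow> dl1 A \<Delta> a c \<in> tcarr A A"
  and dl2_carr: "a \<in> carr A \<Longrightarrow> c \<in> carr A \<Longrightarrow> dl2 A \<Delta> a c \<in> tcarr A A"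
  unfolding dr1_def dr2_def dl1_def dl2_def 
  using unemb_carr[OF ndAA emb_r1] unemb_carr[OF ndAA emb_r2] unemb_carr[OF ndAA emb_l1] unemb_carr[OF ndAA emb_l2] by simp_all

lemma dr1_mul: "a \<in> carr A \<Longrightarrow> c \<in> carr A \<Longrightarrow> x \<in> carr A \<Longrightarrow> y \<in> carr A \<Longrightarrow>
    mul (A \<otimes> A) (dr1 A \<Delta> a c) (ten A A x y) = fst (\<Delta> a) (ten A A (mul A c x) y)"
  and dr2_mul: "a \<in> carr A \<Longrightarrow> c \<in> carr A \<Longrightarrow> x \<in> carr A \<Longrightarrow> y \<in> carr A \<Longrightarrow>
    mul (A \<otimes> A) (dr2 A \<Delta> a c) (ten A A x y) = fst (\<Delta> a) (ten A A x (mul A c y))"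
  unfolding dr1_def dr2_def
  using mul_unemb1[OF ndAA emb_r1, of a c "ten A A x y"] mul_unemb1[OF ndAA emb_r2, of a c "ten A A x y"]
  by (simp_all add: leg1_ten[OF algA algA] leg2_ten[OF algA algA])

lemma dl1_mul: "a \<in> carr A \<Longrightarrow> c \<in> carr A \<Longrightarrow> x \<in> carr A \<Longrightarrow> y \<in> carr A \<Longrightarrow>
    mul (A \<otimes> A) (dl1 A \<Delta> a c) (ten A A x y) = tmap A A A A (mul A c) (\<lambda>x. x) (fst (\<Delta> a) (ten A A x y))"
  and dl2_mul: "a \<in> carr A \<Longrightarrow> c \<in> carr A \<Longrightarrow> x \<in> carr A \<Longrightarrow> y \<in> carr A \<Longrightarrow>
    mul (A \<otimes> A) (dl2 A \<Delta> a c) (ten A A x y) = tmap A A A A (\<lambda>x. x) (mul A c) (fst (\<Delta> a) (ten A A x y))"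
proof -
  assume *: "a \<in> carr A" "c \<in> carr A" "x \<in> carr A" "y \<in> carr A"
  then have c: "fst (\<Delta> a) (ten A A x y) \<in> tcarr A A" using \<Delta>_carr by simp
  show "mul (A \<otimes> A) (dl1 A \<Delta> a c) (ten A A x y) = tmap A A A A (mul A c) (\<lambda>x. x) (fst (\<Delta> a) (ten A A x y))"
    "mul (A \<otimes> A) (dl2 A \<Delta> a c) (ten A A x y) = tmap A A A A (\<lambda>x. x) (mul A c) (fst (\<Delta> a) (ten A A x y))"
    unfolding dl1_def dl2_def
    using mul_unemb1[OF ndAA emb_l1, of a c "ten A A x y"] mul_unemb1[OF ndAA emb_l2, of a c "ten A A x y"] * c algA
    by (simp_all add: leg1_tmap leg2_tmap)
qed

lemma bil_dr1: "bil A A (A \<otimes> A) (dr1 A \<Delta>)" and bil_dr2: "bil A A (A \<otimes> A) (dr2 A \<Delta>)"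
proof -
  have 1: "lin A (A \<otimes> A) (\<lambda>a. fst (\<Delta> a) t)" if "t \<in> tcarr A A" for t
    by (rule lin_comp[OF \<Delta>_lin lin_eval1]) (use that in simp)
  have 2: "lin A (A \<otimes> A) (\<lambda>c. fst (\<Delta> a) (ten A A (mul A c x) y))" "lin A (A \<otimes> A) (\<lambda>c. fst (\<Delta> a) (ten A A x (mul A c y)))"
    if "a \<in> carr A" "x \<in> carr A" "y \<in> carr A" for a x y
    using that by (auto intro!: lin_comp[OF lin_ten1[OF lin_rmul] mult_lin1[OF \<Delta>_mult]] lin_comp[OF lin_ten2[OF lin_rmul] mult_lin1[OF \<Delta>_mult]])
  have c: "lin A (A \<otimes> A) f \<longleftrightarrow> lin A (A \<otimes> A) g" if "\<And>x. x \<in> carr A \<Longrightarrow> f x = g x" for f g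
    using lin_cong[OF that vA] .
  show "bil A A (A \<otimes> A) (dr1 A \<Delta>)"
  proof (intro bilI; rule lin_tensorI[OF ndA ndA vA])
    fix a x y assume *: "a \<in> carr A" "x \<in> carr A" "y \<in> carr A"
    show "lin A (A \<otimes> A) (\<lambda>z. mul (A \<otimes> A) (dr1 A \<Delta> a z) (ten A A x y))"
      by (rule c[THEN iffD2, OF _ 2(1)[OF *]]) (use * in \<open>simp add: dr1_mul\<close>)
    show "lin A (A \<otimes> A) (\<lambda>z. mul (A \<otimes> A) (dr1 A \<Delta> z a) (ten A A x y))"
      by (rule c[THEN iffD2, OF _ 1[of "ten A A (mul A a x) y"]]) (use * algA in \<open>simp_all add: dr1_mul\<close>)
  qed (use dr1_carr in auto)
  show "bil A A (A \<otimes> A) (dr2 A \<Delta>)"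
  proof (intro bilI; rule lin_tensorI[OF ndA ndA vA])
    fix a x y assume *: "a \<in> carr A" "x \<in> carr A" "y \<in> carr A"
    show "lin A (A \<otimes> A) (\<lambda>z. mul (A \<otimes> A) (dr2 A \<Delta> a z) (ten A A x y))"
      by (rule c[THEN iffD2, OF _ 2(2)[OF *]]) (use * in \<open>simp add: dr2_mul\<close>)
    show "lin A (A \<otimes> A) (\<lambda>z. mul (A \<otimes> A) (dr2 A \<Delta> z a) (ten A A x y))"
      by (rule c[THEN iffD2, OF _ 1[of "ten A A x (mul A a y)"]]) (use * algA in \<open>simp_all add: dr2_mul\<close>)
  qed (use dr2_carr in auto)
qed

lemma dr2_right: "a \<in> carr A \<Longrightarrow> c \<in> carr A \<Longrightarrow> d \<in> carr A \<Longrightarrow>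
    dr2 A \<Delta> a (mul A c d) = tmap A A A A (\<lambda>x. x) (\<lambda>x. mul A x d) (dr2 A \<Delta> a c)"
  by (rule tensor_nd_eqI[OF ndA ndA])
    (use algA in \<open>simp_all add: dr2_carr tmap_carr[OF vA vA lin_id lin_rmul] mul_tmap dr2_mul mul_assoc\<close>)

lemma dr1_right: "a \<in> carr A \<Longrightarrow> c \<in> carr A \<Longrightarrow> d \<in> carr A \<Longrightarrow>
    dr1 A \<Delta> a (mul A c d) = tmap A A A A (\<lambda>x. mul A x d) (\<lambda>x. x) (dr1 A \<Delta> a c)"
  by (rule tensor_nd_eqI[OF ndA ndA])
    (use algA in \<open>simp_all add: dr1_carr tmap_carr[OF vA vA lin_rmul lin_id] mul_tmap dr1_mul mul_assoc\<close>)

text \<open>Both sides are \<Delta>(a)(x \<otimes> y).\<close>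

lemma dr_swap: "a \<in> carr A \<Longrightarrow> x \<in> carr A \<Longrightarrow> y \<in> carr A \<Longrightarrow>
    tmap A A A A (\<lambda>z. mul A z x) (\<lambda>z. z) (dr2 A \<Delta> a y) = tmap A A A A (\<lambda>z. z) (\<lambda>z. mul A z y) (dr1 A \<Delta> a x)"
  by (rule tensor_nd_eqI[OF ndA ndA])
    (use algA in \<open>simp_all add: dr1_carr dr2_carr tmap_carr[OF vA vA] lin_rmul lin_id mul_tmap dr1_mul dr2_mul mul_assoc\<close>)

text \<open>The \<open>tlift\<close> is left multiplication by \<Delta>(a), so both parts express
  \<Delta>(a b) = \<Delta>(a) \<Delta>(b), covered on the right.\<close>

lemma dr2_hom:
  assumes a: "a \<in> carr A" and b: "b \<in> carr A" and c: "c \<in> carr A"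
  shows "dr2 A \<Delta> (mul A a b) c = tlift A A (\<lambda>x y. tmap A A A A (\<lambda>z. mul A z x) (\<lambda>z. z) (dr2 A \<Delta> a y)) (dr2 A \<Delta> b c)"
    and "dr1 A \<Delta> (mul A a b) c = tlift A A (\<lambda>x y. tmap A A A A (\<lambda>z. mul A z x) (\<lambda>z. z) (dr2 A \<Delta> a y)) (dr1 A \<Delta> b c)"
proof -
  let ?f = "\<lambda>x y. tmap A A A A (\<lambda>z. mul A z x) (\<lambda>z. z) (dr2 A \<Delta> a y)"
  have bK: "bil A A (A \<otimes> A) ?f"
    by (intro bilI lin_comp[OF bil_lin2[OF bil_dr2] lin_tmap[OF vA vA]], unfold tmap_def)
      (auto intro!: lin_rmul lin_id lin_tlift_param[OF vA vA vsp_tensor vA] bil_tmap lin_ten1 lin_lmul simp: dr2_carr a)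
  note lK = lin_tlift[OF vA vA vsp_tensor bK]
  note m = bil_lin1[OF bil_mul_tensor[OF algA algA]]
  have 1: "mul (A \<otimes> A) (tlift A A ?f t) (ten A A u v) = fst (\<Delta> a) (mul (A \<otimes> A) t (ten A A u v))"
    if t: "t \<in> tcarr A A" and uv: "u \<in> carr A" "v \<in> carr A" for t u v
    by (rule tensor_eqI[OF vA vA lin_comp[OF lK m] lin_comp[OF m mult_lin1[OF \<Delta>_mult[OF a]]] t])
      (use uv a algA in \<open>simp_all add: tlift_ten[OF vA vA vsp_tensor bK] mul_tmap dr2_carr dr2_mul mul_ten\<close>)
  have tc: "tlift A A ?f t \<in> tcarr A A" if "t \<in> tcarr A A" for t using lin_carr[OF lK] that by simp
  show "dr2 A \<Delta> (mul A a b) c = tlift A A ?f (dr2 A \<Delta> b c)"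
    by (rule tensor_nd_eqI[OF ndA ndA])
      (use a b c algA in \<open>simp_all add: dr2_carr tc 1 dr2_mul \<Delta>_mul\<close>)
  show "dr1 A \<Delta> (mul A a b) c = tlift A A ?f (dr1 A \<Delta> b c)"
    by (rule tensor_nd_eqI[OF ndA ndA])
      (use a b c algA in \<open>simp_all add: dr1_carr tc 1 dr1_mul \<Delta>_mul\<close>)
qed

text \<open>(b \<otimes> 1)\<Delta>(c)(1 \<otimes> d) is the tensor (b \<otimes> 1)\<Delta>(c) with
  d multiplied onto its second leg, which is the membership that \<open>left_local_unit\<close> asks
  for.\<close>

lemma left_unit:
  assumes "bij_betw (tlift A A (dr2 A \<Delta>)) (tcarr A A) (tcarr A A)" and "a \<in> carr A"
  shows "\<exists>e\<in>carr A. mul A e a = a"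
proof (rule left_local_unit[OF ndA bil_dr2 assms(1) dr2_right _ assms(2)])
  fix b c d assume *: "b \<in> carr A" "c \<in> carr A" "d \<in> carr A"
  have "tmap A A A A (mul A b) (\<lambda>x. x) (dr2 A \<Delta> c d) = tmap A A A A (\<lambda>x. x) (\<lambda>x. mul A x d) (dl1 A \<Delta> c b)"
    by (rule tensor_nd_eqI[OF ndA ndA])
      (use * algA in \<open>simp_all add: dr2_carr dl1_carr tmap_carr[OF vA vA] lin_rmul lin_lmul lin_id mul_tmap dl1_mul dr2_mul\<close>)
  then show "\<exists>s\<in>tcarr A A. tmap A A A A (mul A b) (\<lambda>x. x) (dr2 A \<Delta> c d) = tmap A A A A (\<lambda>x. x) (\<lambda>x. mul A x d) s"
    using dl1_carr * by blast
qed

end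

lemma covered0_bil:
  assumes c: "covered0 A \<Delta>"
  shows "bil A A (A \<otimes> A) (dr1 A \<Delta>)" "bil A A (A \<otimes> A) (dr2 A \<Delta>)" "bil A A (A \<otimes> A) (dl1 A \<Delta>)" "bil A A (A \<otimes> A) (dl2 A \<Delta>)"
proof -
  interpret covered_comult A \<Delta> by unfold_locales (rule c)
  interpret op: covered_comult "op_alg A" "op_comult \<Delta>" by unfold_locales (rule covered0_op(1)[OF c])
  have *: "bil A A (A \<otimes> A) f \<Longrightarrow> (\<And>a b. a \<in> carr A \<Longrightarrow> b \<in> carr A \<Longrightarrow> f a b = g a b) \<Longrightarrow> bil A A (A \<otimes> A) g" for f g
    unfolding bil_def using lin_cong[OF _ vA] by (smt (verit))
  show "bil A A (A \<otimes> A) (dr1 A \<Delta>)" "bil A A (A \<otimes> A) (dr2 A \<Delta>)" by (rule bil_dr1 bil_dr2)+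
  show "bil A A (A \<otimes> A) (dl1 A \<Delta>)" "bil A A (A \<otimes> A) (dl2 A \<Delta>)"
    by (rule *[OF op.bil_dr1[simplified]], simp add: covered0_op[OF c]) (rule *[OF op.bil_dr2[simplified]], simp add: covered0_op[OF c])
qed

lemma covered_units:
  assumes c: "covered A \<Delta>" and F: "finite F" "F \<subseteq> carr A"
  shows "\<exists>e\<in>carr A. \<forall>a\<in>F. mul A e a = a \<and> mul A a e = a"
proof (rule two_sided_local_units[OF _ _ _ F])
  interpret covered_comult A \<Delta> by unfold_locales (use c in \<open>simp add: covered_def\<close>)
  interpret op: covered_comult "op_alg A" "op_comult \<Delta>"
    by unfold_locales (use covered_op[OF c] in \<open>simp add: covered_def\<close>)
  show "is_algebra A" by (rule algA)
  show "\<exists>e\<in>carr A. mul A e a = a" if "a \<in> carr A" for a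
    using left_unit[OF _ that] c by (simp add: covered_def)
  show "\<exists>e\<in>carr A. mul A a e = a" if "a \<in> carr A" for a
    using op.left_unit[of a] that covered_op[OF c] by (simp add: covered_def)
qed

text \<open>Flipping \<Delta>(a)(c \<otimes> 1) gives the co-opposite comultiplication covered by 1
  \<otimes> c, which is the role of the second map.\<close>

lemma paired_hopfI:
  assumes P: "paired_algebras A B p l r" and c: "covered A \<Delta>"
    and r: "\<And>a b c. a \<in> carr A \<Longrightarrow> b \<in> carr B \<Longrightarrow> c \<in> carr A \<Longrightarrow> slice1 A A (\<lambda>x. p x b) (dr2 A \<Delta> a c) = mul A (r b a) c"
    and l: "\<And>a b c. a \<in> carr A \<Longrightarrow> b \<in> carr B \<Longrightarrow> c \<in> carr A \<Longrightarrow> slice2 A A (\<lambda>x. p x b) (dr1 A \<Delta> a c) = mul A (l b a) c"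
  shows "paired_hopf A B p l r (dr2 A \<Delta>) (\<lambda>a c. flip A A (dr1 A \<Delta> a c))"
proof -
  interpret paired_algebras A B p l r by (rule P)
  interpret covered_comult A \<Delta> by unfold_locales (use c in \<open>simp add: covered_def\<close>)
  have bij_dr1: "bij_betw (tlift A A (dr1 A \<Delta>)) (tcarr A A) (tcarr A A)" 
    and bij_dr2: "bij_betw (tlift A A (dr2 A \<Delta>)) (tcarr A A) (tcarr A A)"
    using c by (simp_all add: covered_def)
  let ?T' = "\<lambda>a c. flip A A (dr1 A \<Delta> a c)"
  note lf = lin_flip[OF vA vA]
  have bT': "bil A A (A \<otimes> A) ?T'"
    by (intro bilI lin_comp[OF bil_lin1[OF bil_dr1] lf] lin_comp[OF bil_lin2[OF bil_dr1] lf])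
  have tf: "tlift A A ?T' t = flip A A (tlift A A (dr1 A \<Delta>) t)" if "t \<in> tcarr A A" for t
    by (rule tlift_tlift[symmetric, OF vA vA vsp_tensor vsp_tensor bil_dr1 lf that])
  have bij: "bij_betw (tlift A A ?T') (tcarr A A) (tcarr A A)"
    using bij_betw_trans[OF bij_dr1 flip_bij[OF vA vA]] bij_betw_cong[of "tcarr A A" "tlift A A ?T'" "flip A A \<circ> tlift A A (dr1 A \<Delta>)"] tf
    by simp
  have ff: "flip A A (tmap A A A A f g t) = tmap A A A A g f (flip A A t)" if "lin A A f" "lin A A g" "t \<in> tcarr A A" for f g t
    by (rule flip_tmap[OF vA vA vA vA that])
  show ?thesis
  proof unfold_locales
    fix a c d assume *: "a \<in> carr A" "c \<in> carr A" "d \<in> carr A"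
    show "flip A A (dr1 A \<Delta> a (mul A c d)) = tmap A A A A (\<lambda>x. x) (\<lambda>x. mul A x d) (flip A A (dr1 A \<Delta> a c))"
      using * by (simp add: dr1_right ff lin_rmul lin_id dr1_carr)
    show "flip A A (tmap A A A A (\<lambda>z. mul A z c) (\<lambda>z. z) (dr2 A \<Delta> a d)) = tmap A A A A (\<lambda>z. mul A z d) (\<lambda>z. z) (flip A A (dr1 A \<Delta> a c))"
      using * by (simp add: dr_swap ff lin_rmul lin_id dr1_carr)
    have bK: "bil A A (A \<otimes> A) (\<lambda>x y. tmap A A A A (\<lambda>z. mul A z x) (\<lambda>z. z) (dr2 A \<Delta> a y))"
      by (intro bilI lin_comp[OF bil_lin2[OF bil_dr2] lin_tmap[OF vA vA]], unfold tmap_def)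
        (auto intro!: lin_rmul lin_id lin_tlift_param[OF vA vA vsp_tensor vA] bil_tmap lin_ten1 lin_lmul simp: dr2_carr *)
    have bK': "bil A A (A \<otimes> A) (\<lambda>x y. tmap A A A A (\<lambda>z. mul A z x) (\<lambda>z. z) (flip A A (dr1 A \<Delta> a y)))"
      by (intro bilI lin_comp[OF bil_lin2[OF bT'] lin_tmap[OF vA vA]], unfold tmap_def)
        (auto intro!: lin_rmul lin_id lin_tlift_param[OF vA vA vsp_tensor vA] bil_tmap lin_ten1 lin_lmul simp: dr1_carr flip_carr[OF vA vA] *)
    have sw: "tmap A A A A (\<lambda>z. mul A z y) (\<lambda>z. z) (flip A A (dr1 A \<Delta> a x)) = flip A A (tmap A A A A (\<lambda>z. mul A z x) (\<lambda>z. z) (dr2 A \<Delta> a y))"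
      if "x \<in> carr A" "y \<in> carr A" for x y
      using that * by (simp add: dr_swap ff lin_rmul lin_id dr1_carr)
    have "flip A A (tlift A A (\<lambda>x y. tmap A A A A (\<lambda>z. mul A z x) (\<lambda>z. z) (dr2 A \<Delta> a y)) t)
      = tlift A A (\<lambda>x y. tmap A A A A (\<lambda>z. mul A z x) (\<lambda>z. z) (flip A A (dr1 A \<Delta> a y))) (flip A A t)" if "t \<in> tcarr A A" for t
      by (rule tensor_eqI[OF vA vA lin_comp[OF lin_tlift[OF vA vA vsp_tensor bK] lf] lin_comp[OF lf lin_tlift[OF vA vA vsp_tensor bK']] that])
       (simp add: tlift_ten[OF vA vA vsp_tensor bK] tlift_ten[OF vA vA vsp_tensor bK'] flip_ten[OF vA vA] sw)
    then show "flip A A (dr1 A \<Delta> (mul A a c) d)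
      = tlift A A (\<lambda>x y. tmap A A A A (\<lambda>z. mul A z x) (\<lambda>z. z) (flip A A (dr1 A \<Delta> a y))) (flip A A (dr1 A \<Delta> c d))"
      using * by (simp add: dr2_hom(2) dr1_carr)
  next
    fix a b c assume "a \<in> carr A" "b \<in> carr B" "c \<in> carr A"
    then show "slice1 A A (\<lambda>x. p x b) (flip A A (dr1 A \<Delta> a c)) = mul A (l b a) c"
      using l[of a b c] by (simp add: slice1_flip[OF vA vA p1] dr1_carr)
  qed (use bil_dr2 bT' bij_dr2 bij dr2_right dr2_hom(1) r in auto)
qed

text \<open>If conjugation by the flip carries m to an element of A \<otimes> A, then m itself is
  such an element. This is the passage from \<open>co_comult\<close> back to \<Delta>.\<close>

lemma flip_multiplier:
  assumes A: "nd_algebra A" and m: "m \<in> carr (mult_alg (A \<otimes> A))"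
    and f: "\<And>t. t \<in> tcarr A A \<Longrightarrow> fst m' (flip A A t) = flip A A (fst m t)" and e: "m' \<in> emb_image (A \<otimes> A)"
  shows "m \<in> emb_image (A \<otimes> A)" "unemb (A \<otimes> A) m = flip A A (unemb (A \<otimes> A) m')"
proof -
  have al: "is_algebra A" and v: "vsp A" and nd: "nd_algebra (A \<otimes> A)" using A by simp_all
  define t' where "t' = unemb (A \<otimes> A) m'"
  have t': "t' \<in> tcarr A A" using unemb_carr[OF nd e] by (simp add: t'_def)
  have t: "flip A A t' \<in> tcarr A A" by (rule flip_carr[OF v v t'])
  have x: "fst m x = mul (A \<otimes> A) (flip A A t') x" if x: "x \<in> tcarr A A" for x
  proof -
    have mx: "fst m x \<in> tcarr A A" using mult_carr1[OF m] x by simp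
    have "flip A A (fst m x) = mul (A \<otimes> A) t' (flip A A x)"
      using f[OF x] mul_unemb1[OF nd e, of "flip A A x"] flip_carr[OF v v x] by (simp add: t'_def)
    then have "flip A A (flip A A (fst m x)) = mul (A \<otimes> A) (flip A A t') (flip A A (flip A A x))"
      using flip_mul[OF al al t' flip_carr[OF v v x]] by simp
    then show ?thesis using x mx by (simp add: flip_flip[OF v v])
  qed
  have "m = emb (A \<otimes> A) (flip A A t')"
    by (rule emb_eqI[OF nd m]) (use t x in simp_all)
  then show "m \<in> emb_image (A \<otimes> A)" "unemb (A \<otimes> A) m = flip A A (unemb (A \<otimes> A) m')"
    using t unemb_emb[OF nd] by (simp_all add: t'_def)
qed

lemma tlift_swap:
  assumes v: "vsp A" and f: "bil A A (A \<otimes> A) f" and t: "t \<in> tcarr A A"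
  shows "tlift A A (\<lambda>x y. f y x) t = tlift A A f (flip A A t)"
  by (rule tensor_eqI[OF v v lin_tlift[OF v v vsp_tensor bil_swap[OF f]] lin_comp[OF lin_flip[OF v v] lin_tlift[OF v v vsp_tensor f]] t])
    (simp add: tlift_ten[OF v v vsp_tensor f] tlift_ten[OF v v vsp_tensor bil_swap[OF f]] flip_ten[OF v v])

text \<open>The axioms for \<Delta> give \<open>dr2\<close> and \<open>dl1\<close> directly; those
  for \<open>co_comult\<close> give \<open>dr1\<close> and \<open>dl2\<close> after
  flipping.\<close>

lemma regular_covered:
  assumes R: "regular_mult_hopf_alg A \<Delta>" shows "covered A \<Delta>"
proof -
  let ?co = "co_comult A \<Delta>"
  have A: "nd_algebra A" and h: "alg_hom A (mult_alg (A \<otimes> A)) \<Delta>"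
    and m2: "\<And>a b. a \<in> carr A \<Longrightarrow> b \<in> carr A \<Longrightarrow> \<Delta> a \<cdot> leg2 A A b \<in> emb_image (A \<otimes> A)"
    "\<And>a b. a \<in> carr A \<Longrightarrow> b \<in> carr A \<Longrightarrow> leg1 A A a \<cdot> \<Delta> b \<in> emb_image (A \<otimes> A)"
    "\<And>a b. a \<in> carr A \<Longrightarrow> b \<in> carr A \<Longrightarrow> ?co a \<cdot> leg2 A A b \<in> emb_image (A \<otimes> A)"
    "\<And>a b. a \<in> carr A \<Longrightarrow> b \<in> carr A \<Longrightarrow> leg1 A A a \<cdot> ?co b \<in> emb_image (A \<otimes> A)"
    and b: "bij_betw (tlift A A (T1 A \<Delta>)) (tcarr A A) (tcarr A A)" "bij_betw (tlift A A (T2 A \<Delta>)) (tcarr A A) (tcarr A A)"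
    "bij_betw (tlift A A (T1 A ?co)) (tcarr A A) (tcarr A A)" "bij_betw (tlift A A (T2 A ?co)) (tcarr A A) (tcarr A A)"
    using R unfolding regular_mult_hopf_alg_def mult_hopf_alg_def tensor_alg_simps by blast+
  have al: "is_algebra A" and v: "vsp A" and nd: "nd_algebra (A \<otimes> A)" using A by simp_all
  note fh = flip_alg_hom[OF al al]
  have fs: "flip A A ` carr (A \<otimes> A) = carr (A \<otimes> A)" using flip_bij[OF v v] by (simp add: bij_betw_def)
  note D = hom_lin_mult[OF h]
  have co: "fst (?co a) (flip A A t) = flip A A (fst (\<Delta> a) t)" if "a \<in> carr A" "t \<in> tcarr A A" for a t
    unfolding co_comult_def using ext_alg_fst[OF nd nd fh fs D[OF that(1)], of t] that(2) by simp
  have leg: "fst (leg2 A A c) (flip A A t) = flip A A (fst (leg1 A A c) t)" "fst (leg1 A A c) (flip A A t) = flip A A (fst (leg2 A A c) t)"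
    if c: "c \<in> carr A" and t: "t \<in> tcarr A A" for c t
    by (rule tensor_eqI[OF v v lin_comp[OF lin_flip[OF v v] mult_lin1[OF leg2_mult[OF al al c]]] lin_comp[OF mult_lin1[OF leg1_mult[OF al al c]] lin_flip[OF v v]] t],
      use c al in \<open>simp add: flip_ten[OF v v] leg1_ten[OF al al] leg2_ten[OF al al]\<close>)
      (rule tensor_eqI[OF v v lin_comp[OF lin_flip[OF v v] mult_lin1[OF leg1_mult[OF al al c]]] lin_comp[OF mult_lin1[OF leg2_mult[OF al al c]] lin_flip[OF v v]] t],
      use c al in \<open>simp add: flip_ten[OF v v] leg1_ten[OF al al] leg2_ten[OF al al]\<close>)
  note l = leg1_mult[OF al al] leg2_mult[OF al al]
  have c1: "\<Delta> a \<cdot> leg1 A A c \<in> emb_image (A \<otimes> A) \<and> dr1 A \<Delta> a c = flip A A (T1 A ?co a c)" if ac: "a \<in> carr A" "c \<in> carr A" for a c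
  proof -
    have "fst (?co a \<cdot> leg2 A A c) (flip A A t) = flip A A (fst (\<Delta> a \<cdot> leg1 A A c) t)" if "t \<in> tcarr A A" for t
      using ac that mult_carr1[OF l(1)] by (simp add: leg co)
    from flip_multiplier[OF A mmul_mult[OF vsp_tensor D l(1)] this m2(3)] show ?thesis
      using ac by (simp add: dr1_def T1_def)
  qed
  have c2: "leg2 A A c \<cdot> \<Delta> a \<in> emb_image (A \<otimes> A) \<and> dl2 A \<Delta> a c = flip A A (T2 A ?co c a)" if ac: "a \<in> carr A" "c \<in> carr A" for a c
  proof -
    have "fst (leg1 A A c \<cdot> ?co a) (flip A A t) = flip A A (fst (leg2 A A c \<cdot> \<Delta> a) t)" if "t \<in> tcarr A A" for t
      using ac that mult_carr1[OF D] by (simp add: leg co)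
    from flip_multiplier[OF A mmul_mult[OF vsp_tensor l(2) D] this m2(4)] show ?thesis
      using ac by (simp add: dl2_def T2_def)
  qed
  have c0: "covered0 A \<Delta>" unfolding covered0_def by (intro conjI ballI A h m2) (use c1 c2 in blast)+
  note bil = covered0_bil[OF c0]
  note f = flip_bij[OF v v] and lf = lin_flip[OF v v]
  interpret covered_comult A \<Delta> by unfold_locales (rule c0)
  have "tlift A A (dr2 A \<Delta>) = tlift A A (T1 A \<Delta>)" by (rule tlift_cong) (simp add: dr2_def T1_def)
  moreover have "bij_betw (tlift A A (dr1 A \<Delta>)) (tcarr A A) (tcarr A A)"
  proof -
    have ff: "flip A A (dr1 A \<Delta> a c) = T1 A ?co a c" if "a \<in> carr A" "c \<in> carr A" for a c
      using c1[OF that] flip_flip[OF v v] unemb_carr[OF nd m2(3)[OF that]] by (simp add: T1_def)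
    have "flip A A (tlift A A (dr1 A \<Delta>) t) = tlift A A (T1 A ?co) t" if t: "t \<in> tcarr A A" for t
      unfolding tlift_tlift[OF v v vsp_tensor vsp_tensor bil(1) lf t] by (rule fun_cong[OF tlift_cong]) (simp add: ff)
    then have e: "tlift A A (dr1 A \<Delta>) t = (flip A A \<circ> tlift A A (T1 A ?co)) t" if t: "t \<in> tcarr A A" for t
      using flip_flip[OF v v, of "tlift A A (dr1 A \<Delta>) t"] lin_carr[OF lin_tlift[OF v v vsp_tensor bil(1)], of t] t by simp
    show ?thesis by (rule bij_betw_cong[OF e, THEN iffD2, OF _ bij_betw_trans[OF b(3) f]])
  qed
  moreover have "bij_betw (tlift A A (dl1 A \<Delta>)) (tcarr A A) (tcarr A A)"
  proof -
    have "T2 A \<Delta> = (\<lambda>x y. dl1 A \<Delta> y x)" by (simp add: T2_def dl1_def fun_eq_iff)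
    then have "tlift A A (T2 A \<Delta>) t = tlift A A (dl1 A \<Delta>) (flip A A t)" if "t \<in> tcarr A A" for t
      using tlift_swap[OF v bil(3) that] by simp
    then have e: "tlift A A (dl1 A \<Delta>) t = (tlift A A (T2 A \<Delta>) \<circ> flip A A) t" if "t \<in> tcarr A A" for t
      using that flip_flip[OF v v that] flip_carr[OF v v that] by simp
    show ?thesis by (rule bij_betw_cong[OF e, THEN iffD2, OF _ bij_betw_trans[OF f b(2)]])
  qed
  moreover have "bij_betw (tlift A A (dl2 A \<Delta>)) (tcarr A A) (tcarr A A)"
  proof -
    have ff: "flip A A (dl2 A \<Delta> a c) = T2 A ?co c a" if "a \<in> carr A" "c \<in> carr A" for a c
      using c2[OF that] flip_flip[OF v v] unemb_carr[OF nd m2(4)[OF that(2,1)]] by (simp add: T2_def)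
    have bs: "bil A A (A \<otimes> A) (\<lambda>x y. flip A A (dl2 A \<Delta> y x))"
      by (intro bilI lin_comp[OF bil_lin1[OF bil(4)] lf] lin_comp[OF bil_lin2[OF bil(4)] lf])
    have "tlift A A (T2 A ?co) t = flip A A (tlift A A (dl2 A \<Delta>) (flip A A t))" if t: "t \<in> tcarr A A" for t
    proof -
      have "tlift A A (T2 A ?co) t = tlift A A (\<lambda>x y. flip A A (dl2 A \<Delta> y x)) t"
        by (rule fun_cong[OF tlift_cong]) (simp add: ff)
      also have "\<dots> = tlift A A (\<lambda>x y. flip A A (dl2 A \<Delta> x y)) (flip A A t)"
        by (rule tlift_swap[OF v bil_swap[OF bs] t])
      also have "\<dots> = flip A A (tlift A A (dl2 A \<Delta>) (flip A A t))"
        by (rule tlift_tlift[symmetric, OF v v vsp_tensor vsp_tensor bil(4) lf flip_carr[OF v v t]])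
      finally show ?thesis .
    qed
    then have e: "tlift A A (dl2 A \<Delta>) t = (flip A A \<circ> (tlift A A (T2 A ?co) \<circ> flip A A)) t" if t: "t \<in> tcarr A A" for t
      using t flip_flip[OF v v] flip_carr[OF v v t] lin_carr[OF lin_tlift[OF v v vsp_tensor bil(4)], of t] by simp
    show ?thesis by (rule bij_betw_cong[OF e, THEN iffD2, OF _ bij_betw_trans[OF bij_betw_trans[OF f b(4)] f]])
  qed
  ultimately show ?thesis unfolding covered_def using c0 b(1) by simp
qed

section \<open>Pairings and the canonical multiplier\<close>

text \<open>In a unital module each element is a finite sum of terms l b a, hence fixed by every e
  that is a unit for the finitely many b involved. One e for all these b serves finitely many
  elements and both actions.\<close>

lemma module_local_units:
  assumes P: "algebra_pairing A B p l r"
    and u: "\<And>F. finite F \<Longrightarrow> F \<subseteq> carr B \<Longrightarrow> \<exists>e\<in>carr B. \<forall>b\<in>F. mul B e b = b \<and> mul B b e = b"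
    and sl: "lspan A {l b a | a b. a \<in> carr A \<and> b \<in> carr B} = carr A"
    and sr: "lspan A {r b a | a b. a \<in> carr A \<and> b \<in> carr B} = carr A"
  shows "paired_algebras A B p l r"
proof -
  interpret algebra_pairing A B p l r by (rule P)
  have P': "algebra_pairing A (op_alg B) p r l"
    using ndA algB bil_p sepA sepB l_carr r_carr p_l p_r by unfold_locales auto
  interpret sw: algebra_pairing A "op_alg B" p r l by (rule P')
  define U where "U F e \<longleftrightarrow> e \<in> carr B \<and> (\<forall>b\<in>F. mul B e b = b \<and> mul B b e = b)" for F e
  have Ul: "\<exists>F. finite F \<and> F \<subseteq> carr B \<and> (\<forall>e. U F e \<longrightarrow> l e a = a)" if "a \<in> carr A" for a
  proof (rule span_image_induct[OF vA sl that vB bil_swap[OF bil_l]])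
    fix a b assume ab: "a \<in> carr A" "b \<in> carr B"
    show "\<exists>F. finite F \<and> F \<subseteq> carr B \<and> (\<forall>e. U F e \<longrightarrow> l e (l b a) = l b a)"
      by (rule exI[of _ "{b}"]) (use ab in \<open>auto simp: U_def l_l\<close>)
  next
    fix x y assume xy: "x \<in> carr A" "y \<in> carr A" "\<exists>F. finite F \<and> F \<subseteq> carr B \<and> (\<forall>e. U F e \<longrightarrow> l e x = x)"
      "\<exists>F. finite F \<and> F \<subseteq> carr B \<and> (\<forall>e. U F e \<longrightarrow> l e y = y)"
    then obtain F G where "finite F" "F \<subseteq> carr B" "\<forall>e. U F e \<longrightarrow> l e x = x" "finite G" "G \<subseteq> carr B" "\<forall>e. U G e \<longrightarrow> l e y = y" by blast
    then show "\<exists>F. finite F \<and> F \<subseteq> carr B \<and> (\<forall>e. U F e \<longrightarrow> l e (x + y) = x + y)"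
      using xy by (intro exI[of _ "F \<union> G"]) (auto simp: U_def lin_add[OF lin_l])
  qed (rule vA)
  have Ur: "\<exists>F. finite F \<and> F \<subseteq> carr B \<and> (\<forall>e. U F e \<longrightarrow> r e a = a)" if "a \<in> carr A" for a
  proof (rule span_image_induct[OF vA sr that vB bil_swap[OF sw.bil_l[simplified]]])
    fix a b assume ab: "a \<in> carr A" "b \<in> carr B"
    show "\<exists>F. finite F \<and> F \<subseteq> carr B \<and> (\<forall>e. U F e \<longrightarrow> r e (r b a) = r b a)"
      by (rule exI[of _ "{b}"]) (use ab in \<open>auto simp: U_def r_r\<close>)
  next
    fix x y assume xy: "x \<in> carr A" "y \<in> carr A" "\<exists>F. finite F \<and> F \<subseteq> carr B \<and> (\<forall>e. U F e \<longrightarrow> r e x = x)"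
      "\<exists>F. finite F \<and> F \<subseteq> carr B \<and> (\<forall>e. U F e \<longrightarrow> r e y = y)"
    then obtain F G where "finite F" "F \<subseteq> carr B" "\<forall>e. U F e \<longrightarrow> r e x = x" "finite G" "G \<subseteq> carr B" "\<forall>e. U G e \<longrightarrow> r e y = y" by blast
    then show "\<exists>F. finite F \<and> F \<subseteq> carr B \<and> (\<forall>e. U F e \<longrightarrow> r e (x + y) = x + y)"
      using xy by (intro exI[of _ "F \<union> G"]) (auto simp: U_def lin_add[OF sw.lin_l])
  qed (rule vA)
  have "\<exists>e\<in>carr B. \<forall>a\<in>F. l e a = a \<and> r e a = a" if F: "finite F" "F \<subseteq> carr A" for F
  proof -
    have "\<forall>a\<in>F. \<exists>G. finite G \<and> G \<subseteq> carr B \<and> (\<forall>e. U G e \<longrightarrow> l e a = a \<and> r e a = a)"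
    proof
      fix a assume "a \<in> F"
      then have "a \<in> carr A" using F by blast
      from Ul[OF this] Ur[OF this] obtain G G' where G: "finite G" "G \<subseteq> carr B" "\<forall>e. U G e \<longrightarrow> l e a = a"
        "finite G'" "G' \<subseteq> carr B" "\<forall>e. U G' e \<longrightarrow> r e a = a" by blast
      then show "\<exists>G. finite G \<and> G \<subseteq> carr B \<and> (\<forall>e. U G e \<longrightarrow> l e a = a \<and> r e a = a)"
        by (intro exI[of _ "G \<union> G'"]) (auto simp: U_def)
    qed
    then obtain G where G: "\<And>a. a \<in> F \<Longrightarrow> finite (G a) \<and> G a \<subseteq> carr B \<and> (\<forall>e. U (G a) e \<longrightarrow> l e a = a \<and> r e a = a)" by metis
    obtain e where e: "e \<in> carr B" "\<forall>b\<in>(\<Union>a\<in>F. G a). mul B e b = b \<and> mul B b e = b"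
      using u[of "\<Union>a\<in>F. G a"] G F(1) by blast
    then have "U (G a) e" if "a \<in> F" for a using that by (auto simp: U_def)
    then show ?thesis using G e by blast
  qed
  then show ?thesis by unfold_locales
qed

locale hopf_pairing =
  fixes A :: "('k::field, 'a::ab_group_add) alg" and \<Delta>A :: "('k, 'a) comult"
    and B :: "('k, 'b::ab_group_add) alg" and \<Delta>B :: "('k, 'b) comult" and p :: "'a \<Rightarrow> 'b \<Rightarrow> 'k"
  assumes pairing: "pairing A \<Delta>A B \<Delta>B p"
begin

text \<open>\<open>l b a\<close> and \<open>r b a\<close> are b acting on a from the left and from
  the right, \<open>lB a b\<close> and \<open>rB a b\<close> are a acting on b likewise; the acting
  element always comes first.\<close>

definition l where "l b a = hit2 A \<Delta>A (\<lambda>x. p x b) a"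
definition r where "r b a = hit1 A \<Delta>A (\<lambda>x. p x b) a"
definition lB where "lB a b = hit2 B \<Delta>B (p a) b"
definition rB where "rB a b = hit1 B \<Delta>B (p a) b"

lemma regA: "regular_mult_hopf_alg A \<Delta>A" and regB: "regular_mult_hopf_alg B \<Delta>B"
  using pairing unfolding pairing_def by blast+

lemma covA: "covered A \<Delta>A" and covB: "covered B \<Delta>B"
  using regular_covered regA regB by blast+

lemma mslices:
  assumes "a \<in> carr A" "b \<in> carr B"
  shows "mslice2 B \<Delta>B (p a) b \<in> emb_image B" "mslice1 B \<Delta>B (p a) b \<in> emb_image B"
    "mslice2 A \<Delta>A (\<lambda>x. p x b) a \<in> emb_image A" "mslice1 A \<Delta>A (\<lambda>x. p x b) a \<in> emb_image A"
  using pairing assms unfolding pairing_def by blast+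

lemma ndA: "nd_algebra A" and ndB: "nd_algebra B"
  using covA covB unfolding covered_def covered0_def by blast+

lemma pairA: "algebra_pairing A B p l r"
proof
  have "bilinear_on A B (*) p" using pairing unfolding pairing_def by blast
  then show "bil A B field_alg p" by (intro bilinear_on_bil) simp_all
  have compat: "\<forall>a\<in>carr A. \<forall>b\<in>carr B. \<forall>b'\<in>carr B.
      p a (mul B b b') = p (hit2 A \<Delta>A (\<lambda>x. p x b') a) b \<and> p a (mul B b b') = p (hit1 A \<Delta>A (\<lambda>x. p x b) a) b'"
    using pairing unfolding pairing_def by blast
  fix a b c assume *: "a \<in> carr A" "b \<in> carr B" "c \<in> carr B"
  show "p (l b a) c = p a (mul B c b)" "p (r b a) c = p a (mul B b c)"
    using compat * unfolding l_def r_def by metis+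
  show "l b a \<in> carr A" "r b a \<in> carr A"
    unfolding l_def r_def hit1_def hit2_def by (intro unemb_carr[OF ndA] mslices *)+
next
  show "a = 0" if "a \<in> carr A" "\<And>b. b \<in> carr B \<Longrightarrow> p a b = 0" for a
    using pairing that unfolding pairing_def by blast
  show "b = 0" if "b \<in> carr B" "\<And>a. a \<in> carr A \<Longrightarrow> p a b = 0" for b
    using pairing that unfolding pairing_def by blast
qed (use ndA ndB in simp_all)

text \<open>The abstract setting with A and B exchanged, so that the actions on B share its
  lemmas.\<close>

lemma pairB: "algebra_pairing B A (\<lambda>b a. p a b) lB rB"
proof
  show "bil B A field_alg (\<lambda>b a. p a b)" by (rule bil_swap[OF algebra_pairing.bil_p[OF pairA]])
  have compat: "\<forall>a\<in>carr A. \<forall>a'\<in>carr A. \<forall>b\<in>carr B.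
      p (mul A a a') b = p a (hit2 B \<Delta>B (p a') b) \<and> p (mul A a a') b = p a' (hit1 B \<Delta>B (p a) b)"
    using pairing unfolding pairing_def by blast
  fix a b c assume *: "b \<in> carr B" "a \<in> carr A" "c \<in> carr A"
  show "p c (lB a b) = p (mul A c a) b" "p c (rB a b) = p (mul A a c) b"
    using compat * unfolding lB_def rB_def by metis+
  show "lB a b \<in> carr B" "rB a b \<in> carr B"
    unfolding lB_def rB_def hit1_def hit2_def by (intro unemb_carr[OF ndB] mslices *)+
next
  show "a = 0" if "a \<in> carr A" "\<And>b. b \<in> carr B \<Longrightarrow> p a b = 0" for a
    using pairing that unfolding pairing_def by blast
  show "b = 0" if "b \<in> carr B" "\<And>a. a \<in> carr A \<Longrightarrow> p a b = 0" for b
    using pairing that unfolding pairing_def by blast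
qed (use ndA ndB in simp_all)

sublocale A: paired_algebras A B p l r
proof (rule module_local_units[OF pairA covered_units[OF covB]])
  show "lspan A {l b a |a b. a \<in> carr A \<and> b \<in> carr B} = carr A" "lspan A {r b a |a b. a \<in> carr A \<and> b \<in> carr B} = carr A"
    using pairing unfolding pairing_def l_def r_def by blast+
qed

sublocale B: paired_algebras B A "\<lambda>b a. p a b" lB rB
proof (rule module_local_units[OF pairB covered_units[OF covA]])
  have e: "{hit2 B \<Delta>B (p a) b |a b. a \<in> carr A \<and> b \<in> carr B} = {lB a b |b a. b \<in> carr B \<and> a \<in> carr A}"
    "{hit1 B \<Delta>B (p a) b |a b. a \<in> carr A \<and> b \<in> carr B} = {rB a b |b a. b \<in> carr B \<and> a \<in> carr A}"
    unfolding lB_def rB_def by blast+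
  show "lspan B {lB a b |b a. b \<in> carr B \<and> a \<in> carr A} = carr B" "lspan B {rB a b |b a. b \<in> carr B \<and> a \<in> carr A} = carr B"
    using pairing unfolding e[symmetric] pairing_def by blast+
qed

lemmas algA = A.algA and algB = B.algA and vA = A.vA and vB = A.vB

sublocale cA: covered_comult A \<Delta>A
  by unfold_locales (use covA in \<open>simp add: covered_def\<close>)

sublocale cB: covered_comult B \<Delta>B
  by unfold_locales (use covB in \<open>simp add: covered_def\<close>)

lemma slices_A:
  assumes "a \<in> carr A" "b \<in> carr B" "c \<in> carr A"
  shows slice_dr2: "slice1 A A (\<lambda>x. p x b) (dr2 A \<Delta>A a c) = mul A (r b a) c"
    and slice_dr1: "slice2 A A (\<lambda>x. p x b) (dr1 A \<Delta>A a c) = mul A (l b a) c"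
    and slice_dl2: "slice1 A A (\<lambda>x. p x b) (dl2 A \<Delta>A a c) = mul A c (r b a)"
    and slice_dl1: "slice2 A A (\<lambda>x. p x b) (dl1 A \<Delta>A a c) = mul A c (l b a)"
  unfolding l_def r_def hit1_def hit2_def dr1_def dr2_def dl1_def dl2_def
  using mul_unemb1[OF ndA mslices(3)[OF assms(1,2)] assms(3)] mul_unemb2[OF ndA mslices(3)[OF assms(1,2)] assms(3)]
     mul_unemb1[OF ndA mslices(4)[OF assms(1,2)] assms(3)] mul_unemb2[OF ndA mslices(4)[OF assms(1,2)] assms(3)] assms(3)
  by (simp_all add: mslice1_def mslice2_def)

lemma slices_B:
  assumes "a \<in> carr A" "b \<in> carr B" "c \<in> carr B"
  shows slice_dr1B: "slice2 B B (p a) (dr1 B \<Delta>B b c) = mul B (lB a b) c"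
  unfolding lB_def hit2_def dr1_def
  using mul_unemb1[OF ndB mslices(1)[OF assms(1,2)] assms(3)] assms(3)
  by (simp add: mslice2_def)

lemma hopfA: "paired_hopf A B p l r (dr2 A \<Delta>A) (\<lambda>a c. flip A A (dr1 A \<Delta>A a c))"
  by (rule paired_hopfI[OF _ covA]) (unfold_locales, simp_all add: slices_A)

text \<open>Passing to the opposite of both algebras exchanges left and right multiplication and
  also \<open>l\<close> and \<open>r\<close>. What \<open>hopfA\<close> yields for the left
  component of a multiplier, this instance yields for the right one.\<close>

lemma hopfA_op: "paired_hopf (op_alg A) (op_alg B) p r l (\<lambda>a c. flip A A (dr1 (op_alg A) (op_comult \<Delta>A) a c)) (dr2 (op_alg A) (op_comult \<Delta>A))"
proof -
  have P: "paired_algebras (op_alg A) B p l r"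
    by unfold_locales (use ndA algB A.bil_p A.sepA A.sepB A.l_carr A.r_carr A.p_l A.p_r A.local_units in auto)
  have c0: "covered0 A \<Delta>A" using covA by (simp add: covered_def)
  from paired_hopf.swap_hopf[OF paired_hopfI[OF P covered_op[OF covA]]] show ?thesis
    by (simp add: slices_A covered0_op[OF c0])
qed

lemma slice_mul_right:
  assumes t: "t \<in> tcarr A B" and x: "x \<in> carr A" and y: "y \<in> carr B" and a: "a \<in> carr A"
  shows "slice2 A B (p a) (mul (A \<otimes> B) t (ten A B x y)) = mul A (slice2 A B (p (l y a)) t) x"
  by (rule tensor_eqI[OF vA vB lin_comp[OF bil_lin1[OF bil_mul_tensor[OF algA algB]] lin_slice2[OF vA vB A.p2[OF a]]]
      lin_comp[OF lin_slice2[OF vA vB A.p2] cA.lin_rmul[OF x]] t])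
    (use assms algA algB in \<open>simp_all add: mul_ten slice2_ten[OF vA vB A.p2] A.l_carr A.p_l lin_smul[OF cA.lin_rmul]\<close>)

lemma slice_mul_left:
  assumes t: "t \<in> tcarr A B" and x: "x \<in> carr A" and y: "y \<in> carr B" and a: "a \<in> carr A"
  shows "slice2 A B (p a) (mul (A \<otimes> B) (ten A B x y) t) = mul A x (slice2 A B (p (r y a)) t)"
  by (rule tensor_eqI[OF vA vB lin_comp[OF bil_lin2[OF bil_mul_tensor[OF algA algB]] lin_slice2[OF vA vB A.p2[OF a]]]
      lin_comp[OF lin_slice2[OF vA vB A.p2] cA.lin_lmul[OF x]] t])
    (use assms algA algB in \<open>simp_all add: mul_ten slice2_ten[OF vA vB A.p2] A.r_carr A.p_r lin_smul[OF cA.lin_lmul]\<close>)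

lemma pair2_slice:
  assumes t: "t \<in> tcarr A B" and a: "a \<in> carr A" and b: "b \<in> carr B"
  shows "pair2 A B p t b a = p (slice2 A B (p a) t) b"
proof -
  have "p (slice2 A B (p a) t) b = tlift A B (\<lambda>x y. p (smul A (p a y) x) b) t"
    unfolding slice2_def by (rule tlift_tlift[OF vA vB vA vsp_field bil_slice2[OF vA vB A.p2[OF a]] A.p1[OF b] t])
  also have "\<dots> = pair2 A B p t b a"
    unfolding pair2_def by (rule fun_cong[OF tlift_cong]) (use b in \<open>simp add: A.p_smul1 mult.commute\<close>)
  finally show ?thesis by simp
qed

section \<open>Slices of the canonical multiplier\<close>

context
  fixes U assumes U: "is_canonical_multiplier A \<Delta>A B \<Delta>B p U"
begin

lemma U_mult: "U \<in> carr (mult_alg (A \<otimes> B))"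
  using U by (simp add: is_canonical_multiplier_def)

lemma U_carr: "t \<in> tcarr A B \<Longrightarrow> fst U t \<in> tcarr A B" "t \<in> tcarr A B \<Longrightarrow> snd U t \<in> tcarr A B"
  using mult_carr1[OF U_mult] mult_carr2[OF U_mult] by simp_all

text \<open>The defining property of U speaks about \<open>pair2_ext\<close>, which is evaluated on
  x \<otimes> y with x and y acting trivially. Splitting c = e c and d = f d moves the factors c and
  d onto b and a and reduces to that case.\<close>

lemma U_slice:
  assumes c: "c \<in> carr A" and d: "d \<in> carr B" and a: "a \<in> carr A"
  shows "slice2 A B (p a) (fst U (ten A B c d)) = mul A (l d a) c"
proof (rule A.eqA)
  define R where "R x y b a = p (slice2 A B (p a) (fst U (ten A B x y))) b" for x y b a
  have R_mul: "R (mul A x x') (mul B y y') b a = R x y (lB x' b) (l y' a)"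
    if "x \<in> carr A" "x' \<in> carr A" "y \<in> carr B" "y' \<in> carr B" "a \<in> carr A" "b \<in> carr B" for x x' y y' a b
  proof -
    have "fst U (ten A B (mul A x x') (mul B y y')) = mul (A \<otimes> B) (fst U (ten A B x y)) (ten A B x' y')"
      using that mult_mul1[OF U_mult, of "ten A B x y" "ten A B x' y'"] by (simp add: mul_ten[OF algA algB])
    then show ?thesis using that A.l_carr U_carr(1)[of "ten A B x y"]
      by (simp add: R_def slice_mul_right B.p_l slice2_carr[OF vA vB A.p2])
  qed
  have R_const: "R x y b a = R x1 y1 b a"
    if x: "x \<in> carr A" "y \<in> carr B" "lB x b = b" "l y a = a" "x1 \<in> carr A" "y1 \<in> carr B" "lB x1 b = b" "l y1 a = a" 
    and ab: "a \<in> carr A" "b \<in> carr B" for x y x1 y1 a b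
  proof -
    \<comment> \<open>Two admissible choices are compared through common left units, e for x and x1
      and f for y and y1: both values equal R e f b a.\<close>
    obtain e where e: "e \<in> carr A" "mul A e x = x" "mul A e x1 = x1" using covered_units[OF covA, of "{x, x1}"] x by auto
    obtain f where f: "f \<in> carr B" "mul B f y = y" "mul B f y1 = y1" using covered_units[OF covB, of "{y, y1}"] x by auto
    show ?thesis using R_mul[OF e(1) x(1) f(1) x(2) ab] R_mul[OF e(1) x(5) f(1) x(6) ab] e f x by simp
  qed
  have ext: "pair2_ext A \<Delta>A B \<Delta>B p U b a = R x y b a"
    if x: "x \<in> carr A" "y \<in> carr B" "lB x b = b" "l y a = a" and ab: "a \<in> carr A" "b \<in> carr B" for x y a b
    unfolding pair2_ext_def lB_def[symmetric] l_def[symmetric]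
  proof (rule the_equality)
    have R2: "pair2 A B p (fst U (ten A B x y)) b a = R x y b a" if "x \<in> carr A" "y \<in> carr B" for x y
      using that ab U_carr by (simp add: pair2_slice R_def)
    show "\<forall>x'\<in>carr A. \<forall>y'\<in>carr B. lB x' b = b \<and> l y' a = a \<longrightarrow> R x y b a = pair2 A B p (fst U (ten A B x' y')) b a"
      using R_const[OF x _ _ _ _ ab] R2 by metis
    show "r = R x y b a" if "\<forall>x\<in>carr A. \<forall>y\<in>carr B. lB x b = b \<and> l y a = a \<longrightarrow> r = pair2 A B p (fst U (ten A B x y)) b a" for r
      using that x R2 by metis
  qed
  have can: "pair2_ext A \<Delta>A B \<Delta>B p U b a = p a b" if "a \<in> carr A" "b \<in> carr B" for a b
    using U that by (simp add: is_canonical_multiplier_def)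
  fix b assume b: "b \<in> carr B"
  obtain e where e: "e \<in> carr A" "mul A e c = c" using covered_units[OF covA, of "{c}"] c by auto
  obtain f where f: "f \<in> carr B" "mul B f d = d" using covered_units[OF covB, of "{d}"] d by auto
  have "R c d b a = R e f (lB c b) (l d a)" using R_mul[OF e(1) c f(1) d a b] e f by simp
  also have "\<dots> = p (l d a) (lB c b)"
    using ext[of e f "lB c b" "l d a"] can[of "l d a" "lB c b"] e f c d a b by (simp add: A.l_carr B.l_carr A.l_l B.l_l)
  finally show "p (slice2 A B (p a) (fst U (ten A B c d))) b = p (mul A (l d a) c) b"
    using a b c d by (simp add: R_def B.p_l A.l_carr)
qed (use assms algA in \<open>simp_all add: A.l_carr slice2_carr[OF vA vB A.p2] U_carr\<close>)

text \<open>Derived from \<open>U_slice\<close> by the multiplier identity (z U) w = z (U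
  w).\<close>

lemma U_slice':
  assumes x: "x \<in> carr A" and y: "y \<in> carr B" and a: "a \<in> carr A"
  shows "slice2 A B (p a) (snd U (ten A B x y)) = mul A x (r y a)"
proof (rule nd_eq_left[OF ndA])
  obtain d where d: "d \<in> carr B" "l d a = a" using A.local_units[of "{a}"] a by auto
  fix c assume c: "c \<in> carr A"
  have "mul (A \<otimes> B) (snd U (ten A B x y)) (ten A B c d) = mul (A \<otimes> B) (ten A B x y) (fst U (ten A B c d))"
    using mult_mul[OF U_mult, of "ten A B x y" "ten A B c d"] x y c d by simp
  then have "slice2 A B (p a) (mul (A \<otimes> B) (snd U (ten A B x y)) (ten A B c d)) = slice2 A B (p a) (mul (A \<otimes> B) (ten A B x y) (fst U (ten A B c d)))"
    by simp
  then show "mul A (slice2 A B (p a) (snd U (ten A B x y))) c = mul A (mul A x (r y a)) c"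
    using x y c d a algA by (simp add: slice_mul_right slice_mul_left U_carr U_slice A.r_carr A.l_r mul_assoc)
qed (use assms algA in \<open>simp_all add: A.r_carr slice2_carr[OF vA vB A.p2] U_carr\<close>)

end

text \<open>Uniqueness holds because \<open>U_slice\<close> prescribes all slices of U(a \<otimes>
  b).\<close>

lemma canonical_multiplier_eq:
  assumes U: "is_canonical_multiplier A \<Delta>A B \<Delta>B p U" shows "canonical_multiplier A \<Delta>A B \<Delta>B p = U"
  unfolding canonical_multiplier_def
proof (rule the_equality, rule U)
  fix V assume V: "is_canonical_multiplier A \<Delta>A B \<Delta>B p V"
  show "V = U"
  proof (rule mult_tensor_eqI[OF ndA ndB U_mult[OF V] U_mult[OF U]])
    fix a b assume ab: "a \<in> carr A" "b \<in> carr B"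
    show "fst V (ten A B a b) = fst U (ten A B a b)"
      by (rule A.slices_eqB[OF vA]) (use ab in \<open>simp_all add: U_carr[OF U] U_carr[OF V] U_slice[OF U] U_slice[OF V]\<close>)
  qed
qed

lemma lin_sliceI:
  assumes X: "vsp X" and c: "\<And>z. z \<in> carr X \<Longrightarrow> f z \<in> tcarr A B"
    and l: "\<And>a. a \<in> carr A \<Longrightarrow> lin X A (\<lambda>z. slice2 A B (p a) (f z))"
  shows "lin X (A \<otimes> B) f"
proof (rule linI)
  note s = lin_slice2[OF vA vB A.p2]
  show "f x \<in> carr (A \<otimes> B)" if "x \<in> carr X" for x using c that by simp
  show "f (x + y) = f x + f y" if xy: "x \<in> carr X" "y \<in> carr X" for x y
  proof (rule A.slices_eqB[OF vA])
    fix a assume a: "a \<in> carr A"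
    show "slice2 A B (p a) (f (x + y)) = slice2 A B (p a) (f x + f y)"
      using lin_add[OF l[OF a] xy] lin_add[OF s[OF a], of "f x" "f y"] c xy by simp
  qed (use c X xy in \<open>simp_all add: vsp_add tcarr_add\<close>)
  show "f (smul X k x) = smul (A \<otimes> B) k (f x)" if x: "x \<in> carr X" for x k
  proof (rule A.slices_eqB[OF vA])
    show "smul (A \<otimes> B) k (f x) \<in> tcarr A B" using vsp_smul[OF vsp_tensor[of A B], of "f x" k] c[OF x] by simp
    fix a assume a: "a \<in> carr A"
    show "slice2 A B (p a) (f (smul X k x)) = slice2 A B (p a) (smul (A \<otimes> B) k (f x))"
      using lin_smul[OF l[OF a] x] lin_smul[OF s[OF a], of "f x"] c x by simp
  qed (use c X x in \<open>simp add: vsp_smul\<close>)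
qed

section \<open>The multiplier \<open>U\<^sup>\<circ>\<close> and the bijectivity of its two
  components\<close>

context
  fixes U assumes U: "is_canonical_multiplier A \<Delta>A B \<Delta>B p U"
    and adm: "\<And>a b. a \<in> carr A \<Longrightarrow> b \<in> carr B \<Longrightarrow> leg2 A B b \<cdot> U \<cdot> leg1 A B a \<in> emb_image (A \<otimes> B)"
      "\<And>a b. a \<in> carr A \<Longrightarrow> b \<in> carr B \<Longrightarrow> leg1 A B a \<cdot> U \<cdot> leg2 A B b \<in> emb_image (A \<otimes> B)"
begin

private lemma ndAB: "nd_algebra (A \<otimes> B)" using ndA ndB by simp

text \<open>\<open>M1\<close> and \<open>M2\<close> are left and right multiplication by
  \<open>U\<^sup>\<circ>\<close> on elementary tensors.\<close>

definition M1 where "M1 a b = unemb (A \<otimes> B) (leg1 A B a \<cdot> U \<cdot> leg2 A B b)"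
definition M2 where "M2 a b = unemb (A \<otimes> B) (leg2 A B b \<cdot> U \<cdot> leg1 A B a)"

lemma M_carr: "a \<in> carr A \<Longrightarrow> b \<in> carr B \<Longrightarrow> M1 a b \<in> tcarr A B" "a \<in> carr A \<Longrightarrow> b \<in> carr B \<Longrightarrow> M2 a b \<in> tcarr A B"
  using unemb_carr[OF ndAB adm(2)] unemb_carr[OF ndAB adm(1)] by (simp_all add: M1_def M2_def)

lemma M_slice:
  assumes x: "x \<in> carr A" and y: "y \<in> carr B" and a: "a \<in> carr A"
  shows M1_slice: "slice2 A B (p a) (M1 x y) = mul A x (l y a)"
    and M2_slice: "slice2 A B (p a) (M2 x y) = mul A (r y a) x"
proof -
  \<comment> \<open>Because l d a = a, multiplication by c \<otimes> d becomes plain multiplication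
    by c after slicing with p(a, -).\<close>
  obtain d where d: "d \<in> carr B" "l d a = a" using A.local_units[of "{a}"] a by auto
  have s2: "slice2 A B (p a) (tmap A B A B (\<lambda>x. x) (mul B y) t) = slice2 A B (p (r y a)) t" if t: "t \<in> tcarr A B" for t
    by (rule tensor_eqI[OF vA vB lin_comp[OF lin_tmap[OF vA vB lin_id cB.lin_lmul[OF y]] lin_slice2[OF vA vB A.p2[OF a]]]
        lin_slice2[OF vA vB A.p2[OF A.r_carr[OF a y]]] t])
      (use x y a algB in \<open>simp add: tmap_ten[OF vA vB] lin_id cB.lin_lmul slice2_ten[OF vA vB A.p2] A.r_carr A.p_r\<close>)
  show "slice2 A B (p a) (M1 x y) = mul A x (l y a)"
  proof (rule nd_eq_left[OF ndA])
    fix c assume c: "c \<in> carr A"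
    have yd: "mul B y d \<in> carr B" using y d algB by simp
    have "mul (A \<otimes> B) (M1 x y) (ten A B c d) = fst (leg1 A B x) (fst U (ten A B c (mul B y d)))"
      unfolding M1_def using mul_unemb1[OF ndAB adm(2)[OF x y], of "ten A B c d"] c d x y algA algB
      by (simp add: leg2_ten)
    also have "\<dots> = tmap A B A B (mul A x) (\<lambda>y. y) (fst U (ten A B c (mul B y d)))"
      using c yd by (simp add: leg1_tmap[OF algA algB] leg2_tmap[OF algA algB] x y U_carr[OF U])
    finally have "slice2 A B (p a) (mul (A \<otimes> B) (M1 x y) (ten A B c d)) = mul A x (mul A (l (mul B y d) a) c)"
      using c yd a slice2_tmap[OF vA vB vA cA.lin_lmul[OF x] A.p2[OF a] U_carr(1)[OF U ten_carr[OF c yd]]]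
      by (simp add: U_slice[OF U])
    then show "mul A (slice2 A B (p a) (M1 x y)) c = mul A (mul A x (l y a)) c"
      using c d x y yd a algA A.l_l[OF a y d(1)] by (simp add: slice_mul_right M_carr mul_assoc A.l_carr)
  qed (use x y a algA in \<open>simp_all add: A.l_carr slice2_carr[OF vA vB A.p2] M_carr\<close>)
  show "slice2 A B (p a) (M2 x y) = mul A (r y a) x"
  proof (rule nd_eq_left[OF ndA])
    fix c assume c: "c \<in> carr A"
    have xc: "mul A x c \<in> carr A" using x c algA by simp
    have "mul (A \<otimes> B) (M2 x y) (ten A B c d) = fst (leg2 A B y) (fst U (ten A B (mul A x c) d))"
      unfolding M2_def using mul_unemb1[OF ndAB adm(1)[OF x y], of "ten A B c d"] c d x y algA algB
      by (simp add: leg1_ten)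
    also have "\<dots> = tmap A B A B (\<lambda>x. x) (mul B y) (fst U (ten A B (mul A x c) d))"
      using d xc by (simp add: leg1_tmap[OF algA algB] leg2_tmap[OF algA algB] x y U_carr[OF U])
    finally have "slice2 A B (p a) (mul (A \<otimes> B) (M2 x y) (ten A B c d)) = mul A (l d (r y a)) (mul A x c)"
      using xc d a y s2[OF U_carr(1)[OF U ten_carr[OF xc d(1)]]] by (simp add: U_slice[OF U] A.r_carr)
    then show "mul A (slice2 A B (p a) (M2 x y)) c = mul A (mul A (r y a) x) c"
      using c d x y a algA by (simp add: slice_mul_right M_carr mul_assoc A.r_carr A.l_r)
  qed (use x y a algA in \<open>simp_all add: A.r_carr slice2_carr[OF vA vB A.p2] M_carr\<close>)
qed

lemma bil_M: "bil A B (A \<otimes> B) M1" "bil A B (A \<otimes> B) M2"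
proof -
  interpret sw: paired_algebras A "op_alg B" p r l by (rule A.swap_paired)
  have c: "lin X A f \<Longrightarrow> vsp X \<Longrightarrow> (\<And>x. x \<in> carr X \<Longrightarrow> f x = g x) \<Longrightarrow> lin X A g" for f g and X :: "('k, 'x::ab_group_add) alg"
    using lin_cong[of X f g A] by blast
  show "bil A B (A \<otimes> B) M1"
  proof (intro bilI)
    show "lin B (A \<otimes> B) (M1 x)" if "x \<in> carr A" for x
      by (rule lin_sliceI[OF vB M_carr(1)[OF that]], assumption, 
        rule c[OF lin_comp[OF A.lin_l' cA.lin_lmul[OF that]] vB], assumption) (simp add: M_slice that)
    show "lin A (A \<otimes> B) (\<lambda>x. M1 x y)" if "y \<in> carr B" for y
      by (rule lin_sliceI[OF vA M_carr(1)[OF _ that]], assumption, 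
        rule c[OF cA.lin_rmul[OF A.l_carr[OF _ that]] vA], assumption) (simp add: M_slice that)
  qed
  show "bil A B (A \<otimes> B) M2"
  proof (intro bilI)
    show "lin B (A \<otimes> B) (M2 x)" if "x \<in> carr A" for x
      by (rule lin_sliceI[OF vB M_carr(2)[OF that]], assumption, 
        rule c[OF lin_comp[OF sw.lin_l'[simplified] cA.lin_rmul[OF that]] vB], assumption) (simp add: M_slice that)
    show "lin A (A \<otimes> B) (\<lambda>x. M2 x y)" if "y \<in> carr B" for y
      by (rule lin_sliceI[OF vA M_carr(2)[OF _ that]], assumption, 
        rule c[OF cA.lin_lmul[OF A.r_carr[OF _ that]] vA], assumption) (simp add: M_slice that)
  qed
qed

lemma circ_eq: "circ_multiplier A B U = (tlift A B M1, tlift A B M2)"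
  by (simp add: circ_multiplier_def M1_def[abs_def] M2_def[abs_def])

lemma circ_ten: "a \<in> carr A \<Longrightarrow> b \<in> carr B \<Longrightarrow> fst (circ_multiplier A B U) (ten A B a b) = M1 a b"
    "a \<in> carr A \<Longrightarrow> b \<in> carr B \<Longrightarrow> snd (circ_multiplier A B U) (ten A B a b) = M2 a b"
  by (simp_all add: circ_eq tlift_ten[OF vA vB vsp_tensor bil_M(1)] tlift_ten[OF vA vB vsp_tensor bil_M(2)])

text \<open>\<open>twisted_canonical_bij\<close> with the components of U as auxiliary maps: the
  left component over A and B, the right component over their opposites.\<close>

lemma circ_bij: "bij_betw (fst (circ_multiplier A B U)) (tcarr A B) (tcarr A B)"
    "bij_betw (snd (circ_multiplier A B U)) (tcarr A B) (tcarr A B)"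
proof -
  interpret h: paired_hopf A B p l r "dr2 A \<Delta>A" "\<lambda>a c. flip A A (dr1 A \<Delta>A a c)" by (rule hopfA)
  interpret ho: paired_hopf "op_alg A" "op_alg B" p r l "\<lambda>a c. flip A A (dr1 (op_alg A) (op_comult \<Delta>A) a c)" "dr2 (op_alg A) (op_comult \<Delta>A)"
    by (rule hopfA_op)
  note lM = lin_tlift[OF vA vB vsp_tensor bil_M(1)] lin_tlift[OF vA vB vsp_tensor bil_M(2)]
  show "bij_betw (fst (circ_multiplier A B U)) (tcarr A B) (tcarr A B)"
    by (rule h.twisted_canonical_bij[where UL = "fst U"])
      (use lM mult_lin1[OF U_mult[OF U]] in \<open>simp_all add: circ_ten M_slice U_slice[OF U], simp add: circ_eq\<close>)
  show "bij_betw (snd (circ_multiplier A B U)) (tcarr A B) (tcarr A B)"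
    using ho.twisted_canonical_bij[of "snd (circ_multiplier A B U)" "snd U"] lM mult_lin2[OF U_mult[OF U]]
    by (simp add: circ_ten M_slice U_slice'[OF U], simp add: circ_eq)
qed

text \<open>On slices the multiplier identities reduce to associativity of A and to the module laws
  of \<open>l\<close> and \<open>r\<close>.\<close>

lemma circ_mult: "circ_multiplier A B U \<in> carr (mult_alg (op_alg A \<otimes> B))"
proof (rule mult_tensorI)
  have oA: "is_algebra (op_alg A)" using algA by simp
  show "is_algebra (op_alg A)" "is_algebra B" using algB oA by simp_all
  note lM = lin_tlift[OF vA vB vsp_tensor bil_M(1)] lin_tlift[OF vA vB vsp_tensor bil_M(2)]
  show "lin (op_alg A \<otimes> B) (op_alg A \<otimes> B) (fst (circ_multiplier A B U))" "lin (op_alg A \<otimes> B) (op_alg A \<otimes> B) (snd (circ_multiplier A B U))"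
    using lM by (simp_all add: circ_eq)
  show "fst (circ_multiplier A B U) x = 0" "snd (circ_multiplier A B U) x = 0" if "x \<notin> tcarr (op_alg A) B" for x
    using that tlift_outside[OF vA vB vsp_tensor bil_M(1)] tlift_outside[OF vA vB vsp_tensor bil_M(2)] by (simp_all add: circ_eq)
  note m = bil_mul_tensor[OF oA algB]
  have right: "slice2 A B (p e) (mul (op_alg A \<otimes> B) t (ten A B x y)) = mul A x (slice2 A B (p (l y e)) t)"
    and left: "slice2 A B (p e) (mul (op_alg A \<otimes> B) (ten A B x y) t) = mul A (slice2 A B (p (r y e)) t) x"
    if t: "t \<in> tcarr A B" and x: "x \<in> carr A" and y: "y \<in> carr B" and e: "e \<in> carr A" for t x y e
  proof -
    have m1: "lin (A \<otimes> B) (A \<otimes> B) (\<lambda>s. mul (op_alg A \<otimes> B) s (ten A B x y))" "lin (A \<otimes> B) (A \<otimes> B) (mul (op_alg A \<otimes> B) (ten A B x y))"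
      using bil_lin1[OF m, of "ten A B x y"] bil_lin2[OF m, of "ten A B x y"] x y by simp_all
    show "slice2 A B (p e) (mul (op_alg A \<otimes> B) t (ten A B x y)) = mul A x (slice2 A B (p (l y e)) t)"
      by (rule tensor_eqI[OF vA vB lin_comp[OF m1(1) lin_slice2[OF vA vB A.p2[OF e]]] lin_comp[OF lin_slice2[OF vA vB A.p2] cA.lin_lmul[OF x]] t])
        (use x y e oA algA algB mul_ten[OF oA algB] in \<open>simp_all add: slice2_ten[OF vA vB A.p2] A.l_carr A.p_l lin_smul[OF cA.lin_lmul]\<close>)
    show "slice2 A B (p e) (mul (op_alg A \<otimes> B) (ten A B x y) t) = mul A (slice2 A B (p (r y e)) t) x"
      by (rule tensor_eqI[OF vA vB lin_comp[OF m1(2) lin_slice2[OF vA vB A.p2[OF e]]] lin_comp[OF lin_slice2[OF vA vB A.p2] cA.lin_rmul[OF x]] t])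
        (use x y e oA algA algB mul_ten[OF oA algB] in \<open>simp_all add: slice2_ten[OF vA vB A.p2] A.r_carr A.p_r lin_smul[OF cA.lin_rmul]\<close>)
  qed
  have c: "mul (op_alg A \<otimes> B) s t \<in> tcarr A B" if "s \<in> tcarr A B" "t \<in> tcarr A B" for s t
    using bil_carr[OF m] that by simp
  fix a b a' b' assume "a \<in> carr (op_alg A)" "b \<in> carr B" "a' \<in> carr (op_alg A)" "b' \<in> carr B"
  then have *: "a \<in> carr A" "b \<in> carr B" "a' \<in> carr A" "b' \<in> carr B" by simp_all
  show "fst (circ_multiplier A B U) (ten (op_alg A) B (mul (op_alg A) a a') (mul B b b')) =
       mul (op_alg A \<otimes> B) (fst (circ_multiplier A B U) (ten (op_alg A) B a b)) (ten (op_alg A) B a' b')"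
    by (rule A.slices_eqB[OF vA])
      (use * algA algB in \<open>simp_all add: circ_ten M_carr c right M_slice A.l_carr A.l_l mul_assoc\<close>)
  show "snd (circ_multiplier A B U) (ten (op_alg A) B (mul (op_alg A) a a') (mul B b b')) =
       mul (op_alg A \<otimes> B) (ten (op_alg A) B a b) (snd (circ_multiplier A B U) (ten (op_alg A) B a' b'))"
    by (rule A.slices_eqB[OF vA])
      (use * algA algB in \<open>simp_all add: circ_ten M_carr c left M_slice A.r_carr A.r_r mul_assoc\<close>)
  show "mul (op_alg A \<otimes> B) (ten (op_alg A) B a b) (fst (circ_multiplier A B U) (ten (op_alg A) B a' b')) =
       mul (op_alg A \<otimes> B) (snd (circ_multiplier A B U) (ten (op_alg A) B a b)) (ten (op_alg A) B a' b')"
    by (rule A.slices_eqB[OF vA])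
      (use * algA algB in \<open>simp_all add: circ_ten M_carr c left right M_slice A.r_carr A.l_carr A.l_r mul_assoc\<close>)
qed

end

end

section \<open>Rebracketing threefold tensor products\<close>

context
  fixes A :: "('k::field, 'a::ab_group_add) alg" and B :: "('k, 'b::ab_group_add) alg" and C :: "('k, 'c::ab_group_add) alg"
  assumes A: "vsp A" and B: "vsp B" and C: "vsp C"
begin

lemma triple_eqI1:
  assumes "lin ((A \<otimes> B) \<otimes> C) D f" "lin ((A \<otimes> B) \<otimes> C) D' g" "t \<in> tcarr (A \<otimes> B) C"
    and "\<And>a b c. a \<in> carr A \<Longrightarrow> b \<in> carr B \<Longrightarrow> c \<in> carr C \<Longrightarrow>
      f (ten (A \<otimes> B) C (ten A B a b) c) = g (ten (A \<otimes> B) C (ten A B a b) c)"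
  shows "f t = g t"
proof (rule tensor_eqI[OF vsp_tensor C assms(1-3)])
  fix s c assume "s \<in> carr (A \<otimes> B)" and c: "c \<in> carr C"
  then have s: "s \<in> tcarr A B" by simp
  show "f (ten (A \<otimes> B) C s c) = g (ten (A \<otimes> B) C s c)"
    by (rule tensor_eqI[OF A B lin_comp[OF lin_ten1[OF lin_id c] assms(1)] lin_comp[OF lin_ten1[OF lin_id c] assms(2)] s])
      (use assms(4) c in simp)
qed

lemma triple_eqI2:
  assumes "lin (A \<otimes> B \<otimes> C) D f" "lin (A \<otimes> B \<otimes> C) D' g" "t \<in> tcarr A (B \<otimes> C)"
    and "\<And>a b c. a \<in> carr A \<Longrightarrow> b \<in> carr B \<Longrightarrow> c \<in> carr C \<Longrightarrow>
      f (ten A (B \<otimes> C) a (ten B C b c)) = g (ten A (B \<otimes> C) a (ten B C b c))"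
  shows "f t = g t"
proof (rule tensor_eqI[OF A vsp_tensor assms(1-3)])
  fix a s assume a: "a \<in> carr A" and "s \<in> carr (B \<otimes> C)"
  then have s: "s \<in> tcarr B C" by simp
  show "f (ten A (B \<otimes> C) a s) = g (ten A (B \<otimes> C) a s)"
    by (rule tensor_eqI[OF B C lin_comp[OF lin_ten2[OF lin_id a] assms(1)] lin_comp[OF lin_ten2[OF lin_id a] assms(2)] s])
      (use assms(4) a in simp)
qed

lemma triple_surj:
  assumes f: "lin D (A \<otimes> B \<otimes> C) f" and D: "vsp D"
    and h: "\<And>a b c. a \<in> carr A \<Longrightarrow> b \<in> carr B \<Longrightarrow> c \<in> carr C \<Longrightarrow> ten A (B \<otimes> C) a (ten B C b c) \<in> f ` carr D"
  shows "f ` carr D = carr (A \<otimes> B \<otimes> C)"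
proof
  have sumI: "x + y \<in> f ` carr D" if xy: "x \<in> f ` carr D" "y \<in> f ` carr D" for x y
  proof -
    from xy obtain u v where "u \<in> carr D" "v \<in> carr D" "x = f u" "y = f v" by auto
    then show ?thesis using lin_add[OF f, of u v] vsp_add[OF D] by (metis imageI)
  qed
  show "f ` carr D \<subseteq> carr (A \<otimes> B \<otimes> C)" using lin_carr[OF f] by blast
  show "carr (A \<otimes> B \<otimes> C) \<subseteq> f ` carr D"
  proof
    fix t assume "t \<in> carr (A \<otimes> B \<otimes> C)"
    then have "t \<in> tcarr A (B \<otimes> C)" by simp
    with A vsp_tensor show "t \<in> f ` carr D"
    proof (induction rule: tcarr_induct)
      case (ten a s)
      from ten(2) have "s \<in> tcarr B C" by simp
      with B C show ?case
      proof (induction rule: tcarr_induct)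
        case (add u v)
        then show ?case using sumI[OF add(3,4)] lin_add[OF bil_lin2[OF bil_ten[of A "B \<otimes> C"] ten(1)], of u v] by simp
      qed (use h ten in blast)
    qed (use sumI in blast)
  qed
qed

lemma bil_tassoc1: "c \<in> carr C \<Longrightarrow> bil A B (A \<otimes> B \<otimes> C) (\<lambda>a b. ten A (B \<otimes> C) a (ten B C b c))"
  by (intro bilI lin_ten1[OF lin_id] lin_ten2[OF lin_ten1[OF lin_id]]) simp_all

lemma bil_tassoc: "bil (A \<otimes> B) C (A \<otimes> B \<otimes> C) (\<lambda>t c. tlift A B (\<lambda>a b. ten A (B \<otimes> C) a (ten B C b c)) t)"
  by (intro bilI lin_tlift_param[OF A B vsp_tensor C bil_tassoc1] lin_tlift[OF A B vsp_tensor bil_tassoc1] lin_ten2[OF lin_ten2[OF lin_id]]) simp_all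

lemma lin_tassoc: "lin ((A \<otimes> B) \<otimes> C) (A \<otimes> B \<otimes> C) (tassoc A B C)"
  unfolding tassoc_def by (rule lin_tlift[OF vsp_tensor C vsp_tensor bil_tassoc])

lemma tassoc_ten: "a \<in> carr A \<Longrightarrow> b \<in> carr B \<Longrightarrow> c \<in> carr C \<Longrightarrow>
    tassoc A B C (ten (A \<otimes> B) C (ten A B a b) c) = ten A (B \<otimes> C) a (ten B C b c)"
  unfolding tassoc_def
  by (simp add: tlift_ten[OF vsp_tensor C vsp_tensor bil_tassoc] tlift_ten[OF A B vsp_tensor bil_tassoc1])

lemma tassoc_surj: "tassoc A B C ` carr ((A \<otimes> B) \<otimes> C) = carr (A \<otimes> B \<otimes> C)"
proof (rule triple_surj[OF lin_tassoc vsp_tensor])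
  show "ten A (B \<otimes> C) a (ten B C b c) \<in> tassoc A B C ` carr ((A \<otimes> B) \<otimes> C)" if "a \<in> carr A" "b \<in> carr B" "c \<in> carr C" for a b c
    by (rule image_eqI[of _ _ "ten (A \<otimes> B) C (ten A B a b) c"]) (use that in \<open>simp_all add: tassoc_ten\<close>)
qed

end

lemma bil_flip12':
  assumes A: "vsp A" and B: "vsp B" and C: "vsp C" and a: "a \<in> carr A"
  shows "bil B C (B \<otimes> A \<otimes> C) (\<lambda>b c. ten B (A \<otimes> C) b (ten A C a c))"
  by (intro bilI lin_ten1[OF lin_id] lin_ten2[OF lin_ten2[OF lin_id]]) (simp_all add: a)

lemma bil_flip12:
  assumes A: "vsp A" and B: "vsp B" and C: "vsp C"
  shows "bil A (B \<otimes> C) (B \<otimes> A \<otimes> C) (\<lambda>a t. tlift B C (\<lambda>b c. ten B (A \<otimes> C) b (ten A C a c)) t)"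
  by (intro bilI lin_tlift_param[OF B C vsp_tensor A bil_flip12'[OF A B C]] lin_tlift[OF B C vsp_tensor bil_flip12'[OF A B C]] lin_ten2[OF lin_ten1[OF lin_id]]) simp_all

lemma lin_flip12: "vsp A \<Longrightarrow> vsp B \<Longrightarrow> vsp C \<Longrightarrow> lin (A \<otimes> B \<otimes> C) (B \<otimes> A \<otimes> C) (flip12 A B C)"
  unfolding flip12_def by (rule lin_tlift[OF _ vsp_tensor vsp_tensor bil_flip12])

lemma flip12_ten: "vsp A \<Longrightarrow> vsp B \<Longrightarrow> vsp C \<Longrightarrow> a \<in> carr A \<Longrightarrow> b \<in> carr B \<Longrightarrow> c \<in> carr C \<Longrightarrow>
    flip12 A B C (ten A (B \<otimes> C) a (ten B C b c)) = ten B (A \<otimes> C) b (ten A C a c)"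
  unfolding flip12_def
  by (simp add: tlift_ten[OF _ vsp_tensor vsp_tensor bil_flip12] tlift_ten[OF _ _ vsp_tensor bil_flip12'])

lemma flip12_surj:
  assumes "vsp A" "vsp B" "vsp C" shows "flip12 A B C ` carr (A \<otimes> B \<otimes> C) = carr (B \<otimes> A \<otimes> C)"
proof (rule triple_surj[OF assms(2,1,3) lin_flip12[OF assms] vsp_tensor])
  show "ten B (A \<otimes> C) b (ten A C a c) \<in> flip12 A B C ` carr (A \<otimes> B \<otimes> C)" if "b \<in> carr B" "a \<in> carr A" "c \<in> carr C" for a b c
    by (rule image_eqI[of _ _ "ten A (B \<otimes> C) a (ten B C b c)"]) (use that assms in \<open>simp_all add: flip12_ten\<close>)
qed

context
  fixes A :: "('k::field, 'a::ab_group_add) alg" and B :: "('k, 'b::ab_group_add) alg" and C :: "('k, 'c::ab_group_add) alg"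
  assumes A: "is_algebra A" and B: "is_algebra B" and C: "is_algebra C"
begin

private lemma v3: "vsp A" "vsp B" "vsp C" using A B C by simp_all

lemma mul_ten3: "a \<in> carr A \<Longrightarrow> b \<in> carr B \<Longrightarrow> c \<in> carr C \<Longrightarrow> a' \<in> carr A \<Longrightarrow> b' \<in> carr B \<Longrightarrow> c' \<in> carr C \<Longrightarrow>
    mul (A \<otimes> B \<otimes> C) (ten A (B \<otimes> C) a (ten B C b c)) (ten A (B \<otimes> C) a' (ten B C b' c')) = ten A (B \<otimes> C) (mul A a a') (ten B C (mul B b b') (mul C c c'))"
    "a \<in> carr A \<Longrightarrow> b \<in> carr B \<Longrightarrow> c \<in> carr C \<Longrightarrow> a' \<in> carr A \<Longrightarrow> b' \<in> carr B \<Longrightarrow> c' \<in> carr C \<Longrightarrow>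
    mul ((A \<otimes> B) \<otimes> C) (ten (A \<otimes> B) C (ten A B a b) c) (ten (A \<otimes> B) C (ten A B a' b') c') = ten (A \<otimes> B) C (ten A B (mul A a a') (mul B b b')) (mul C c c')"
  using A B C by (simp_all add: mul_ten)

lemma tassoc_hom: "alg_hom ((A \<otimes> B) \<otimes> C) (A \<otimes> B \<otimes> C) (tassoc A B C)"
proof (rule alg_homI[OF lin_tassoc[OF v3]])
  note m = bil_mul_tensor[OF is_algebra_tensor[OF A B] C] bil_mul_tensor[OF A is_algebra_tensor[OF B C]]
  note lt = lin_tassoc[OF v3]
  fix s t assume "s \<in> carr ((A \<otimes> B) \<otimes> C)" "t \<in> carr ((A \<otimes> B) \<otimes> C)"
  then have st: "s \<in> tcarr (A \<otimes> B) C" "t \<in> tcarr (A \<otimes> B) C" by simp_all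
  have tc: "tassoc A B C t \<in> tcarr A (B \<otimes> C)" using lin_carr[OF lt] st by simp
  have 1: "tassoc A B C (mul ((A \<otimes> B) \<otimes> C) u t) = mul (A \<otimes> B \<otimes> C) (tassoc A B C u) (tassoc A B C t)"
    if u: "u = ten (A \<otimes> B) C (ten A B a b) c" and abc: "a \<in> carr A" "b \<in> carr B" "c \<in> carr C" for u a b c
    by (rule triple_eqI1[OF v3 lin_comp[OF bil_lin2[OF m(1)] lt] lin_comp[OF lt bil_lin2[OF m(2)]] st(2)])
      (use u abc A B C in \<open>simp_all add: tassoc_ten v3 mul_ten3\<close>)
  show "tassoc A B C (mul ((A \<otimes> B) \<otimes> C) s t) = mul (A \<otimes> B \<otimes> C) (tassoc A B C s) (tassoc A B C t)"
    by (rule triple_eqI1[OF v3 lin_comp[OF bil_lin1[OF m(1)] lt] lin_comp[OF lt bil_lin1[OF m(2)]] st(1)])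
      (use 1 st tc in simp_all)
qed

lemma flip12_hom: "alg_hom (A \<otimes> B \<otimes> C) (B \<otimes> A \<otimes> C) (flip12 A B C)"
proof (rule alg_homI[OF lin_flip12[OF v3]])
  note m = bil_mul_tensor[OF A is_algebra_tensor[OF B C]] bil_mul_tensor[OF B is_algebra_tensor[OF A C]]
  note lt = lin_flip12[OF v3]
  have B3: "mul (B \<otimes> A \<otimes> C) (ten B (A \<otimes> C) b (ten A C a c)) (ten B (A \<otimes> C) b' (ten A C a' c')) = ten B (A \<otimes> C) (mul B b b') (ten A C (mul A a a') (mul C c c'))"
    if "a \<in> carr A" "b \<in> carr B" "c \<in> carr C" "a' \<in> carr A" "b' \<in> carr B" "c' \<in> carr C" for a b c a' b' c'
    using A B C that by (simp add: mul_ten)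
  fix s t assume "s \<in> carr (A \<otimes> B \<otimes> C)" "t \<in> carr (A \<otimes> B \<otimes> C)"
  then have st: "s \<in> tcarr A (B \<otimes> C)" "t \<in> tcarr A (B \<otimes> C)" by simp_all
  have tc: "flip12 A B C t \<in> tcarr B (A \<otimes> C)" using lin_carr[OF lt] st by simp
  have 1: "flip12 A B C (mul (A \<otimes> B \<otimes> C) u t) = mul (B \<otimes> A \<otimes> C) (flip12 A B C u) (flip12 A B C t)"
    if u: "u = ten A (B \<otimes> C) a (ten B C b c)" and abc: "a \<in> carr A" "b \<in> carr B" "c \<in> carr C" for u a b c
    by (rule triple_eqI2[OF v3 lin_comp[OF bil_lin2[OF m(1)] lt] lin_comp[OF lt bil_lin2[OF m(2)]] st(2)])
      (use u abc A B C in \<open>simp_all add: flip12_ten v3 mul_ten3 B3\<close>)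
  show "flip12 A B C (mul (A \<otimes> B \<otimes> C) s t) = mul (B \<otimes> A \<otimes> C) (flip12 A B C s) (flip12 A B C t)"
    by (rule triple_eqI2[OF v3 lin_comp[OF bil_lin1[OF m(1)] lt] lin_comp[OF lt bil_lin1[OF m(2)]] st(1)])
      (use 1 st tc in simp_all)
qed

end

section \<open>The action induced by a coaction\<close>

text \<open>The multiplier m acts on c \<otimes> y through the genuine tensor m(c \<otimes> 1), to
  which slices can be applied.\<close>

lemma leg1_factor:
  assumes C: "nd_algebra C" and X: "nd_algebra X" and m: "m \<in> carr (mult_alg (C \<otimes> X))"
    and c: "c \<in> carr C" and e: "m \<cdot> leg1 C X c \<in> emb_image (C \<otimes> X)" and y: "y \<in> carr X"
  shows "fst m (ten C X c y) = tmap C X C X (\<lambda>z. z) (\<lambda>z. mul X z y) (unemb (C \<otimes> X) (m \<cdot> leg1 C X c))"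
proof -
  define t where "t = unemb (C \<otimes> X) (m \<cdot> leg1 C X c)"
  note al = nd_algebra_alg[OF C] nd_algebra_alg[OF X]
  note v = vsp_algebra[OF al(1)] vsp_algebra[OF al(2)]
  have nd: "nd_algebra (C \<otimes> X)" using C X by simp
  have t: "t \<in> tcarr C X" using unemb_carr[OF nd e] by (simp add: t_def)
  note l = lin_mul1[OF al(2) lin_id y]
  show ?thesis unfolding t_def[symmetric]
  proof (rule tensor_nd_eqI[OF C X])
    fix d z assume dz: "d \<in> carr C" "z \<in> carr X"
    have "mul (C \<otimes> X) (fst m (ten C X c y)) (ten C X d z) = fst m (ten C X (mul C c d) (mul X y z))"
      using mult_mul1[OF m, of "ten C X c y" "ten C X d z"] c y dz by (simp add: mul_ten[OF al])
    also have "\<dots> = mul (C \<otimes> X) t (ten C X d (mul X y z))"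
      using mul_unemb1[OF nd e, of "ten C X d (mul X y z)"] c y dz al by (simp add: t_def leg1_ten)
    also have "\<dots> = mul (C \<otimes> X) (tmap C X C X (\<lambda>z. z) (\<lambda>z. mul X z y) t) (ten C X d z)"
      using tmap_carr[OF v lin_id l t] t y dz al
      by (simp add: mul_ten_right tmap_tmap[OF v v lin_id l] lin_mul1 lin_id mul_assoc)
        (simp add: tmap_def mul_assoc al y dz cong: tlift_cong)
    finally show "mul (C \<otimes> X) (fst m (ten C X c y)) (ten C X d z) = mul (C \<otimes> X) (tmap C X C X (\<lambda>z. z) (\<lambda>z. mul X z y) t) (ten C X d z)" .
  qed (use mult_carr1[OF m] c y tmap_carr[OF v lin_id l t] in simp_all)
qed

lemma slice1_tmap2:
  assumes "vsp A" "vsp X" "vsp Y" "lin A field_alg \<omega>" "lin X Y f" "t \<in> tcarr A X"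
  shows "slice1 A Y \<omega> (tmap A X A Y (\<lambda>x. x) f t) = f (slice1 A X \<omega> t)"
  by (rule tensor_eqI[OF assms(1,2) lin_comp[OF lin_tmap[OF assms(1,2) lin_id assms(5)] lin_slice1[OF assms(1,3,4)]]
        lin_comp[OF lin_slice1[OF assms(1,2,4)] assms(5)] assms(6)])
    (use assms in \<open>simp add: tmap_ten lin_id slice1_ten lin_carr lin_smul\<close>)

locale coaction_setting = hopf_pairing A \<Delta>A B \<Delta>B p
  for A :: "('k::field, 'a::ab_group_add) alg" and \<Delta>A B and \<Delta>B :: "('k, 'b::ab_group_add) comult" and p +
  fixes X :: "('k, 'x::ab_group_add) alg" and \<beta> :: "'x \<Rightarrow> ('k, 'b, 'x) tensor multiplier"
  assumes ndX: "nd_algebra X" and co: "left_coaction B \<Delta>B X \<beta>"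
begin

lemma algX: "is_algebra X" and vX: "vsp X" and ndBX: "nd_algebra (B \<otimes> X)" and algBX: "is_algebra (B \<otimes> X)"
  using ndX ndB by simp_all

lemma \<beta>_hom: "nondeg_hom X (B \<otimes> X) \<beta>"
  using co unfolding left_coaction_def by blast

lemma \<beta>_mult: "x \<in> carr X \<Longrightarrow> \<beta> x \<in> carr (mult_alg (B \<otimes> X))"
  and \<beta>_mul: "x \<in> carr X \<Longrightarrow> y \<in> carr X \<Longrightarrow> \<beta> (mul X x y) = \<beta> x \<cdot> \<beta> y"
  using hom_mult[OF algX ndBX \<beta>_hom] hom_mul[OF algX ndBX \<beta>_hom] by blast+

lemma \<beta>_carr: "x \<in> carr X \<Longrightarrow> t \<in> tcarr B X \<Longrightarrow> fst (\<beta> x) t \<in> tcarr B X"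
  using mult_carr1[OF \<beta>_mult] by simp

lemma lin_\<beta>: "t \<in> tcarr B X \<Longrightarrow> lin X (B \<otimes> X) (\<lambda>x. fst (\<beta> x) t)"
  by (rule lin_comp[OF hom_lin[OF algX ndBX \<beta>_hom] lin_eval1]) simp

lemma leg1_\<beta>: "b \<in> carr B \<Longrightarrow> x \<in> carr X \<Longrightarrow> leg1 B X b \<cdot> \<beta> x \<in> emb_image (B \<otimes> X)"
  and \<beta>_leg1: "b \<in> carr B \<Longrightarrow> x \<in> carr X \<Longrightarrow> \<beta> x \<cdot> leg1 B X b \<in> emb_image (B \<otimes> X)"
proof -
  have s: "lspan (mult_alg (B \<otimes> X)) {leg1 B X a \<cdot> \<beta> x | a x. a \<in> carr B \<and> x \<in> carr X} = emb_image (B \<otimes> X)"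
    "lspan (mult_alg (B \<otimes> X)) {\<beta> x \<cdot> leg1 B X a | a x. a \<in> carr B \<and> x \<in> carr X} = emb_image (B \<otimes> X)"
    using co unfolding left_coaction_def by blast+
  show "leg1 B X b \<cdot> \<beta> x \<in> emb_image (B \<otimes> X)" "\<beta> x \<cdot> leg1 B X b \<in> emb_image (B \<otimes> X)" if "b \<in> carr B" "x \<in> carr X"
    by (subst s[symmetric], rule lspan_base[OF vsp_mult_alg[OF algBX]], use that in blast)+
qed

definition lc where "lc b x = unemb (B \<otimes> X) (leg1 B X b \<cdot> \<beta> x)"
definition rc where "rc x b = unemb (B \<otimes> X) (\<beta> x \<cdot> leg1 B X b)"
definition sl where "sl a = slice1 B X (p a)"
definition act where "act x a = induced_action A \<Delta>A B p X \<beta> x a"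

lemma lc_carr: "b \<in> carr B \<Longrightarrow> x \<in> carr X \<Longrightarrow> lc b x \<in> tcarr B X"
  and rc_carr: "b \<in> carr B \<Longrightarrow> x \<in> carr X \<Longrightarrow> rc x b \<in> tcarr B X"
  using unemb_carr[OF ndBX leg1_\<beta>] unemb_carr[OF ndBX \<beta>_leg1] by (simp_all add: lc_def rc_def)

lemma lc_mul: "b \<in> carr B \<Longrightarrow> x \<in> carr X \<Longrightarrow> t \<in> tcarr B X \<Longrightarrow>
    mul (B \<otimes> X) (lc b x) t = tmap B X B X (mul B b) (\<lambda>x. x) (fst (\<beta> x) t)"
  using mul_unemb1[OF ndBX leg1_\<beta>, of b x t] by (simp add: lc_def leg1_tmap[OF algB algX] \<beta>_carr)

lemma rc_mul: "b \<in> carr B \<Longrightarrow> x \<in> carr X \<Longrightarrow> t \<in> tcarr B X \<Longrightarrow>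
    mul (B \<otimes> X) (rc x b) t = fst (\<beta> x) (tmap B X B X (mul B b) (\<lambda>x. x) t)"
  using mul_unemb1[OF ndBX \<beta>_leg1, of b x t] by (simp add: rc_def leg1_tmap[OF algB algX])

lemma \<beta>_rc: "b \<in> carr B \<Longrightarrow> x \<in> carr X \<Longrightarrow> y \<in> carr X \<Longrightarrow>
    fst (\<beta> x) (ten B X b y) = tmap B X B X (\<lambda>z. z) (\<lambda>z. mul X z y) (rc x b)"
  unfolding rc_def by (rule leg1_factor[OF ndB ndX \<beta>_mult _ \<beta>_leg1])

lemma lin_rmulX: "y \<in> carr X \<Longrightarrow> lin X X (\<lambda>x. mul X x y)" and lin_lmulX: "y \<in> carr X \<Longrightarrow> lin X X (mul X y)"
  using lin_mul1[OF algX lin_id] lin_mul2[OF algX lin_id] by blast+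

lemma lc_left:
  assumes "b \<in> carr B" "d \<in> carr B" "x \<in> carr X"
  shows "lc (mul B d b) x = tmap B X B X (mul B d) (\<lambda>x. x) (lc b x)"
proof (rule tensor_nd_eqI[OF ndB ndX])
  note l = cB.lin_lmul[OF assms(1)] cB.lin_lmul[OF assms(2)]
  fix c y assume cy: "c \<in> carr B" "y \<in> carr X"
  have "tmap B X B X (mul B (mul B d b)) (\<lambda>x. x) t = tmap B X B X (mul B d) (\<lambda>x. x) (tmap B X B X (mul B b) (\<lambda>x. x) t)" if "t \<in> tcarr B X" for t
    using assms algB that by (simp add: tmap_tmap[OF vB vX vB vX l(1) lin_id l(2) lin_id], simp add: tmap_def mul_assoc cong: tlift_cong)
  then show "mul (B \<otimes> X) (lc (mul B d b) x) (ten B X c y) = mul (B \<otimes> X) (tmap B X B X (mul B d) (\<lambda>x. x) (lc b x)) (ten B X c y)"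
    using assms cy algB by (simp add: mul_tmap[OF algB algX] lc_mul lc_carr \<beta>_carr)
qed (use assms algB tmap_carr[OF vB vX cB.lin_lmul lin_id] lc_carr in simp_all)

text \<open>Both sides are (b \<otimes> 1)\<beta>(x)(d \<otimes> 1).\<close>

lemma lc_rc:
  assumes "b \<in> carr B" "d \<in> carr B" "x \<in> carr X"
  shows "tmap B X B X (\<lambda>z. mul B z d) (\<lambda>x. x) (lc b x) = tmap B X B X (mul B b) (\<lambda>x. x) (rc x d)"
  by (rule tensor_nd_eqI[OF ndB ndX])
    (use assms algB in \<open>simp_all add: tmap_carr[OF vB vX] cB.lin_lmul cB.lin_rmul lin_id lc_carr rc_carr mul_tmap[OF algB algX] lc_mul rc_mul tmap_ten[OF vB vX]\<close>)

lemma lin_sl: "a \<in> carr A \<Longrightarrow> lin (B \<otimes> X) X (sl a)"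
  unfolding sl_def by (rule lin_slice1[OF vB vX A.p2])

lemma sl_carr: "a \<in> carr A \<Longrightarrow> t \<in> tcarr B X \<Longrightarrow> sl a t \<in> carr X"
  using lin_carr[OF lin_sl] by simp

lemma sl_ten: "a \<in> carr A \<Longrightarrow> b \<in> carr B \<Longrightarrow> y \<in> carr X \<Longrightarrow> sl a (ten B X b y) = smul X (p a b) y"
  unfolding sl_def by (rule slice1_ten[OF vB vX A.p2])

lemma lin_sl': "t \<in> tcarr B X \<Longrightarrow> lin A X (\<lambda>a. sl a t)"
  unfolding sl_def slice1_def
  by (rule lin_tlift_param[OF vB vX vX vA bil_slice1[OF vB vX A.p2]]) (auto intro!: lin_smul_fun[OF vX] A.p1)

lemma sl_lmul: "a \<in> carr A \<Longrightarrow> b \<in> carr B \<Longrightarrow> t \<in> tcarr B X \<Longrightarrow> sl a (tmap B X B X (mul B b) (\<lambda>x. x) t) = sl (r b a) t"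
  by (rule tensor_eqI[OF vB vX lin_comp[OF lin_tmap[OF vB vX cB.lin_lmul lin_id] lin_sl] lin_sl])
    (use algB in \<open>simp_all add: tmap_ten[OF vB vX] cB.lin_lmul lin_id sl_ten A.r_carr A.p_r\<close>)

lemma sl_rmul: "a \<in> carr A \<Longrightarrow> b \<in> carr B \<Longrightarrow> t \<in> tcarr B X \<Longrightarrow> sl a (tmap B X B X (\<lambda>z. mul B z b) (\<lambda>x. x) t) = sl (l b a) t"
  by (rule tensor_eqI[OF vB vX lin_comp[OF lin_tmap[OF vB vX cB.lin_rmul lin_id] lin_sl] lin_sl])
    (use algB in \<open>simp_all add: tmap_ten[OF vB vX] cB.lin_rmul lin_id sl_ten A.l_carr A.p_l\<close>)

lemma sl_map: "a \<in> carr A \<Longrightarrow> lin X X f \<Longrightarrow> t \<in> tcarr B X \<Longrightarrow> sl a (tmap B X B X (\<lambda>x. x) f t) = f (sl a t)"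
  unfolding sl_def by (rule slice1_tmap2[OF vB vX vX A.p2])

text \<open>Evaluates the definite description: two choices b and b' are compared through a common
  right unit e, for which both give the slice of (e \<otimes> 1)\<beta>(x) by p(a, -).\<close>

lemma act_eq:
  assumes x: "x \<in> carr X" and a: "a \<in> carr A" and b: "b \<in> carr B" "r b a = a"
  shows "act x a = sl a (lc b x)"
  unfolding act_def induced_action_def r_def[symmetric] lc_def[symmetric] sl_def[symmetric]
proof (rule the_equality)
  have *: "sl a (lc b x) = sl a (lc b' x)" if b': "b' \<in> carr B" "r b' a = a" for b'
  proof -
    obtain e where e: "e \<in> carr B" "mul B b e = b" "mul B b' e = b'" using covered_units[OF covB, of "{b, b'}"] b b' by auto
    have "sl a (lc d x) = sl (r d a) (lc e x)" if "d \<in> carr B" "mul B d e = d" for d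
      using lc_left[OF e(1) that(1) x] sl_lmul[OF a that(1) lc_carr[OF e(1) x]] that by simp
    then show ?thesis using e b b' by simp
  qed
  then show "\<forall>b'\<in>carr B. r b' a = a \<longrightarrow> sl a (lc b x) = sl a (lc b' x)" by blast
  show "y = sl a (lc b x)" if "\<forall>b\<in>carr B. r b a = a \<longrightarrow> y = sl a (lc b x)" for y
    using that b by blast
qed

lemma act_r:
  assumes x: "x \<in> carr X" and a: "a \<in> carr A" and b: "b \<in> carr B"
  shows "act x (r b a) = sl a (lc b x)"
proof -
  obtain e where e: "e \<in> carr B" "mul B b e = b" using covered_units[OF covB, of "{b}"] b by auto
  have "sl a (lc b x) = sl (r b a) (lc e x)"
    using lc_left[OF e(1) b x] sl_lmul[OF a b lc_carr[OF e(1) x]] e by simp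
  then show ?thesis using act_eq[OF x A.r_carr[OF a b] e(1)] A.r_r[OF a e(1) b] e by simp
qed

text \<open>Covering \<beta>(x) from the right gives the same action: a factor e on the left with r
  e a = a is invisible to the slice and allows the passage from \<open>rc\<close> to
  \<open>lc\<close>.\<close>

lemma act_l:
  assumes x: "x \<in> carr X" and a: "a \<in> carr A" and b: "b \<in> carr B"
  shows "act x (l b a) = sl a (rc x b)"
proof -
  obtain e where e: "e \<in> carr B" "r e a = a" using A.local_units[of "{a}"] a by auto
  have "sl a (rc x b) = sl a (tmap B X B X (mul B e) (\<lambda>x. x) (rc x b))"
    using sl_lmul[OF a e(1) rc_carr[OF b x]] e by simp
  also have "\<dots> = sl (l b a) (lc e x)"
    using sl_rmul[OF a b lc_carr[OF e(1) x]] lc_rc[OF e(1) b x] by simp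
  finally show ?thesis using act_eq[OF x A.l_carr[OF a b] e(1)] A.l_r[OF a b e(1)] e by simp
qed

text \<open>The bridge between coaction and action, used wherever a slice meets \<beta>(x) applied
  to a vector.\<close>

lemma act_\<beta>:
  assumes "x \<in> carr X" "a \<in> carr A" "b \<in> carr B" "y \<in> carr X"
  shows "sl a (fst (\<beta> x) (ten B X b y)) = mul X (act x (l b a)) y"
  using assms by (simp add: \<beta>_rc act_l sl_map lin_rmulX rc_carr)

lemma act_carr: "x \<in> carr X \<Longrightarrow> a \<in> carr A \<Longrightarrow> act x a \<in> carr X"
proof -
  assume x: "x \<in> carr X" and a: "a \<in> carr A"
  obtain e where e: "e \<in> carr B" "r e a = a" using A.local_units[of "{a}"] a by auto
  then show ?thesis using act_eq[OF x a e] sl_carr[OF a lc_carr[OF e(1) x]] by simp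
qed

lemma bil_lc: "bil B X (B \<otimes> X) lc"
proof (rule bilI)
  show "lin X (B \<otimes> X) (lc b)" if b: "b \<in> carr B" for b
  proof (rule lin_tensorI[OF ndB ndX vX lc_carr[OF b]], assumption)
    fix c y assume cy: "c \<in> carr B" "y \<in> carr X"
    have t: "ten B X c y \<in> tcarr B X" using cy by simp
    show "lin X (B \<otimes> X) (\<lambda>z. mul (B \<otimes> X) (lc b z) (ten B X c y))"
      by (rule lin_cong[THEN iffD2, OF _ vX lin_comp[OF lin_\<beta>[OF t] lin_tmap[OF vB vX cB.lin_lmul[OF b] lin_id]]])
        (simp add: lc_mul b cy)
  qed
  show "lin B (B \<otimes> X) (\<lambda>b. lc b x)" if x: "x \<in> carr X" for x
  proof (rule lin_tensorI[OF ndB ndX vB lc_carr[OF _ x]], assumption)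
    fix c y assume cy: "c \<in> carr B" "y \<in> carr X"
    have t: "fst (\<beta> x) (ten B X c y) \<in> tcarr B X" using cy x \<beta>_carr by simp
    have "lin B (B \<otimes> X) (\<lambda>z. tmap B X B X (mul B z) (\<lambda>x. x) (fst (\<beta> x) (ten B X c y)))"
      unfolding tmap_def
      by (rule lin_tlift_param[OF vB vX vsp_tensor vB _ _ t]) (auto intro!: bil_tmap cB.lin_lmul lin_id lin_ten1 cB.lin_rmul)
    then show "lin B (B \<otimes> X) (\<lambda>z. mul (B \<otimes> X) (lc z x) (ten B X c y))"
      by (rule lin_cong[THEN iffD2, OF _ vB, rotated]) (simp add: lc_mul x cy)
  qed
qed

lemma bil_act: "bil X A X act"
proof (rule bilI)
  show "lin X X (\<lambda>x. act x a)" if a: "a \<in> carr A" for a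
  proof -
    obtain e where e: "e \<in> carr B" "r e a = a" using A.local_units[of "{a}"] a by auto
    show ?thesis
      by (rule lin_cong[THEN iffD2, OF _ vX lin_comp[OF bil_lin2[OF bil_lc e(1)] lin_sl[OF a]]]) (rule act_eq[OF _ a e])
  qed
  show "lin A X (act x)" if x: "x \<in> carr X" for x
  proof (rule linI)
    show "act x a \<in> carr X" if "a \<in> carr A" for a by (rule act_carr[OF x that])
    show "act x (a + a') = act x a + act x a'" if a: "a \<in> carr A" "a' \<in> carr A" for a a'
    proof -
      \<comment> \<open>One e must serve all three elements, so that the three actions are slices of
        the same tensor.\<close>
      obtain e where e: "e \<in> carr B" "\<forall>c\<in>{a, a', a + a'}. r e c = c"
        using A.local_units[of "{a, a', a + a'}"] a vsp_add[OF vA a] by auto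
      then show ?thesis using a x act_eq[of x _ e] lin_add[OF lin_sl'[OF lc_carr[OF e(1) x]] a] vsp_add[OF vA a] by simp
    qed
    show "act x (smul A k a) = smul X k (act x a)" if a: "a \<in> carr A" for a k
    proof -
      obtain e where e: "e \<in> carr B" "\<forall>c\<in>{a, smul A k a}. r e c = c"
        using A.local_units[of "{a, smul A k a}"] a vsp_smul[OF vA a] by auto
      then show ?thesis using a x act_eq[of x _ e] lin_smul[OF lin_sl'[OF lc_carr[OF e(1) x]] a] vsp_smul[OF vA a] by simp
    qed
  qed
qed

text \<open>
  If \<open>B = 0\<close>, the extension of the counit slice to multipliers does not depend on its argument,
  so that the counit axiom forces \<open>X = 0\<close>.
\<close>

lemma trivial_coaction:
  assumes B: "carr B = {0}" and x: "x \<in> carr X" shows "x = 0"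
proof -
  have z: "t = 0" if "t \<in> tcarr B X" for t
    using vB vX that
  proof (induction rule: tcarr_induct)
    case (ten b y)
    then show ?case using B lin_zero[OF vB bil_lin1[OF bil_ten[of B X], of y]] by simp
  qed simp
  have f: "fst (\<beta> y) 0 = 0" "snd (\<beta> y) 0 = 0" if "y \<in> carr X" for y
    using lin_zero[OF vsp_tensor mult_lin1[OF \<beta>_mult[OF that]]] lin_zero[OF vsp_tensor mult_lin2[OF \<beta>_mult[OF that]]] by simp_all
  have c: "emb X y = ext_alg (B \<otimes> X) X (slice1 B X (counit B \<Delta>B)) (\<beta> y)" if "y \<in> carr X" for y
    using co that unfolding left_coaction_def by simp
  have t: "fst (\<beta> x) t = fst (\<beta> 0) t" "snd (\<beta> x) t = snd (\<beta> 0) t" if "t \<in> tcarr B X" for t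
    using z[OF that] f[OF x] f[OF vsp_zero[OF vX]] by simp_all
  have "ext_alg (B \<otimes> X) X (slice1 B X (counit B \<Delta>B)) (\<beta> x) = ext_alg (B \<otimes> X) X (slice1 B X (counit B \<Delta>B)) (\<beta> 0)"
    unfolding ext_alg_def ext_def using t by (simp cong: ball_cong)
  then have "emb X x = emb X 0" using c x vsp_zero[OF vX] by simp
  then show ?thesis using emb_inj[OF ndX] x vsp_zero[OF vX] by (auto dest: inj_onD)
qed

text \<open>The elements (b \<otimes> 1)\<beta>(x) span B \<otimes> X, and their slices lie in the
  span of the action. Slicing b \<otimes> x with p(a, b) \<noteq> 0 recovers x; if no such pair
  exists, non-degeneracy of p gives B = 0.\<close>

lemma act_unital: "lspan X {act x a |x a. x \<in> carr X \<and> a \<in> carr A} = carr X"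
proof (rule lspan_eqI[OF vX])
  let ?S = "{act x a |x a. x \<in> carr X \<and> a \<in> carr A}"
  show "?S \<subseteq> carr X" using act_carr by blast
  fix x assume x: "x \<in> carr X"
  show "x \<in> lspan X ?S"
  proof (cases "\<exists>a\<in>carr A. \<exists>b\<in>carr B. p a b \<noteq> 0")
    case True
    then obtain a b where ab: "a \<in> carr A" "b \<in> carr B" "p a b \<noteq> 0" by blast
    have s: "emb_image (B \<otimes> X) = lspan (mult_alg (B \<otimes> X)) {leg1 B X b \<cdot> \<beta> x | b x. b \<in> carr B \<and> x \<in> carr X}"
      using co unfolding left_coaction_def by blast
    note le = hom_lin[OF algBX ndBX nondeg_emb[OF ndBX]]
    have "emb (B \<otimes> X) (ten B X b x) \<in> lspan (mult_alg (B \<otimes> X)) {leg1 B X b \<cdot> \<beta> x | b x. b \<in> carr B \<and> x \<in> carr X}"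
      unfolding s[symmetric] using ab x by simp
    then have "\<exists>t\<in>tcarr B X. emb (B \<otimes> X) (ten B X b x) = emb (B \<otimes> X) t \<and> sl a t \<in> lspan X ?S"
    proof (rule lspan_induct[OF vsp_mult_alg[OF algBX]])
      show "\<exists>t\<in>tcarr B X. e = emb (B \<otimes> X) t \<and> sl a t \<in> lspan X ?S"
        if "e \<in> {leg1 B X b \<cdot> \<beta> x | b x. b \<in> carr B \<and> x \<in> carr X}" for e
      proof -
        obtain d y where e: "e = leg1 B X d \<cdot> \<beta> y" and d: "d \<in> carr B" and y: "y \<in> carr X" using \<open>e \<in> _\<close> by blast
        have "sl a (lc d y) \<in> lspan X ?S"
          unfolding act_r[OF y ab(1) d, symmetric] by (rule lspan_base[OF vX]) (use y A.r_carr[OF ab(1) d] in blast)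
        then show ?thesis using lc_carr[OF d y] emb_unemb[OF ndBX leg1_\<beta>[OF d y]] e by (intro bexI[of _ "lc d y"]) (simp_all add: lc_def)
      qed
      show "\<exists>t\<in>tcarr B X. 0 = emb (B \<otimes> X) t \<and> sl a t \<in> lspan X ?S"
        using lin_zero[OF vsp_tensor le] lin_zero[OF vsp_tensor lin_sl[OF ab(1)]] lspan_zero[OF vX] by (intro bexI[of _ 0]) simp_all
      show "\<exists>t\<in>tcarr B X. m + n = emb (B \<otimes> X) t \<and> sl a t \<in> lspan X ?S"
        if "\<exists>t\<in>tcarr B X. m = emb (B \<otimes> X) t \<and> sl a t \<in> lspan X ?S" "\<exists>t\<in>tcarr B X. n = emb (B \<otimes> X) t \<and> sl a t \<in> lspan X ?S" for m n
      proof -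
        from that obtain s t where "s \<in> tcarr B X" "m = emb (B \<otimes> X) s" "sl a s \<in> lspan X ?S" "t \<in> tcarr B X" "n = emb (B \<otimes> X) t" "sl a t \<in> lspan X ?S" by blast
        then show ?thesis using lin_add[OF le, of s t] lin_add[OF lin_sl[OF ab(1)], of s t] lspan_add[OF vX]
          by (intro bexI[of _ "s + t"]) auto
      qed
      show "\<exists>t\<in>tcarr B X. smul (mult_alg (B \<otimes> X)) k m = emb (B \<otimes> X) t \<and> sl a t \<in> lspan X ?S"
        if "\<exists>t\<in>tcarr B X. m = emb (B \<otimes> X) t \<and> sl a t \<in> lspan X ?S" for m k
      proof -
        from that obtain t where t: "t \<in> tcarr B X" "m = emb (B \<otimes> X) t" "sl a t \<in> lspan X ?S" by blast
        have "smul (B \<otimes> X) k t \<in> tcarr B X" using vsp_smul[OF vsp_tensor[of B X], of t k] t by simp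
        then show ?thesis using t lin_smul[OF le, of t k] lin_smul[OF lin_sl[OF ab(1)], of t k] lspan_smul[OF vX, of "sl a t"]
          by (intro bexI[of _ "smul (B \<otimes> X) k t"]) simp_all
      qed
    qed
    then obtain t where t: "t \<in> tcarr B X" "emb (B \<otimes> X) (ten B X b x) = emb (B \<otimes> X) t" "sl a t \<in> lspan X ?S" by blast
    then have "t = ten B X b x"
      using unemb_emb[OF ndBX, of t] unemb_emb[OF ndBX, of "ten B X b x"] ab x by simp
    then have "smul X (p a b) x \<in> lspan X ?S" using t sl_ten[OF ab(1,2) x] by simp
    then have "smul X (1 / p a b) (smul X (p a b) x) \<in> lspan X ?S" by (rule lspan_smul[OF vX])
    then show ?thesis using ab by (simp add: smul_laws[OF vX])
  next
    case False
    then have "carr B = {0}" using A.sepB vsp_zero[OF vB] by blast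
    then show ?thesis using trivial_coaction[OF _ x] lspan_zero[OF vX] by simp
  qed
qed

section \<open>The module law from coassociativity of \<beta>\<close>

definition pp :: "'a \<Rightarrow> 'a \<Rightarrow> ('k, 'b, 'b) tensor \<Rightarrow> 'k" where
  "pp a a' = tlift B B (\<lambda>f g. p a f * p a' g)"

lemma bil_pp: "a \<in> carr A \<Longrightarrow> a' \<in> carr A \<Longrightarrow> bil B B field_alg (\<lambda>f g. p a f * p a' g)"
  by (intro bilI linI) (simp_all add: A.p_add2 A.p_smul2 algebra_simps)

lemma lin_pp: "a \<in> carr A \<Longrightarrow> a' \<in> carr A \<Longrightarrow> lin (B \<otimes> B) field_alg (pp a a')"
  and pp_ten: "a \<in> carr A \<Longrightarrow> a' \<in> carr A \<Longrightarrow> f \<in> carr B \<Longrightarrow> g \<in> carr B \<Longrightarrow> pp a a' (ten B B f g) = p a f * p a' g"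
  unfolding pp_def by (rule lin_tlift[OF vB vB vsp_field bil_pp], assumption+) (rule tlift_ten[OF vB vB vsp_field bil_pp])

text \<open>Duality of product and coproduct in covered form: b and b' are moved onto a and a',
  which then multiply inside p.\<close>

lemma pp_\<Delta>:
  assumes a: "a \<in> carr A" "a' \<in> carr A" and b: "b \<in> carr B" "b' \<in> carr B" and z: "z \<in> carr B"
  shows "pp a a' (fst (\<Delta>B z) (ten B B b b')) = p (mul A (l b a) (l b' a')) z"
proof -
  define e where "e = l b' a'"
  have e: "e \<in> carr A" using A.l_carr a b by (simp add: e_def)
  have d: "dr1 B \<Delta>B z b \<in> tcarr B B" by (rule cB.dr1_carr[OF z b(1)])
  have "fst (\<Delta>B z) (ten B B b b') = tmap B B B B (\<lambda>x. x) (\<lambda>x. mul B x b') (dr1 B \<Delta>B z b)"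
    unfolding dr1_def by (rule leg1_factor[OF ndB ndB cB.\<Delta>_mult[OF z] b(1) cB.emb_r1[OF z b(1)] b(2)])
  then have "pp a a' (fst (\<Delta>B z) (ten B B b b')) = pp a a' (tmap B B B B (\<lambda>x. x) (\<lambda>x. mul B x b') (dr1 B \<Delta>B z b))" by simp
  also have "\<dots> = p a (slice2 B B (p e) (dr1 B \<Delta>B z b))"
    by (rule tensor_eqI[OF vB vB lin_comp[OF lin_tmap[OF vB vB lin_id cB.lin_rmul[OF b(2)]] lin_pp[OF a]] lin_comp[OF lin_slice2[OF vB vB A.p2[OF e]] A.p2[OF a(1)]] d])
      (use a b e algB in \<open>simp add: tmap_ten[OF vB vB] lin_id cB.lin_rmul pp_ten slice2_ten[OF vB vB A.p2] A.p_smul2, simp add: e_def A.p_l\<close>)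
  also have "\<dots> = p (mul A (l b a) e) z"
    using slices_B[OF e z b(1)] B.p_l[OF z e A.l_carr[OF a(1) b(1)]] A.p_l[OF a(1) b(1) B.l_carr[OF z e]] by simp
  finally show ?thesis by (simp add: e_def)
qed

lemma bil_ll: "a \<in> carr A \<Longrightarrow> a' \<in> carr A \<Longrightarrow> bil B B A (\<lambda>f g. mul A (l f a) (l g a'))"
  by (intro bilI lin_comp[OF A.lin_l' cA.lin_rmul] lin_comp[OF A.lin_l' cA.lin_lmul] A.l_carr)

text \<open>A is a module algebra over B. Paired with z, the claim becomes \<Delta>(z d) =
  \<Delta>(z) \<Delta>(d).\<close>

lemma l_mul:
  assumes a: "a \<in> carr A" "a' \<in> carr A" and b: "b \<in> carr B" "b' \<in> carr B" and d: "d \<in> carr B"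
  shows "l d (mul A (l b a) (l b' a')) = tlift B B (\<lambda>f g. mul A (l f a) (l g a')) (fst (\<Delta>B d) (ten B B b b'))"
proof (rule A.eqA)
  note lt = lin_tlift[OF vB vB vA bil_ll[OF a]]
  have c: "fst (\<Delta>B d) (ten B B b b') \<in> tcarr B B" using cB.\<Delta>_carr d b by simp
  have e: "mul A (l b a) (l b' a') \<in> carr A" using a b algA A.l_carr by simp
  show "l d (mul A (l b a) (l b' a')) \<in> carr A" by (rule A.l_carr[OF e d])
  show "tlift B B (\<lambda>f g. mul A (l f a) (l g a')) (fst (\<Delta>B d) (ten B B b b')) \<in> carr A" using lin_carr[OF lt] c by simp
  fix z assume z: "z \<in> carr B"
  have 1: "p (tlift B B (\<lambda>f g. mul A (l f a) (l g a')) t) z = pp a a' (fst (\<Delta>B z) t)" if "t \<in> tcarr B B" for t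
    by (rule tensor_eqI[OF vB vB lin_comp[OF lt A.p1[OF z]] lin_comp[OF mult_lin1[OF cB.\<Delta>_mult[OF z]] lin_pp[OF a]] that])
      (use z a in \<open>simp add: tlift_ten[OF vB vB vA bil_ll] pp_\<Delta>\<close>)
  have "p (l d (mul A (l b a) (l b' a'))) z = pp a a' (fst (\<Delta>B (mul B z d)) (ten B B b b'))"
    using pp_\<Delta>[OF a b, of "mul B z d"] A.p_l[OF e d z] z d algB by simp
  then show "p (l d (mul A (l b a) (l b' a'))) z = p (tlift B B (\<lambda>f g. mul A (l f a) (l g a')) (fst (\<Delta>B d) (ten B B b b'))) z"
    using 1[OF c] z d by (simp add: cB.\<Delta>_mul)
qed

text \<open>Coassociativity of \<beta> is stated with the extension of \<Delta> \<otimes> id, and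
  \<open>ext\<close> is characterised for non-degenerate maps. Density comes from surjectivity of
  \<open>dr2\<close> and idempotence of B \<otimes> B; the right-hand version is the left-hand one
  for the opposite algebra.\<close>

lemma comult_nondeg: "nondeg_hom B (B \<otimes> B) \<Delta>B"
proof -
  have gen: "carr (C \<otimes> C) \<subseteq> lspan (C \<otimes> C) {fst (\<Delta> a) t |a t. a \<in> carr C \<and> t \<in> carr (C \<otimes> C)}"
    if cov: "covered C \<Delta>" for C :: "('k, 'b) alg" and \<Delta>
  proof
    interpret c: covered_comult C \<Delta> by unfold_locales (use cov in \<open>simp add: covered_def\<close>)
    let ?S = "{fst (\<Delta> a) t |a t. a \<in> carr C \<and> t \<in> carr (C \<otimes> C)}"
    note m = bil_mul_tensor[OF c.algA c.algA]
    fix t assume "t \<in> carr (C \<otimes> C)"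
    with c.ndAA show "t \<in> lspan (C \<otimes> C) ?S"
    proof (induction rule: idempotent_induct)
      case (mul s u)
      then have s: "s \<in> tcarr C C" and u: "u \<in> tcarr C C" by simp_all
      from c.vA c.vA u show ?case
      proof (induction rule: tcarr_induct)
        case (ten x y)
        note m1 = bil_lin1[OF m, of "ten C C x y", simplified, OF ten_carr[OF ten]]
        show ?case
        proof (rule tlift_surj_induct[OF c.vA c.vA c.bil_dr2 _ s])
          show "tcarr C C \<subseteq> tlift C C (dr2 C \<Delta>) ` tcarr C C" using cov by (simp add: covered_def bij_betw_def)
          show "mul (C \<otimes> C) (dr2 C \<Delta> a b) (ten C C x y) \<in> lspan (C \<otimes> C) ?S" if "a \<in> carr C" "b \<in> carr C" for a b
          proof (rule lspan_base[OF vsp_tensor])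
            have "mul (C \<otimes> C) (dr2 C \<Delta> a b) (ten C C x y) = fst (\<Delta> a) (ten C C x (mul C b y))" using that ten by (simp add: c.dr2_mul)
            moreover have "ten C C x (mul C b y) \<in> carr (C \<otimes> C)" using that ten c.algA by simp
            ultimately show "mul (C \<otimes> C) (dr2 C \<Delta> a b) (ten C C x y) \<in> ?S" using that(1) by blast
          qed
        qed (simp add: lin_add[OF m1] lspan_add[OF vsp_tensor])
      next
        case (add u w)
        then show ?case using lin_add[OF bil_lin2[OF m], of s u w] s by (simp add: lspan_add[OF vsp_tensor])
      qed
    qed (simp add: lspan_add[OF vsp_tensor])
  qed
  show ?thesis unfolding nondeg_hom_def
  proof (intro conjI cB.hom)
    show "lspan (B \<otimes> B) {fst (\<Delta>B a) t |a t. a \<in> carr B \<and> t \<in> carr (B \<otimes> B)} = carr (B \<otimes> B)"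
      by (rule lspan_eqI[OF vsp_tensor]) (use gen[OF covB] mult_carr1[OF cB.\<Delta>_mult] in auto)
    have "lspan (op_alg B \<otimes> op_alg B) E = lspan (B \<otimes> B) E" for E by (simp add: lspan_def)
    then show "lspan (B \<otimes> B) {snd (\<Delta>B a) t |a t. a \<in> carr B \<and> t \<in> carr (B \<otimes> B)} = carr (B \<otimes> B)"
      using gen[OF covered_op[OF covB]] mult_carr2[OF cB.\<Delta>_mult] 
      by (intro lspan_eqI[OF vsp_tensor]) (auto simp: op_comult_def)
  qed
qed

lemma bil_dd: "x \<in> carr X \<Longrightarrow> a \<in> carr A \<Longrightarrow> a' \<in> carr A \<Longrightarrow> bil B B X (\<lambda>f g. act (act x (l f a)) (l g a'))"
  by (intro bilI lin_comp[OF lin_comp[OF A.lin_l' bil_lin2[OF bil_act]] bil_lin1[OF bil_act]] lin_comp[OF A.lin_l' bil_lin2[OF bil_act]] act_carr A.l_carr)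

lemma sl_hten:
  assumes t: "t \<in> tcarr B X" and w: "w \<in> carr D" and a: "a \<in> carr A" and D: "nd_algebra D" and G: "nondeg_hom X D \<Gamma>"
  shows "slice1 B D (p a) (tlift B X (\<lambda>b y. ten B D b (fst (\<Gamma> y) w)) t) = fst (\<Gamma> (sl a t)) w"
proof -
  have vD: "vsp D" using D by simp
  have lG: "lin X D (\<lambda>y. fst (\<Gamma> y) w)" using bil_lin1[OF hom_bil1[OF algX D G] w] .
  have b: "bil B X (B \<otimes> D) (\<lambda>b y. ten B D b (fst (\<Gamma> y) w))" by (rule bil_tmap[OF lin_id lG])
  show ?thesis
    by (rule tensor_eqI[OF vB vX lin_comp[OF lin_tlift[OF vB vX vsp_tensor b] lin_slice1[OF vB vD A.p2[OF a]]] lin_comp[OF lin_sl[OF a] lG] t])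
      (use a w vD lG in \<open>simp add: tlift_ten[OF vB vX vsp_tensor b] slice1_ten[OF vB vD A.p2] lin_carr[OF lG] sl_ten lin_smul[OF lG]\<close>)
qed

text \<open>Both sides of (\<Delta> \<otimes> id)\<beta>(x) = (id \<otimes> \<beta>)\<beta>(x) are
  applied to \<Delta>(d)(b \<otimes> b') \<otimes> y z and sliced by p(a, -) and p(a', -). One side
  acts once with a product, the other acts twice. The factors \<Delta>(d) and y z are there because
  \<open>ext_fst\<close> evaluates the extension of \<Delta> \<otimes> id on vectors of this
  form.\<close>

lemma act_act_\<Delta>:
  assumes x: "x \<in> carr X" and a: "a \<in> carr A" "a' \<in> carr A" and d: "d \<in> carr B" and b: "b \<in> carr B" "b' \<in> carr B"
  shows "tlift B B (\<lambda>f g. act (act x (l f a)) (l g a')) (fst (\<Delta>B d) (ten B B b b')) = act x (l d (mul A (l b a) (l b' a')))"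
proof -
  define h where "h = hten B (B \<otimes> B) X X \<Delta>B (emb X)"
  define E where "E = ext (B \<otimes> X) ((B \<otimes> B) \<otimes> X) h (\<beta> x)"
  define Z where "Z = ext (B \<otimes> X) (B \<otimes> B \<otimes> X) (hten B B X (B \<otimes> X) (emb B) \<beta>) (\<beta> x)"
  define G where "G = tlift B B (\<lambda>f g. act (act x (l f a)) (l g a'))"
  define e where "e = mul A (l b a) (l b' a')"
  have e: "e \<in> carr A" using a b algA A.l_carr by (simp add: e_def)
  note ndBB = cB.ndAA
  note lG = lin_tlift[OF vB vB vX bil_dd[OF x a], folded G_def]
  have EZ: "ext_alg ((B \<otimes> B) \<otimes> X) (B \<otimes> B \<otimes> X) (tassoc B B X) E = Z"
    using co x unfolding left_coaction_def E_def Z_def h_def by blast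
  have \<Delta>nd: "nondeg_hom B (B \<otimes> B) \<Delta>B" 
    by (rule comult_nondeg)
  note hn = hten_nondeg[OF algB ndBB \<Delta>nd algX ndX nondeg_emb[OF ndX], folded h_def]
  note ht = hten_ten[OF algB ndBB \<Delta>nd algX ndX nondeg_emb[OF ndX], folded h_def]
  note ndBBX = nd_algebra_tensor[OF ndBB ndX]
  note EM = ext_mult[OF algBX ndBBX hn \<beta>_mult[OF x], folded E_def]
  have Zt: "fst Z (tassoc B B X t) = tassoc B B X (fst E t)" if "t \<in> tcarr (B \<otimes> B) X" for t
    unfolding EZ[symmetric]
    using ext_alg_fst[OF ndBBX nd_algebra_tensor[OF ndB ndBX] tassoc_hom[OF algB algB algX] tassoc_surj[OF vB vB vX] EM, of t] that by simp
  define D where "D u = sl a' (slice1 B (B \<otimes> X) (p a) u)" for u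
  have lD: "lin (B \<otimes> B \<otimes> X) X D"
    unfolding D_def by (rule lin_comp[OF lin_slice1[OF vB vsp_tensor A.p2[OF a(1)]] lin_sl[OF a(2)]])
  note la = lin_tassoc[OF vB vB vX]
  have D1: "D (tassoc B B X (ten (B \<otimes> B) X s v)) = smul X (pp a a' s) v" if s: "s \<in> tcarr B B" and v: "v \<in> carr X" for s v
  proof (rule tensor_eqI[OF vB vB lin_comp[OF lin_ten1[OF lin_id v] lin_comp[OF la lD]] lin_smul_fun[OF vX lin_pp[OF a] v] s])
    fix f g assume "f \<in> carr B" "g \<in> carr B"
    then show "D (tassoc B B X (ten (B \<otimes> B) X (ten B B f g) v)) = smul X (pp a a' (ten B B f g)) v"
      using v a smul_laws(3)[OF vX]
      by (simp add: tassoc_ten[OF vB vB vX] D_def slice1_ten[OF vB vsp_tensor A.p2] lin_smul[OF lin_sl, simplified] sl_ten pp_ten)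
  qed
  \<comment> \<open>The side (id \<otimes> \<beta>)\<beta>(x): each of the two slices meets one
    \<beta> and produces one action.\<close>
  have D2: "D (fst Z (tassoc B B X (ten (B \<otimes> B) X s v))) = mul X (G s) v" if s: "s \<in> tcarr B B" and v: "v \<in> carr X" for s v
  proof -
    have ZM: "Z \<in> carr (mult_alg (B \<otimes> B \<otimes> X))"
      unfolding EZ[symmetric] by (rule ext_alg_mult[OF ndBBX nd_algebra_tensor[OF ndB ndBX] tassoc_hom[OF algB algB algX] tassoc_surj[OF vB vB vX] EM])
    show ?thesis
    proof (rule tensor_eqI[OF vB vB lin_comp[OF lin_ten1[OF lin_id v] lin_comp[OF la lin_comp[OF mult_lin1[OF ZM] lD]]] lin_comp[OF lG lin_rmulX[OF v]] s])
      fix f g assume fg: "f \<in> carr B" "g \<in> carr B"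
      have w: "ten B X g v \<in> carr (B \<otimes> X)" using fg v by simp
      have "fst Z (ten B (B \<otimes> X) f (ten B X g v)) = tlift B X (\<lambda>b y. ten B (B \<otimes> X) b (fst (\<beta> y) (ten B X g v))) (rc x f)"
        unfolding Z_def
        by (rule ext_hten_leg1[OF ndB ndX ndBX \<beta>_hom \<beta>_mult[OF x] fg(1) rc_carr[OF fg(1) x] _ w])
          (use emb_unemb[OF ndBX \<beta>_leg1[OF fg(1) x]] in \<open>simp add: rc_def\<close>)
      then have "D (fst Z (ten B (B \<otimes> X) f (ten B X g v))) = sl a' (fst (\<beta> (sl a (rc x f))) (ten B X g v))"
        unfolding D_def using sl_hten[OF rc_carr[OF fg(1) x] w a(1) ndBX \<beta>_hom] by simp
      also have "\<dots> = mul X (act (act x (l f a)) (l g a')) v"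
        using act_\<beta>[OF _ a(2) fg(2) v] act_l[OF x a(1) fg(1)] act_carr[OF x A.l_carr[OF a(1) fg(1)]] by simp
      finally show "D (fst Z (tassoc B B X (ten (B \<otimes> B) X (ten B B f g) v))) = mul X (G (ten B B f g)) v"
        using fg v by (simp add: tassoc_ten[OF vB vB vX] G_def tlift_ten[OF vB vB vX bil_dd[OF x a]])
    qed
  qed
  define s where "s = ten B B b b'"
  have s: "s \<in> tcarr B B" using b by (simp add: s_def)
  have key: "mul X (G (fst (\<Delta>B d) s)) (mul X y z) = mul X (act x (l d e)) (mul X y z)" if yz: "y \<in> carr X" "z \<in> carr X" for y z
  proof -
    have yz': "mul X y z \<in> carr X" using yz algX by simp
    have sc: "fst (\<Delta>B d) s \<in> tcarr B B" by (rule cB.\<Delta>_carr[OF d s])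
    have sz: "ten (B \<otimes> B) X s z \<in> carr ((B \<otimes> B) \<otimes> X)" using s yz by simp
    have lh: "lin (B \<otimes> X) X (\<lambda>t. D (tassoc B B X (fst (h t) (ten (B \<otimes> B) X s z))))"
      by (rule lin_comp[OF lin_comp[OF hten_lin[OF algB ndBB \<Delta>nd algX ndX nondeg_emb[OF ndX], folded h_def] lin_eval1[OF sz]] lin_comp[OF la lD]])
    \<comment> \<open>The side (\<Delta> \<otimes> id)\<beta>(x): by \<open>pp_\<Delta>\<close>,
      slicing \<Delta>(d') s amounts to pairing d' with e.\<close>
    have 1: "D (tassoc B B X (fst (h t) (ten (B \<otimes> B) X s z))) = mul X (sl e t) z" if t: "t \<in> tcarr B X" for t
    proof (rule tensor_eqI[OF vB vX lh lin_comp[OF lin_sl[OF e] lin_rmulX[OF yz(2)]] t])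
      fix d' x' assume dx: "d' \<in> carr B" "x' \<in> carr X"
      have sc': "fst (\<Delta>B d') s \<in> tcarr B B" by (rule cB.\<Delta>_carr[OF dx(1) s])
      have "fst (h (ten B X d' x')) (ten (B \<otimes> B) X s z) = ten (B \<otimes> B) X (fst (\<Delta>B d') s) (mul X x' z)"
        using dx s yz ndBB algX by (simp add: ht mten_ten cB.\<Delta>_mult emb_mult)
      then show "D (tassoc B B X (fst (h (ten B X d' x')) (ten (B \<otimes> B) X s z))) = mul X (sl e (ten B X d' x')) z"
        using D1[OF sc', of "mul X x' z"] dx yz algX e pp_\<Delta>[OF a b dx(1)] by (simp add: s_def e_def sl_ten lin_smul[OF lin_rmulX])
    qed
    have "fst (h (ten B X d y)) (ten (B \<otimes> B) X s z) = ten (B \<otimes> B) X (fst (\<Delta>B d) s) (mul X y z)"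
      using d s yz ndBB algX by (simp add: ht mten_ten cB.\<Delta>_mult emb_mult)
    then have "fst E (ten (B \<otimes> B) X (fst (\<Delta>B d) s) (mul X y z)) = fst (h (fst (\<beta> x) (ten B X d y))) (ten (B \<otimes> B) X s z)"
      using ext_fst[OF algBX ndBBX hn \<beta>_mult[OF x], of "ten B X d y" "ten (B \<otimes> B) X s z"] d yz s by (simp add: E_def)
    then have "mul X (G (fst (\<Delta>B d) s)) (mul X y z) = mul X (sl e (fst (\<beta> x) (ten B X d y))) z"
      using D2[OF sc yz'] Zt[of "ten (B \<otimes> B) X (fst (\<Delta>B d) s) (mul X y z)"] 1[OF \<beta>_carr[OF x], of "ten B X d y"] sc yz' d yz by simp
    also have "\<dots> = mul X (act x (l d e)) (mul X y z)"
      using act_\<beta>[OF x e d yz(1)] act_carr[OF x A.l_carr[OF e d]] yz algX by (simp add: mul_assoc)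
    finally show ?thesis .
  qed
  have Gc: "G (fst (\<Delta>B d) s) \<in> carr X" using lin_carr[OF lG] cB.\<Delta>_carr[OF d s] by simp
  have ac: "act x (l d e) \<in> carr X" by (rule act_carr[OF x A.l_carr[OF e d]])
  have "G (fst (\<Delta>B d) s) = act x (l d e)"
  proof (rule nd_eq_left[OF ndX Gc ac])
    fix v assume v: "v \<in> carr X"
    show "mul X (G (fst (\<Delta>B d) s)) v = mul X (act x (l d e)) v"
      by (rule lin_idempotent_eqI[OF ndX lin_lmulX[OF Gc] lin_lmulX[OF ac] v key])
  qed
  then show ?thesis by (simp add: G_def s_def e_def)
qed

lemma act_act:
  assumes x: "x \<in> carr X" and a: "a \<in> carr A" "a' \<in> carr A" shows "act (act x a) a' = act x (mul A a a')"
proof -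
  define G where "G = tlift B B (\<lambda>f g. act (act x (l f a)) (l g a'))"
  define H where "H = tlift B B (\<lambda>f g. act x (mul A (l f a) (l g a')))"
  have bH: "bil B B X (\<lambda>f g. act x (mul A (l f a) (l g a')))"
    by (intro bilI lin_comp[OF bil_lin1[OF bil_ll[OF a]] bil_lin2[OF bil_act x]] lin_comp[OF bil_lin2[OF bil_ll[OF a]] bil_lin2[OF bil_act x]])
  note lG = lin_tlift[OF vB vB vX bil_dd[OF x a], folded G_def] and lH = lin_tlift[OF vB vB vX bH, folded H_def]
  have GH: "G (fst (\<Delta>B d) (ten B B b b')) = H (fst (\<Delta>B d) (ten B B b b'))" if *: "d \<in> carr B" "b \<in> carr B" "b' \<in> carr B" for d b b'
  proof -
    have c: "fst (\<Delta>B d) (ten B B b b') \<in> tcarr B B" using * by (intro cB.\<Delta>_carr) simp_all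
    have "H (fst (\<Delta>B d) (ten B B b b')) = act x (tlift B B (\<lambda>f g. mul A (l f a) (l g a')) (fst (\<Delta>B d) (ten B B b b')))"
      unfolding H_def by (rule tlift_tlift[symmetric, OF vB vB vA vX bil_ll[OF a] bil_lin2[OF bil_act x] c])
    then show ?thesis unfolding G_def using act_act_\<Delta>[OF x a *] l_mul[OF a *(2,3,1)] by simp
  qed
  have bij: "bij_betw (tlift B B (dr2 B \<Delta>B)) (tcarr B B) (tcarr B B)" using covB by (simp add: covered_def)
  \<comment> \<open>Since \<open>dr2\<close> is onto, sums of the vectors \<Delta>(d)(u \<otimes> c
    v) reach every t (u \<otimes> v).\<close>
  have GH2: "G (mul (B \<otimes> B) t (ten B B u v)) = H (mul (B \<otimes> B) t (ten B B u v))" if t: "t \<in> tcarr B B" and uv: "u \<in> carr B" "v \<in> carr B" for t u v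
  proof -
    note m = bil_lin1[OF bil_mul_tensor[OF algB algB], of "ten B B u v", simplified, OF ten_carr[OF uv]]
    show ?thesis
    proof (rule tlift_surj_induct[OF vB vB cB.bil_dr2 _ t])
      show "tcarr B B \<subseteq> tlift B B (dr2 B \<Delta>B) ` tcarr B B" using bij by (simp add: bij_betw_def)
      show "G (mul (B \<otimes> B) (dr2 B \<Delta>B d c) (ten B B u v)) = H (mul (B \<otimes> B) (dr2 B \<Delta>B d c) (ten B B u v))" if "d \<in> carr B" "c \<in> carr B" for d c
        using GH[OF that(1) uv(1), of "mul B c v"] that uv algB by (simp add: cB.dr2_mul)
    qed (simp_all add: lin_add[OF lin_comp[OF m lG]] lin_add[OF lin_comp[OF m lH]])
  qed
  \<comment> \<open>f and g act trivially on a and a', and e is a right unit for both. So f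
    \<otimes> g = (f \<otimes> g)(e \<otimes> e) is covered by \<open>GH2\<close> and yields the
    claim for a and a' themselves.\<close>
  obtain f where f: "f \<in> carr B" "l f a = a" using A.local_units[of "{a}"] a by auto
  obtain g where g: "g \<in> carr B" "l g a' = a'" using A.local_units[of "{a'}"] a by auto
  obtain e where e: "e \<in> carr B" "mul B f e = f" "mul B g e = g" using covered_units[OF covB, of "{f, g}"] f g by auto
  have "G (ten B B f g) = H (ten B B f g)"
    using GH2[OF ten_carr[OF f(1) g(1)] e(1) e(1)] f g e algB by (simp add: mul_ten)
  then show ?thesis using f g by (simp add: G_def H_def tlift_ten[OF vB vB vX bil_dd[OF x a]] tlift_ten[OF vB vB vX bH])
qed

text \<open>(b \<otimes> 1)\<beta>(x y) = ((b \<otimes> 1)\<beta>(x))\<beta>(y), and each first leg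
  b' of the left factor covers \<beta>(y) in turn.\<close>

lemma lc_prod:
  assumes x: "x \<in> carr X" and y: "y \<in> carr X" and b: "b \<in> carr B"
  shows "lc b (mul X x y) = tlift B X (\<lambda>b' x'. tmap B X B X (\<lambda>z. z) (mul X x') (lc b' y)) (lc b x)"
    and "bil B X (B \<otimes> X) (\<lambda>b' x'. tmap B X B X (\<lambda>z. z) (mul X x') (lc b' y))"
proof -
  show b2: "bil B X (B \<otimes> X) (\<lambda>b' x'. tmap B X B X (\<lambda>z. z) (mul X x') (lc b' y))"
  proof (rule bilI)
    show "lin B (B \<otimes> X) (\<lambda>b'. tmap B X B X (\<lambda>z. z) (mul X x') (lc b' y))" if "x' \<in> carr X" for x'
      by (rule lin_comp[OF bil_lin1[OF bil_lc y] lin_tmap[OF vB vX lin_id lin_lmulX[OF that]]])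
    show "lin X (B \<otimes> X) (\<lambda>x'. tmap B X B X (\<lambda>z. z) (mul X x') (lc b' y))" if "b' \<in> carr B" for b'
      unfolding tmap_def
      by (rule lin_tlift_param[OF vB vX vsp_tensor vX])
        (auto intro!: bil_tmap lin_id lin_lmulX lin_ten2 lin_rmulX simp: lc_carr y that)
  qed
  note lt = lin_tlift[OF vB vX vsp_tensor b2]
  note m = bil_lin1[OF bil_mul_tensor[OF algB algX]]
  show "lc b (mul X x y) = tlift B X (\<lambda>b' x'. tmap B X B X (\<lambda>z. z) (mul X x') (lc b' y)) (lc b x)"
  proof (rule tensor_nd_eqI[OF ndB ndX])
    fix c w assume cw: "c \<in> carr B" "w \<in> carr X"
    have t: "ten B X c w \<in> tcarr B X" using cw by simp
    have yt: "fst (\<beta> y) (ten B X c w) \<in> tcarr B X" by (rule \<beta>_carr[OF y t])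
    have t': "fst (\<beta> y) (ten B X c w) \<in> carr (B \<otimes> X)" "ten B X c w \<in> carr (B \<otimes> X)" using yt t by simp_all
    have 1: "mul (B \<otimes> X) (tlift B X (\<lambda>b' x'. tmap B X B X (\<lambda>z. z) (mul X x') (lc b' y)) s) (ten B X c w) = mul (B \<otimes> X) s (fst (\<beta> y) (ten B X c w))"
      if s: "s \<in> tcarr B X" for s
    proof (rule tensor_eqI[OF vB vX lin_comp[OF lt m[OF t'(2)]] m[OF t'(1)] s])
      fix b' x' assume bx: "b' \<in> carr B" "x' \<in> carr X"
      have "mul (B \<otimes> X) (tmap B X B X (\<lambda>z. z) (mul X x') u) (ten B X c w) = tmap B X B X (\<lambda>z. z) (mul X x') (mul (B \<otimes> X) u (ten B X c w))" if u: "u \<in> tcarr B X" for u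
        by (rule tensor_eqI[OF vB vX lin_comp[OF lin_tmap[OF vB vX lin_id lin_lmulX[OF bx(2)]] m[OF t'(2)]] lin_comp[OF m[OF t'(2)] lin_tmap[OF vB vX lin_id lin_lmulX[OF bx(2)]]] u])
          (use bx cw algB algX in \<open>simp add: tmap_ten[OF vB vX] lin_id lin_lmulX mul_ten mul_assoc\<close>)
      then show "mul (B \<otimes> X) (tlift B X (\<lambda>b' x'. tmap B X B X (\<lambda>z. z) (mul X x') (lc b' y)) (ten B X b' x')) (ten B X c w) = mul (B \<otimes> X) (ten B X b' x') (fst (\<beta> y) (ten B X c w))"
        using bx y t yt algB algX
        by (simp add: tlift_ten[OF vB vX vsp_tensor b2] lc_carr lc_mul mul_ten_left tmap_tmap[OF vB vX vB vX cB.lin_lmul lin_id lin_id lin_lmulX])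
    qed
    show "mul (B \<otimes> X) (lc b (mul X x y)) (ten B X c w) =
        mul (B \<otimes> X) (tlift B X (\<lambda>b' x'. tmap B X B X (\<lambda>z. z) (mul X x') (lc b' y)) (lc b x)) (ten B X c w)"
      using 1[OF lc_carr[OF b x]] x y b t yt algX by (simp add: lc_mul \<beta>_mul)
  qed (use lc_carr[OF b] x y algX lin_carr[OF lt] in simp_all)
qed

text \<open>By \<open>lc_prod\<close>, the action of a on x y is the sum of x' (y \<lhd> (r b' a))
  over the legs b' \<otimes> x' of (b \<otimes> 1)\<beta>(x). For x = z \<lhd> c the tensors x'
  \<otimes> (r b' a) add up to the image of (c \<otimes> 1)\<Delta>(a) under z \<lhd> - on its first
  leg.\<close>

lemma act_prod:
  assumes z: "z \<in> carr X" and c: "c \<in> carr A" and y: "y \<in> carr X" and a: "a \<in> carr A"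
  shows "act (mul X (act z c) y) a = tlift A A (\<lambda>e f. mul X (act z e) (act y f)) (T2 A \<Delta>A c a)"
proof -
  define x where "x = act z c"
  have x: "x \<in> carr X" using act_carr z c by (simp add: x_def)
  obtain b where b: "b \<in> carr B" "r b a = a" using A.local_units[of "{a}"] a by auto
  have T: "T2 A \<Delta>A c a = dl1 A \<Delta>A a c" by (simp add: T2_def dl1_def)
  have Tc: "dl1 A \<Delta>A a c \<in> tcarr A A" by (rule cA.dl1_carr[OF a c])
  interpret sw: paired_algebras A "op_alg B" p r l by (rule A.swap_paired)
  have lr: "lin B A (\<lambda>b. r b a)" using sw.lin_l'[OF a] by simp
  have b1: "bil B X (X \<otimes> A) (\<lambda>b' x'. ten X A x' (r b' a))"
    by (intro bilI lin_ten2[OF lr] lin_ten1[OF lin_id] A.r_carr a)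
  have b2: "bil A A (X \<otimes> A) (\<lambda>e f. ten X A (act z e) f)"
    by (rule bil_tmap[OF bil_lin2[OF bil_act z] lin_id])
  note l1 = lin_tlift[OF vB vX vsp_tensor b1] and l2 = lin_tlift[OF vA vA vsp_tensor b2]
  \<comment> \<open>The second leg is tested with p(-, b'). Both sides become z acted on by c (l b'
    a): the left through \<open>act_eq\<close> and \<open>act_act\<close>, the right through the
    slice of (c \<otimes> 1)\<Delta>(a).\<close>
  have eq: "tlift B X (\<lambda>b' x'. ten X A x' (r b' a)) (lc b x) = tlift A A (\<lambda>e f. ten X A (act z e) f) (dl1 A \<Delta>A a c)" (is "?u = ?v")
  proof (rule A.slices_eqA2[OF vX])
    show "?u \<in> tcarr X A" "?v \<in> tcarr X A" using lin_carr[OF l1, of "lc b x"] lin_carr[OF l2, of "dl1 A \<Delta>A a c"] lc_carr[OF b(1) x] Tc by simp_all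
    fix b' assume b': "b' \<in> carr B"
    note s = lin_slice2[OF vX vA A.p1[OF b']]
    have "slice2 X A (\<lambda>a. p a b') ?u = sl (l b' a) (lc b x)"
      by (rule tensor_eqI[OF vB vX lin_comp[OF l1 s] lin_sl[OF A.l_carr[OF a b']] lc_carr[OF b(1) x]])
        (use a b' in \<open>simp add: tlift_ten[OF vB vX vsp_tensor b1] slice2_ten[OF vX vA A.p1] A.r_carr A.l_carr sl_ten A.p_r A.p_l\<close>)
    also have "\<dots> = act x (l b' a)"
      using act_eq[OF x A.l_carr[OF a b'] b(1)] A.l_r[OF a b' b(1)] b by simp
    also have "\<dots> = act z (mul A c (l b' a))"
      unfolding x_def by (rule act_act[OF z c A.l_carr[OF a b']])
    also have "\<dots> = act z (slice2 A A (\<lambda>x. p x b') (dl1 A \<Delta>A a c))" using slice_dl1[OF a b' c] by simp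
    also have "\<dots> = slice2 X A (\<lambda>a. p a b') ?v"
      by (rule tensor_eqI[OF vA vA lin_comp[OF lin_slice2[OF vA vA A.p1[OF b']] bil_lin2[OF bil_act z]] lin_comp[OF l2 s] Tc])
        (use z b' in \<open>simp add: slice2_ten[OF vA vA A.p1] slice2_ten[OF vX vA A.p1] tlift_ten[OF vA vA vsp_tensor b2] act_carr lin_smul[OF bil_lin2[OF bil_act]]\<close>)
    finally show "slice2 X A (\<lambda>a. p a b') ?u = slice2 X A (\<lambda>a. p a b') ?v" .
  qed
  have b3: "bil X A X (\<lambda>x' f. mul X x' (act y f))"
    by (intro bilI lin_comp[OF bil_lin2[OF bil_act y] lin_lmulX] lin_rmulX act_carr y)
  note l3 = lin_tlift[OF vX vA vX b3]
  have xy: "mul X x y \<in> carr X" using x y algX by simp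
  have "act (mul X x y) a = sl a (lc b (mul X x y))" by (rule act_eq[OF xy a b])
  also have "\<dots> = tlift X A (\<lambda>x' f. mul X x' (act y f)) ?u"
    unfolding lc_prod(1)[OF x y b(1)]
    by (rule tensor_eqI[OF vB vX lin_comp[OF lin_tlift[OF vB vX vsp_tensor lc_prod(2)[OF x y b(1)]] lin_sl[OF a]] lin_comp[OF l1 l3] lc_carr[OF b(1) x]])
      (use a y in \<open>simp add: tlift_ten[OF vB vX vsp_tensor lc_prod(2)[OF x y b(1)]] tlift_ten[OF vB vX vsp_tensor b1] tlift_ten[OF vX vA vX b3] sl_map lin_lmulX lc_carr act_r A.r_carr\<close>)
  also have "\<dots> = tlift A A (\<lambda>e f. mul X (act z e) (act y f)) (dl1 A \<Delta>A a c)"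
  proof -
    have b4: "bil A A X (\<lambda>e f. mul X (act z e) (act y f))"
      by (intro bilI lin_comp[OF bil_lin2[OF bil_act y] lin_lmulX] lin_comp[OF bil_lin2[OF bil_act z] lin_rmulX] act_carr y z)
    show ?thesis unfolding eq
      by (rule tensor_eqI[OF vA vA lin_comp[OF l2 l3] lin_tlift[OF vA vA vX b4] Tc])
        (use z in \<open>simp add: tlift_ten[OF vA vA vsp_tensor b2] tlift_ten[OF vX vA vX b3] tlift_ten[OF vA vA vX b4] act_carr\<close>)
  qed
  finally show ?thesis by (simp add: T x_def)
qed

lemma right_action_act: "right_action A \<Delta>A X act"
  unfolding right_action_def
proof (intro conjI ballI)
  show "bilinear_on X A (smul X) act" by (rule bil_bilinear_on[OF bil_act])
  show "lspan X {act x a |x a. x \<in> carr X \<and> a \<in> carr A} = carr X" by (rule act_unital)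
qed (simp_all add: act_carr act_act act_prod)

end

section \<open>Yetter--Drinfeld algebras\<close>

locale two_coactions = coaction_setting A \<Delta>A B \<Delta>B p X \<beta>
  for A :: "('k::field, 'a::ab_group_add) alg" and \<Delta>A B and \<Delta>B :: "('k, 'b::ab_group_add) comult" and p
    and X :: "('k, 'x::ab_group_add) alg" and \<beta> +
  fixes \<alpha> :: "'x \<Rightarrow> ('k, 'a, 'x) tensor multiplier" and U :: "('k, 'a, 'b) tensor multiplier"
  assumes coA: "left_coaction (op_alg A) (op_comult \<Delta>A) X \<alpha>"
    and U: "is_canonical_multiplier A \<Delta>A B \<Delta>B p U"
    and adm1: "\<And>a b. a \<in> carr A \<Longrightarrow> b \<in> carr B \<Longrightarrow> leg2 A B b \<cdot> U \<cdot> leg1 A B a \<in> emb_image (A \<otimes> B)"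
    and adm2: "\<And>a b. a \<in> carr A \<Longrightarrow> b \<in> carr B \<Longrightarrow> leg1 A B a \<cdot> U \<cdot> leg2 A B b \<in> emb_image (A \<otimes> B)"
begin

abbreviation A' where "A' \<equiv> op_alg A"
abbreviation M where "M \<equiv> M1 U"

lemma ndA': "nd_algebra A'" and algA': "is_algebra A'" and ndAX: "nd_algebra (A' \<otimes> X)" and ndAB: "nd_algebra (A' \<otimes> B)"
  and ndABX: "nd_algebra (A' \<otimes> B \<otimes> X)" and ndBAX: "nd_algebra (B \<otimes> A' \<otimes> X)" and ndABX': "nd_algebra ((A' \<otimes> B) \<otimes> X)"
  using ndA ndB ndX by simp_all

lemma vA': "vsp A'" using vA by simp

lemma \<alpha>_hom: "nondeg_hom X (A' \<otimes> X) \<alpha>"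
  using coA unfolding left_coaction_def by blast

lemma \<alpha>_mult: "x \<in> carr X \<Longrightarrow> \<alpha> x \<in> carr (mult_alg (A' \<otimes> X))"
  by (rule hom_mult[OF algX ndAX \<alpha>_hom])

lemma \<alpha>_leg1: "c \<in> carr A \<Longrightarrow> x \<in> carr X \<Longrightarrow> \<alpha> x \<cdot> leg1 A' X c \<in> emb_image (A' \<otimes> X)"
proof -
  have s: "lspan (mult_alg (A' \<otimes> X)) {\<alpha> x \<cdot> leg1 A' X a | a x. a \<in> carr A' \<and> x \<in> carr X} = emb_image (A' \<otimes> X)"
    using coA unfolding left_coaction_def by blast
  show "\<alpha> x \<cdot> leg1 A' X c \<in> emb_image (A' \<otimes> X)" if "c \<in> carr A" "x \<in> carr X"
    by (subst s[symmetric], rule lspan_base[OF vsp_mult_alg[OF nd_algebra_alg[OF ndAX]]]) (use that in auto)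
qed

definition br where "br x c = bracket A X \<alpha> x c"

lemma br_carr: "c \<in> carr A \<Longrightarrow> x \<in> carr X \<Longrightarrow> br x c \<in> tcarr A X"
  using unemb_carr[OF ndAX \<alpha>_leg1] by (simp add: br_def bracket_def)

lemma emb_br: "c \<in> carr A \<Longrightarrow> x \<in> carr X \<Longrightarrow> \<alpha> x \<cdot> leg1 A' X c = emb (A' \<otimes> X) (br x c)"
  using emb_unemb[OF ndAX \<alpha>_leg1] by (simp add: br_def bracket_def)

lemma \<alpha>_ten: "c \<in> carr A \<Longrightarrow> x \<in> carr X \<Longrightarrow> y \<in> carr X \<Longrightarrow> fst (\<alpha> x) (ten A X c y) = tmap A X A X (\<lambda>z. z) (\<lambda>z. mul X z y) (br x c)"
  using leg1_factor[OF ndA' ndX \<alpha>_mult _ \<alpha>_leg1, of x c y] by (simp add: br_def bracket_def)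

lemma bil_br: "bil X A (A \<otimes> X) br"
proof -
  have m: "mul (A' \<otimes> X) (br x c) (ten A X d z) = fst (\<alpha> x) (ten A X (mul A d c) z)"
    if "x \<in> carr X" "c \<in> carr A" "d \<in> carr A" "z \<in> carr X" for x c d z
    using mul_unemb1[OF ndAX \<alpha>_leg1[OF that(2,1)], of "ten A X d z"] that algA' algX leg1_ten(1)[OF algA' algX, of c d z] by (simp add: br_def bracket_def)
  have "bil X A (A' \<otimes> X) br"
  proof (rule bilI)
    show "lin A (A' \<otimes> X) (br x)" if x: "x \<in> carr X" for x
    proof (rule lin_tensorI[OF ndA' ndX vA])
      fix d z assume dz: "d \<in> carr A'" "z \<in> carr X"
      then have d: "d \<in> carr A" by simp
      have "lin A (A' \<otimes> X) (\<lambda>c. ten A X (mul A d c) z)" using lin_ten1[OF cA.lin_lmul[OF d] dz(2)] by simp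
      from lin_comp[OF this mult_lin1[OF \<alpha>_mult[OF x]]]
      show "lin A (A' \<otimes> X) (\<lambda>c. mul (A' \<otimes> X) (br x c) (ten A' X d z))"
        by (rule lin_cong[THEN iffD2, OF _ vA, rotated]) (use m x d dz in simp)
    qed (use br_carr x in simp)
    show "lin X (A' \<otimes> X) (\<lambda>x. br x c)" if c: "c \<in> carr A" for c
    proof (rule lin_tensorI[OF ndA' ndX vX])
      fix d z assume dz: "d \<in> carr A'" "z \<in> carr X"
      have t: "ten A X (mul A d c) z \<in> carr (A' \<otimes> X)" using dz c algA by simp
      show "lin X (A' \<otimes> X) (\<lambda>x. mul (A' \<otimes> X) (br x c) (ten A' X d z))"
        by (rule lin_cong[THEN iffD2, OF _ vX lin_comp[OF hom_lin[OF algX ndAX \<alpha>_hom] lin_eval1[OF t]]]) (use m c dz in simp)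
    qed (use br_carr c in simp)
  qed
  then show ?thesis by simp
qed

text \<open>\<open>LHS\<close> and \<open>RHS\<close> are the two sides of the right-left condition,
  with the covering element a' written c.\<close>

definition LHS where "LHS x a c = tlift A X (\<lambda>c y. tlift A A (\<lambda>e f. ten A X e (act y f)) (T2 A \<Delta>A c a)) (br x c)"
definition RHS where "RHS x a c = tlift A A (\<lambda>d e. br (act x d) e) (unemb (A \<otimes> A) (leg2 A A c \<cdot> \<Delta>A a))"

lemma bil_act2: "y \<in> carr X \<Longrightarrow> bil A A (A \<otimes> X) (\<lambda>e f. ten A X e (act y f))"
  by (rule bil_tmap[OF lin_id bil_lin2[OF bil_act]])

lemma LHS_eq: "LHS x a c = tlift A X (\<lambda>c y. tlift A A (\<lambda>e f. ten A X e (act y f)) (dl1 A \<Delta>A a c)) (br x c)"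
  by (simp add: LHS_def T2_def dl1_def)

lemma bil_LHS:
  assumes a: "a \<in> carr A"
  shows "bil A X (A \<otimes> X) (\<lambda>c y. tlift A A (\<lambda>e f. ten A X e (act y f)) (dl1 A \<Delta>A a c))"
proof (rule bilI)
  have c0: "covered0 A \<Delta>A" using covA by (simp add: covered_def)
  show "lin A (A \<otimes> X) (\<lambda>c. tlift A A (\<lambda>e f. ten A X e (act y f)) (dl1 A \<Delta>A a c))" if "y \<in> carr X" for y
    by (rule lin_comp[OF bil_lin2[OF covered0_bil(3)[OF c0] a] lin_tlift[OF vA vA vsp_tensor bil_act2[OF that]]])
  show "lin X (A \<otimes> X) (\<lambda>y. tlift A A (\<lambda>e f. ten A X e (act y f)) (dl1 A \<Delta>A a c))" if c: "c \<in> carr A" for c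
    by (rule lin_tlift_param[OF vA vA vsp_tensor vX bil_act2 _ cA.dl1_carr[OF a c]])
      (auto intro: lin_ten2[OF bil_lin1[OF bil_act]])
qed

lemma bil_RHS: "x \<in> carr X \<Longrightarrow> bil A A (A \<otimes> X) (\<lambda>d e. br (act x d) e)"
  by (intro bilI lin_comp[OF bil_lin2[OF bil_act] bil_lin1[OF bil_br]] bil_lin2[OF bil_br] act_carr)

lemma LHS_carr: "x \<in> carr X \<Longrightarrow> a \<in> carr A \<Longrightarrow> c \<in> carr A \<Longrightarrow> LHS x a c \<in> tcarr A X"
  unfolding LHS_eq using lin_carr[OF lin_tlift[OF vA vX vsp_tensor bil_LHS]] br_carr by simp

lemma RHS_carr: "x \<in> carr X \<Longrightarrow> a \<in> carr A \<Longrightarrow> c \<in> carr A \<Longrightarrow> RHS x a c \<in> tcarr A X"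
  unfolding RHS_def dl2_def[symmetric] using lin_carr[OF lin_tlift[OF vA vA vsp_tensor bil_RHS]] cA.dl2_carr by simp

abbreviation U0 where "U0 \<equiv> circ_multiplier A B U"

text \<open>In leg notation, P x is (id \<otimes> \<alpha>)\<beta>(x), Q x is (id \<otimes>
  \<beta>)\<alpha>(x), and W m is m placed on the first two of three legs.\<close>

definition P where "P x = ext (B \<otimes> X) (B \<otimes> A' \<otimes> X) (hten B B X (A' \<otimes> X) (emb B) \<alpha>) (\<beta> x)"
definition Q where "Q x = ext (A' \<otimes> X) (A' \<otimes> B \<otimes> X) (hten A' A' X (B \<otimes> X) (emb A') \<beta>) (\<alpha> x)"
definition W where "W m = ext_alg ((A' \<otimes> B) \<otimes> X) (A' \<otimes> B \<otimes> X) (tassoc A' B X) (mten (A' \<otimes> B) X m (mone X))"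

lemma P_mult: "x \<in> carr X \<Longrightarrow> P x \<in> carr (mult_alg (B \<otimes> A' \<otimes> X))"
  unfolding P_def by (rule ext_mult[OF algBX ndBAX hten_nondeg[OF algB ndB nondeg_emb[OF ndB] algX ndAX \<alpha>_hom] \<beta>_mult])

lemma Q_mult: "x \<in> carr X \<Longrightarrow> Q x \<in> carr (mult_alg (A' \<otimes> B \<otimes> X))"
  unfolding Q_def by (rule ext_mult[OF nd_algebra_alg[OF ndAX] ndABX hten_nondeg[OF algA' ndA' nondeg_emb[OF ndA'] algX ndBX \<beta>_hom] \<alpha>_mult])

lemma P_ten: "x \<in> carr X \<Longrightarrow> b \<in> carr B \<Longrightarrow> w \<in> tcarr A X \<Longrightarrow>
    fst (P x) (ten B (A' \<otimes> X) b w) = tlift B X (\<lambda>b y. ten B (A' \<otimes> X) b (fst (\<alpha> y) w)) (rc x b)"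
  unfolding P_def
  by (rule ext_hten_leg1[OF ndB ndX ndAX \<alpha>_hom \<beta>_mult _ rc_carr])
    (use emb_unemb[OF ndBX \<beta>_leg1] in \<open>simp_all add: rc_def\<close>)

lemma Q_ten: "x \<in> carr X \<Longrightarrow> c \<in> carr A \<Longrightarrow> w \<in> tcarr B X \<Longrightarrow>
    fst (Q x) (ten A' (B \<otimes> X) c w) = tlift A X (\<lambda>c y. ten A' (B \<otimes> X) c (fst (\<beta> y) w)) (br x c)"
  unfolding Q_def
  using ext_hten_leg1[OF ndA' ndX ndBX \<beta>_hom \<alpha>_mult _ _ emb_br, of x c w] br_carr by simp

lemma mten_one:
  assumes m: "m \<in> carr (mult_alg (A' \<otimes> B))"
  shows W_mult: "W m \<in> carr (mult_alg (A' \<otimes> B \<otimes> X))"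
    and W_tassoc: "\<And>t. t \<in> tcarr (A' \<otimes> B) X \<Longrightarrow> fst (W m) (tassoc A' B X t) = tassoc A' B X (fst (mten (A' \<otimes> B) X m (mone X)) t)"
    and W_ten: "\<And>u y. u \<in> tcarr A B \<Longrightarrow> y \<in> carr X \<Longrightarrow> fst (W m) (tassoc A' B X (ten (A' \<otimes> B) X u y)) = tassoc A' B X (ten (A' \<otimes> B) X (fst m u) y)"
proof -
  have mt: "mten (A' \<otimes> B) X m (mone X) \<in> carr (mult_alg ((A' \<otimes> B) \<otimes> X))"
    by (rule mten_mult[OF nd_algebra_alg[OF ndAB] algX m mone_mult[OF algX]])
  note e = ndABX' ndABX tassoc_hom[OF algA' algB algX] tassoc_surj[OF vA' vB vX] mt
  show "W m \<in> carr (mult_alg (A' \<otimes> B \<otimes> X))" unfolding W_def by (rule ext_alg_mult[OF e])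
  show 1: "fst (W m) (tassoc A' B X t) = tassoc A' B X (fst (mten (A' \<otimes> B) X m (mone X)) t)" if "t \<in> tcarr (A' \<otimes> B) X" for t
    unfolding W_def using ext_alg_fst[OF e, of t] that by simp
  show "fst (W m) (tassoc A' B X (ten (A' \<otimes> B) X u y)) = tassoc A' B X (ten (A' \<otimes> B) X (fst m u) y)"
    if "u \<in> tcarr A B" "y \<in> carr X" for u y
    using that 1 mten_ten(1)[OF nd_algebra_alg[OF ndAB] algX m mone_mult[OF algX]] by simp
qed

text \<open>Placing a multiplier on two legs is multiplicative on elementary tensors, so an inverse
  of \<open>U0\<close> gives one of \<open>W U0\<close>.\<close>

lemma W_inverse:
  assumes m: "m \<in> carr (mult_alg (A' \<otimes> B))" and n: "n \<in> carr (mult_alg (A' \<otimes> B))" and mn: "m \<cdot> n = mone (A' \<otimes> B)"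
  shows "W m \<cdot> W n = mone (A' \<otimes> B \<otimes> X)"
proof (rule mult_tensor_eqI[OF ndA' ndBX mmul_mult[OF vsp_tensor W_mult[OF m] W_mult[OF n]] mone_mult[OF nd_algebra_alg[OF ndABX]]])
  fix a w assume a: "a \<in> carr A'" and "w \<in> carr (B \<otimes> X)"
  then have aw: "ten A' (B \<otimes> X) a w \<in> tcarr A' (B \<otimes> X)" by simp
  show "fst (W m \<cdot> W n) (ten A' (B \<otimes> X) a w) = fst (mone (A' \<otimes> B \<otimes> X)) (ten A' (B \<otimes> X) a w)"
  proof (rule triple_eqI2[OF vA' vB vX mult_lin1[OF mmul_mult[OF vsp_tensor W_mult[OF m] W_mult[OF n]]] mult_lin1[OF mone_mult[OF nd_algebra_alg[OF ndABX]]] aw])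
    fix a b y assume *: "a \<in> carr A'" "b \<in> carr B" "y \<in> carr X"
    have nc: "fst n (ten A B a b) \<in> tcarr A B" using mult_carr1[OF n, of "ten A B a b"] * by simp
    have "fst m (fst n (ten A B a b)) = ten A B a b" using mn * mmul_fst[of m n "ten A B a b"] by simp
    moreover have "fst (mone (A' \<otimes> B \<otimes> X)) (ten A' (B \<otimes> X) a (ten B X b y)) = ten A' (B \<otimes> X) a (ten B X b y)"
      using * by simp
    ultimately show "fst (W m \<cdot> W n) (ten A' (B \<otimes> X) a (ten B X b y)) = fst (mone (A' \<otimes> B \<otimes> X)) (ten A' (B \<otimes> X) a (ten B X b y))"
      using * tassoc_ten[OF vA' vB vX *, symmetric] nc W_ten[OF n, of "ten A B a b" y] W_ten[OF m nc *(3)] by simp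
  qed
qed

lemma U0_mult: "U0 \<in> carr (mult_alg (A' \<otimes> B))"
  by (rule circ_mult[OF U adm1 adm2])

lemma U0_inverse: obtains V where "V \<in> carr (mult_alg (A' \<otimes> B))" "U0 \<cdot> V = mone (A' \<otimes> B)" "V \<cdot> U0 = mone (A' \<otimes> B)"
  using mult_invertible[OF ndAB U0_mult] circ_bij[OF U adm1 adm2] by auto

lemma M_carr': "a \<in> carr A \<Longrightarrow> b \<in> carr B \<Longrightarrow> M a b \<in> tcarr A B"
  by (rule M_carr(1)[OF U adm1 adm2])

section \<open>Slicing the two sides of the left-left condition\<close>

abbreviation \<phi> where "\<phi> \<equiv> flip12 A' B X"
abbreviation s3 where "s3 a \<equiv> slice1 B (A' \<otimes> X) (p a)"

lemma lin_\<phi>: "lin (A' \<otimes> B \<otimes> X) (B \<otimes> A' \<otimes> X) \<phi>"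
  by (rule lin_flip12[OF vA' vB vX])

lemma lin_s3: "a \<in> carr A \<Longrightarrow> lin (B \<otimes> A' \<otimes> X) (A \<otimes> X) (s3 a)"
  using lin_slice1[OF vB vsp_tensor A.p2, of a A' X] by simp

lemma lin_tassoc_ten: "y \<in> carr X \<Longrightarrow> lin (A \<otimes> B) (A' \<otimes> B \<otimes> X) (\<lambda>u. tassoc A' B X (ten (A' \<otimes> B) X u y))"
  using lin_comp[OF lin_ten1[OF lin_id[of "A' \<otimes> B"]] lin_tassoc[OF vA' vB vX]] by simp

text \<open>Write U0(c \<otimes> b) as a sum of c' \<otimes> b'. Slicing P x on b' \<otimes> c'
  \<otimes> y gives \<alpha>(x \<lhd> (l b' a)) applied to c' \<otimes> y. The sum of (l b' a)
  \<otimes> c' is (1 \<otimes> c)\<Delta>(l b a), the tensor that \<open>RHS\<close>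
  evaluates.\<close>

lemma slice_PW:
  assumes x: "x \<in> carr X" and c: "c \<in> carr A" and b: "b \<in> carr B" and y: "y \<in> carr X" and a: "a \<in> carr A"
  shows "s3 a (fst (P x) (\<phi> (fst (W U0) (ten A' (B \<otimes> X) c (ten B X b y))))) = tmap A X A X (\<lambda>z. z) (\<lambda>z. mul X z y) (RHS x (l b a) c)"
proof -
  note ly = lin_tmap[OF vA vX lin_id lin_rmulX[OF y]]
  have b1: "bil A B (A \<otimes> X) (\<lambda>c' b'. br (act x (l b' a)) c')"
    by (intro bilI bil_lin2[OF bil_br] lin_comp[OF lin_comp[OF A.lin_l'[OF a] bil_lin2[OF bil_act x]] bil_lin1[OF bil_br]] act_carr x A.l_carr a)
  have b2: "bil A B (A \<otimes> A) (\<lambda>c' b'. ten A A (l b' a) c')"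
    by (intro bilI lin_ten1[OF A.lin_l'[OF a]] lin_ten2[OF lin_id] A.l_carr a)
  note l1 = lin_tlift[OF vA vB vsp_tensor b1] and l2 = lin_tlift[OF vA vB vsp_tensor b2]
  have Mc: "M c b \<in> tcarr A B" by (rule M_carr'[OF c b])
  have "fst (W U0) (ten A' (B \<otimes> X) c (ten B X b y)) = tassoc A' B X (ten (A' \<otimes> B) X (M c b) y)"
    using W_ten[OF U0_mult, of "ten A B c b" y] tassoc_ten[OF vA' vB vX, of c b y] c b y circ_ten(1)[OF U adm1 adm2 c b] by simp
  moreover have "s3 a (fst (P x) (\<phi> (tassoc A' B X (ten (A' \<otimes> B) X u y)))) = tmap A X A X (\<lambda>z. z) (\<lambda>z. mul X z y) (tlift A B (\<lambda>c' b'. br (act x (l b' a)) c') u)"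
    if u: "u \<in> tcarr A B" for u
  proof (rule tensor_eqI[OF vA vB lin_comp[OF lin_comp[OF lin_comp[OF lin_tassoc_ten[OF y] lin_\<phi>] mult_lin1[OF P_mult[OF x]]] lin_s3[OF a]] lin_comp[OF l1 ly] u])
    fix c' b' assume cb: "c' \<in> carr A" "b' \<in> carr B"
    have w: "ten A X c' y \<in> carr (A' \<otimes> X)" using cb y by simp
    have "s3 a (fst (P x) (ten B (A' \<otimes> X) b' (ten A X c' y))) = fst (\<alpha> (act x (l b' a))) (ten A X c' y)"
      using sl_hten[OF rc_carr[OF cb(2) x] w a ndAX \<alpha>_hom] P_ten[OF x cb(2), of "ten A X c' y"] act_l[OF x a cb(2)] w by simp
    then show "s3 a (fst (P x) (\<phi> (tassoc A' B X (ten (A' \<otimes> B) X (ten A B c' b') y)))) =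
        tmap A X A X (\<lambda>z. z) (\<lambda>z. mul X z y) (tlift A B (\<lambda>c' b'. br (act x (l b' a)) c') (ten A B c' b'))"
      using cb y x a tassoc_ten[OF vA' vB vX, of c' b' y] flip12_ten[OF vA' vB vX, of c' b' y]
      by (simp add: tlift_ten[OF vA vB vsp_tensor b1] \<alpha>_ten act_carr A.l_carr)
  qed
  moreover have "tlift A B (\<lambda>c' b'. br (act x (l b' a)) c') (M c b) = RHS x (l b a) c"
  proof -
    \<comment> \<open>Pairing the first leg with b' reduces the claim to \<open>M1_slice\<close> on
      one side and to \<open>slice_dl2\<close> on the other.\<close>
    have Z: "tlift A B (\<lambda>c' b'. ten A A (l b' a) c') (M c b) = dl2 A \<Delta>A (l b a) c"
    proof (rule A.slices_eqA[OF vA])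
      show "tlift A B (\<lambda>c' b'. ten A A (l b' a) c') (M c b) \<in> tcarr A A" using lin_carr[OF l2] Mc by simp
      show "dl2 A \<Delta>A (l b a) c \<in> tcarr A A" by (rule cA.dl2_carr[OF A.l_carr[OF a b] c])
      fix b' assume b': "b' \<in> carr B"
      have "slice1 A A (\<lambda>x. p x b') (tlift A B (\<lambda>c' b'. ten A A (l b' a) c') (M c b)) = slice2 A B (p (r b' a)) (M c b)"
        by (rule tensor_eqI[OF vA vB lin_comp[OF l2 lin_slice1[OF vA vA A.p1[OF b']]] lin_slice2[OF vA vB A.p2[OF A.r_carr[OF a b']]] Mc])
          (use a b' in \<open>simp add: tlift_ten[OF vA vB vsp_tensor b2] slice1_ten[OF vA vA A.p1] slice2_ten[OF vA vB A.p2] A.l_carr A.r_carr A.p_l A.p_r\<close>)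
      then show "slice1 A A (\<lambda>x. p x b') (tlift A B (\<lambda>c' b'. ten A A (l b' a) c') (M c b)) = slice1 A A (\<lambda>x. p x b') (dl2 A \<Delta>A (l b a) c)"
        using M1_slice[OF U adm1 adm2 c b A.r_carr[OF a b']] slice_dl2[OF A.l_carr[OF a b] b' c] A.l_r[OF a b b'] by simp
    qed
    have "tlift A B (\<lambda>c' b'. br (act x (l b' a)) c') u = tlift A A (\<lambda>d e. br (act x d) e) (tlift A B (\<lambda>c' b'. ten A A (l b' a) c') u)" if u: "u \<in> tcarr A B" for u
      by (rule tensor_eqI[OF vA vB l1 lin_comp[OF l2 lin_tlift[OF vA vA vsp_tensor bil_RHS[OF x]]] u])
        (use a in \<open>simp add: tlift_ten[OF vA vB vsp_tensor b1] tlift_ten[OF vA vB vsp_tensor b2] tlift_ten[OF vA vA vsp_tensor bil_RHS[OF x]] A.l_carr\<close>)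
    then show ?thesis using Z Mc by (simp add: RHS_def dl2_def)
  qed
  ultimately show ?thesis using Mc by simp
qed

text \<open>Coassociativity, seen by pairing the second leg with b': both sides become c (l (b' b)
  a).\<close>

lemma tmap_l_dl1:
  assumes a: "a \<in> carr A" and c: "c \<in> carr A" and b: "b \<in> carr B"
  shows "tmap A A A A (\<lambda>x. x) (l b) (dl1 A \<Delta>A a c) = dl1 A \<Delta>A (l b a) c"
proof (rule A.slices_eqA2[OF vA _ cA.dl1_carr[OF A.l_carr[OF a b] c]])
  note t = cA.dl1_carr[OF a c] and lt = lin_tmap[OF vA vA lin_id A.lin_l[OF b]]
  show "tmap A A A A (\<lambda>x. x) (l b) (dl1 A \<Delta>A a c) \<in> tcarr A A" using lin_carr[OF lt] t by simp
  fix b' assume b': "b' \<in> carr B"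
  have bb: "mul B b' b \<in> carr B" using b b' algB by simp
  have "slice2 A A (\<lambda>x. p x b') (tmap A A A A (\<lambda>x. x) (l b) (dl1 A \<Delta>A a c)) = slice2 A A (\<lambda>x. p x (mul B b' b)) (dl1 A \<Delta>A a c)"
    by (rule tensor_eqI[OF vA vA lin_comp[OF lt lin_slice2[OF vA vA A.p1[OF b']]] lin_slice2[OF vA vA A.p1[OF bb]] t])
      (use b b' bb in \<open>simp add: tmap_ten[OF vA vA] lin_id A.lin_l slice2_ten[OF vA vA A.p1] A.l_carr A.p_l\<close>)
  then show "slice2 A A (\<lambda>x. p x b') (tmap A A A A (\<lambda>x. x) (l b) (dl1 A \<Delta>A a c)) = slice2 A A (\<lambda>x. p x b') (dl1 A \<Delta>A (l b a) c)"
    using slice_dl1[OF a bb c] slice_dl1[OF A.l_carr[OF a b] b' c] A.l_l[OF a b' b] by simp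
qed

text \<open>Under \<open>W U0\<close> and the slice, a B-leg b' multiplies the A-leg from the right
  by l b' a. Over a whole vector v of B \<otimes> X this is \<Delta>(a) with its second leg paired
  against v; for v = \<beta>(x')(b \<otimes> y) that pairing is the action.\<close>

lemma slice_WQ:
  assumes x: "x \<in> carr X" and c: "c \<in> carr A" and b: "b \<in> carr B" and y: "y \<in> carr X" and a: "a \<in> carr A"
  shows "s3 a (\<phi> (fst (W U0) (fst (Q x) (ten A' (B \<otimes> X) c (ten B X b y))))) = tmap A X A X (\<lambda>z. z) (\<lambda>z. mul X z y) (LHS x (l b a) c)"
proof -
  note ly = lin_tmap[OF vA vX lin_id lin_rmulX[OF y]]
  define H where "H u = s3 a (\<phi> (fst (W U0) u))" for u
  have lH: "lin (A' \<otimes> B \<otimes> X) (A \<otimes> X) H"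
    unfolding H_def by (rule lin_comp[OF lin_comp[OF mult_lin1[OF W_mult[OF U0_mult]] lin_\<phi>] lin_s3[OF a]])
  have H3: "H (ten A' (B \<otimes> X) c' (ten B X b' y')) = ten A X (mul A c' (l b' a)) y'"
    if *: "c' \<in> carr A" "b' \<in> carr B" "y' \<in> carr X" for c' b' y'
  proof -
    have "fst (W U0) (ten A' (B \<otimes> X) c' (ten B X b' y')) = tassoc A' B X (ten (A' \<otimes> B) X (M c' b') y')"
      using W_ten[OF U0_mult, of "ten A B c' b'" y'] tassoc_ten[OF vA' vB vX, of c' b' y'] * circ_ten(1)[OF U adm1 adm2 *(1,2)] by simp
    moreover have "s3 a (\<phi> (tassoc A' B X (ten (A' \<otimes> B) X u y'))) = ten A X (slice2 A B (p a) u) y'" if u: "u \<in> tcarr A B" for u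
    proof (rule tensor_eqI[OF vA vB lin_comp[OF lin_comp[OF lin_tassoc_ten[OF *(3)] lin_\<phi>] lin_s3[OF a]] lin_ten1[OF lin_slice2[OF vA vB A.p2[OF a]] *(3)] u])
      fix c'' b'' assume cb: "c'' \<in> carr A" "b'' \<in> carr B"
      have "s3 a (ten B (A' \<otimes> X) b'' (ten A X c'' y')) = smul (A \<otimes> X) (p a b'') (ten A X c'' y')"
        using slice1_ten[OF vB vsp_tensor[of A' X] A.p2[OF a] cb(2), of "ten A X c'' y'"] cb * by simp
      then show "s3 a (\<phi> (tassoc A' B X (ten (A' \<otimes> B) X (ten A B c'' b'') y'))) = ten A X (slice2 A B (p a) (ten A B c'' b'')) y'"
        using cb * a tassoc_ten[OF vA' vB vX, of c'' b'' y'] flip12_ten[OF vA' vB vX, of c'' b'' y'] lin_smul[OF bil_lin1[OF bil_ten[of A X] *(3)] cb(1)]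
        by (simp add: slice2_ten[OF vA vB A.p2])
    qed
    ultimately show ?thesis using M_carr'[OF *(1,2)] M1_slice[OF U adm1 adm2 *(1,2) a] by (simp add: H_def)
  qed
  \<comment> \<open>c' (l b' a) is the slice of (c' \<otimes> 1)\<Delta>(a) by p(-, b'). Written in
    this way the value is linear in v and extends to every v in B \<otimes> X.\<close>
  have H2: "H (ten A' (B \<otimes> X) c' v) = tlift A A (\<lambda>e f. ten A X e (sl f v)) (dl1 A \<Delta>A a c')" if c': "c' \<in> carr A" and v: "v \<in> tcarr B X" for c' v
  proof -
    have be: "bil A A (A \<otimes> X) (\<lambda>e f. ten A X e (sl f v))" if "v \<in> tcarr B X" for v
      by (rule bil_tmap[OF lin_id lin_sl'[OF that]])
    have l1: "lin (B \<otimes> X) (A \<otimes> X) (\<lambda>v. H (ten A' (B \<otimes> X) c' v))"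
      by (rule lin_comp[OF lin_ten2[OF lin_id] lH]) (simp add: c')
    have l2: "lin (B \<otimes> X) (A \<otimes> X) (\<lambda>v. tlift A A (\<lambda>e f. ten A X e (sl f v)) (dl1 A \<Delta>A a c'))"
      by (rule lin_tlift_param[OF vA vA vsp_tensor vsp_tensor be _ cA.dl1_carr[OF a c']]) (auto intro: lin_ten2[OF lin_sl])
    show ?thesis
    proof (rule tensor_eqI[OF vB vX l1 l2 v])
      fix b' y' assume by': "b' \<in> carr B" "y' \<in> carr X"
      have t: "ten B X b' y' \<in> tcarr B X" using by' by simp
      have "ten A X (slice2 A A (\<lambda>x. p x b') s) y' = tlift A A (\<lambda>e f. ten A X e (sl f (ten B X b' y'))) s" if s: "s \<in> tcarr A A" for s
        by (rule tensor_eqI[OF vA vA lin_ten1[OF lin_slice2[OF vA vA A.p1[OF by'(1)]] by'(2)] lin_tlift[OF vA vA vsp_tensor be[OF t]] s])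
          (use by' lin_smul[OF bil_lin1[OF bil_ten[of A X] by'(2)]] lin_smul[OF bil_lin2[OF bil_ten[of A X]]] in \<open>simp add: slice2_ten[OF vA vA A.p1] tlift_ten[OF vA vA vsp_tensor be[OF t]] sl_ten\<close>)
      from this[OF cA.dl1_carr[OF a c']]
      show "H (ten A' (B \<otimes> X) c' (ten B X b' y')) = tlift A A (\<lambda>e f. ten A X e (sl f (ten B X b' y'))) (dl1 A \<Delta>A a c')"
        using H3[OF c' by'] slice_dl1[OF a by'(1) c'] by simp
    qed
  qed
  have w: "ten B X b y \<in> tcarr B X" using b y by simp
  have ba: "l b a \<in> carr A" by (rule A.l_carr[OF a b])
  \<comment> \<open>\<open>act_\<beta>\<close> puts l b onto the second leg of (c' \<otimes>
    1)\<Delta>(a), and \<open>tmap_l_dl1\<close> moves it inside \<Delta>.\<close>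
  have H1: "H (ten A' (B \<otimes> X) c' (fst (\<beta> x') (ten B X b y))) = tmap A X A X (\<lambda>z. z) (\<lambda>z. mul X z y) (tlift A A (\<lambda>e f. ten A X e (act x' f)) (dl1 A \<Delta>A (l b a) c'))"
    if c': "c' \<in> carr A" and x': "x' \<in> carr X" for c' x'
  proof -
    have be: "bil A A (A \<otimes> X) (\<lambda>e f. ten A X e (sl f (fst (\<beta> x') (ten B X b y))))"
      by (rule bil_tmap[OF lin_id lin_sl'[OF \<beta>_carr[OF x' w]]])
    note la = lin_tlift[OF vA vA vsp_tensor bil_act2[OF x']]
    have "tlift A A (\<lambda>e f. ten A X e (sl f (fst (\<beta> x') (ten B X b y)))) s = tmap A X A X (\<lambda>z. z) (\<lambda>z. mul X z y) (tlift A A (\<lambda>e f. ten A X e (act x' f)) (tmap A A A A (\<lambda>x. x) (l b) s))"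
      if s: "s \<in> tcarr A A" for s
      by (rule tensor_eqI[OF vA vA lin_tlift[OF vA vA vsp_tensor be] lin_comp[OF lin_comp[OF lin_tmap[OF vA vA lin_id A.lin_l[OF b]] la] ly] s])
        (use x' b y in \<open>simp add: tlift_ten[OF vA vA vsp_tensor be] tmap_ten[OF vA vA] tmap_ten[OF vA vX] lin_id A.lin_l lin_rmulX tlift_ten[OF vA vA vsp_tensor bil_act2[OF x']] A.l_carr act_carr act_\<beta>\<close>)
    then show ?thesis using H2[OF c' \<beta>_carr[OF x' w]] cA.dl1_carr[OF a c'] tmap_l_dl1[OF a c' b] by simp
  qed
  have bq: "bil A X (A' \<otimes> B \<otimes> X) (\<lambda>c y'. ten A' (B \<otimes> X) c (fst (\<beta> y') (ten B X b y)))"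
    using bil_tmap[OF lin_id[of A'] lin_\<beta>[OF w]] by simp
  have "H (fst (Q x) (ten A' (B \<otimes> X) c (ten B X b y))) = H (tlift A X (\<lambda>c y'. ten A' (B \<otimes> X) c (fst (\<beta> y') (ten B X b y))) (br x c))"
    using Q_ten[OF x c w] by simp
  also have "\<dots> = tlift A X (\<lambda>c y'. H (ten A' (B \<otimes> X) c (fst (\<beta> y') (ten B X b y)))) (br x c)"
    by (rule tlift_tlift[OF vA vX vsp_tensor vsp_tensor bq lH br_carr[OF c x]])
  also have "\<dots> = tlift A X (\<lambda>c' x'. tmap A X A X (\<lambda>z. z) (\<lambda>z. mul X z y) (tlift A A (\<lambda>e f. ten A X e (act x' f)) (dl1 A \<Delta>A (l b a) c'))) (br x c)"
    by (rule fun_cong[OF tlift_cong]) (rule H1)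
  also have "\<dots> = tmap A X A X (\<lambda>z. z) (\<lambda>z. mul X z y) (LHS x (l b a) c)"
    unfolding LHS_eq by (rule tlift_tlift[symmetric, OF vA vX vsp_tensor vsp_tensor bil_LHS[OF ba] ly br_carr[OF c x]])
  finally show ?thesis by (simp add: H_def)
qed

lemma YD_condition_iff:
  assumes x: "x \<in> carr X"
  shows "P x = ext_alg (A' \<otimes> B \<otimes> X) (B \<otimes> A' \<otimes> X) \<phi> (W U0 \<cdot> Q x \<cdot> minv (A' \<otimes> B \<otimes> X) (W U0)) \<longleftrightarrow>
    (\<forall>a\<in>carr A. \<forall>c\<in>carr A. LHS x a c = RHS x a c)" (is "?L \<longleftrightarrow> ?R")
proof -
  obtain V where V: "V \<in> carr (mult_alg (A' \<otimes> B))" "U0 \<cdot> V = mone (A' \<otimes> B)" "V \<cdot> U0 = mone (A' \<otimes> B)" by (rule U0_inverse)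
  note WU = W_mult[OF U0_mult] and WV = W_mult[OF V(1)]
  note UV = W_inverse[OF U0_mult V(1,2)] and VU = W_inverse[OF V(1) U0_mult V(3)]
  have inv: "minv (A' \<otimes> B \<otimes> X) (W U0) = W V" by (rule mult_inverse_unique[OF ndABX WU WV UV VU])
  define N where "N = W U0 \<cdot> Q x \<cdot> W V"
  have N: "N \<in> carr (mult_alg (A' \<otimes> B \<otimes> X))" unfolding N_def by (intro mmul_mult vsp_tensor WU WV Q_mult x)
  note e = ndABX ndBAX flip12_hom[OF algA' algB algX] flip12_surj[OF vA' vB vX] N
  have F: "fst (ext_alg (A' \<otimes> B \<otimes> X) (B \<otimes> A' \<otimes> X) \<phi> N) (\<phi> s) = \<phi> (fst N s)" if "s \<in> carr (A' \<otimes> B \<otimes> X)" for s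
    by (rule ext_alg_fst[OF e that])
  have "?L \<longleftrightarrow> P x = ext_alg (A' \<otimes> B \<otimes> X) (B \<otimes> A' \<otimes> X) \<phi> N" by (simp add: inv N_def)
  also have "\<dots> \<longleftrightarrow> (\<forall>s\<in>carr (A' \<otimes> B \<otimes> X). fst (P x) (\<phi> s) = \<phi> (fst N s))"
  proof
    assume *: "\<forall>s\<in>carr (A' \<otimes> B \<otimes> X). fst (P x) (\<phi> s) = \<phi> (fst N s)"
    show "P x = ext_alg (A' \<otimes> B \<otimes> X) (B \<otimes> A' \<otimes> X) \<phi> N"
    proof (rule mult_eqI[OF ndBAX P_mult[OF x] ext_alg_mult[OF e]])
      fix t assume "t \<in> carr (B \<otimes> A' \<otimes> X)"
      then obtain s where "s \<in> carr (A' \<otimes> B \<otimes> X)" "t = \<phi> s" using flip12_surj[OF vA' vB vX] by blast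
      then show "fst (P x) t = fst (ext_alg (A' \<otimes> B \<otimes> X) (B \<otimes> A' \<otimes> X) \<phi> N) t" using * F by simp
    qed
  qed (use F in simp)
  \<comment> \<open>As \<open>W U0\<close> is bijective on vectors, its image of s may be inserted
    for s, which cancels the inverse inside N.\<close>
  also have "\<dots> \<longleftrightarrow> (\<forall>s\<in>carr (A' \<otimes> B \<otimes> X). fst (P x) (\<phi> (fst (W U0) s)) = \<phi> (fst (W U0) (fst (Q x) s)))"
  proof -
    have 1: "fst (W V) (fst (W U0) s) = s" "fst (W U0) (fst (W V) s) = s" if "s \<in> carr (A' \<otimes> B \<otimes> X)" for s
      using that mmul_fst[of "W V" "W U0" s] mmul_fst[of "W U0" "W V" s] UV VU by simp_all
    have NW: "fst N s = fst (W U0) (fst (Q x) (fst (W V) s))" for s by (simp add: N_def)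
    show ?thesis
    proof (intro iffI ballI)
      fix s assume *: "\<forall>s\<in>carr (A' \<otimes> B \<otimes> X). fst (P x) (\<phi> s) = \<phi> (fst N s)" and s: "s \<in> carr (A' \<otimes> B \<otimes> X)"
      have "fst (P x) (\<phi> (fst (W U0) s)) = \<phi> (fst N (fst (W U0) s))" using * mult_carr1[OF WU s] by blast
      then show "fst (P x) (\<phi> (fst (W U0) s)) = \<phi> (fst (W U0) (fst (Q x) s))" unfolding NW 1(1)[OF s] .
    next
      fix s assume *: "\<forall>s\<in>carr (A' \<otimes> B \<otimes> X). fst (P x) (\<phi> (fst (W U0) s)) = \<phi> (fst (W U0) (fst (Q x) s))" and s: "s \<in> carr (A' \<otimes> B \<otimes> X)"
      have "fst (P x) (\<phi> (fst (W U0) (fst (W V) s))) = \<phi> (fst (W U0) (fst (Q x) (fst (W V) s)))" using * mult_carr1[OF WV s] by blast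
      then show "fst (P x) (\<phi> s) = \<phi> (fst N s)" unfolding NW 1(2)[OF s] .
    qed
  qed
  also have "\<dots> \<longleftrightarrow> (\<forall>c\<in>carr A. \<forall>b\<in>carr B. \<forall>y\<in>carr X. fst (P x) (\<phi> (fst (W U0) (ten A' (B \<otimes> X) c (ten B X b y)))) =
      \<phi> (fst (W U0) (fst (Q x) (ten A' (B \<otimes> X) c (ten B X b y)))))"
  proof
    note l1 = lin_comp[OF lin_comp[OF mult_lin1[OF WU] lin_\<phi>] mult_lin1[OF P_mult[OF x]]]
    note l2 = lin_comp[OF lin_comp[OF mult_lin1[OF Q_mult[OF x]] mult_lin1[OF WU]] lin_\<phi>]
    assume *: "\<forall>c\<in>carr A. \<forall>b\<in>carr B. \<forall>y\<in>carr X. fst (P x) (\<phi> (fst (W U0) (ten A' (B \<otimes> X) c (ten B X b y)))) =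
      \<phi> (fst (W U0) (fst (Q x) (ten A' (B \<otimes> X) c (ten B X b y))))"
    show "\<forall>s\<in>carr (A' \<otimes> B \<otimes> X). fst (P x) (\<phi> (fst (W U0) s)) = \<phi> (fst (W U0) (fst (Q x) s))"
    proof
      fix s assume "s \<in> carr (A' \<otimes> B \<otimes> X)"
      then have s: "s \<in> tcarr A' (B \<otimes> X)" by simp
      show "fst (P x) (\<phi> (fst (W U0) s)) = \<phi> (fst (W U0) (fst (Q x) s))"
        by (rule triple_eqI2[OF vA' vB vX l1 l2 s]) (use * in simp)
    qed
  qed simp
  also have "\<dots> \<longleftrightarrow> (\<forall>c\<in>carr A. \<forall>b\<in>carr B. \<forall>y\<in>carr X. \<forall>a\<in>carr A.
      tmap A X A X (\<lambda>z. z) (\<lambda>z. mul X z y) (RHS x (l b a) c) = tmap A X A X (\<lambda>z. z) (\<lambda>z. mul X z y) (LHS x (l b a) c))"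
  proof -
    have "fst (P x) (\<phi> (fst (W U0) (ten A' (B \<otimes> X) c (ten B X b y)))) = \<phi> (fst (W U0) (fst (Q x) (ten A' (B \<otimes> X) c (ten B X b y)))) \<longleftrightarrow>
      (\<forall>a\<in>carr A. tmap A X A X (\<lambda>z. z) (\<lambda>z. mul X z y) (RHS x (l b a) c) = tmap A X A X (\<lambda>z. z) (\<lambda>z. mul X z y) (LHS x (l b a) c))" (is "?p = ?q \<longleftrightarrow> _")
      if c: "c \<in> carr A" and b: "b \<in> carr B" and y: "y \<in> carr X" for c b y
    proof -
      have s: "ten A' (B \<otimes> X) c (ten B X b y) \<in> carr (A' \<otimes> B \<otimes> X)" using c b y by simp
      have pq: "?p \<in> tcarr B (A' \<otimes> X)" "?q \<in> tcarr B (A' \<otimes> X)"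
        using lin_carr[OF lin_comp[OF lin_comp[OF mult_lin1[OF WU] lin_\<phi>] mult_lin1[OF P_mult[OF x]]] s]
          lin_carr[OF lin_comp[OF lin_comp[OF mult_lin1[OF Q_mult[OF x]] mult_lin1[OF WU]] lin_\<phi>] s] by simp_all
      \<comment> \<open>The slices p(a, -) on the B-leg separate points, which is where the
        quantifier over a enters.\<close>
      have "?p = ?q \<longleftrightarrow> (\<forall>a\<in>carr A. s3 a ?p = s3 a ?q)"
        using A.slices_eqB1[OF vsp_tensor pq] by metis
      then show ?thesis using slice_PW[OF x c b y] slice_WQ[OF x c b y] by simp
    qed
    then show ?thesis by blast
  qed
  also have "\<dots> \<longleftrightarrow> ?R"
  proof
    assume *: "\<forall>c\<in>carr A. \<forall>b\<in>carr B. \<forall>y\<in>carr X. \<forall>a\<in>carr A.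
      tmap A X A X (\<lambda>z. z) (\<lambda>z. mul X z y) (RHS x (l b a) c) = tmap A X A X (\<lambda>z. z) (\<lambda>z. mul X z y) (LHS x (l b a) c)"
    show ?R
    proof (intro ballI)
      fix a c assume a: "a \<in> carr A" and c: "c \<in> carr A"
      \<comment> \<open>A b with l b a = a makes every a appear as a translate; the factor y is then
        removed by non-degeneracy of X.\<close>
      obtain b where b: "b \<in> carr B" "l b a = a" using A.local_units[of "{a}"] a by auto
      note t = LHS_carr[OF x a c] RHS_carr[OF x a c]
      have "LHS x a c - RHS x a c = 0"
      proof (rule tmap_separates2[OF vA vX vX tcarr_diff[OF t], where I = "carr X" and \<phi> = "\<lambda>y z. mul X z y"])
        fix y assume y: "y \<in> carr X"
        have "tmap A X A X (\<lambda>z. z) (\<lambda>z. mul X z y) (RHS x (l b a) c) = tmap A X A X (\<lambda>z. z) (\<lambda>z. mul X z y) (LHS x (l b a) c)"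
          using * c b(1) y a by blast
        then show "tmap A X A X (\<lambda>z. z) (\<lambda>z. mul X z y) (LHS x a c - RHS x a c) = 0"
          using t lin_diff[OF vsp_tensor lin_tmap[OF vA vX lin_id lin_rmulX[OF y]]] b by simp
      qed (use lin_rmulX nd_left[OF ndX] in auto)
      then show "LHS x a c = RHS x a c" by simp
    qed
  next
    assume ?R
    then show "\<forall>c\<in>carr A. \<forall>b\<in>carr B. \<forall>y\<in>carr X. \<forall>a\<in>carr A.
      tmap A X A X (\<lambda>z. z) (\<lambda>z. mul X z y) (RHS x (l b a) c) = tmap A X A X (\<lambda>z. z) (\<lambda>z. mul X z y) (LHS x (l b a) c)"
      using A.l_carr by simp
  qed
  finally show ?thesis .
qed

end

theorem proposition3p2:
  fixes A :: "('k::field, 'a::ab_group_add) alg" and \<Delta>A :: "('k, 'a) comult"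
    and B :: "('k, 'b::ab_group_add) alg" and \<Delta>B :: "('k, 'b) comult"
    and p :: "'a \<Rightarrow> 'b \<Rightarrow> 'k"
    and X :: "('k, 'x::ab_group_add) alg"
    and \<alpha> :: "'x \<Rightarrow> ('k, 'a, 'x) tensor multiplier"
    and \<beta> :: "'x \<Rightarrow> ('k, 'b, 'x) tensor multiplier"
  assumes "regular_mult_hopf_alg A \<Delta>A" and "regular_mult_hopf_alg B \<Delta>B"
    and "admissible_pairing A \<Delta>A B \<Delta>B p"
    and "nd_algebra X"
    and "left_coaction (op_alg A) (op_comult \<Delta>A) X \<alpha>"
    and "left_coaction B \<Delta>B X \<beta>"
  shows "left_left_YD_algebra A \<Delta>A B \<Delta>B p X \<alpha> \<beta> \<longleftrightarrow>
         right_left_YD_algebra A \<Delta>A X (induced_action A \<Delta>A B p X \<beta>) \<alpha>"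
proof -
  obtain U where U: "is_canonical_multiplier A \<Delta>A B \<Delta>B p U"
    and adm: "\<forall>a\<in>carr A. \<forall>b\<in>carr B. leg2 A B b \<cdot> U \<cdot> leg1 A B a \<in> emb_image (A \<otimes> B) \<and>
      leg1 A B a \<cdot> U \<cdot> leg2 A B b \<in> emb_image (A \<otimes> B)"
    and pair: "pairing A \<Delta>A B \<Delta>B p"
    using assms(3) unfolding admissible_pairing_def by blast
  interpret two_coactions A \<Delta>A B \<Delta>B p X \<beta> \<alpha> U
    by unfold_locales (use U adm pair assms in blast)+
  have act: "induced_action A \<Delta>A B p X \<beta> = act" by (simp add: fun_eq_iff act_def)
  have "left_left_YD_algebra A \<Delta>A B \<Delta>B p X \<alpha> \<beta> \<longleftrightarrow>
    (\<forall>x\<in>carr X. P x = ext_alg (A' \<otimes> B \<otimes> X) (B \<otimes> A' \<otimes> X) \<phi> (W U0 \<cdot> Q x \<cdot> minv (A' \<otimes> B \<otimes> X) (W U0)))"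
    using assms(5,6) by (simp add: left_left_YD_algebra_def Let_def canonical_multiplier_eq[OF U] P_def Q_def W_def)
  also have "\<dots> \<longleftrightarrow> (\<forall>x\<in>carr X. \<forall>a\<in>carr A. \<forall>c\<in>carr A. LHS x a c = RHS x a c)"
    using YD_condition_iff by simp
  \<comment> \<open>The right-left notion contains the action axioms as well;
    \<open>right_action_act\<close> supplies them.\<close>
  also have "\<dots> \<longleftrightarrow> right_left_YD_algebra A \<Delta>A X (induced_action A \<Delta>A B p X \<beta>) \<alpha>"
    unfolding right_left_YD_algebra_def act using assms(5) right_action_act by (simp add: LHS_def RHS_def br_def)
  finally show ?thesis .
qed

end
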